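(* Let $M$ be an almost-CR manifold, $\Omega$ an open domain in $M$, and $p_0\in\partial\Omega$ a smooth point of the boundary. If $\partial\Omega$ is $\Theta$-non-characteristic at $p_0$, or $\Omega$ is strongly-$1$-convex at $p_0$, then any $f$ satisfying condition $(\ast)$ in $\Omega$ and having zero boundary values on a neighborhood of $p_0$ in $\partial\Omega$ is $0$ almost everywhere on the intersection of $\Omega$ with a neighborhood of $p_0$ in $M$.
   Context: An almost-CR manifold is a smooth real manifold $M$ with a smooth complex subbundle $T^{0,1}M\subset\mathbb{C}TM$ of constant rank such that $T^{0,1}M\cap\overline{T^{0,1}M}=0$; no formal integrability is required. $\mathcal{Z}$ is the sheaf of smooth sections of $T^{0,1}M$, $H_pM=\{\mathrm{Re}\,Z\mid Z\in T^{0,1}_pM\}$, $\pi_M:TM\to TM/HM$ the projection. $H^{1,1}_pM$ is the convex hull of $\{Z_p\otimes\bar Z_p\mid Z_p\in T^{0,1}_pM\}$. The vector valued Levi form is the linear extension $\mathcal{L}:H^{1,1}M\to TM/HM$ of $Z_p\otimes\bar Z_p\mapsto-\pi_M(i[Z,\bar Z]_p)$, $Z\in\mathcal{Z}$. Put $[\ker\mathcal{L}]_p=\{\tau\in H^{1,1}_pM\mid\tau\neq0,\ \mathcal{L}(\tau)=0\}$; for $U$ open, $[\ker\mathcal{L}](U)$ is the set of sections $\tau$ over $U$ with $\tau_p\in[\ker\mathcal{L}]_p$ for all $p\in U$, locally of the form $\tau=\sum_{j=1}^rZ_j\otimes\bar Z_j$ with $Z_j\in\mathcal{Z}$; then $\sum_j[Z_j,\bar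 Z_j]=\bar L_0-L_0$ with $L_0\in\mathcal{Z}$. For such $\tau$, $\Theta(\tau)$ is the span of $Z_1,\dots,Z_r$, and $\tilde\Theta(\tau)$ the span of $Z_1,\dots,Z_r,L_0$, over smooth complex functions; $\Theta=\bigcup_\tau\Theta(\tau)$, $\tilde\Theta=\bigcup_\tau\tilde\Theta(\tau)$ (over local sections $\tau$ of $[\ker\mathcal{L}]$). A smooth hypersurface $N$ is $\Theta$-non-characteristic at $p_0\in N$ if $T_{p_0}N+\{\mathrm{Re}\,Z_{p_0}\mid Z\in\Theta\}=T_{p_0}M$. Definition of $dd^c$: given a smooth real $\rho$, choose a smooth real $1$-form $\xi$ such that $d\rho+i\xi$ vanishes on $T^{0,1}M$. For $\tau=\sum_jZ_j\otimes\bar Z_j\in[\ker\mathcal{L}]_p$ set $dd^c\rho_p(\tau)=\tfrac i2\sum_jd\xi(Z_j,\bar Z_j)$ (independent of $\xi$), with $d\xi(X,Y)=X\xi(Y)-Y\xi(X)-\xi([X,Y])$. If $\rho$ is a smooth defining function of $\Omega$ near the smooth boundary point $p_0$ ($\Omega=\{\rho<0\}$ near $p_0$, $d\rho(p_0)\neq0$), $\Omega$ is strongly-$1$-convex at $p_0$ if there is $\tau=\sum_jZ_j\otimes\bar Z_j\in[\ker\mathcal{L}]_{p_0}$ with all $Z_j\in T^{0,1}_{p_0}M$ tangent to $\partial\Omega$ and $dd^c\rho_{p_0}(\tau)>0$. Condition $(\ast)$ for a function $f$ on an open set $W\subset M$: $f\in L^2_{\mathrm{loc}}(W)$ and, for every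 $Z\in\tilde\Theta$ (defined on an open $U\subset W$), $Zf\in L^2_{\mathrm{loc}}(U)$ and there is $\kappa_Z\in L^\infty_{\mathrm{loc}}(U,\mathbb{R})$ such that $|(Zf)(p)|\leq\kappa_Z(p)|f(p)|$ for almost all $p\in U$. That $f$, defined on $\Omega$, has zero boundary values on a neighborhood of $p_0$ in $\partial\Omega$ means that there is an open neighborhood $W$ of $p_0$ in $M$ such that the extension of $f|_{W\cap\Omega}$ by $0$ to $W$ satisfies $(\ast)$ on $W$.
   Formalization: In strong 1-convexity, τ must be the value at p_0 of a local section of [ker L] near p_0, not just an element of the fibre; otherwise the claim fails (Im w = |z|^4, Ω = {Re w + |z|^2 < 0}, p_0 = 0, f = 1). *)

theory Defs
  imports "HOL-Analysis.Analysis" "HOL-Library.Function_Algebras"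
begin

section \<open>Vector space structure on functionals\<close>

text \<open>
  Tangent vectors and tensors are functionals on complex functions. The pointwise real structure
  gives access to \<^const>\<open>hull\<close>; the complex structure is the locale interpretation \<open>cvec\<close> below.
\<close>

instantiation "fun" :: (type, real_vector) real_vector
begin

definition scaleR_fun_def: "r *\<^sub>R f = (\<lambda>x. r *\<^sub>R f x)"

instance
  by standard (auto simp: scaleR_fun_def fun_eq_iff scaleR_add_right scaleR_add_left)

end

type_synonym 'm tvec = "('m \<Rightarrow> complex) \<Rightarrow> complex"

type_synonym 'm tensor = "('m \<Rightarrow> complex) \<Rightarrow> ('m \<Rightarrow> complex) \<Rightarrow> complex"

definition cscale :: "complex \<Rightarrow> 'm tvec \<Rightarrow> 'm tvec" where
  "cscale c X = (\<lambda>f. c * X f)"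

global_interpretation cvec: vector_space cscale
  by standard (auto simp: cscale_def fun_eq_iff algebra_simps)

definition conj_vec :: "'m tvec \<Rightarrow> 'm tvec" where
  "conj_vec X = (\<lambda>f. cnj (X (\<lambda>q. cnj (f q))))"

definition re_vec :: "'m tvec \<Rightarrow> 'm tvec" where
  "re_vec X = cscale (1/2) (X + conj_vec X)"

text \<open>The tensor \<open>Z \<otimes> conj Z\<close>, as a bilinear form on (germs of) functions.\<close>

definition herm_tensor :: "'m tvec \<Rightarrow> 'm tensor" where
  "herm_tensor Z = (\<lambda>f g. Z f * conj_vec Z g)"


section \<open>Smooth manifolds\<close>

text \<open>\<open>Ck_on k S f\<close>: all iterated directional derivatives up to order \<open>k\<close> exist and are
  continuous; meant for open \<open>S\<close>.\<close>

primrec Ck_on :: "nat \<Rightarrow> 'a::real_normed_vector set \<Rightarrow> ('a \<Rightarrow> 'b::real_normed_vector) \<Rightarrow> bool" where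
  "Ck_on 0 S f \<longleftrightarrow> continuous_on S f"
| "Ck_on (Suc k) S f \<longleftrightarrow>
     (\<forall>x\<in>S. f differentiable (at x)) \<and> (\<forall>v. Ck_on k S (\<lambda>x. frechet_derivative f (at x) v))"

definition smooth_on :: "'a::real_normed_vector set \<Rightarrow> ('a \<Rightarrow> 'b::real_normed_vector) \<Rightarrow> bool" where
  "smooth_on S f \<longleftrightarrow> (\<forall>k. Ck_on k S f)"

text \<open>A chart is a pair of its domain and its coordinate map. The manifold is the whole type \<open>'m\<close>,
  Hausdorff and second countable, with a smooth atlas that need not be maximal.\<close>

type_synonym ('m, 'e) chart = "'m set \<times> ('m \<Rightarrow> 'e)"

definition smooth_atlas ::
  "('m::{t2_space,second_countable_topology}, 'e::euclidean_space) chart set \<Rightarrow> bool" where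
  "smooth_atlas A \<longleftrightarrow>
     (\<Union>(U,\<phi>)\<in>A. U) = UNIV \<and>
     (\<forall>(U,\<phi>)\<in>A. open U \<and> open (\<phi> ` U) \<and> homeomorphism U (\<phi> ` U) \<phi> (inv_into U \<phi>)) \<and>
     (\<forall>(U,\<phi>)\<in>A. \<forall>(V,\<psi>)\<in>A. smooth_on (\<phi> ` (U \<inter> V)) (\<lambda>x. \<psi> (inv_into U \<phi> x)))"

definition msmooth_on ::
  "('m::topological_space, 'e::euclidean_space) chart set \<Rightarrow> 'm set \<Rightarrow>
   ('m \<Rightarrow> 'b::real_normed_vector) \<Rightarrow> bool" where
  "msmooth_on A W f \<longleftrightarrow> (\<forall>(V,\<phi>)\<in>A. smooth_on (\<phi> ` (W \<inter> V)) (\<lambda>x. f (inv_into V \<phi> x)))"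

definition msmooth_near ::
  "('m::topological_space, 'e::euclidean_space) chart set \<Rightarrow> 'm \<Rightarrow>
   ('m \<Rightarrow> 'b::real_normed_vector) \<Rightarrow> bool" where
  "msmooth_near A p f \<longleftrightarrow> (\<exists>W. open W \<and> p \<in> W \<and> msmooth_on A W f)"


section \<open>Tangent vectors and vector fields\<close>

text \<open>A real tangent vector at \<open>p\<close> is a directional derivative in a chart, acting on complex
  functions that are smooth near \<open>p\<close>; the value 0 on all other functions only makes the functional
  determined by the geometric vector.\<close>

definition tangent_space ::
  "('m::topological_space, 'e::euclidean_space) chart set \<Rightarrow> 'm \<Rightarrow> 'm tvec set" where
  "tangent_space A p = {X. \<exists>(V,\<phi>)\<in>A. p \<in> V \<and> (\<exists>v. X = (\<lambda>f. if msmooth_near A p f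
     then frechet_derivative (\<lambda>x. f (inv_into V \<phi> x)) (at (\<phi> p)) v else 0))}"

definition ctangent_space ::
  "('m::topological_space, 'e::euclidean_space) chart set \<Rightarrow> 'm \<Rightarrow> 'm tvec set" where
  "ctangent_space A p = cvec.span (tangent_space A p)"

text \<open>Vector fields on \<open>U\<close> are total functions; their values outside \<open>U\<close> are irrelevant.\<close>

definition smooth_vfield ::
  "('m::topological_space, 'e::euclidean_space) chart set \<Rightarrow> 'm set \<Rightarrow> ('m \<Rightarrow> 'm tvec) \<Rightarrow> bool" where
  "smooth_vfield A U X \<longleftrightarrow>
     (\<forall>p\<in>U. X p \<in> ctangent_space A p) \<and>
     (\<forall>V f. open V \<longrightarrow> V \<subseteq> U \<longrightarrow> msmooth_on A V f \<longrightarrow> msmooth_on A V (\<lambda>p. X p f))"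

definition conj_field :: "('m \<Rightarrow> 'm tvec) \<Rightarrow> 'm \<Rightarrow> 'm tvec" where
  "conj_field X = (\<lambda>p. conj_vec (X p))"

definition lie_bracket ::
  "('m::topological_space, 'e::euclidean_space) chart set \<Rightarrow>
   ('m \<Rightarrow> 'm tvec) \<Rightarrow> ('m \<Rightarrow> 'm tvec) \<Rightarrow> 'm \<Rightarrow> 'm tvec" where
  "lie_bracket A X Y p = (\<lambda>f. if msmooth_near A p f
     then X p (\<lambda>q. Y q f) - Y p (\<lambda>q. X q f) else 0)"

definition real_one_form ::
  "('m::topological_space, 'e::euclidean_space) chart set \<Rightarrow> 'm set \<Rightarrow>
   ('m \<Rightarrow> 'm tvec \<Rightarrow> complex) \<Rightarrow> bool" where
  "real_one_form A U \<xi> \<longleftrightarrow>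
     (\<forall>p\<in>U. (\<forall>X\<in>ctangent_space A p. \<forall>Y\<in>ctangent_space A p. \<xi> p (X + Y) = \<xi> p X + \<xi> p Y) \<and>
            (\<forall>c. \<forall>X\<in>ctangent_space A p. \<xi> p (cscale c X) = c * \<xi> p X) \<and>
            (\<forall>X\<in>tangent_space A p. \<xi> p X \<in> \<real>)) \<and>
     (\<forall>V X. open V \<longrightarrow> V \<subseteq> U \<longrightarrow> smooth_vfield A V X \<longrightarrow> msmooth_on A V (\<lambda>p. \<xi> p (X p)))"

definition ext_deriv ::
  "('m::topological_space, 'e::euclidean_space) chart set \<Rightarrow> ('m \<Rightarrow> 'm tvec \<Rightarrow> complex) \<Rightarrow>
   ('m \<Rightarrow> 'm tvec) \<Rightarrow> ('m \<Rightarrow> 'm tvec) \<Rightarrow> 'm \<Rightarrow> complex" where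
  "ext_deriv A \<xi> X Y p =
     X p (\<lambda>q. \<xi> q (Y q)) - Y p (\<lambda>q. \<xi> q (X q)) - \<xi> p (lie_bracket A X Y p)"

text \<open>Tangency of a (real or complex) vector at \<open>p\<close> to an embedded submanifold \<open>N\<close>: it annihilates
  all smooth functions vanishing on \<open>N\<close> near \<open>p\<close>.\<close>

definition tangent_to ::
  "('m::topological_space, 'e::euclidean_space) chart set \<Rightarrow> 'm set \<Rightarrow> 'm \<Rightarrow> 'm tvec \<Rightarrow> bool" where
  "tangent_to A N p X \<longleftrightarrow>
     (\<forall>U g. open U \<and> p \<in> U \<and> msmooth_on A U g \<and> (\<forall>q\<in>U \<inter> N. g q = 0) \<longrightarrow> X g = 0)"


section \<open>Almost-CR manifolds\<close>

text \<open>\<open>T p\<close> is the fibre of the antiholomorphic tangent bundle at \<open>p\<close>.\<close>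

definition smooth_subbundle ::
  "('m::topological_space, 'e::euclidean_space) chart set \<Rightarrow> ('m \<Rightarrow> 'm tvec set) \<Rightarrow> nat \<Rightarrow> bool" where
  "smooth_subbundle A T k \<longleftrightarrow>
     (\<forall>p. \<exists>U E. open U \<and> p \<in> U \<and> (\<forall>j<k. smooth_vfield A U (E j)) \<and>
        (\<forall>q\<in>U. inj_on (\<lambda>j. E j q) {..<k} \<and> cvec.independent ((\<lambda>j. E j q) ` {..<k}) \<and>
               T q = cvec.span ((\<lambda>j. E j q) ` {..<k})))"

definition almost_CR_manifold ::
  "('m::{t2_space,second_countable_topology}, 'e::euclidean_space) chart set \<Rightarrow>
   ('m \<Rightarrow> 'm tvec set) \<Rightarrow> bool" where
  "almost_CR_manifold A T \<longleftrightarrow>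
     smooth_atlas A \<and> (\<exists>k. smooth_subbundle A T k) \<and> (\<forall>p. T p \<inter> conj_vec ` T p = {0})"

definition cr_sections ::
  "('m::topological_space, 'e::euclidean_space) chart set \<Rightarrow> ('m \<Rightarrow> 'm tvec set) \<Rightarrow>
   'm set \<Rightarrow> ('m \<Rightarrow> 'm tvec) set" where
  "cr_sections A T U = {Z. smooth_vfield A U Z \<and> (\<forall>p\<in>U. Z p \<in> T p)}"

definition HM :: "('m \<Rightarrow> 'm tvec set) \<Rightarrow> 'm \<Rightarrow> 'm tvec set" where
  "HM T p = re_vec ` T p"

definition H11 :: "('m \<Rightarrow> 'm tvec set) \<Rightarrow> 'm \<Rightarrow> 'm tensor set" where
  "H11 T p = convex hull (herm_tensor ` T p)"

text \<open>The projection onto the quotient by \<open>HM\<close>; the quotient is the set of cosets, with zero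
  element \<open>quot_proj T p 0\<close>.\<close>

definition quot_proj :: "('m \<Rightarrow> 'm tvec set) \<Rightarrow> 'm \<Rightarrow> 'm tvec \<Rightarrow> 'm tvec set" where
  "quot_proj T p X = (\<lambda>Y. X + Y) ` HM T p"

text \<open>The vector valued Levi form. Every element of \<open>H11 T p\<close> is a finite sum of tensors
  \<open>herm_tensor (Z j p)\<close> with local sections \<open>Z j\<close>, and the resulting coset does not depend on the
  choice of the \<open>Z j\<close>.\<close>

definition levi_form ::
  "('m::topological_space, 'e::euclidean_space) chart set \<Rightarrow> ('m \<Rightarrow> 'm tvec set) \<Rightarrow>
   'm \<Rightarrow> 'm tensor \<Rightarrow> 'm tvec set" where
  "levi_form A T p \<tau> = (THE c. \<exists>U (r::nat) Z. open U \<and> p \<in> U \<and>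
     (\<forall>j<r. Z j \<in> cr_sections A T U) \<and> \<tau> = (\<Sum>j<r. herm_tensor (Z j p)) \<and>
     c = quot_proj T p (- (\<Sum>j<r. cscale \<i> (lie_bracket A (Z j) (conj_field (Z j)) p))))"

definition ker_levi ::
  "('m::topological_space, 'e::euclidean_space) chart set \<Rightarrow> ('m \<Rightarrow> 'm tvec set) \<Rightarrow>
   'm \<Rightarrow> 'm tensor set" where
  "ker_levi A T p = {\<tau> \<in> H11 T p. \<tau> \<noteq> 0 \<and> levi_form A T p \<tau> = quot_proj T p 0}"

definition represents ::
  "('m::topological_space, 'e::euclidean_space) chart set \<Rightarrow> ('m \<Rightarrow> 'm tvec set) \<Rightarrow> 'm set \<Rightarrow>
   nat \<Rightarrow> (nat \<Rightarrow> 'm \<Rightarrow> 'm tvec) \<Rightarrow> ('m \<Rightarrow> 'm tensor) \<Rightarrow> bool" where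
  "represents A T U r Z \<tau> \<longleftrightarrow>
     (\<forall>j<r. Z j \<in> cr_sections A T U) \<and> (\<forall>q\<in>U. \<tau> q = (\<Sum>j<r. herm_tensor (Z j q)))"

definition ker_levi_sections ::
  "('m::topological_space, 'e::euclidean_space) chart set \<Rightarrow> ('m \<Rightarrow> 'm tvec set) \<Rightarrow>
   'm set \<Rightarrow> ('m \<Rightarrow> 'm tensor) set" where
  "ker_levi_sections A T U = {\<tau>. (\<forall>p\<in>U. \<tau> p \<in> ker_levi A T p) \<and>
     (\<forall>p\<in>U. \<exists>V r Z. open V \<and> p \<in> V \<and> V \<subseteq> U \<and> represents A T V r Z \<tau>)}"

definition smooth_span ::
  "('m::topological_space, 'e::euclidean_space) chart set \<Rightarrow> 'm set \<Rightarrow>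
   nat \<Rightarrow> (nat \<Rightarrow> 'm \<Rightarrow> 'm tvec) \<Rightarrow> ('m \<Rightarrow> 'm tvec) set" where
  "smooth_span A U r Z = {X. \<exists>a. (\<forall>j<r. msmooth_on A U (a j)) \<and>
     (\<forall>q\<in>U. X q = (\<Sum>j<r. cscale (a j q) (Z j q)))}"

text \<open>\<open>Theta A T U\<close> and \<open>Theta_tilde A T U\<close> collect the elements of \<open>\<Theta>\<close> and of its tilde
  variant that are defined on the open set \<open>U\<close>. The representation of \<open>\<tau>\<close> is taken on all of \<open>U\<close>;
  as \<open>U\<close> ranges over all open sets, this covers the local representations.\<close>

definition Theta_of ::
  "('m::topological_space, 'e::euclidean_space) chart set \<Rightarrow> ('m \<Rightarrow> 'm tvec set) \<Rightarrow>
   'm set \<Rightarrow> ('m \<Rightarrow> 'm tensor) \<Rightarrow> ('m \<Rightarrow> 'm tvec) set" where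
  "Theta_of A T U \<tau> = {X. \<exists>r Z. represents A T U r Z \<tau> \<and> X \<in> smooth_span A U r Z}"

definition Theta_tilde_of ::
  "('m::topological_space, 'e::euclidean_space) chart set \<Rightarrow> ('m \<Rightarrow> 'm tvec set) \<Rightarrow>
   'm set \<Rightarrow> ('m \<Rightarrow> 'm tensor) \<Rightarrow> ('m \<Rightarrow> 'm tvec) set" where
  "Theta_tilde_of A T U \<tau> = {X. \<exists>r Z L0. represents A T U r Z \<tau> \<and> L0 \<in> cr_sections A T U \<and>
     (\<forall>q\<in>U. (\<Sum>j<r. lie_bracket A (Z j) (conj_field (Z j)) q) = conj_field L0 q - L0 q) \<and>
     X \<in> smooth_span A U (Suc r) (Z(r := L0))}"

definition Theta ::
  "('m::topological_space, 'e::euclidean_space) chart set \<Rightarrow> ('m \<Rightarrow> 'm tvec set) \<Rightarrow>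
   'm set \<Rightarrow> ('m \<Rightarrow> 'm tvec) set" where
  "Theta A T U = (\<Union>\<tau>\<in>ker_levi_sections A T U. Theta_of A T U \<tau>)"

definition Theta_tilde ::
  "('m::topological_space, 'e::euclidean_space) chart set \<Rightarrow> ('m \<Rightarrow> 'm tvec set) \<Rightarrow>
   'm set \<Rightarrow> ('m \<Rightarrow> 'm tvec) set" where
  "Theta_tilde A T U = (\<Union>\<tau>\<in>ker_levi_sections A T U. Theta_tilde_of A T U \<tau>)"

definition Theta_noncharacteristic ::
  "('m::topological_space, 'e::euclidean_space) chart set \<Rightarrow> ('m \<Rightarrow> 'm tvec set) \<Rightarrow>
   'm set \<Rightarrow> 'm \<Rightarrow> bool" where
  "Theta_noncharacteristic A T N p \<longleftrightarrow>
     {X + Y | X Y. X \<in> {X \<in> tangent_space A p. tangent_to A N p X} \<and>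
                   Y \<in> {re_vec (Z p) | Z U. open U \<and> p \<in> U \<and> Z \<in> Theta A T U}}
     = tangent_space A p"


section \<open>Strong 1-convexity\<close>

definition defining_function ::
  "('m::topological_space, 'e::euclidean_space) chart set \<Rightarrow> 'm set \<Rightarrow> 'm \<Rightarrow> ('m \<Rightarrow> real) \<Rightarrow> bool" where
  "defining_function A \<Omega> p \<rho> \<longleftrightarrow>
     (\<exists>U. open U \<and> p \<in> U \<and> msmooth_on A U \<rho> \<and> \<Omega> \<inter> U = {q \<in> U. \<rho> q < 0}) \<and>
     (\<exists>X\<in>tangent_space A p. X (\<lambda>q. complex_of_real (\<rho> q)) \<noteq> 0)"

definition smooth_boundary_point ::
  "('m::topological_space, 'e::euclidean_space) chart set \<Rightarrow> 'm set \<Rightarrow> 'm \<Rightarrow> bool" where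
  "smooth_boundary_point A \<Omega> p \<longleftrightarrow> p \<in> frontier \<Omega> \<and> (\<exists>\<rho>. defining_function A \<Omega> p \<rho>)"

text \<open>\<open>ddc A T \<rho> p \<tau>\<close> does not depend on \<open>\<xi>\<close> and \<open>Z\<close> for \<open>\<tau>\<close> in \<open>ker_levi A T p\<close>.\<close>

definition ddc ::
  "('m::topological_space, 'e::euclidean_space) chart set \<Rightarrow> ('m \<Rightarrow> 'm tvec set) \<Rightarrow>
   ('m \<Rightarrow> real) \<Rightarrow> 'm \<Rightarrow> 'm tensor \<Rightarrow> real" where
  "ddc A T \<rho> p \<tau> = (THE v. \<exists>U \<xi> (r::nat) Z. open U \<and> p \<in> U \<and> msmooth_on A U \<rho> \<and>
     real_one_form A U \<xi> \<and>
     (\<forall>q\<in>U. \<forall>X\<in>T q. X (\<lambda>q'. complex_of_real (\<rho> q')) + \<i> * \<xi> q X = 0) \<and>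
     (\<forall>j<r. Z j \<in> cr_sections A T U) \<and> \<tau> = (\<Sum>j<r. herm_tensor (Z j p)) \<and>
     complex_of_real v = \<i> / 2 * (\<Sum>j<r. ext_deriv A \<xi> (Z j) (conj_field (Z j)) p))"

text \<open>
  The kernel element at \<open>p\<close> is required to be the value at \<open>p\<close> of a local section of the kernel.
  An isolated element of \<open>ker_levi A T p\<close> puts no restriction at all on functions near \<open>p\<close>: on the
  hypersurface \<open>Im w = |z|^4\<close> of complex 2-space the kernel is nonempty exactly where \<open>z = 0\<close>, so
  \<open>Theta_tilde A T U\<close> is empty for nonempty open \<open>U\<close>, although \<open>ddc A T \<rho> 0 \<tau> > 0\<close> for
  \<open>\<rho> = Re w + |z|^2\<close> and the kernel element \<open>\<tau>\<close> at 0.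
\<close>

definition strongly_1_convex ::
  "('m::topological_space, 'e::euclidean_space) chart set \<Rightarrow> ('m \<Rightarrow> 'm tvec set) \<Rightarrow>
   'm set \<Rightarrow> 'm \<Rightarrow> bool" where
  "strongly_1_convex A T \<Omega> p \<longleftrightarrow>
     (\<exists>\<rho>. defining_function A \<Omega> p \<rho> \<and>
       (\<exists>U \<tau>. open U \<and> p \<in> U \<and> \<tau> \<in> ker_levi_sections A T U \<and>
          (\<exists>(r::nat) Z. (\<forall>j<r. Z j \<in> T p \<and> tangent_to A (frontier \<Omega>) p (Z j)) \<and>
             \<tau> p = (\<Sum>j<r. herm_tensor (Z j))) \<and>
          ddc A T \<rho> p (\<tau> p) > 0))"


section \<open>Local Lebesgue spaces and weak derivatives\<close>

definition ae_on ::
  "('m::topological_space, 'e::euclidean_space) chart set \<Rightarrow> 'm set \<Rightarrow> ('m \<Rightarrow> bool) \<Rightarrow> bool" where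
  "ae_on A U P \<longleftrightarrow>
     (\<forall>(V,\<phi>)\<in>A. AE x in lebesgue. x \<in> \<phi> ` (U \<inter> V) \<longrightarrow> P (inv_into V \<phi> x))"

definition L2_loc ::
  "('m::topological_space, 'e::euclidean_space) chart set \<Rightarrow> 'm set \<Rightarrow> ('m \<Rightarrow> complex) \<Rightarrow> bool" where
  "L2_loc A U f \<longleftrightarrow>
     (\<forall>(V,\<phi>)\<in>A. \<forall>K. compact K \<and> K \<subseteq> \<phi> ` (U \<inter> V) \<longrightarrow>
        set_borel_measurable lebesgue K (\<lambda>x. f (inv_into V \<phi> x)) \<and>
        set_integrable lebesgue K (\<lambda>x. (cmod (f (inv_into V \<phi> x)))\<^sup>2))"

definition Linf_loc ::
  "('m::topological_space, 'e::euclidean_space) chart set \<Rightarrow> 'm set \<Rightarrow> ('m \<Rightarrow> real) \<Rightarrow> bool" where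
  "Linf_loc A U \<kappa> \<longleftrightarrow>
     (\<forall>(V,\<phi>)\<in>A. \<forall>K. compact K \<and> K \<subseteq> \<phi> ` (U \<inter> V) \<longrightarrow>
        set_borel_measurable lebesgue K (\<lambda>x. \<kappa> (inv_into V \<phi> x)) \<and>
        (\<exists>C. AE x in lebesgue. x \<in> K \<longrightarrow> \<bar>\<kappa> (inv_into V \<phi> x)\<bar> \<le> C))"

text \<open>\<open>g = Z f\<close> on \<open>U\<close> in the sense of distributions: in a chart, \<open>Z\<close> is the sum of the
  \<open>a b * \<partial>\<^sub>b\<close> with \<open>a b\<close> the value of \<open>Z\<close> on the coordinate function along \<open>b\<close>, and it is moved
  to the test function \<open>u\<close> by its formal transpose.\<close>

definition weak_deriv ::
  "('m::topological_space, 'e::euclidean_space) chart set \<Rightarrow> 'm set \<Rightarrow> ('m \<Rightarrow> 'm tvec) \<Rightarrow>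
   ('m \<Rightarrow> complex) \<Rightarrow> ('m \<Rightarrow> complex) \<Rightarrow> bool" where
  "weak_deriv A U Z f g \<longleftrightarrow>
     (\<forall>(V,\<phi>)\<in>A. \<forall>K u. compact K \<and> K \<subseteq> \<phi> ` (U \<inter> V) \<and> smooth_on UNIV u \<and> (\<forall>x. x \<notin> K \<longrightarrow> u x = 0) \<longrightarrow>
        (LINT x|lebesgue. g (inv_into V \<phi> x) * u x) =
        - (LINT x|lebesgue. f (inv_into V \<phi> x) *
             (\<Sum>b\<in>Basis. frechet_derivative
                (\<lambda>y. Z (inv_into V \<phi> y) (\<lambda>q. complex_of_real (\<phi> q \<bullet> b)) * u y) (at x) b)))"

definition condition_star ::
  "('m::topological_space, 'e::euclidean_space) chart set \<Rightarrow> ('m \<Rightarrow> 'm tvec set) \<Rightarrow>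
   'm set \<Rightarrow> ('m \<Rightarrow> complex) \<Rightarrow> bool" where
  "condition_star A T W f \<longleftrightarrow> L2_loc A W f \<and>
     (\<forall>U Z. open U \<and> U \<subseteq> W \<and> Z \<in> Theta_tilde A T U \<longrightarrow>
        (\<exists>g \<kappa>. weak_deriv A U Z f g \<and> L2_loc A U g \<and> Linf_loc A U \<kappa> \<and>
               ae_on A U (\<lambda>p. cmod (g p) \<le> \<kappa> p * cmod (f p))))"

definition zero_boundary_values ::
  "('m::topological_space, 'e::euclidean_space) chart set \<Rightarrow> ('m \<Rightarrow> 'm tvec set) \<Rightarrow>
   'm set \<Rightarrow> 'm \<Rightarrow> ('m \<Rightarrow> complex) \<Rightarrow> bool" where
  "zero_boundary_values A T \<Omega> p f \<longleftrightarrow>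
     (\<exists>W. open W \<and> p \<in> W \<and> condition_star A T W (\<lambda>q. if q \<in> \<Omega> then f q else 0))"

end

theory Submission
  imports Defs "HOL-Computational_Algebra.Polynomial"
begin

text \<open>
  Near the boundary point the kernel section is \<open>\<Sum> Z\<^sub>j \<otimes> conj Z\<^sub>j\<close> with
  \<open>\<Sum> [Z\<^sub>j, conj Z\<^sub>j] = conj L\<^sub>0 - L\<^sub>0\<close>. Conjugating the \<open>Z\<^sub>j\<close> by \<open>exp (s \<phi>)\<close> and commuting them past their
  formal adjoints produces the term \<open>s Q \<phi>\<close>, where
  \<open>Q = \<Sum> (conj Z\<^sub>j Z\<^sub>j + Z\<^sub>j conj Z\<^sub>j) - L\<^sub>0 - conj L\<^sub>0\<close>, up to derivatives along \<open>L\<^sub>0\<close>. Hence \<open>Q \<phi> > 0\<close> gives a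
  Carleman estimate \<open>s \<parallel>exp (s \<phi>) u\<parallel>\<^sup>2 \<le> C (\<Sum> \<parallel>exp (s \<phi>) Z\<^sub>j u\<parallel>\<^sup>2 + \<parallel>exp (s \<phi>) L\<^sub>0 u\<parallel>\<^sup>2)\<close>, first for test
  functions and then, by Friedrichs mollification, for the cut off weak solution. Letting \<open>s\<close> tend to
  infinity makes the solution vanish where \<open>\<phi>\<close> is close to its maximum 0 on the support.
  The weight is \<open>\<rho> + \<mu> \<rho>\<^sup>2 - \<epsilon> |x - x\<^sub>0|\<^sup>2\<close>: at \<open>\<rho> = 0\<close> the square adds
  \<open>4 \<mu> \<Sum> |Z\<^sub>j \<rho>|\<^sup>2\<close> to \<open>Q \<rho>\<close>, which wins for large \<open>\<mu>\<close> in the non-characteristic case, while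
  \<open>Q \<rho> = 2 dd\<^sup>c \<rho> (\<tau>)\<close> is already positive in the strongly 1-convex case.
\<close>

section \<open>Smooth functions on open sets\<close>

text \<open>The bracket sum leaves derivatives of the test function along L_0 and its conjugate. The
  latter is integrated by parts; the former, completed to its weighted version, goes to the right
  hand side. This is why \<open>condition_star\<close> must control L_0 besides the Z_j. Limits are
  taken in a fixed order: the mollification error contains the product of the parameter and the
  scale, so the scale tends to 0 before the parameter grows. The quadratic term of the weight makes
  it negative away from the centre on the side \<rho> < 0, which makes the cutoff error
  exponentially smaller than the value near the centre. The kernel condition is pointwise, and
  \<open>levi_form\<close> and \<open>ddc\<close> are definite descriptions. So their values must be
  shown independent of the representing sections, and a smooth L_0 must be produced from pointwise
  ones. For the latter the almost-CR condition is decisive: a frame of T and its conjugate are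
  jointly independent, and the coefficients of a smooth field in an independent smooth family are
  smooth. Gram-Schmidt elimination proves this, and also solves for the 1-form \<xi> in the
  definition of \<open>ddc\<close>.\<close>

lemma Ck_on_subset: "Ck_on k S f \<Longrightarrow> T \<subseteq> S \<Longrightarrow> Ck_on k T f"
proof (induction k arbitrary: f)
  case 0
  then show ?case by (auto intro: continuous_on_subset)
next
  case (Suc k)
  then show ?case by (auto simp: subset_eq)
qed

text \<open>Openness makes the derivative at a point depend only on values inside the set, so
  agreement on \<open>S\<close> passes to every iterated derivative.\<close>

lemma Ck_on_cong:
  assumes "open S" "\<And>x. x \<in> S \<Longrightarrow> f x = g x" "Ck_on k S f"
  shows "Ck_on k S g"
  using assms(2,3)
proof (induction k arbitrary: f g)
  case 0
  then show ?case using continuous_on_cong by (metis Ck_on.simps(1))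
next
  case (Suc k)
  have d: "(g has_derivative frechet_derivative f (at x)) (at x)" if "x \<in> S" for x
    using Suc.prems that assms(1)
    by (metis Ck_on.simps(2) frechet_derivative_works has_derivative_transform_within_open)
  then have "frechet_derivative f (at x) v = frechet_derivative g (at x) v" if "x \<in> S" for x v
    using that frechet_derivative_at by metis
  then have "Ck_on k S (\<lambda>x. frechet_derivative g (at x) v)" for v
    using Suc.IH[of "\<lambda>x. frechet_derivative f (at x) v" "\<lambda>x. frechet_derivative g (at x) v"] Suc.prems(2)
    by simp
  then show ?case using d by (auto simp: differentiable_def)
qed

lemma Ck_on_continuous_on: "Ck_on k S f \<Longrightarrow> continuous_on S f"
  by (cases k) (auto simp: continuous_at_imp_continuous_on differentiable_imp_continuous_within)

lemma Ck_on_Suc_imp: "Ck_on (Suc k) S f \<Longrightarrow> Ck_on k S f"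
proof (induction k arbitrary: f)
  case 0
  then show ?case by (metis Ck_on.simps(1) Ck_on_continuous_on)
next
  case (Suc k)
  then show ?case by (metis Ck_on.simps(2))
qed

text \<open>Any explicit derivative may stand in for the chosen \<open>frechet_derivative\<close>.
  This lets the closure rules below run by induction on the order with the usual sum, product and
  chain rules.\<close>

lemma Ck_on_SucI:
  assumes "open S" "\<And>x. x \<in> S \<Longrightarrow> (f has_derivative (\<lambda>v. f' x v)) (at x)"
    and "\<And>v. Ck_on k S (\<lambda>x. f' x v)"
  shows "Ck_on (Suc k) S f"
proof -
  have "f' x v = frechet_derivative f (at x) v" if "x \<in> S" for x v
    using assms(2)[OF that] frechet_derivative_at by metis
  then have "Ck_on k S (\<lambda>x. frechet_derivative f (at x) v)" for v
    using Ck_on_cong[OF assms(1) _ assms(3)[of v]] by simp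
  then show ?thesis using assms(2) by (auto simp: differentiable_def)
qed

lemma Ck_on_SucD:
  assumes "Ck_on (Suc k) S f"
  shows "x \<in> S \<Longrightarrow> (f has_derivative frechet_derivative f (at x)) (at x)"
    and "Ck_on k S (\<lambda>x. frechet_derivative f (at x) v)"
  using assms by (auto simp: frechet_derivative_works[symmetric])

lemma Ck_on_const: "open S \<Longrightarrow> Ck_on k S (\<lambda>x. c)"
proof (induction k arbitrary: c)
  case (Suc k)
  show ?case by (rule Ck_on_SucI[where f'="\<lambda>_ _. 0"]) (use Suc in auto)
qed auto

lemma Ck_on_add:
  assumes "open S" "Ck_on k S f" "Ck_on k S g"
  shows "Ck_on k S (\<lambda>x. f x + g x)"
  using assms(2,3)
proof (induction k arbitrary: f g)
  case 0
  then show ?case by (auto intro: continuous_intros)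
next
  case (Suc k)
  show ?case
    by (rule Ck_on_SucI[OF assms(1), where f'="\<lambda>x v. frechet_derivative f (at x) v + frechet_derivative g (at x) v"])
      (use Suc in \<open>auto intro!: derivative_eq_intros Ck_on_SucD simp del: Ck_on.simps\<close>)
qed

lemma Ck_on_linear:
  assumes "open S" "bounded_linear L" "Ck_on k S f"
  shows "Ck_on k S (\<lambda>x. L (f x))"
  using assms(3)
proof (induction k arbitrary: f)
  case 0
  then show ?case using bounded_linear.continuous_on[OF assms(2)] by simp
next
  case (Suc k)
  show ?case
    by (rule Ck_on_SucI[OF assms(1), where f'="\<lambda>x v. L (frechet_derivative f (at x) v)"])
      (use Suc in \<open>auto intro!: bounded_linear.has_derivative[OF assms(2)] Ck_on_SucD simp del: Ck_on.simps\<close>)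
qed

text \<open>The derivative is again a sum of two values of \<open>P\<close>, each with one argument
  differentiated, so the induction is generalised over both arguments. Products, scalings and inner
  products are instances.\<close>

lemma Ck_on_bilinear:
  assumes "open S" "bounded_bilinear P" "Ck_on k S f" "Ck_on k S g"
  shows "Ck_on k S (\<lambda>x. P (f x) (g x))"
  using assms(3,4)
proof (induction k arbitrary: f g)
  case 0
  then show ?case by (auto intro: bounded_bilinear.continuous_on[OF assms(2)])
next
  case (Suc k)
  have "Ck_on k S (\<lambda>x. P (f x) (frechet_derivative g (at x) v) + P (frechet_derivative f (at x) v) (g x))" for v
    by (intro Ck_on_add assms(1) Suc.IH Ck_on_SucD(2) Suc.prems Ck_on_Suc_imp)
  then show ?case
    by (intro Ck_on_SucI[OF assms(1), where f'="\<lambda>x v. P (f x) (frechet_derivative g (at x) v) + P (frechet_derivative f (at x) v) (g x)"]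
      bounded_bilinear.FDERIV[OF assms(2)] Ck_on_SucD(1)[OF Suc.prems(1)] Ck_on_SucD(1)[OF Suc.prems(2)])
qed

lemma smooth_on_subset: "smooth_on S f \<Longrightarrow> T \<subseteq> S \<Longrightarrow> smooth_on T f"
  by (auto simp: smooth_on_def intro: Ck_on_subset)

lemma smooth_on_cong:
  "open S \<Longrightarrow> (\<And>x. x \<in> S \<Longrightarrow> f x = g x) \<Longrightarrow> smooth_on S f \<Longrightarrow> smooth_on S g"
  unfolding smooth_on_def using Ck_on_cong by blast

lemma smooth_on_has_derivative:
  "smooth_on S f \<Longrightarrow> x \<in> S \<Longrightarrow> (f has_derivative frechet_derivative f (at x)) (at x)"
  unfolding smooth_on_def using Ck_on_SucD(1) by blast

lemma smooth_on_differentiable: "smooth_on S f \<Longrightarrow> x \<in> S \<Longrightarrow> f differentiable (at x)"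
  using smooth_on_has_derivative differentiable_def by blast

lemma smooth_on_continuous_on: "smooth_on S f \<Longrightarrow> continuous_on S f"
  unfolding smooth_on_def using Ck_on_continuous_on by blast

lemma smooth_on_deriv: "smooth_on S f \<Longrightarrow> smooth_on S (\<lambda>x. frechet_derivative f (at x) v)"
  unfolding smooth_on_def using Ck_on_SucD(2) by blast

lemma smooth_on_const: "open S \<Longrightarrow> smooth_on S (\<lambda>x. c)"
  by (simp add: smooth_on_def Ck_on_const)

lemma smooth_on_add: "open S \<Longrightarrow> smooth_on S f \<Longrightarrow> smooth_on S g \<Longrightarrow> smooth_on S (\<lambda>x. f x + g x)"
  by (simp add: smooth_on_def Ck_on_add)

lemma smooth_on_linear: "open S \<Longrightarrow> bounded_linear L \<Longrightarrow> smooth_on S f \<Longrightarrow> smooth_on S (\<lambda>x. L (f x))"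
  by (simp add: smooth_on_def Ck_on_linear)

lemma smooth_on_bilinear:
  "open S \<Longrightarrow> bounded_bilinear P \<Longrightarrow> smooth_on S f \<Longrightarrow> smooth_on S g \<Longrightarrow> smooth_on S (\<lambda>x. P (f x) (g x))"
  by (simp add: smooth_on_def Ck_on_bilinear)

lemma smooth_on_ident: "open S \<Longrightarrow> smooth_on S (\<lambda>x. x)"
proof -
  assume o: "open S"
  have "Ck_on k S (\<lambda>x. x)" for k
  proof (cases k)
    case (Suc l)
    show ?thesis unfolding Suc
      by (rule Ck_on_SucI[OF o, where f'="\<lambda>x v. v"]) (auto intro: Ck_on_const o)
  qed auto
  then show ?thesis by (simp add: smooth_on_def)
qed

lemma smooth_on_minus: "open S \<Longrightarrow> smooth_on S f \<Longrightarrow> smooth_on S (\<lambda>x. - f x)"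
  using smooth_on_linear[OF _ bounded_linear_minus[OF bounded_linear_ident]] by blast

lemma smooth_on_diff: "open S \<Longrightarrow> smooth_on S f \<Longrightarrow> smooth_on S g \<Longrightarrow> smooth_on S (\<lambda>x. f x - g x)"
  using smooth_on_add[of S f "\<lambda>x. - g x"] smooth_on_minus[of S g] by simp

lemma smooth_on_mult:
  fixes f g :: "'a::real_normed_vector \<Rightarrow> 'b::real_normed_algebra"
  shows "open S \<Longrightarrow> smooth_on S f \<Longrightarrow> smooth_on S g \<Longrightarrow> smooth_on S (\<lambda>x. f x * g x)"
  using smooth_on_bilinear[OF _ bounded_bilinear_mult] by blast

lemma smooth_on_cnj: "open S \<Longrightarrow> smooth_on S f \<Longrightarrow> smooth_on S (\<lambda>x. cnj (f x))"
  using smooth_on_linear[OF _ bounded_linear_cnj] by blast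

lemma smooth_on_of_real:
  "open S \<Longrightarrow> smooth_on S f \<Longrightarrow> smooth_on S (\<lambda>x. of_real (f x) :: 'b::real_normed_algebra_1)"
  using smooth_on_linear[OF _ bounded_linear_of_real] by blast

lemma smooth_on_sum:
  "open S \<Longrightarrow> (\<And>i. i \<in> I \<Longrightarrow> smooth_on S (f i)) \<Longrightarrow> smooth_on S (\<lambda>x. \<Sum>i\<in>I. f i x)"
  by (induction I rule: infinite_finite_induct) (auto intro: smooth_on_const smooth_on_add)

lemma smooth_on_inner_const:
  fixes f :: "'a::real_normed_vector \<Rightarrow> 'b::real_inner"
  shows "open S \<Longrightarrow> smooth_on S f \<Longrightarrow> smooth_on S (\<lambda>x. f x \<bullet> c)"
  using smooth_on_linear[OF _ bounded_linear_inner_left] by blast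

lemma smooth_on_dist_sq:
  fixes c :: "'a::real_inner"
  assumes "open S"
  shows "smooth_on S (\<lambda>x. (norm (x - c))\<^sup>2)"
  unfolding power2_norm_eq_inner
  by (intro smooth_on_bilinear[OF assms bounded_bilinear_inner] smooth_on_diff smooth_on_ident smooth_on_const assms)

lemma smooth_on_power2:
  fixes f :: "'a::real_normed_vector \<Rightarrow> 'b::real_normed_field"
  shows "open S \<Longrightarrow> smooth_on S f \<Longrightarrow> smooth_on S (\<lambda>x. (f x)\<^sup>2)"
  by (simp add: power2_eq_square smooth_on_mult)

text \<open>The derivative is built from two factors \<open>inverse (f x)\<close> and a derivative
  of \<open>f\<close>, so order k of the inverse already gives order k + 1.\<close>

lemma smooth_on_inverse:
  fixes f :: "'a::real_normed_vector \<Rightarrow> 'b::real_normed_field"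
  assumes S: "open S" and f: "smooth_on S f" and nz: "\<And>x. x \<in> S \<Longrightarrow> f x \<noteq> 0"
  shows "smooth_on S (\<lambda>x. inverse (f x))"
proof -
  have "Ck_on k S (\<lambda>x. inverse (f x))" for k
  proof (induction k)
    case 0
    then show ?case using nz smooth_on_continuous_on[OF f] by (auto intro: continuous_intros)
  next
    case (Suc k)
    have "Ck_on k S (\<lambda>x. frechet_derivative f (at x) v)" for v
      using smooth_on_deriv[OF f] by (simp add: smooth_on_def)
    then have "Ck_on k S (\<lambda>x. - (inverse (f x) * frechet_derivative f (at x) v * inverse (f x)))" for v
      using Suc
      by (intro Ck_on_linear[OF S bounded_linear_minus[OF bounded_linear_ident]] Ck_on_bilinear[OF S bounded_bilinear_mult])
    then show ?case
      by (intro Ck_on_SucI[OF S, where f'="\<lambda>x v. - (inverse (f x) * frechet_derivative f (at x) v * inverse (f x))"]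
          Deriv.has_derivative_inverse nz smooth_on_has_derivative[OF f])
  qed
  then show ?thesis by (simp add: smooth_on_def)
qed

lemma smooth_on_divide:
  fixes f g :: "'a::real_normed_vector \<Rightarrow> 'b::real_normed_field"
  assumes "open S" "smooth_on S f" "smooth_on S g" "\<And>x. x \<in> S \<Longrightarrow> g x \<noteq> 0"
  shows "smooth_on S (\<lambda>x. f x / g x)"
  unfolding divide_inverse by (intro smooth_on_mult smooth_on_inverse assms)

text \<open>A family of scalar functions closed under differentiation replaces the higher chain
  rule: the derivative of \<open>h (s x)\<close> is \<open>h' (s x)\<close> times a derivative of
  \<open>s\<close>, with \<open>h'\<close> in the family. It is applied to \<open>exp\<close> and to
  the flat functions behind the bump.\<close>

lemma smooth_on_compose_family:
  fixes s :: "'a::real_normed_vector \<Rightarrow> real"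
  assumes S: "open S" and s: "smooth_on S s"
    and F: "\<And>h. h \<in> F \<Longrightarrow> \<exists>h'\<in>F. \<forall>y. (h has_real_derivative h' y) (at y)"
    and h: "h \<in> F"
  shows "smooth_on S (\<lambda>x. h (s x))"
proof -
  have "Ck_on k S (\<lambda>x. h (s x))" if "h \<in> F" for k h
    using that
  proof (induction k arbitrary: h)
    case 0
    have "continuous_on UNIV h"
      using F[OF 0] by (meson DERIV_continuous continuous_at_imp_continuous_on)
    then show ?case
      using continuous_on_compose2[OF _ smooth_on_continuous_on[OF s]] by (metis Ck_on.simps(1) subset_UNIV)
  next
    case (Suc k)
    obtain h' where h': "h' \<in> F" "\<And>y. (h has_real_derivative h' y) (at y)"
      using F[OF Suc.prems] by blast
    have "Ck_on k S (\<lambda>x. h' (s x) * frechet_derivative s (at x) v)" for v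
      using Suc.IH[OF h'(1)] smooth_on_deriv[OF s]
      by (intro Ck_on_bilinear[OF S bounded_bilinear_mult]) (auto simp: smooth_on_def)
    moreover have "((\<lambda>x. h (s x)) has_derivative (\<lambda>v. h' (s x) * frechet_derivative s (at x) v)) (at x)"
      if "x \<in> S" for x
      using has_derivative_compose[OF smooth_on_has_derivative[OF s that], of h] h'(2)
      unfolding has_field_derivative_def by auto
    ultimately show ?case by (intro Ck_on_SucI[OF S])
  qed
  then show ?thesis using h by (simp add: smooth_on_def)
qed

lemma smooth_on_exp:
  fixes f :: "'a::real_normed_vector \<Rightarrow> real"
  assumes "open S" "smooth_on S f"
  shows "smooth_on S (\<lambda>x. exp (f x))"
  by (rule smooth_on_compose_family[OF assms, where F="{exp}"]) auto

text \<open>Expanding the outer derivative in the basis turns the chain rule into a finite sum of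
  scalar factors times functions composed with the same \<open>f\<close>; hence the induction varies
  the outer function only.\<close>

lemma smooth_on_compose:
  fixes f :: "'a::real_normed_vector \<Rightarrow> 'b::euclidean_space" and g :: "'b \<Rightarrow> 'c::real_normed_vector"
  assumes S: "open S" and f: "smooth_on S f" and g: "smooth_on T g" and im: "f ` S \<subseteq> T"
  shows "smooth_on S (\<lambda>x. g (f x))"
proof -
  have "Ck_on k S (\<lambda>x. g (f x))" if "smooth_on T g" for k and g :: "'b \<Rightarrow> 'c"
    using that
  proof (induction k arbitrary: g)
    case 0
    show ?case
      using continuous_on_compose2[OF smooth_on_continuous_on[OF 0] smooth_on_continuous_on[OF f] im] by simp
  next
    case (Suc k)
    let ?d = "\<lambda>x v. \<Sum>b\<in>Basis. (frechet_derivative f (at x) v \<bullet> b) *\<^sub>R frechet_derivative g (at (f x)) b"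
    have t: "Ck_on k S (\<lambda>x. frechet_derivative g (at (f x)) b)" for b
      by (rule Suc.IH[OF smooth_on_deriv[OF Suc.prems]])
    have e: "Ck_on k S (\<lambda>x. frechet_derivative f (at x) v \<bullet> b)" for v b
      using smooth_on_inner_const[OF S smooth_on_deriv[OF f]] by (simp add: smooth_on_def)
    have sm: "Ck_on k S (\<lambda>x. \<Sum>b\<in>I. (frechet_derivative f (at x) v \<bullet> b) *\<^sub>R frechet_derivative g (at (f x)) b)" for v I
      by (induction I rule: infinite_finite_induct)
        (auto intro!: Ck_on_const Ck_on_add S Ck_on_bilinear[OF S bounded_bilinear_scaleR] t e)
    have "((\<lambda>x. g (f x)) has_derivative (\<lambda>v. ?d x v)) (at x)" if "x \<in> S" for x
    proof -
      have dg: "(g has_derivative frechet_derivative g (at (f x))) (at (f x))"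
        using smooth_on_has_derivative[OF Suc.prems] im that by blast
      then have l: "linear (frechet_derivative g (at (f x)))" by (simp add: has_derivative_linear)
      have eq: "frechet_derivative g (at (f x)) w = (\<Sum>b\<in>Basis. (w \<bullet> b) *\<^sub>R frechet_derivative g (at (f x)) b)" for w
      proof -
        have "frechet_derivative g (at (f x)) w = frechet_derivative g (at (f x)) (\<Sum>b\<in>Basis. (w \<bullet> b) *\<^sub>R b)"
          by (simp only: euclidean_representation)
        also have "\<dots> = (\<Sum>b\<in>Basis. (w \<bullet> b) *\<^sub>R frechet_derivative g (at (f x)) b)"
          by (simp only: linear_sum[OF l] linear_cmul[OF l])
        finally show ?thesis .
      qed
      have "(\<lambda>v. frechet_derivative g (at (f x)) (frechet_derivative f (at x) v)) = ?d x"
        by (rule ext) (rule eq)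
      with has_derivative_compose[OF smooth_on_has_derivative[OF f that] dg] show ?thesis by metis
    qed
    then show ?case using sm by (intro Ck_on_SucI[OF S, where f'="?d"]) auto
  qed
  then show ?thesis using g by (simp add: smooth_on_def)
qed

text \<open>The open sets \<open>S\<close> and \<open>- K\<close> cover the space, and the
  derivatives vanish off \<open>K\<close> again, so the induction closes. Coefficients will be
  smooth on \<open>S\<close> only, while integration by parts takes place on the whole
  space.\<close>

lemma smooth_on_UNIV_extend:
  fixes f :: "'a::real_normed_vector \<Rightarrow> 'b::real_normed_vector"
  assumes S: "open S" and K: "closed K" "K \<subseteq> S" and f: "smooth_on S f" and z: "\<And>x. x \<notin> K \<Longrightarrow> f x = 0"
  shows "smooth_on UNIV f"
proof -
  have "Ck_on k UNIV f" if "smooth_on S f" "\<And>x. x \<notin> K \<Longrightarrow> f x = 0" for k and f :: "'a \<Rightarrow> 'b"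
    using that
  proof (induction k arbitrary: f)
    case 0
    have "continuous_on (- K) f"
      by (rule continuous_on_eq[where f="\<lambda>x. 0"]) (use 0(2) in auto)
    then have "continuous_on (S \<union> - K) f"
      using K S smooth_on_continuous_on[OF 0(1)] by (intro continuous_on_open_Un) (auto simp: open_Compl)
    moreover have "S \<union> - K = UNIV" using K by auto
    ultimately show ?case by simp
  next
    case (Suc k)
    have z: "(f has_derivative (\<lambda>v. 0)) (at x)" if "x \<notin> K" for x
      by (rule has_derivative_transform_within_open[where f="\<lambda>x. 0" and s="-K"]) (use Suc.prems that K in auto)
    then have "(f has_derivative frechet_derivative f (at x)) (at x)" for x
      using smooth_on_has_derivative[OF Suc.prems(1)] K
      by (metis differentiable_def frechet_derivative_works subsetD)
    moreover have "Ck_on k UNIV (\<lambda>x. frechet_derivative f (at x) v)" for v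
    proof (rule Suc.IH)
      show "frechet_derivative f (at x) v = 0" if "x \<notin> K" for x
        using frechet_derivative_at[OF z[OF that]] by metis
    qed (rule smooth_on_deriv[OF Suc.prems(1)])
    ultimately show ?case by (intro Ck_on_SucI) auto
  qed
  then show ?thesis using f z by (simp add: smooth_on_def)
qed

section \<open>A smooth bump function\<close>

text \<open>Every derivative of exp (-1/s) is a polynomial in 1/s times exp (-1/s). With the
  polynomial as a parameter the family becomes closed under differentiation.\<close>

definition flat_exp :: "real poly \<Rightarrow> real \<Rightarrow> real" where
  "flat_exp p s = (if s \<le> 0 then 0 else poly p (1/s) * exp (- (1/s)))"

lemma flat_exp_tendsto:
  fixes p :: "real poly"
  shows "((\<lambda>s. poly p (1/s) * exp (- (1/s))) \<longlongrightarrow> 0) (at_right 0)"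
proof -
  have "((\<lambda>y. \<Sum>i\<le>degree p. coeff p i * (y ^ i / exp y)) \<longlongrightarrow> (\<Sum>i\<le>degree p. coeff p i * 0)) at_top"
    by (intro tendsto_sum tendsto_mult tendsto_const tendsto_power_div_exp_0)
  then have "((\<lambda>y. poly p y / exp y) \<longlongrightarrow> 0) at_top"
    by (simp add: poly_altdef sum_divide_distrib)
  moreover have "filterlim (\<lambda>s::real. 1/s) at_top (at_right 0)"
    using filterlim_inverse_at_top_right by (simp add: inverse_eq_divide)
  ultimately have "((\<lambda>s. poly p (1/s) / exp (1/s)) \<longlongrightarrow> 0) (at_right 0)"
    using filterlim_compose by fast
  then show ?thesis by (simp add: exp_minus divide_inverse)
qed

text \<open>With y = 1/s, differentiation acts on the polynomial factor as p to y^2 (p - p'), which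
  is the polynomial in the statement. Only s = 0 requires a limit argument.\<close>

lemma flat_exp_deriv:
  "(flat_exp p has_real_derivative flat_exp ([:0,0,1:] * (p - pderiv p)) s) (at s)"
proof -
  consider "s < 0" | "s > 0" | "s = 0" by linarith
  then show ?thesis
  proof cases
    case 1
    show ?thesis
      by (rule has_field_derivative_transform_within_open[where f="\<lambda>s. 0" and S="{..<0}"])
        (use 1 in \<open>auto simp: flat_exp_def\<close>)
  next
    case 2
    have "((\<lambda>s. poly p (1/s) * exp (- (1/s))) has_real_derivative flat_exp ([:0,0,1:] * (p - pderiv p)) s) (at s)"
      using 2 by (auto intro!: derivative_eq_intros poly_DERIV[THEN DERIV_chain2] simp: flat_exp_def field_simps power2_eq_square)
    then show ?thesis
      by (rule has_field_derivative_transform_within_open[where S="{0<..}"])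
        (use 2 in \<open>auto simp: flat_exp_def\<close>)
  next
    case 3
    \<comment> \<open>The difference quotient at 0 is a function of the same kind, with polynomial y
      p(y), so its limit is already known.\<close>
    have r: "((\<lambda>y. (flat_exp p y - flat_exp p 0) / (y - 0)) \<longlongrightarrow> 0) (at_right 0)"
    proof (rule Lim_transform_eventually[OF flat_exp_tendsto[of "[:0,1:] * p"]])
      show "\<forall>\<^sub>F y in at_right 0. poly ([:0,1:] * p) (1/y) * exp (- (1/y)) = (flat_exp p y - flat_exp p 0) / (y - 0)"
        unfolding eventually_at_right_field by (auto intro!: exI[of _ 1] simp: flat_exp_def)
    qed
    have l: "((\<lambda>y. (flat_exp p y - flat_exp p 0) / (y - 0)) \<longlongrightarrow> 0) (at_left 0)"
    proof (rule Lim_transform_eventually[OF tendsto_const])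
      show "\<forall>\<^sub>F y in at_left 0. 0 = (flat_exp p y - flat_exp p 0) / (y - 0)"
        unfolding eventually_at_left_field by (auto intro!: exI[of _ "-1"] simp: flat_exp_def)
    qed
    have "(flat_exp p has_real_derivative 0) (at 0)"
      unfolding has_field_derivative_iff using filterlim_split_at[OF l r] by simp
    then show ?thesis using 3 by (simp add: flat_exp_def)
  qed
qed

text \<open>The squared norm keeps the argument of the flat function smooth even at the
  centre.\<close>

definition bump :: "'a::real_inner \<Rightarrow> real \<Rightarrow> 'a \<Rightarrow> real" where
  "bump c r x = flat_exp 1 (r\<^sup>2 - (norm (x - c))\<^sup>2)"

lemma smooth_on_bump:
  assumes "open S"
  shows "smooth_on S (bump c r)"
proof -
  have "smooth_on S (\<lambda>x. flat_exp 1 (r\<^sup>2 - (norm (x - c))\<^sup>2))"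
  proof (rule smooth_on_compose_family[OF assms, where F="range flat_exp" and h="flat_exp 1"])
    show "smooth_on S (\<lambda>x. r\<^sup>2 - (norm (x - c))\<^sup>2)"
      by (intro smooth_on_diff smooth_on_const smooth_on_dist_sq assms)
    show "\<exists>h'\<in>range flat_exp. \<forall>y. (h has_real_derivative h' y) (at y)" if h: "h \<in> range flat_exp" for h
      using h flat_exp_deriv by blast
  qed simp
  then show ?thesis by (simp add: bump_def[abs_def])
qed

lemma bump_nonneg: "bump c r x \<ge> 0"
  by (simp add: bump_def flat_exp_def)

lemma bump_le_1: "bump c r x \<le> 1"
  by (simp add: bump_def flat_exp_def)

lemma bump_pos_iff: "r > 0 \<Longrightarrow> bump c r x > 0 \<longleftrightarrow> norm (x - c) < r"
  using power2_less_imp_less[of "norm (x - c)" r] power_strict_mono[of "norm (x - c)" r 2]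
  by (auto simp: bump_def flat_exp_def)

lemma bump_eq_0: "r > 0 \<Longrightarrow> r \<le> norm (x - c) \<Longrightarrow> bump c r x = 0"
  using bump_pos_iff[of r c x] bump_nonneg[of c r x] by linarith

section \<open>Compactly supported smooth functions\<close>

lemma compact_support_bounded:
  fixes u :: "'a::topological_space \<Rightarrow> 'b::real_normed_vector"
  assumes "compact K" "continuous_on UNIV u" "\<And>x. x \<notin> K \<Longrightarrow> u x = 0"
  obtains M where "M > 0" "\<And>x. norm (u x) \<le> M"
proof -
  have "bounded (u ` K)"
    using assms by (intro compact_imp_bounded compact_continuous_image) (auto intro: continuous_on_subset)
  then obtain M where "M > 0" "\<And>x. x \<in> K \<Longrightarrow> norm (u x) \<le> M"
    by (auto simp: bounded_pos)
  then have "norm (u x) \<le> M" for x using assms(3)[of x] by (cases "x \<in> K") auto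
  then show thesis using that \<open>M > 0\<close> by blast
qed

lemma deriv_zero_off:
  assumes "closed K" "x \<notin> K" "\<And>x. x \<notin> K \<Longrightarrow> u x = 0"
  shows "frechet_derivative u (at x) v = 0"
proof -
  have "(u has_derivative (\<lambda>v. 0)) (at x)"
    by (rule has_derivative_transform_within_open[where f="\<lambda>x. 0" and s="-K"]) (use assms in auto)
  then show ?thesis using frechet_derivative_at by metis
qed

lemma frechet_derivative_coords:
  fixes u :: "'a::euclidean_space \<Rightarrow> 'b::real_normed_vector"
  assumes "u differentiable (at x)"
  shows "frechet_derivative u (at x) v = (\<Sum>b\<in>Basis. (v \<bullet> b) *\<^sub>R frechet_derivative u (at x) b)"
proof -
  have l: "linear (frechet_derivative u (at x))" using assms by (rule linear_frechet_derivative)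
  have "frechet_derivative u (at x) v = frechet_derivative u (at x) (\<Sum>b\<in>Basis. (v \<bullet> b) *\<^sub>R b)"
    by (simp only: euclidean_representation)
  also have "\<dots> = (\<Sum>b\<in>Basis. (v \<bullet> b) *\<^sub>R frechet_derivative u (at x) b)"
    by (simp only: linear_sum[OF l] linear_cmul[OF l])
  finally show ?thesis .
qed

lemma norm_coords_le:
  fixes A :: "'a::euclidean_space \<Rightarrow> 'b::real_normed_vector"
  assumes "\<And>b. b \<in> Basis \<Longrightarrow> norm (A b) \<le> M"
  shows "norm (\<Sum>b\<in>Basis. (v \<bullet> b) *\<^sub>R A b) \<le> (real DIM('a) * M) * norm v"
proof -
  have "norm (\<Sum>b\<in>Basis. (v \<bullet> b) *\<^sub>R A b) \<le> (\<Sum>b\<in>(Basis::'a set). norm v * M)"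
    using assms by (intro sum_norm_le) (auto intro!: mult_mono Basis_le_norm)
  then show ?thesis by (simp add: algebra_simps)
qed

lemma compact_support_lipschitz:
  fixes u :: "'a::euclidean_space \<Rightarrow> 'b::real_normed_vector"
  assumes "compact K" "smooth_on UNIV u" "\<And>x. x \<notin> K \<Longrightarrow> u x = 0"
  obtains L where "L > 0" "\<And>x y. norm (u x - u y) \<le> L * norm (x - y)"
proof -
  have "\<exists>M>0. \<forall>x. norm (frechet_derivative u (at x) b) \<le> M" for b
    using compact_support_bounded[OF assms(1) smooth_on_continuous_on[OF smooth_on_deriv[OF assms(2)]]
      deriv_zero_off[OF compact_imp_closed[OF assms(1)] _ assms(3)]] by blast
  then obtain M where M: "\<And>b. M b > 0" "\<And>b x. norm (frechet_derivative u (at x) b) \<le> M b" by metis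
  define B where "B = (\<Sum>b\<in>Basis. M b)"
  have B: "M b \<le> B" if "b \<in> Basis" for b
    unfolding B_def using that M(1) by (intro member_le_sum) (auto simp: less_imp_le)
  have Bp: "B > 0" unfolding B_def by (intro sum_pos) (use M(1) in auto)
  have "norm (u x - u y) \<le> (real DIM('a) * B) * norm (x - y)" for x y
  proof (rule differentiable_bound[where S=UNIV and f'="\<lambda>x. frechet_derivative u (at x)"])
    show "onorm (frechet_derivative u (at x)) \<le> real DIM('a) * B" for x
    proof (rule onorm_le)
      show "norm (frechet_derivative u (at x) v) \<le> real DIM('a) * B * norm v" for v
        unfolding frechet_derivative_coords[OF smooth_on_differentiable[OF assms(2) UNIV_I], of x v]
        using norm_coords_le[of "frechet_derivative u (at x)" B v] M(2) B by (meson order_trans)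
    qed
  qed (auto intro: smooth_on_has_derivative[OF assms(2)])
  moreover have "real DIM('a) * B > 0" using Bp by simp
  ultimately show thesis using that by blast
qed

text \<open>The constant is uniform in the base point, so difference quotients can be integrated
  with an explicit error instead of a dominated convergence argument.\<close>

lemma compact_support_taylor:
  fixes u :: "'a::euclidean_space \<Rightarrow> 'b::real_normed_vector"
  assumes K: "compact K" and u: "smooth_on UNIV u" and z: "\<And>x. x \<notin> K \<Longrightarrow> u x = 0"
  obtains C where "C > 0"
    "\<And>x h. norm (u (x + h) - u x - frechet_derivative u (at x) h) \<le> C * (norm h)\<^sup>2"
proof -
  have "\<exists>L>0. \<forall>x y. norm (frechet_derivative u (at x) b - frechet_derivative u (at y) b) \<le> L * norm (x - y)" for b
    using compact_support_lipschitz[OF K smooth_on_deriv[OF u]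
      deriv_zero_off[OF compact_imp_closed[OF K] _ z]] by blast
  then obtain M where M: "\<And>b. M b > 0"
    "\<And>b x y. norm (frechet_derivative u (at x) b - frechet_derivative u (at y) b) \<le> M b * norm (x - y)" by metis
  define B where "B = (\<Sum>b\<in>Basis. M b)"
  have B: "M b \<le> B" if "b \<in> Basis" for b
    unfolding B_def using that M(1) by (intro member_le_sum) (auto simp: less_imp_le)
  have Bp: "B > 0" unfolding B_def by (intro sum_pos) (use M(1) in auto)
  have "norm (u (x + h) - u x - frechet_derivative u (at x) h) \<le> (real DIM('a) * B) * (norm h)\<^sup>2" for x h
  proof -
    let ?S = "cball x (norm h)"
    have "norm (u (x + h) - u x - frechet_derivative u (at x) (x + h - x)) \<le> norm (x + h - x) * (real DIM('a) * (B * norm h))"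
    proof (rule differentiable_bound_linearization[where S="?S" and f'="\<lambda>x. frechet_derivative u (at x)"])
      show "x + t *\<^sub>R (x + h - x) \<in> ?S" if "t \<in> {0..1}" for t
        using that by (auto simp: dist_norm mult_left_le_one_le)
      show "(u has_derivative frechet_derivative u (at y)) (at y within ?S)" for y
        using smooth_on_has_derivative[OF u UNIV_I] has_derivative_at_withinI by blast
      show "onorm (frechet_derivative u (at y) - frechet_derivative u (at x)) \<le> real DIM('a) * (B * norm h)" if "y \<in> ?S" for y
      proof (rule onorm_le)
        fix v
        have "(frechet_derivative u (at y) - frechet_derivative u (at x)) v =
          (\<Sum>b\<in>Basis. (v \<bullet> b) *\<^sub>R (frechet_derivative u (at y) b - frechet_derivative u (at x) b))"
          using frechet_derivative_coords[OF smooth_on_differentiable[OF u UNIV_I], of x v]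
            frechet_derivative_coords[OF smooth_on_differentiable[OF u UNIV_I], of y v]
          by (simp add: scaleR_diff_right sum_subtractf fun_diff_def)
        moreover have "norm (frechet_derivative u (at y) b - frechet_derivative u (at x) b) \<le> B * norm h" if b: "b \<in> Basis" for b
        proof -
          have "norm (y - x) \<le> norm h" using \<open>y \<in> ?S\<close> by (simp add: dist_norm norm_minus_commute)
          then have "M b * norm (y - x) \<le> B * norm h" using B[OF b] M(1)[of b] Bp by (intro mult_mono) auto
          with M(2)[of y b x] show ?thesis by linarith
        qed
        ultimately show "norm ((frechet_derivative u (at y) - frechet_derivative u (at x)) v) \<le> real DIM('a) * (B * norm h) * norm v"
          using norm_coords_le[of "\<lambda>b. frechet_derivative u (at y) b - frechet_derivative u (at x) b" "B * norm h" v] by simp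
      qed
    qed simp
    then show ?thesis by (simp add: power2_eq_square algebra_simps)
  qed
  moreover have "real DIM('a) * B > 0" using Bp by simp
  ultimately show thesis using that by blast
qed

lemma compact_support_integrable:
  fixes u :: "'a::euclidean_space \<Rightarrow> 'b::{banach,second_countable_topology}"
  assumes "compact K" "continuous_on UNIV u" "\<And>x. x \<notin> K \<Longrightarrow> u x = 0"
  shows "integrable lborel u"
proof -
  have "integrable lborel (\<lambda>x. indicator K x *\<^sub>R u x)"
    using assms by (intro borel_integrable_compact) (auto intro: continuous_on_subset)
  moreover have "(\<lambda>x. indicator K x *\<^sub>R u x) = u" using assms(3) by (auto simp: indicator_def)
  ultimately show ?thesis by simp
qed

section \<open>Invariance of Lebesgue measure and integrals of derivatives\<close>

lemma nn_integral_lborel_shift: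
  fixes f :: "'a::euclidean_space \<Rightarrow> ennreal"
  assumes [measurable]: "f \<in> borel_measurable borel"
  shows "(\<integral>\<^sup>+x. f (c + x) \<partial>lborel) = (\<integral>\<^sup>+x. f x \<partial>lborel)"
  by (subst (2) lborel_distr_plus[of c, symmetric]) (simp add: nn_integral_distr)

lemma nn_integral_lborel_reflect:
  fixes f :: "'a::euclidean_space \<Rightarrow> ennreal"
  assumes [measurable]: "f \<in> borel_measurable borel"
  shows "(\<integral>\<^sup>+y. f (x - y) \<partial>lborel) = (\<integral>\<^sup>+y. f y \<partial>lborel)"
  by (subst (2) lborel_affine[of "-1" x]) (simp_all add: nn_integral_density nn_integral_distr)

lemma nn_integral_lborel_scale:
  fixes f :: "'a::euclidean_space \<Rightarrow> ennreal"
  assumes [measurable]: "f \<in> borel_measurable borel" and "e > 0"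
  shows "(\<integral>\<^sup>+z. f (z /\<^sub>R e) \<partial>lborel) = ennreal (e ^ DIM('a)) * (\<integral>\<^sup>+z. f z \<partial>lborel)"
  using assms(2)
  by (subst lborel_affine[of e 0]) (simp_all add: nn_integral_density nn_integral_distr nn_integral_cmult)

lemma integral_lborel_shift:
  fixes f :: "'a::euclidean_space \<Rightarrow> 'b::{banach,second_countable_topology}"
  assumes [measurable]: "f \<in> borel_measurable borel"
  shows "(\<integral>x. f (c + x) \<partial>lborel) = (\<integral>x. f x \<partial>lborel)"
  by (subst (2) lborel_distr_plus[of c, symmetric]) (simp add: integral_distr)

lemma norm_integral_le:
  fixes f :: "'a \<Rightarrow> 'b::{banach,second_countable_topology}"
  assumes g: "integrable M g" and f: "integrable M f" and "\<And>x. norm (f x) \<le> g x"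
  shows "norm (\<integral>x. f x \<partial>M) \<le> (\<integral>x. g x \<partial>M)"
  using order_trans[OF integral_norm_bound Bochner_Integration.integral_mono[OF integrable_norm[OF f] g]] assms(3)
  by blast

text \<open>By translation invariance the integral of u (x + h b) - u x is 0, so h times the
  integral of the derivative is minus the integrated Taylor remainder, which is of order h^2 on a
  bounded set. Dividing by h and letting h tend to 0 avoids iterated integrals.\<close>

lemma integral_deriv_zero:
  fixes u :: "'a::euclidean_space \<Rightarrow> complex"
  assumes K: "compact K" and u: "smooth_on UNIV u" and z: "\<And>x. x \<notin> K \<Longrightarrow> u x = 0" and b: "b \<in> Basis"
  shows "(\<integral>x. frechet_derivative u (at x) b \<partial>lborel) = 0"
proof -
  obtain C where C: "C > 0" "\<And>x h. norm (u (x + h) - u x - frechet_derivative u (at x) h) \<le> C * (norm h)\<^sup>2"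
    using compact_support_taylor[OF K u z] by blast
  obtain R where R: "\<And>x. x \<in> K \<Longrightarrow> norm x \<le> R"
    using compact_imp_bounded[OF K] by (auto simp: bounded_iff)
  let ?D = "\<lambda>x. frechet_derivative u (at x) b"
  let ?V = "measure lborel (cball (0::'a) (R + 1))"
  have Db: "integrable lborel ?D"
    by (rule compact_support_integrable[OF K smooth_on_continuous_on[OF smooth_on_deriv[OF u]] deriv_zero_off[OF compact_imp_closed[OF K] _ z]])
  have um [measurable]: "u \<in> borel_measurable borel"
    using smooth_on_continuous_on[OF u] by (rule borel_measurable_continuous_onI)
  have ui: "integrable lborel u"
    by (rule compact_support_integrable[OF K smooth_on_continuous_on[OF u] z])
  have "norm (\<integral>x. ?D x \<partial>lborel) \<le> C * ?V * h" if h: "0 < h" "h \<le> 1" for h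
  proof -
    have us: "integrable lborel (\<lambda>x. u (h *\<^sub>R b + x))"
      using ui integrable_distr_eq[of "(+) (h *\<^sub>R b)" lborel borel u] lborel_distr_plus[of "h *\<^sub>R b"] by simp
    have "(\<integral>x. (u (h *\<^sub>R b + x) - u x) \<partial>lborel) = 0"
      using us ui integral_lborel_shift[OF um] by simp
    then have "(\<integral>x. h *\<^sub>R ?D x \<partial>lborel) = - (\<integral>x. (u (h *\<^sub>R b + x) - u x - h *\<^sub>R ?D x) \<partial>lborel)"
      using us ui Db by (simp add: Bochner_Integration.integral_diff)
    then have "norm (\<integral>x. h *\<^sub>R ?D x \<partial>lborel) = norm (\<integral>x. (u (h *\<^sub>R b + x) - u x - h *\<^sub>R ?D x) \<partial>lborel)" by simp
    \<comment> \<open>Since h is at most 1, both x and x + h b lie outside \<open>K\<close> once the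
      norm of x exceeds R + 1, so the remainder lives on this ball.\<close>
    also have "\<dots> \<le> (\<integral>x. C * h\<^sup>2 * indicator (cball (0::'a) (R + 1)) x \<partial>lborel)"
    proof (rule norm_integral_le)
      show "integrable lborel (\<lambda>x. C * h\<^sup>2 * indicator (cball 0 (R + 1)) (x::'a))"
        by (intro integrable_mult_right integrable_real_indicator) (use emeasure_lborel_cball_finite[of "0::'a" "R + 1"] in \<open>auto simp: infinity_ennreal_def\<close>)
      show "norm (u (h *\<^sub>R b + x) - u x - h *\<^sub>R ?D x) \<le> C * h\<^sup>2 * indicator (cball 0 (R + 1)) x" for x
      proof (cases "norm x \<le> R + 1")
        case True
        have l: "linear (frechet_derivative u (at x))"
          using smooth_on_differentiable[OF u UNIV_I] by (rule linear_frechet_derivative)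
        have "frechet_derivative u (at x) (h *\<^sub>R b) = h *\<^sub>R ?D x"
          using linear_cmul[OF l] by simp
        then show ?thesis using C(2)[of x "h *\<^sub>R b"] True b h by (simp add: add.commute)
      next
        case False
        have "norm x \<le> norm (h *\<^sub>R b + x) + h" using b h norm_triangle_ineq4[of "h *\<^sub>R b + x" "h *\<^sub>R b"] by simp
        then have "x \<notin> K" "h *\<^sub>R b + x \<notin> K" using R False h by force+
        moreover have "?D x = 0" by (rule deriv_zero_off[OF compact_imp_closed[OF K] \<open>x \<notin> K\<close> z])
        ultimately show ?thesis using z C(1) by simp
      qed
    qed (use us ui Db in auto)
    also have "\<dots> = C * h\<^sup>2 * ?V" by simp
    finally have "h * norm (\<integral>x. ?D x \<partial>lborel) \<le> h * (C * ?V * h)"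
      using h by (simp add: power2_eq_square algebra_simps)
    then show ?thesis using h by simp
  qed
  then have "\<forall>\<^sub>F h in at_right 0. norm (\<integral>x. ?D x \<partial>lborel) \<le> C * ?V * h"
    unfolding eventually_at_right_field by (intro exI[of _ 1]) auto
  moreover have "((\<lambda>h. C * ?V * h) \<longlongrightarrow> C * ?V * 0) (at_right 0)" by (intro tendsto_intros)
  ultimately have "norm (\<integral>x. ?D x \<partial>lborel) \<le> C * ?V * 0"
    by (intro tendsto_lowerbound[of _ _ "at_right 0"]) auto
  then show ?thesis by simp
qed

section \<open>Convolution with smooth kernels\<close>

definition conv :: "('a::euclidean_space \<Rightarrow> real) \<Rightarrow> ('a \<Rightarrow> complex) \<Rightarrow> 'a \<Rightarrow> complex" where
  "conv k v x = (\<integral>y. k (x - y) *\<^sub>R v y \<partial>lborel)"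

lemma conv_integrable:
  fixes v :: "'a::euclidean_space \<Rightarrow> complex"
  assumes "compact K" "continuous_on UNIV k" "\<And>x. x \<notin> K \<Longrightarrow> k x = 0" "integrable lborel v"
  shows "integrable lborel (\<lambda>y. k (x - y) *\<^sub>R v y)"
proof -
  obtain M where M: "M > 0" "\<And>x. norm (k x) \<le> M"
    using compact_support_bounded[OF assms(1-3)] by blast
  have [measurable]: "k \<in> borel_measurable borel" using assms(2) by (rule borel_measurable_continuous_onI)
  have [measurable]: "v \<in> borel_measurable borel" using assms(4) by auto
  show ?thesis
    by (rule Bochner_Integration.integrable_bound[of _ "\<lambda>y. M *\<^sub>R v y"])
      (use M assms(4) in \<open>auto intro!: mult_right_mono\<close>)
qed

text \<open>The Taylor bound of the kernel is uniform, so the remainder of the convolution is at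
  most a constant times |h|^2 times the L1 norm of \<open>v\<close>.\<close>

lemma conv_has_derivative:
  assumes K: "compact K" and k: "smooth_on UNIV k" and z: "\<And>x. x \<notin> K \<Longrightarrow> k x = 0" and v: "integrable lborel v"
  shows "(conv k v has_derivative (\<lambda>h. conv (\<lambda>z. frechet_derivative k (at z) h) v x)) (at x)"
proof -
  obtain C where C: "C > 0" "\<And>x h. norm (k (x + h) - k x - frechet_derivative k (at x) h) \<le> C * (norm h)\<^sup>2"
    using compact_support_taylor[OF K k z] by blast
  have dz: "\<And>x v. x \<notin> K \<Longrightarrow> frechet_derivative k (at x) v = 0"
    using deriv_zero_off[OF compact_imp_closed[OF K] _ z] .
  have i0: "integrable lborel (\<lambda>y. k (x - y) *\<^sub>R v y)" for x
    by (rule conv_integrable[OF K smooth_on_continuous_on[OF k] z v])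
  have i1: "integrable lborel (\<lambda>y. frechet_derivative k (at (x - y)) h *\<^sub>R v y)" for x h
    by (rule conv_integrable[OF K smooth_on_continuous_on[OF smooth_on_deriv[OF k]] dz v])
  have l: "linear (frechet_derivative k (at z))" for z
    using smooth_on_differentiable[OF k UNIV_I] by (rule linear_frechet_derivative)
  let ?A = "\<lambda>h. conv (\<lambda>z. frechet_derivative k (at z) h) v x"
  let ?I = "\<integral>y. norm (v y) \<partial>lborel"
  have "linear ?A"
  proof (rule linearI)
    show "?A (h1 + h2) = ?A h1 + ?A h2" for h1 h2
      unfolding conv_def linear_add[OF l] scaleR_add_left by (rule Bochner_Integration.integral_add[OF i1 i1])
    show "?A (r *\<^sub>R h) = r *\<^sub>R ?A h" for r h
      unfolding conv_def linear_cmul[OF l] by (simp add: integral_scaleR_right[symmetric] del: integral_scaleR_right)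
  qed
  then have bl: "bounded_linear ?A" by (rule linear_conv_bounded_linear[THEN iffD1])
  have est: "norm (conv k v (x + h) - conv k v x - ?A h) \<le> C * ?I * (norm h)\<^sup>2" for h
  proof -
    have "conv k v (x + h) - conv k v x - ?A h =
      (\<integral>y. (k (x - y + h) - k (x - y) - frechet_derivative k (at (x - y)) h) *\<^sub>R v y \<partial>lborel)"
      unfolding conv_def using i0[of "x+h"] i0[of x] i1[of x h]
      by (simp add: scaleR_diff_left Bochner_Integration.integral_diff algebra_simps)
    also have "norm \<dots> \<le> (\<integral>y. C * (norm h)\<^sup>2 * norm (v y) \<partial>lborel)"
    proof (rule norm_integral_le)
      show "integrable lborel (\<lambda>y. (k (x - y + h) - k (x - y) - frechet_derivative k (at (x - y)) h) *\<^sub>R v y)"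
        using Bochner_Integration.integrable_diff[OF Bochner_Integration.integrable_diff[OF i0[of "x+h"] i0[of x]] i1[of x h]]
        by (simp add: scaleR_diff_left algebra_simps)
      show "norm ((k (x - y + h) - k (x - y) - frechet_derivative k (at (x - y)) h) *\<^sub>R v y) \<le> C * (norm h)\<^sup>2 * norm (v y)" for y
        using C(2)[of "x - y" h] by (simp add: mult_right_mono)
    qed (use v in auto)
    finally show ?thesis by (simp add: algebra_simps)
  qed
  show ?thesis
  proof (rule has_derivativeI)
    show "((\<lambda>y. (conv k v y - conv k v x - ?A (y - x)) /\<^sub>R norm (y - x)) \<longlongrightarrow> 0) (at x)"
    proof (rule Lim_null_comparison)
      show "\<forall>\<^sub>F y in at x. norm ((conv k v y - conv k v x - ?A (y - x)) /\<^sub>R norm (y - x)) \<le> C * ?I * norm (y - x)"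
      proof (rule eventually_at_filter[THEN iffD2], rule always_eventually, intro allI impI)
        fix y assume "y \<noteq> x"
        then have "norm (conv k v y - conv k v x - ?A (y - x)) / norm (y - x) \<le> C * ?I * norm (y - x)"
          using est[of "y - x"] by (simp add: divide_le_eq power2_eq_square mult.assoc)
        then show "norm ((conv k v y - conv k v x - ?A (y - x)) /\<^sub>R norm (y - x)) \<le> C * ?I * norm (y - x)"
          by (simp add: divide_inverse mult.commute)
      qed
      have "((\<lambda>y. C * ?I * norm (y - x)) \<longlongrightarrow> C * ?I * norm (x - x)) (at x)" by (intro tendsto_intros)
      then show "((\<lambda>y. C * ?I * norm (y - x)) \<longlongrightarrow> 0) (at x)" by simp
    qed
  qed (rule bl)
qed

lemma conv_deriv:
  assumes "compact K" "smooth_on UNIV k" "\<And>x. x \<notin> K \<Longrightarrow> k x = 0" "integrable lborel v"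
  shows "frechet_derivative (conv k v) (at x) h = conv (\<lambda>z. frechet_derivative k (at z) h) v x"
  using frechet_derivative_at[OF conv_has_derivative[OF assms]] by metis

text \<open>Differentiation falls on the kernel, whose derivatives are smooth and vanish off the
  same compact set; hence the induction varies the kernel and keeps \<open>v\<close>.\<close>

lemma smooth_on_conv:
  fixes k :: "'a::euclidean_space \<Rightarrow> real"
  assumes K: "compact K" and k: "smooth_on UNIV k" and z: "\<And>x. x \<notin> K \<Longrightarrow> k x = 0" and v: "integrable lborel v"
  shows "smooth_on UNIV (conv k v)"
proof -
  have "Ck_on n UNIV (conv k v)" if "smooth_on UNIV k" "\<And>x. x \<notin> K \<Longrightarrow> k x = 0" for n and k :: "'a \<Rightarrow> real"
    using that
  proof (induction n arbitrary: k)
    case 0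
    have "continuous_on UNIV (conv k v)"
      using conv_has_derivative[OF K 0 v] has_derivative_continuous by (blast intro: continuous_at_imp_continuous_on)
    then show ?case by simp
  next
    case (Suc n)
    show ?case
    proof (rule Ck_on_SucI[where f'="\<lambda>x h. conv (\<lambda>z. frechet_derivative k (at z) h) v x"])
      show "Ck_on n UNIV (\<lambda>x. conv (\<lambda>z. frechet_derivative k (at z) h) v x)" for h
        using Suc.IH[of "\<lambda>z. frechet_derivative k (at z) h"] smooth_on_deriv[OF Suc.prems(1)]
          deriv_zero_off[OF compact_imp_closed[OF K] _ Suc.prems(2)] by (simp add: eta_contract_eq)
    qed (auto intro: conv_has_derivative[OF K Suc.prems v])
  qed
  then show ?thesis using k z unfolding smooth_on_def by blast
qed

section \<open>Convolution inequalities and mollification\<close>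

lemma nn_conv_L1:
  fixes k H :: "'a::euclidean_space \<Rightarrow> ennreal"
  assumes [measurable]: "k \<in> borel_measurable borel" "H \<in> borel_measurable borel"
  shows "(\<integral>\<^sup>+x. (\<integral>\<^sup>+y. k (x - y) * H y \<partial>lborel) \<partial>lborel) = (\<integral>\<^sup>+x. k x \<partial>lborel) * (\<integral>\<^sup>+y. H y \<partial>lborel)"
proof -
  have s: "(\<integral>\<^sup>+x. k (x - y) \<partial>lborel) = (\<integral>\<^sup>+x. k x \<partial>lborel)" for y
    using nn_integral_lborel_shift[of k "-y"] by simp
  have "(\<integral>\<^sup>+x. (\<integral>\<^sup>+y. k (x - y) * H y \<partial>lborel) \<partial>lborel) = (\<integral>\<^sup>+y. (\<integral>\<^sup>+x. k (x - y) * H y \<partial>lborel) \<partial>lborel)"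
    by (rule lborel_pair.Fubini') simp
  also have "\<dots> = (\<integral>\<^sup>+y. (\<integral>\<^sup>+x. k x \<partial>lborel) * H y \<partial>lborel)"
    by (simp add: nn_integral_multc s)
  finally show ?thesis by (simp add: nn_integral_cmult)
qed

text \<open>Young's inequality, by Cauchy-Schwarz for the measure with density \<open>k (x - y)\<close>.\<close>

lemma nn_conv_L2:
  fixes k H :: "'a::euclidean_space \<Rightarrow> ennreal"
  assumes [measurable]: "k \<in> borel_measurable borel" "H \<in> borel_measurable borel"
  shows "(\<integral>\<^sup>+x. (\<integral>\<^sup>+y. k (x - y) * H y \<partial>lborel)\<^sup>2 \<partial>lborel) \<le> (\<integral>\<^sup>+x. k x \<partial>lborel)\<^sup>2 * (\<integral>\<^sup>+y. (H y)\<^sup>2 \<partial>lborel)"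
proof -
  have "(\<integral>\<^sup>+y. k (x - y) * H y \<partial>lborel)\<^sup>2 \<le> (\<integral>\<^sup>+x. k x \<partial>lborel) * (\<integral>\<^sup>+y. k (x - y) * (H y)\<^sup>2 \<partial>lborel)" for x
    using Cauchy_Schwarz_nn_integral[of "\<lambda>_. 1" "density lborel (\<lambda>y. k (x - y))" H] nn_integral_lborel_reflect[of k x]
    by (simp add: nn_integral_density emeasure_density)
  then have "(\<integral>\<^sup>+x. (\<integral>\<^sup>+y. k (x - y) * H y \<partial>lborel)\<^sup>2 \<partial>lborel) \<le>
    (\<integral>\<^sup>+x. (\<integral>\<^sup>+x. k x \<partial>lborel) * (\<integral>\<^sup>+y. k (x - y) * (H y)\<^sup>2 \<partial>lborel) \<partial>lborel)"
    by (intro nn_integral_mono)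
  also have "\<dots> = (\<integral>\<^sup>+x. k x \<partial>lborel) * ((\<integral>\<^sup>+x. k x \<partial>lborel) * (\<integral>\<^sup>+y. (H y)\<^sup>2 \<partial>lborel))"
    by (simp add: nn_integral_cmult nn_conv_L1[of k "\<lambda>y. (H y)\<^sup>2"])
  finally show ?thesis by (simp add: power2_eq_square mult.assoc)
qed

section \<open>Mollifiers and a scale invariant majorant\<close>

definition bump_mass :: "'a::euclidean_space itself \<Rightarrow> real" where
  "bump_mass _ = (\<integral>x. bump (0::'a) 1 x \<partial>lborel)"

definition mollifier :: "real \<Rightarrow> 'a::euclidean_space \<Rightarrow> real" where
  "mollifier e z = bump 0 1 (z /\<^sub>R e) / (bump_mass TYPE('a) * e ^ DIM('a))"

lemma bump_integrable: "integrable lborel (bump (0::'a::euclidean_space) 1)"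
  by (rule compact_support_integrable[of "cball 0 1"])
    (auto intro: smooth_on_continuous_on smooth_on_bump bump_eq_0)

text \<open>Otherwise the bump vanishes almost everywhere, which would make the open unit ball a
  null set.\<close>

lemma bump_mass_pos: "bump_mass TYPE('a::euclidean_space) > 0"
proof (rule ccontr)
  assume "\<not> ?thesis"
  moreover have "bump_mass TYPE('a) \<ge> 0" unfolding bump_mass_def by (simp add: bump_nonneg)
  ultimately have "(\<integral>x. bump (0::'a) 1 x \<partial>lborel) = 0" by (simp add: bump_mass_def)
  then have "AE x in lborel. bump (0::'a) 1 x = 0"
    using integral_nonneg_eq_0_iff_AE[OF bump_integrable[where 'a='a]] by (simp add: bump_nonneg)
  then have "AE x in lborel. x \<notin> ball (0::'a) 1"
    by eventually_elim (use bump_pos_iff[of 1 "0::'a"] in \<open>force simp: dist_norm\<close>)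
  then have "ball (0::'a) 1 \<in> null_sets lborel" by (subst AE_iff_null_sets) auto
  then have "negligible (ball (0::'a) 1)" by (simp add: negligible_iff_null_sets null_sets_completionI)
  then show False using open_not_negligible[of "ball (0::'a) 1"] by simp
qed

lemma mollifier_nonneg: "e > 0 \<Longrightarrow> mollifier e (z::'a::euclidean_space) \<ge> 0"
  using bump_mass_pos[where 'a='a] by (simp add: mollifier_def bump_nonneg less_imp_le)

lemma mollifier_eq_0: "e > 0 \<Longrightarrow> e \<le> norm z \<Longrightarrow> mollifier e z = 0"
  unfolding mollifier_def by (subst bump_eq_0) (auto simp: field_simps)

lemma mollifier_smooth: "smooth_on UNIV (mollifier e :: 'a::euclidean_space \<Rightarrow> real)"
proof -
  have "smooth_on UNIV (\<lambda>z::'a. bump 0 1 (z /\<^sub>R e))"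
    by (rule smooth_on_compose[where f="\<lambda>z. z /\<^sub>R e" and g="bump 0 1" and T=UNIV])
      (auto intro!: smooth_on_linear[where L="\<lambda>z. z /\<^sub>R e"] bounded_linear_scaleR_right smooth_on_ident smooth_on_bump)
  then show ?thesis unfolding mollifier_def[abs_def] divide_inverse
    by (intro smooth_on_mult smooth_on_const) auto
qed

lemma mollifier_cball: "e > 0 \<Longrightarrow> z \<notin> cball 0 e \<Longrightarrow> mollifier e z = 0"
  by (rule mollifier_eq_0) auto

lemma mollifier_measurable [measurable]: "mollifier e \<in> borel_measurable borel"
  using smooth_on_continuous_on[OF mollifier_smooth] by (rule borel_measurable_continuous_onI)

lemma nn_integral_mollifier:
  assumes "e > 0"
  shows "(\<integral>\<^sup>+z. ennreal (mollifier e (z::'a::euclidean_space)) \<partial>lborel) = 1"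
proof -
  let ?B = "bump_mass TYPE('a)"
  have [measurable]: "bump (0::'a) 1 \<in> borel_measurable borel"
    using smooth_on_continuous_on[OF smooth_on_bump[of UNIV]] by (intro borel_measurable_continuous_onI) auto
  have "(\<integral>\<^sup>+z. ennreal (mollifier e (z::'a)) \<partial>lborel) =
    (\<integral>\<^sup>+z. ennreal (1 / (?B * e ^ DIM('a))) * ennreal (bump 0 1 ((z::'a) /\<^sub>R e)) \<partial>lborel)"
    using assms bump_mass_pos[where 'a='a] by (intro nn_integral_cong)
      (simp add: mollifier_def bump_nonneg ennreal_mult'[symmetric])
  also have "\<dots> = ennreal (1 / (?B * e ^ DIM('a))) * (ennreal (e ^ DIM('a)) * (\<integral>\<^sup>+z. ennreal (bump (0::'a) 1 z) \<partial>lborel))"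
    using nn_integral_lborel_scale[of "\<lambda>z::'a. ennreal (bump 0 1 z)" e] assms by (simp add: nn_integral_cmult)
  also have "(\<integral>\<^sup>+z. ennreal (bump (0::'a) 1 z) \<partial>lborel) = ennreal ?B"
    unfolding bump_mass_def by (rule nn_integral_eq_integral[OF bump_integrable]) (simp add: bump_nonneg)
  also have "ennreal (1 / (?B * e ^ DIM('a))) * (ennreal (e ^ DIM('a)) * ennreal ?B) = 1"
    using assms bump_mass_pos[where 'a='a] by (simp add: ennreal_mult'[symmetric] less_imp_le)
  finally show ?thesis .
qed

text \<open>A common majorant, up to a constant, of the mollifier and of \<open>e\<close> times its
  partial derivatives. Its L1 norm is the volume of the unit ball for every \<open>e\<close>, so
  Young's inequality with it gives bounds independent of the scale.\<close>

definition ball_kernel :: "real \<Rightarrow> 'a::euclidean_space \<Rightarrow> real" where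
  "ball_kernel e z = indicator (ball 0 e) z / e ^ DIM('a)"

lemma ball_kernel_measurable [measurable]: "ball_kernel e \<in> borel_measurable borel"
  unfolding ball_kernel_def[abs_def]
  by (intro borel_measurable_divide borel_measurable_indicator borel_measurable_const) simp

lemma nn_integral_ball_kernel:
  assumes "e > 0"
  shows "(\<integral>\<^sup>+z. ennreal (ball_kernel e (z::'a::euclidean_space)) \<partial>lborel) = ennreal (measure lborel (ball (0::'a) 1))"
proof -
  have [measurable]: "(indicator (ball 0 1) :: 'a \<Rightarrow> ennreal) \<in> borel_measurable borel"
    by (rule borel_measurable_indicator) simp
  have "(\<integral>\<^sup>+z. ennreal (ball_kernel e (z::'a)) \<partial>lborel) =
    (\<integral>\<^sup>+z. ennreal (1 / e ^ DIM('a)) * indicator (ball 0 1) ((z::'a) /\<^sub>R e) \<partial>lborel)"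
    using assms by (intro nn_integral_cong) (auto simp: ball_kernel_def indicator_def divide_simps)
  also have "\<dots> = ennreal (1 / e ^ DIM('a)) * (ennreal (e ^ DIM('a)) * emeasure lborel (ball (0::'a) 1))"
    using nn_integral_lborel_scale[of "indicator (ball 0 1) :: 'a \<Rightarrow> ennreal" e] assms by (simp add: nn_integral_cmult)
  also have "\<dots> = emeasure lborel (ball (0::'a) 1)"
    using assms by (simp add: mult.assoc[symmetric] ennreal_mult'[symmetric])
  finally show ?thesis
    using emeasure_lborel_ball_finite[of "0::'a" 1] by (simp add: emeasure_eq_ennreal_measure infinity_ennreal_def)
qed

text \<open>One constant serves all scales. The factor 1/e in the derivative bound is later
  cancelled by a coefficient difference whose size is at most a multiple of
  \<open>e\<close>.\<close>

lemma mollifier_bounds: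
  obtains M where "M > 0"
    "\<And>e z::'a::euclidean_space. e > 0 \<Longrightarrow> mollifier e z \<le> M * ball_kernel e z"
    "\<And>e b z::'a. e > 0 \<Longrightarrow> b \<in> Basis \<Longrightarrow> \<bar>frechet_derivative (mollifier e) (at z) b\<bar> \<le> M / e * ball_kernel e z"
proof -
  let ?\<beta> = "bump (0::'a) 1"
  let ?B = "bump_mass TYPE('a)"
  have z1: "?\<beta> x = 0" if "x \<notin> cball 0 1" for x using that by (intro bump_eq_0) auto
  obtain L where L: "L > 0" "\<And>x y. norm (?\<beta> x - ?\<beta> y) \<le> L * norm (x - y)"
    using compact_support_lipschitz[OF compact_cball smooth_on_bump[OF open_UNIV] z1] by blast
  \<comment> \<open>The Lipschitz constant bounds all difference quotients, hence also the partial
    derivative as their limit.\<close>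
  have dB: "\<bar>frechet_derivative ?\<beta> (at x) b\<bar> \<le> L" if "b \<in> Basis" for x b
  proof -
    have "((\<lambda>h. (?\<beta> (x + h *\<^sub>R b) - ?\<beta> x) / h) \<longlongrightarrow> frechet_derivative ?\<beta> (at x) b) (at 0)"
    proof -
      have "((\<lambda>h. ?\<beta> (x + h *\<^sub>R b)) has_derivative (\<lambda>h. frechet_derivative ?\<beta> (at (x + 0 *\<^sub>R b)) (h *\<^sub>R b))) (at 0)"
        using smooth_on_has_derivative[OF smooth_on_bump[OF open_UNIV, of "0::'a" 1], of "x + 0 *\<^sub>R b"]
        by (rule has_derivative_compose[where f="\<lambda>h. x + h *\<^sub>R b", rotated]) (auto intro!: derivative_eq_intros)
      moreover have "linear (frechet_derivative ?\<beta> (at x))"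
        using smooth_on_differentiable[OF smooth_on_bump[OF open_UNIV] UNIV_I] by (rule linear_frechet_derivative)
      ultimately have "((\<lambda>h. ?\<beta> (x + h *\<^sub>R b)) has_real_derivative frechet_derivative ?\<beta> (at x) b) (at 0)"
        by (simp add: has_field_derivative_def linear_cmul mult_commute_abs)
      then show ?thesis by (simp add: has_field_derivative_iff)
    qed
    then have "((\<lambda>h. \<bar>(?\<beta> (x + h *\<^sub>R b) - ?\<beta> x) / h\<bar>) \<longlongrightarrow> \<bar>frechet_derivative ?\<beta> (at x) b\<bar>) (at 0)"
      by (rule tendsto_rabs)
    moreover have "\<bar>(?\<beta> (x + h *\<^sub>R b) - ?\<beta> x) / h\<bar> \<le> L" for h
      using L(2)[of "x + h *\<^sub>R b" x] that L(1) by (cases "h = 0") (auto simp: divide_le_eq)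
    ultimately show ?thesis by (intro tendsto_upperbound[where F="at (0::real)"]) auto
  qed
  \<comment> \<open>The sum 1 + L covers the bound 1 of the bump and the bound L of its derivatives
    at once.\<close>
  define M where "M = (1 + L) / ?B"
  have Mp: "M > 0" using bump_mass_pos[where 'a='a] L by (simp add: M_def)
  have 1: "mollifier e z \<le> M * ball_kernel e z" if e: "e > 0" for e and z :: 'a
  proof (cases "norm z < e")
    case True
    have "mollifier e z \<le> (1 + L) / (?B * e ^ DIM('a))"
      unfolding mollifier_def using bump_le_1[of 0 1 "z /\<^sub>R e"] L e bump_mass_pos[where 'a='a]
      by (intro divide_right_mono) (auto simp: less_imp_le)
    then show ?thesis using True by (simp add: ball_kernel_def M_def)
  qed (use e mollifier_eq_0[of e z] in \<open>simp add: ball_kernel_def\<close>)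
  have 2: "\<bar>frechet_derivative (mollifier e) (at z) b\<bar> \<le> M / e * ball_kernel e z" if e: "e > 0" and b: "b \<in> Basis" for e and b z :: 'a
  proof -
    have ds: "((\<lambda>z. ?\<beta> (z /\<^sub>R e)) has_derivative (\<lambda>v. frechet_derivative ?\<beta> (at (z /\<^sub>R e)) (v /\<^sub>R e))) (at z)"
      using smooth_on_has_derivative[OF smooth_on_bump[OF open_UNIV, of "0::'a" 1], of "z /\<^sub>R e"]
      by (rule has_derivative_compose[where f="\<lambda>z. z /\<^sub>R e", rotated]) (auto intro!: derivative_eq_intros)
    have "(mollifier e has_derivative (\<lambda>v. inverse (?B * e ^ DIM('a)) * frechet_derivative ?\<beta> (at (z /\<^sub>R e)) (v /\<^sub>R e))) (at z)"
      unfolding mollifier_def[abs_def] divide_inverse mult.commute[of _ "inverse _"]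
      by (rule has_derivative_mult_right[OF ds])
    then have "frechet_derivative (mollifier e) (at z) b = inverse (?B * e ^ DIM('a)) * frechet_derivative ?\<beta> (at (z /\<^sub>R e)) (b /\<^sub>R e)"
      using frechet_derivative_at by metis
    also have "\<dots> = frechet_derivative ?\<beta> (at (z /\<^sub>R e)) b / (e * (?B * e ^ DIM('a)))"
      using linear_cmul[OF linear_frechet_derivative[OF smooth_on_differentiable[OF smooth_on_bump[OF open_UNIV, of "0::'a" 1] UNIV_I]]]
      by (simp add: divide_inverse)
    finally have eq: "frechet_derivative (mollifier e) (at z) b = frechet_derivative ?\<beta> (at (z /\<^sub>R e)) b / (e * (?B * e ^ DIM('a)))" .
    show ?thesis
    proof (cases "norm z < e")
      case True
      have "\<bar>frechet_derivative (mollifier e) (at z) b\<bar> \<le> (1 + L) / (e * (?B * e ^ DIM('a)))"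
        unfolding eq abs_divide using dB[OF b, of "z /\<^sub>R e"] e bump_mass_pos[where 'a='a]
        by (auto simp: abs_mult intro!: divide_right_mono)
      then show ?thesis using True by (simp add: ball_kernel_def M_def mult_ac)
    next
      case False
      then have n1: "norm (z /\<^sub>R e) \<ge> 1" using e by (simp add: field_simps)
      have "frechet_derivative ?\<beta> (at (z /\<^sub>R e)) b = 0"
      proof -
        have "?\<beta> (z /\<^sub>R e) = 0" using bump_eq_0[OF _ , of 1 "z /\<^sub>R e" 0] n1 by simp
        then have "\<forall>y. ?\<beta> (z /\<^sub>R e) \<le> ?\<beta> y" by (simp add: bump_nonneg)
        then show ?thesis
          using differential_zero_maxmin[of "z /\<^sub>R e" UNIV ?\<beta>] smooth_on_has_derivative[OF smooth_on_bump[OF open_UNIV, of "0::'a" 1] UNIV_I]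
          by (metis UNIV_I open_UNIV)
      qed
      then show ?thesis using eq False by (simp add: ball_kernel_def)
    qed
  qed
  show thesis using that Mp 1 2 by blast
qed

text \<open>If the integrand is not integrable, the Bochner integral is 0 by convention and the
  bound is trivial.\<close>

lemma norm_conv_le:
  assumes "\<And>z. k z \<ge> 0"
  shows "ennreal (norm (conv k v x)) \<le> (\<integral>\<^sup>+y. ennreal (k (x - y)) * ennreal (norm (v y)) \<partial>lborel)"
proof (cases "integrable lborel (\<lambda>y. k (x - y) *\<^sub>R v y)")
  case True
  have "ennreal (norm (conv k v x)) \<le> (\<integral>\<^sup>+y. ennreal (norm (k (x - y) *\<^sub>R v y)) \<partial>lborel)"
    unfolding conv_def using integral_norm_bound_ennreal[OF True] .
  then show ?thesis using assms by (simp add: ennreal_mult')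
next
  case False
  then show ?thesis by (simp add: conv_def not_integrable_integral_eq)
qed

section \<open>Convergence of mollifications in L1\<close>

lemma conv_mollifier_measurable [measurable]:
  assumes "integrable lborel v" "e > 0"
  shows "conv (mollifier e) v \<in> borel_measurable borel"
  using smooth_on_continuous_on[OF smooth_on_conv[OF compact_cball mollifier_smooth mollifier_cball[OF assms(2)] assms(1)]]
  by (rule borel_measurable_continuous_onI)

lemma conv_mollifier_L1:
  assumes v: "integrable lborel v" and e: "e > 0"
  shows "(\<integral>\<^sup>+x. ennreal (norm (conv (mollifier e) v x)) \<partial>lborel) \<le> (\<integral>\<^sup>+x. ennreal (norm (v x)) \<partial>lborel)"
proof -
  have [measurable]: "v \<in> borel_measurable borel" using v by auto
  have "(\<integral>\<^sup>+x. ennreal (norm (conv (mollifier e) v x)) \<partial>lborel) \<le>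
    (\<integral>\<^sup>+x. (\<integral>\<^sup>+y. ennreal (mollifier e (x - y)) * ennreal (norm (v y)) \<partial>lborel) \<partial>lborel)"
    by (intro nn_integral_mono norm_conv_le mollifier_nonneg e)
  also have "\<dots> = (\<integral>\<^sup>+x. ennreal (norm (v x)) \<partial>lborel)"
    by (subst nn_conv_L1[of "\<lambda>z. ennreal (mollifier e z)"]) (simp_all add: nn_integral_mollifier[OF e])
  finally show ?thesis .
qed

text \<open>A Scheffe type argument. At points of \<open>U\<close> the mollified indicator is
  eventually 1, and its total mass equals that of \<open>U\<close>. Equal masses turn the L1
  distance into twice the integral of the positive part of the difference, which is dominated by the
  indicator. No pointwise claim is made outside \<open>U\<close>, so a boundary of positive measure
  does no harm.\<close>

lemma conv_mollifier_open:
  fixes U :: "'a::euclidean_space set"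
  assumes ep: "\<And>n::nat. e n > 0" and e0: "e \<longlonglongrightarrow> 0" and U: "open U" "emeasure lborel U < \<infinity>"
  shows "(\<lambda>n. \<integral>\<^sup>+x. ennreal (norm (conv (mollifier (e n)) (\<lambda>y. indicator U y *\<^sub>R c) x - indicator U x *\<^sub>R c)) \<partial>lborel) \<longlonglongrightarrow> 0"
proof -
  define j where "j n x = (\<integral>y. mollifier (e n) (x - y) * indicator U y \<partial>lborel)" for n and x :: 'a
  have Um [measurable]: "U \<in> sets borel" using U by simp
  have jm [measurable]: "j n \<in> borel_measurable borel" for n
    unfolding j_def[abs_def] by measurable
  have Ui: "integrable lborel (indicator U :: 'a \<Rightarrow> real)" using U by (intro integrable_real_indicator) auto
  have Uc: "integrable lborel (\<lambda>y. indicator U y *\<^sub>R c)" using Ui by (rule integrable_scaleR_left)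
  have mi: "integrable lborel (\<lambda>y. mollifier (e n) (x - y))" for n and x :: 'a
  proof -
    have "(\<integral>\<^sup>+y. ennreal (mollifier (e n) (x - y)) \<partial>lborel) = 1"
      using nn_integral_lborel_reflect[of "\<lambda>z. ennreal (mollifier (e n) z)" x] nn_integral_mollifier[OF ep] by simp
    then show ?thesis by (intro integrableI_nn_integral_finite[where x=1]) (auto simp: mollifier_nonneg ep)
  qed
  have m1: "(\<integral>y. mollifier (e n) (x - y) \<partial>lborel) = 1" for n and x :: 'a
  proof -
    have "(\<integral>\<^sup>+y. ennreal (mollifier (e n) (x - y)) \<partial>lborel) = 1"
      using nn_integral_lborel_reflect[of "\<lambda>z. ennreal (mollifier (e n) z)" x] nn_integral_mollifier[OF ep] by simp
    then show ?thesis by (intro integral_eq_nn_integral[THEN trans]) (auto simp: mollifier_nonneg ep)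
  qed
  have miU: "integrable lborel (\<lambda>y. mollifier (e n) (x - y) * indicator U y)" for n x
    by (rule Bochner_Integration.integrable_bound[OF mi[of n x]]) (auto simp: indicator_def)
  have j0: "j n x \<ge> 0" for n x unfolding j_def by (intro Bochner_Integration.integral_nonneg) (simp add: mollifier_nonneg ep)
  have nj: "(\<integral>\<^sup>+x. ennreal (j n x) \<partial>lborel) = emeasure lborel U" for n
  proof -
    have "ennreal (j n x) = (\<integral>\<^sup>+y. ennreal (mollifier (e n) (x - y)) * indicator U y \<partial>lborel)" for x
      unfolding j_def by (subst nn_integral_eq_integral[symmetric, OF miU])
        (auto simp: mollifier_nonneg ep indicator_def intro!: nn_integral_cong)
    then show ?thesis using Um
      by (simp add: nn_conv_L1[of "\<lambda>z. ennreal (mollifier (e n) z)" "indicator U"] nn_integral_mollifier[OF ep])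
  qed
  have ji: "integrable lborel (j n)" for n
    using nj[of n] U by (intro integrableI_nonneg) (auto simp: j0)
  have jU: "(\<integral>x. j n x \<partial>lborel) = (\<integral>x. indicator U x \<partial>lborel)" for n
    using nj[of n] by (subst (1 2) integral_eq_nn_integral) (auto simp: j0 ennreal_indicator)
  have lim: "(\<lambda>n. \<integral>x. max 0 (indicator U x - j n x) \<partial>lborel) \<longlonglongrightarrow> (\<integral>x. 0 \<partial>(lborel :: 'a measure))"
  proof (rule integral_dominated_convergence[where w="indicator U"])
    show "AE x in lborel. (\<lambda>n. max 0 (indicator U x - j n x)) \<longlonglongrightarrow> 0"
    proof (rule AE_I2)
      fix x :: 'a
      show "(\<lambda>n. max 0 (indicator U x - j n x)) \<longlonglongrightarrow> 0"
      proof (cases "x \<in> U")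
        case True
        then obtain d where d: "d > 0" "ball x d \<subseteq> U" using U(1) open_contains_ball by blast
        have "j n x = 1" if N: "e n < d" for n
        proof -
          have "mollifier (e n) (x - y) * indicator U y = mollifier (e n) (x - y)" for y
            using mollifier_eq_0[OF ep, of n "x - y"] d(2) N by (cases "y \<in> U") (auto simp: subset_eq dist_norm)
          then have "(\<lambda>y. mollifier (e n) (x - y) * indicator U y) = (\<lambda>y. mollifier (e n) (x - y))" by blast
          then show ?thesis unfolding j_def by (simp only: m1)
        qed
        then have "\<forall>\<^sub>F n in sequentially. max 0 (indicator U x - j n x) = 0"
          using order_tendstoD(2)[OF e0 d(1)] True by (auto elim: eventually_mono)
        then show ?thesis by (rule tendsto_eventually)
      qed (simp add: j0 max_absorb1)
    qed
  qed (auto simp: Ui j0 indicator_def)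
  \<comment> \<open>The absolute value of d is 2 max 0 d - d, and the integral of d vanishes because
    the masses agree.\<close>
  have eq: "(\<integral>\<^sup>+x. ennreal (norm (conv (mollifier (e n)) (\<lambda>y. indicator U y *\<^sub>R c) x - indicator U x *\<^sub>R c)) \<partial>lborel) =
     ennreal (norm c * (2 * (\<integral>x. max 0 (indicator U x - j n x) \<partial>lborel)))" for n
  proof -
    have "conv (mollifier (e n)) (\<lambda>y. indicator U y *\<^sub>R c) x = j n x *\<^sub>R c" for x
      unfolding conv_def j_def by (subst integral_scaleR_left[symmetric, OF miU]) simp
    then have "norm (conv (mollifier (e n)) (\<lambda>y. indicator U y *\<^sub>R c) x - indicator U x *\<^sub>R c) =
       norm c * (2 * max 0 (indicator U x - j n x) - (indicator U x - j n x))" for x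
      by (simp add: scaleR_diff_left[symmetric] max_def abs_if del: scaleR_scaleR)
    moreover have mxi: "integrable lborel (\<lambda>x. max 0 (indicator U x - j n x))"
      using Ui ji by (intro integrable_max) auto
    moreover have "0 \<le> norm c * (2 * max 0 (indicator U x - j n x) - (indicator U x - j n x))" for x
      by (auto simp: max_def)
    ultimately show ?thesis using Ui ji[of n] jU[of n]
      by (simp only:) (subst nn_integral_eq_integral, auto)
  qed
  have "(\<lambda>n. norm c * (2 * (\<integral>x. max 0 (indicator U x - j n x) \<partial>lborel))) \<longlonglongrightarrow> norm c * (2 * 0)"
    using lim by (intro tendsto_intros) simp
  then have "(\<lambda>n. norm c * (2 * (\<integral>x. max 0 (indicator U x - j n x) \<partial>lborel))) \<longlonglongrightarrow> 0" by simp
  then have "(\<lambda>n. ennreal (norm c * (2 * (\<integral>x. max 0 (indicator U x - j n x) \<partial>lborel)))) \<longlonglongrightarrow> ennreal 0"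
    by (rule tendsto_ennrealI)
  then show ?thesis unfolding eq by simp
qed

lemma conv_add:
  assumes "compact K" "continuous_on UNIV k" "\<And>x. x \<notin> K \<Longrightarrow> k x = 0" "integrable lborel f" "integrable lborel g"
  shows "conv k (\<lambda>x. f x + g x) x = conv k f x + conv k g x"
  unfolding conv_def scaleR_add_right
  by (rule Bochner_Integration.integral_add; rule conv_integrable[OF assms(1-3)]) (use assms in auto)

lemma conv_mollifier_add:
  assumes "e > 0" "integrable lborel f" "integrable lborel g"
  shows "conv (mollifier e) (\<lambda>x. f x + g x) x = conv (mollifier e) f x + conv (mollifier e) g x"
  by (rule conv_add[OF compact_cball[of 0 e] smooth_on_continuous_on[OF mollifier_smooth] mollifier_cball[OF assms(1)] assms(2,3)])

definition mollifies :: "(nat \<Rightarrow> real) \<Rightarrow> ('a::euclidean_space \<Rightarrow> complex) \<Rightarrow> bool" where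
  "mollifies e v \<longleftrightarrow>
     (\<lambda>n. \<integral>\<^sup>+x. ennreal (norm (conv (mollifier (e n)) v x - v x)) \<partial>lborel) \<longlonglongrightarrow> 0"

text \<open>Mollification does not increase the L1 norm, so replacing \<open>f\<close> by
  \<open>g\<close> costs at most twice their distance: a quarter of the tolerance for each
  occurrence, and half of it for \<open>g\<close> itself.\<close>

lemma mollifies_approx:
  fixes f :: "'a::euclidean_space \<Rightarrow> complex"
  assumes ep: "\<And>n. e n > 0" and f: "integrable lborel f"
    and ap: "\<And>d::real. d > 0 \<Longrightarrow> \<exists>g. integrable lborel g \<and> mollifies e g \<and> (\<integral>\<^sup>+x. ennreal (norm (f x - g x)) \<partial>lborel) \<le> ennreal d"
  shows "mollifies e f"
  unfolding mollifies_def
proof -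
  have fm [measurable]: "f \<in> borel_measurable borel" using f by auto
  have "\<forall>\<^sub>F n in sequentially. (\<integral>\<^sup>+x. ennreal (norm (conv (mollifier (e n)) f x - f x)) \<partial>lborel) < ennreal r" if r: "0 < r" for r :: real
  proof -
    obtain g where g: "integrable lborel g" "mollifies e g" and fg: "(\<integral>\<^sup>+x. ennreal (norm (f x - g x)) \<partial>lborel) \<le> ennreal (r / 4)"
      using ap[of "r / 4"] r by auto
    have gm [measurable]: "g \<in> borel_measurable borel" using g(1) by auto
    have d: "integrable lborel (\<lambda>x. f x - g x)" using f g by auto
    have "\<forall>\<^sub>F n in sequentially. (\<integral>\<^sup>+x. ennreal (norm (conv (mollifier (e n)) g x - g x)) \<partial>lborel) < ennreal (r / 2)"
      using order_tendstoD(2)[OF g(2)[unfolded mollifies_def], of "ennreal (r / 2)"] r by simp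
    then show ?thesis
    proof eventually_elim
      case (elim n)
      have [measurable]: "conv (mollifier (e n)) g \<in> borel_measurable borel"
        "conv (mollifier (e n)) (\<lambda>x. f x - g x) \<in> borel_measurable borel"
        using conv_mollifier_measurable ep g(1) d by blast+
      have "conv (mollifier (e n)) f x = conv (mollifier (e n)) (\<lambda>x. f x - g x) x + conv (mollifier (e n)) g x" for x
        using conv_mollifier_add[OF ep d g(1), of n x] by simp
      then have "norm (conv (mollifier (e n)) f x - f x) \<le>
        norm (conv (mollifier (e n)) (\<lambda>x. f x - g x) x) + norm (conv (mollifier (e n)) g x - g x) + norm (f x - g x)" for x
        using norm_triangle_ineq[of "conv (mollifier (e n)) (\<lambda>x. f x - g x) x" "conv (mollifier (e n)) g x - g x"]
          norm_triangle_ineq4[of "conv (mollifier (e n)) (\<lambda>x. f x - g x) x + (conv (mollifier (e n)) g x - g x)" "f x - g x"]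
        by (simp add: algebra_simps)
      then have "(\<integral>\<^sup>+x. ennreal (norm (conv (mollifier (e n)) f x - f x)) \<partial>lborel) \<le>
        (\<integral>\<^sup>+x. ennreal (norm (conv (mollifier (e n)) (\<lambda>x. f x - g x) x)) + ennreal (norm (conv (mollifier (e n)) g x - g x)) + ennreal (norm (f x - g x)) \<partial>lborel)"
        by (intro nn_integral_mono) (simp add: ennreal_plus[symmetric] ennreal_leI del: ennreal_plus)
      also have "\<dots> = (\<integral>\<^sup>+x. ennreal (norm (conv (mollifier (e n)) (\<lambda>x. f x - g x) x)) \<partial>lborel)
         + (\<integral>\<^sup>+x. ennreal (norm (conv (mollifier (e n)) g x - g x)) \<partial>lborel) + (\<integral>\<^sup>+x. ennreal (norm (f x - g x)) \<partial>lborel)"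
        by (simp add: nn_integral_add)
      also have "\<dots> \<le> ennreal (r / 4) + (\<integral>\<^sup>+x. ennreal (norm (conv (mollifier (e n)) g x - g x)) \<partial>lborel) + ennreal (r / 4)"
        using order_trans[OF conv_mollifier_L1[OF d ep] fg] fg by (intro add_mono) auto
      also have "\<dots> < ennreal (r / 4) + ennreal (r / 2) + ennreal (r / 4)"
        using elim by (simp add: ennreal_add_left_cancel_less add.commute add.left_commute)
      also have "\<dots> = ennreal r" using r by (simp add: ennreal_plus[symmetric] del: ennreal_plus)
      finally show ?case .
    qed
  qed
  then show "(\<lambda>n. \<integral>\<^sup>+x. ennreal (norm (conv (mollifier (e n)) f x - f x)) \<partial>lborel) \<longlonglongrightarrow> 0"
  proof (intro order_tendstoI)
    fix a :: ennreal assume h: "\<And>r::real. 0 < r \<Longrightarrow> \<forall>\<^sub>F n in sequentially. (\<integral>\<^sup>+x. ennreal (norm (conv (mollifier (e n)) f x - f x)) \<partial>lborel) < ennreal r"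
      and a: "0 < a"
    obtain r where r: "0 < r" "ennreal r \<le> a"
      using a by (cases a) (auto intro: that[of 1] that)
    show "\<forall>\<^sub>F n in sequentially. (\<integral>\<^sup>+x. ennreal (norm (conv (mollifier (e n)) f x - f x)) \<partial>lborel) < a"
      using h[OF r(1)] by eventually_elim (use r(2) in \<open>simp add: less_le_trans\<close>)
  qed simp
qed

text \<open>Induction over integrable functions. Measurable sets of finite measure are approximated
  from outside by open ones, where convergence is known; sums use the triangle inequality, and
  dominated limits the approximation lemma again.\<close>

lemma mollifies_integrable:
  fixes v :: "'a::euclidean_space \<Rightarrow> complex"
  assumes ep: "\<And>n. e n > 0" and e0: "e \<longlonglongrightarrow> 0" and v: "integrable lborel v"
  shows "mollifies e v"
  using v
proof (induction rule: integrable_induct)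
  case (base A c)
  have Am [measurable]: "A \<in> sets borel" using base by simp
  have Ai: "integrable lborel (indicator A :: 'a \<Rightarrow> real)" using base by (intro integrable_real_indicator) auto
  show ?case
  proof (rule mollifies_approx[OF ep integrable_scaleR_left[OF Ai]])
    fix d :: real assume d: "d > 0"
    \<comment> \<open>Dividing by norm c + 1 instead of norm c avoids a separate case c = 0.\<close>
    define d' where "d' = d / (norm c + 1)"
    have d': "d' > 0" "norm c * d' \<le> d"
      using d by (auto simp: d'_def field_simps add_pos_nonneg intro: divide_pos_pos)
    obtain U where U: "open U" "A \<subseteq> U" "emeasure lborel (U - A) < ennreal d'"
      using outer_regular_lborel[OF Am d'(1)] by blast
    have [measurable]: "U \<in> sets borel" using U by simp
    have "emeasure lborel U \<le> emeasure lborel A + emeasure lborel (U - A)"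
      using emeasure_subadditive[of A lborel "U - A"] U(2) by (simp add: Un_absorb1)
    also have "\<dots> < \<infinity>" using base(2) U(3) by (auto simp: less_top[symmetric] infinity_ennreal_def top_unique)
    finally have Uf: "emeasure lborel U < \<infinity>" .
    have Ui: "integrable lborel (\<lambda>x. indicator U x *\<^sub>R c)"
      using Uf by (intro integrable_scaleR_left integrable_real_indicator) auto
    have "(\<integral>\<^sup>+x. ennreal (norm (indicator A x *\<^sub>R c - indicator U x *\<^sub>R c)) \<partial>lborel) =
      (\<integral>\<^sup>+x. ennreal (norm c) * indicator (U - A) x \<partial>lborel)"
      using U(2) by (intro nn_integral_cong) (auto simp: indicator_def)
    also have "\<dots> = ennreal (norm c) * emeasure lborel (U - A)" by (simp add: nn_integral_cmult)
    also have "\<dots> \<le> ennreal (norm c) * ennreal d'" using U(3) by (intro mult_left_mono) auto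
    also have "\<dots> = ennreal (norm c * d')" using d'(1) by (simp add: ennreal_mult)
    also have "\<dots> \<le> ennreal d" using d'(2) by (rule ennreal_leI)
    finally show "\<exists>g. integrable lborel g \<and> mollifies e g \<and>
       (\<integral>\<^sup>+x. ennreal (norm (indicator A x *\<^sub>R c - g x)) \<partial>lborel) \<le> ennreal d"
      using Ui conv_mollifier_open[OF ep e0 U(1) Uf, of c] unfolding mollifies_def by blast
  qed
next
  case (add f g)
  have [measurable]: "f \<in> borel_measurable borel" "g \<in> borel_measurable borel" using add by auto
  have [measurable]: "conv (mollifier (e n)) f \<in> borel_measurable borel"
        "conv (mollifier (e n)) g \<in> borel_measurable borel" for n
        using conv_mollifier_measurable ep add by blast+
  have "conv (mollifier (e n)) (\<lambda>x. f x + g x) x = conv (mollifier (e n)) f x + conv (mollifier (e n)) g x" for n x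
    by (rule conv_mollifier_add[OF ep add(1,2)])
  then have nle: "norm (conv (mollifier (e n)) (\<lambda>x. f x + g x) x - (f x + g x)) \<le>
    norm (conv (mollifier (e n)) f x - f x) + norm (conv (mollifier (e n)) g x - g x)" for n x
    using norm_triangle_ineq[of "conv (mollifier (e n)) f x - f x" "conv (mollifier (e n)) g x - g x"] by (simp add: algebra_simps)
  have "(\<lambda>n. (\<integral>\<^sup>+x. ennreal (norm (conv (mollifier (e n)) f x - f x)) \<partial>lborel) +
     (\<integral>\<^sup>+x. ennreal (norm (conv (mollifier (e n)) g x - g x)) \<partial>lborel)) \<longlonglongrightarrow> 0 + 0"
    by (rule tendsto_add[OF add(3)[unfolded mollifies_def] add(4)[unfolded mollifies_def]])
  then have A: "(\<lambda>n. (\<integral>\<^sup>+x. ennreal (norm (conv (mollifier (e n)) f x - f x)) \<partial>lborel) +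
     (\<integral>\<^sup>+x. ennreal (norm (conv (mollifier (e n)) g x - g x)) \<partial>lborel)) \<longlonglongrightarrow> 0" by simp
  have B: "(\<integral>\<^sup>+x. ennreal (norm (conv (mollifier (e n)) (\<lambda>x. f x + g x) x - (f x + g x))) \<partial>lborel) \<le>
     (\<integral>\<^sup>+x. ennreal (norm (conv (mollifier (e n)) f x - f x)) \<partial>lborel) +
     (\<integral>\<^sup>+x. ennreal (norm (conv (mollifier (e n)) g x - g x)) \<partial>lborel)" for n
    using nle by (subst nn_integral_add[symmetric])
      (auto intro!: nn_integral_mono ennreal_leI simp: ennreal_plus[symmetric] simp del: ennreal_plus)
  show ?case unfolding mollifies_def
    by (rule tendsto_sandwich[OF _ _ tendsto_const A]) (auto intro: always_eventually B)
next
  case (lim f s)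
  show ?case
  proof (rule mollifies_approx[OF ep lim(4)])
    fix d :: real assume d: "d > 0"
    have [measurable]: "f \<in> borel_measurable borel" "\<And>i. s i \<in> borel_measurable borel" using lim by auto
    have "(\<lambda>i. \<integral>\<^sup>+x. ennreal (norm (f x - s i x)) \<partial>lborel) \<longlonglongrightarrow> (\<integral>\<^sup>+x. 0 \<partial>(lborel :: 'a measure))"
    proof (rule nn_integral_dominated_convergence[where w="\<lambda>x. ennreal (3 * norm (f x))"])
      show "AE x in lborel. ennreal (norm (f x - s i x)) \<le> ennreal (3 * norm (f x))" for i
      proof (rule AE_I2, rule ennreal_leI)
        fix x :: 'a
        show "norm (f x - s i x) \<le> 3 * norm (f x)"
          using norm_triangle_ineq4[of "f x" "s i x"] lim(3)[of x i] by simp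
      qed
      show "AE x in lborel. (\<lambda>i. ennreal (norm (f x - s i x))) \<longlonglongrightarrow> 0"
      proof (rule AE_I2)
        fix x :: 'a
        have "(\<lambda>i. norm (f x - s i x)) \<longlonglongrightarrow> norm (f x - f x)"
          using lim(2)[of x] by (intro tendsto_intros) simp
        then show "(\<lambda>i. ennreal (norm (f x - s i x))) \<longlonglongrightarrow> 0"
          using tendsto_ennrealI by fastforce
      qed
      show "(\<integral>\<^sup>+x. ennreal (3 * norm (f x)) \<partial>lborel) < \<infinity>"
        using lim(4) by (auto simp: integrable_iff_bounded ennreal_mult nn_integral_cmult ennreal_mult_less_top)
    qed auto
    then have "\<forall>\<^sub>F i in sequentially. (\<integral>\<^sup>+x. ennreal (norm (f x - s i x)) \<partial>lborel) < ennreal d"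
      using order_tendstoD(2)[of _ 0 sequentially "ennreal d"] d by simp
    then obtain i where "(\<integral>\<^sup>+x. ennreal (norm (f x - s i x)) \<partial>lborel) < ennreal d"
      by (meson eventually_happens' sequentially_bot)
    then show "\<exists>g. integrable lborel g \<and> mollifies e g \<and> (\<integral>\<^sup>+x. ennreal (norm (f x - g x)) \<partial>lborel) \<le> ennreal d"
      using lim(1,5) by (intro exI[of _ "s i"]) auto
  qed
qed

text \<open>Convergence in L1 gives a subsequence converging almost everywhere, and Fatou's lemma
  transfers the L2 bounds. In this way an estimate for smooth mollifications reaches the weak
  solution.\<close>

lemma mollifier_lower_semicontinuous:
  fixes v :: "'a::euclidean_space \<Rightarrow> complex"
  assumes ep: "\<And>n. e n > 0" and e0: "e \<longlonglongrightarrow> 0" and v: "integrable lborel v"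
    and le: "\<forall>\<^sub>F n in sequentially. (\<integral>\<^sup>+x. ennreal ((norm (conv (mollifier (e n)) v x))\<^sup>2) \<partial>lborel) \<le> a n"
    and a: "a \<longlonglongrightarrow> (c::ennreal)"
  shows "(\<integral>\<^sup>+x. ennreal ((norm (v x))\<^sup>2) \<partial>lborel) \<le> c"
proof -
  let ?w = "\<lambda>n. conv (mollifier (e n)) v"
  have [measurable]: "v \<in> borel_measurable borel" using v by auto
  have [measurable]: "?w n \<in> borel_measurable borel" for n
    using conv_mollifier_measurable[OF v ep] .
  have wi: "integrable lborel (?w n)" for n
    using v conv_mollifier_L1[OF v ep, of n] by (auto simp: integrable_iff_bounded intro: le_less_trans)
  have "(\<integral>\<^sup>+x. ennreal (norm (?w n x - v x)) \<partial>lborel) = ennreal (\<integral>x. norm (?w n x - v x) \<partial>lborel)" for n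
    using wi[of n] v by (intro nn_integral_eq_integral) auto
  then have "(\<lambda>n. ennreal (\<integral>x. norm (?w n x - v x) \<partial>lborel)) \<longlonglongrightarrow> ennreal 0"
    using mollifies_integrable[OF ep e0 v] unfolding mollifies_def by simp
  then have "(\<lambda>n. (\<integral>x. norm (?w n x - v x) \<partial>lborel)) \<longlonglongrightarrow> 0"
    by (subst (asm) tendsto_ennreal_iff) auto
  then obtain r :: "nat \<Rightarrow> nat" where r: "strict_mono r" "AE x in lborel. (\<lambda>n. ?w (r n) x - v x) \<longlonglongrightarrow> 0"
    using tendsto_L1_AE_subseq[of lborel "\<lambda>n x. ?w n x - v x"] wi v by auto
  have "(\<integral>\<^sup>+x. ennreal ((norm (v x))\<^sup>2) \<partial>lborel) \<le> (\<integral>\<^sup>+x. liminf (\<lambda>n. ennreal ((norm (?w (r n) x))\<^sup>2)) \<partial>lborel)"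
  proof (rule nn_integral_mono_AE, use r(2) in eventually_elim)
    case (elim x)
    then have "(\<lambda>n. ?w (r n) x) \<longlonglongrightarrow> v x" by (simp add: LIM_zero_iff)
    then have "(\<lambda>n. ennreal ((norm (?w (r n) x))\<^sup>2)) \<longlonglongrightarrow> ennreal ((norm (v x))\<^sup>2)"
      by (intro tendsto_ennrealI tendsto_intros)
    then show ?case using lim_imp_Liminf[OF sequentially_bot] by fastforce
  qed
  also have "\<dots> \<le> liminf (\<lambda>n. \<integral>\<^sup>+x. ennreal ((norm (?w (r n) x))\<^sup>2) \<partial>lborel)"
    by (rule nn_integral_liminf) simp
  also have "\<dots> \<le> liminf (\<lambda>n. a (r n))"
    by (rule Liminf_mono) (use eventually_subseq[OF r(1) le] in simp)
  also have "\<dots> = c"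
    using lim_imp_Liminf[OF sequentially_bot LIMSEQ_subseq_LIMSEQ[OF a r(1)]] by (simp add: o_def)
  finally show ?thesis .
qed

section \<open>First order operators and the energy identity\<close>

text \<open>A complex vector field on Euclidean space is encoded by its coefficient functions, with
  the basis vector as the first argument.\<close>

definition dir :: "('a::euclidean_space \<Rightarrow> 'a \<Rightarrow> complex) \<Rightarrow> ('a \<Rightarrow> complex) \<Rightarrow> 'a \<Rightarrow> complex" where
  "dir a u x = (\<Sum>b\<in>Basis. a b x * frechet_derivative u (at x) b)"

definition dvg :: "('a::euclidean_space \<Rightarrow> 'a \<Rightarrow> complex) \<Rightarrow> 'a \<Rightarrow> complex" where
  "dvg a x = (\<Sum>b\<in>Basis. frechet_derivative (a b) (at x) b)"

definition cnj_coeffs :: "('a \<Rightarrow> 'a \<Rightarrow> complex) \<Rightarrow> 'a \<Rightarrow> 'a \<Rightarrow> complex" where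
  "cnj_coeffs a = (\<lambda>b x. cnj (a b x))"

lemma cnj_coeffs_invol [simp]: "cnj_coeffs (cnj_coeffs a) = a"
  by (simp add: cnj_coeffs_def)

definition smooth_coeffs :: "'a::euclidean_space set \<Rightarrow> ('a \<Rightarrow> 'a \<Rightarrow> complex) \<Rightarrow> bool" where
  "smooth_coeffs S a \<longleftrightarrow> (\<forall>b\<in>Basis. smooth_on S (a b))"

lemma smooth_coeffs_cnj: "open S \<Longrightarrow> smooth_coeffs S a \<Longrightarrow> smooth_coeffs S (cnj_coeffs a)"
  by (simp add: smooth_coeffs_def cnj_coeffs_def smooth_on_cnj)

lemma smooth_on_dir: "open S \<Longrightarrow> smooth_coeffs S a \<Longrightarrow> smooth_on S u \<Longrightarrow> smooth_on S (dir a u)"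
  unfolding dir_def[abs_def] smooth_coeffs_def by (intro smooth_on_sum smooth_on_mult smooth_on_deriv) auto

lemma smooth_on_dvg: "open S \<Longrightarrow> smooth_coeffs S a \<Longrightarrow> smooth_on S (dvg a)"
  unfolding dvg_def[abs_def] smooth_coeffs_def by (intro smooth_on_sum smooth_on_deriv) auto

lemma frechet_derivative_mult:
  fixes u w :: "'a::real_normed_vector \<Rightarrow> complex"
  assumes "u differentiable (at x)" "w differentiable (at x)"
  shows "frechet_derivative (\<lambda>y. u y * w y) (at x) v = u x * frechet_derivative w (at x) v + frechet_derivative u (at x) v * w x"
proof -
  have "((\<lambda>y. u y * w y) has_derivative (\<lambda>v. u x * frechet_derivative w (at x) v + frechet_derivative u (at x) v * w x)) (at x)"
    using assms by (intro has_derivative_mult) (simp_all add: frechet_derivative_works)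
  then show ?thesis using frechet_derivative_at by metis
qed

lemma frechet_derivative_linear_compose:
  assumes "u differentiable (at x)" "bounded_linear L"
  shows "frechet_derivative (\<lambda>y. L (u y)) (at x) v = L (frechet_derivative u (at x) v)"
proof -
  have "((\<lambda>y. L (u y)) has_derivative (\<lambda>v. L (frechet_derivative u (at x) v))) (at x)"
    using assms(1) by (intro bounded_linear.has_derivative[OF assms(2)]) (simp add: frechet_derivative_works)
  then show ?thesis using frechet_derivative_at by metis
qed

lemma frechet_derivative_plus:
  assumes "u differentiable (at x)" "w differentiable (at x)"
  shows "frechet_derivative (\<lambda>y. u y + w y) (at x) v = frechet_derivative u (at x) v + frechet_derivative w (at x) v"
proof -
  have "((\<lambda>y. u y + w y) has_derivative (\<lambda>v. frechet_derivative u (at x) v + frechet_derivative w (at x) v)) (at x)"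
    using assms by (intro has_derivative_add) (simp_all add: frechet_derivative_works)
  then show ?thesis using frechet_derivative_at by metis
qed

lemma dir_mult:
  assumes "u differentiable (at x)" "w differentiable (at x)"
  shows "dir a (\<lambda>y. u y * w y) x = u x * dir a w x + w x * dir a u x"
  unfolding dir_def frechet_derivative_mult[OF assms] sum_distrib_left sum.distrib[symmetric]
  by (intro sum.cong) (auto simp: algebra_simps)

lemma dir_add:
  assumes "u differentiable (at x)" "w differentiable (at x)"
  shows "dir a (\<lambda>y. u y + w y) x = dir a u x + dir a w x"
  unfolding dir_def frechet_derivative_plus[OF assms] by (simp add: sum.distrib algebra_simps)

lemma dir_minus:
  assumes "u differentiable (at x)"
  shows "dir a (\<lambda>y. - u y) x = - dir a u x"
  unfolding dir_def frechet_derivative_linear_compose[OF assms bounded_linear_minus[OF bounded_linear_ident]]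
  by (simp add: sum_negf)

lemma dir_diff:
  assumes "u differentiable (at x)" "w differentiable (at x)"
  shows "dir a (\<lambda>y. u y - w y) x = dir a u x - dir a w x"
  using dir_add[OF assms(1), of "\<lambda>y. - w y"] dir_minus[OF assms(2)] assms(2) by simp

lemma dir_cmult:
  assumes "u differentiable (at x)"
  shows "dir a (\<lambda>y. c * u y) x = c * dir a u x"
  unfolding dir_def frechet_derivative_linear_compose[OF assms bounded_linear_mult_right]
  by (simp add: sum_distrib_left algebra_simps)

lemma dir_cnj:
  assumes "u differentiable (at x)"
  shows "dir a (\<lambda>y. cnj (u y)) x = cnj (dir (cnj_coeffs a) u x)"
  unfolding dir_def cnj_coeffs_def frechet_derivative_linear_compose[OF assms bounded_linear_cnj] by simp

lemma dir_cong:
  assumes "open S" "x \<in> S" "\<And>y. y \<in> S \<Longrightarrow> u y = w y" "u differentiable (at x)"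
  shows "dir a u x = dir a w x"
  unfolding dir_def using frechet_derivative_transform_within_open[OF assms(4,1,2,3)] by simp

section \<open>Test functions and integration by parts\<close>

definition test_on :: "'a::euclidean_space set \<Rightarrow> 'a set \<Rightarrow> ('a \<Rightarrow> complex) \<Rightarrow> bool" where
  "test_on S K u \<longleftrightarrow> smooth_on S u \<and> (\<forall>x. x \<notin> K \<longrightarrow> u x = 0)"

locale test_domain =
  fixes S K :: "'a::euclidean_space set"
  assumes S: "open S" and K: "compact K" and KS: "K \<subseteq> S"
begin

text \<open>Test functions are required to be smooth on \<open>S\<close> only, so products with
  coefficients known only there remain test functions; extension by 0 makes them globally
  smooth.\<close>

lemma test_smooth: "test_on S K u \<Longrightarrow> smooth_on UNIV u"
  using smooth_on_UNIV_extend[OF S compact_imp_closed[OF K] KS] by (auto simp: test_on_def)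

lemma test_smooth_on: "test_on S K u \<Longrightarrow> smooth_on S u"
  by (simp add: test_on_def)

lemma test_integrable: "test_on S K u \<Longrightarrow> integrable lborel u"
  using compact_support_integrable[OF K smooth_on_continuous_on[OF test_smooth]] by (auto simp: test_on_def)

lemma test_add: "test_on S K u \<Longrightarrow> test_on S K w \<Longrightarrow> test_on S K (\<lambda>x. u x + w x)"
  by (auto simp: test_on_def intro: smooth_on_add S)

lemma test_minus: "test_on S K u \<Longrightarrow> test_on S K (\<lambda>x. - u x)"
  by (auto simp: test_on_def intro: smooth_on_minus S)

lemma test_diff: "test_on S K u \<Longrightarrow> test_on S K w \<Longrightarrow> test_on S K (\<lambda>x. u x - w x)"
  by (auto simp: test_on_def intro: smooth_on_diff S)

lemma test_mult: "smooth_on S u \<Longrightarrow> test_on S K w \<Longrightarrow> test_on S K (\<lambda>x. u x * w x)"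
  by (auto simp: test_on_def intro: smooth_on_mult S)

lemma test_cnj: "test_on S K u \<Longrightarrow> test_on S K (\<lambda>x. cnj (u x))"
  by (auto simp: test_on_def intro: smooth_on_cnj S)

lemma test_sum: "(\<And>i. i \<in> I \<Longrightarrow> test_on S K (u i)) \<Longrightarrow> test_on S K (\<lambda>x. \<Sum>i\<in>I. u i x)"
  by (auto simp: test_on_def intro!: smooth_on_sum S sum.neutral)

lemma test_dir: "smooth_coeffs S a \<Longrightarrow> test_on S K u \<Longrightarrow> test_on S K (dir a u)"
  unfolding test_on_def
  by (auto intro!: smooth_on_dir S simp: dir_def deriv_zero_off[OF compact_imp_closed[OF K]])

lemma test_differentiable: "test_on S K u \<Longrightarrow> u differentiable (at x)"
  using smooth_on_differentiable[OF test_smooth] by blast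

text \<open>On \<open>S\<close> the integrand is the sum of the partial derivatives of the products
  \<open>a b * u\<close>, each of integral 0. Off \<open>S\<close> the coefficients are arbitrary,
  but \<open>u\<close> and its derivatives vanish.\<close>

lemma integral_dir_dvg:
  assumes a: "smooth_coeffs S a" and u: "test_on S K u"
  shows "(\<integral>x. dir a u x + dvg a x * u x \<partial>lborel) = 0"
proof -
  have t: "test_on S K (\<lambda>x. a b x * u x)" if "b \<in> Basis" for b
    using a u that by (intro test_mult) (auto simp: smooth_coeffs_def)
  have z: "a b x * u x = 0" if "x \<notin> K" for b x using u that by (simp add: test_on_def)
  have eq: "dir a u x + dvg a x * u x = (\<Sum>b\<in>Basis. frechet_derivative (\<lambda>x. a b x * u x) (at x) b)" for x
  proof (cases "x \<in> S")
    case True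
    have "frechet_derivative (\<lambda>x. a b x * u x) (at x) b = a b x * frechet_derivative u (at x) b + frechet_derivative (a b) (at x) b * u x"
      if "b \<in> Basis" for b
      using True a u that
      by (intro frechet_derivative_mult) (auto simp: smooth_coeffs_def intro: smooth_on_differentiable test_differentiable)
    then show ?thesis by (simp add: dir_def dvg_def sum.distrib sum_distrib_right)
  next
    case False
    then have "x \<notin> K" using KS by auto
    then have "frechet_derivative (\<lambda>x. a b x * u x) (at x) b = 0" "frechet_derivative u (at x) b = 0" "u x = 0" for b
      using deriv_zero_off[OF compact_imp_closed[OF K] _ z] deriv_zero_off[OF compact_imp_closed[OF K], of x u] u
      by (auto simp: test_on_def)
    then show ?thesis by (simp add: dir_def)
  qed
  have "(\<integral>x. frechet_derivative (\<lambda>x. a b x * u x) (at x) b \<partial>lborel) = 0" if b: "b \<in> Basis" for b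
    using integral_deriv_zero[OF K test_smooth[OF t[OF b]] z b] .
  moreover have "integrable lborel (\<lambda>x. frechet_derivative (\<lambda>x. a b x * u x) (at x) b)" if b: "b \<in> Basis" for b
    by (rule compact_support_integrable[OF K smooth_on_continuous_on[OF smooth_on_deriv[OF test_smooth[OF t[OF b]]]]
      deriv_zero_off[OF compact_imp_closed[OF K] _ z]])
  ultimately show ?thesis unfolding eq by (simp add: Bochner_Integration.integral_sum)
qed

lemma integral_dir_by_parts:
  assumes a: "smooth_coeffs S a" and u: "test_on S K u" and w: "test_on S K w"
  shows "(\<integral>x. dir a u x * w x \<partial>lborel) = - (\<integral>x. u x * dir a w x + dvg a x * (u x * w x) \<partial>lborel)"
proof -
  have uw: "test_on S K (\<lambda>x. u x * w x)" by (intro test_mult test_smooth_on u w)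
  have 1: "test_on S K (\<lambda>x. dir a u x * w x)" by (intro test_mult test_smooth_on test_dir a u w)
  have 2: "test_on S K (\<lambda>x. u x * dir a w x + dvg a x * (u x * w x))"
    by (intro test_add test_mult uw smooth_on_dvg S test_smooth_on test_dir a u w)
  have "dir a u x * w x + (u x * dir a w x + dvg a x * (u x * w x)) =
      dir a (\<lambda>x. u x * w x) x + dvg a x * (u x * w x)" for x
    by (simp add: dir_mult test_differentiable u w algebra_simps)
  then have "(\<integral>x. dir a u x * w x + (u x * dir a w x + dvg a x * (u x * w x)) \<partial>lborel) = 0"
    using integral_dir_dvg[OF a uw] by (simp only:)
  then show ?thesis
    using Bochner_Integration.integral_add[OF test_integrable[OF 1] test_integrable[OF 2]]
    by (simp add: eq_neg_iff_add_eq_0)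
qed

text \<open>With \<open>p = t * dir a ph\<close> this is \<open>dir a\<close> conjugated by the
  exponential weight: it maps exp (t ph) u to exp (t ph) times \<open>dir a u\<close>.\<close>

definition shifted :: "('a \<Rightarrow> 'a \<Rightarrow> complex) \<Rightarrow> ('a \<Rightarrow> complex) \<Rightarrow> ('a \<Rightarrow> complex) \<Rightarrow> 'a \<Rightarrow> complex" where
  "shifted a p w x = dir a w x - p x * w x"

text \<open>The formal adjoint of \<open>shifted\<close> for the L2 pairing; the divergence comes
  from integrating by parts.\<close>

definition shifted_adj :: "('a \<Rightarrow> 'a \<Rightarrow> complex) \<Rightarrow> ('a \<Rightarrow> complex) \<Rightarrow> ('a \<Rightarrow> complex) \<Rightarrow> 'a \<Rightarrow> complex" where
  "shifted_adj a p w x = - dir (cnj_coeffs a) w x - dvg (cnj_coeffs a) x * w x - cnj (p x) * w x"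

lemma test_shifted: "smooth_coeffs S a \<Longrightarrow> smooth_on S p \<Longrightarrow> test_on S K w \<Longrightarrow> test_on S K (shifted a p w)"
  unfolding shifted_def[abs_def] by (intro test_diff test_mult test_dir)

lemma test_shifted_adj: "smooth_coeffs S a \<Longrightarrow> smooth_on S p \<Longrightarrow> test_on S K w \<Longrightarrow> test_on S K (shifted_adj a p w)"
  unfolding shifted_adj_def[abs_def]
  by (intro test_diff test_mult test_dir test_minus smooth_on_cnj smooth_on_dvg S smooth_coeffs_cnj)

lemma cnj_dvg:
  assumes "smooth_coeffs S a" "x \<in> S"
  shows "cnj (dvg (cnj_coeffs a) x) = dvg a x"
proof -
  have "frechet_derivative (\<lambda>y. cnj (a b y)) (at x) b = cnj (frechet_derivative (a b) (at x) b)" if "b \<in> Basis" for b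
    using assms that
    by (intro frechet_derivative_linear_compose bounded_linear_cnj) (auto simp: smooth_coeffs_def intro: smooth_on_differentiable)
  then show ?thesis by (simp add: dvg_def cnj_coeffs_def)
qed

lemma shifted_adjoint:
  assumes a: "smooth_coeffs S a" and p: "smooth_on S p" and u: "test_on S K u" and w: "test_on S K w"
  shows "(\<integral>x. shifted a p u x * cnj (w x) \<partial>lborel) = (\<integral>x. u x * cnj (shifted_adj a p w x) \<partial>lborel)"
proof -
  note cw = test_cnj[OF w]
  have uw: "test_on S K (\<lambda>x. u x * cnj (w x))" by (intro test_mult test_smooth_on u cw)
  have t1: "test_on S K (\<lambda>x. dir a u x * cnj (w x))" by (intro test_mult test_smooth_on test_dir a u cw)
  have t2: "test_on S K (\<lambda>x. p x * (u x * cnj (w x)))" by (intro test_mult uw p)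
  have t3: "test_on S K (\<lambda>x. u x * dir a (\<lambda>x. cnj (w x)) x + dvg a x * (u x * cnj (w x)))"
    by (intro test_add test_mult uw smooth_on_dvg S test_smooth_on test_dir a u cw)
  have e1: "shifted a p u x * cnj (w x) = dir a u x * cnj (w x) - p x * (u x * cnj (w x))" for x
    by (simp add: shifted_def algebra_simps)
  have e2: "u x * cnj (shifted_adj a p w x) = - (u x * dir a (\<lambda>x. cnj (w x)) x + dvg a x * (u x * cnj (w x))) - p x * (u x * cnj (w x))" for x
  proof (cases "x \<in> S")
    case True
    then show ?thesis
      by (simp add: shifted_adj_def dir_cnj[OF test_differentiable[OF w]] cnj_dvg[OF a True] algebra_simps)
  next
    case False
    then show ?thesis using u KS by (auto simp: test_on_def)
  qed
  have "(\<integral>x. shifted a p u x * cnj (w x) \<partial>lborel) = (\<integral>x. dir a u x * cnj (w x) \<partial>lborel) - (\<integral>x. p x * (u x * cnj (w x)) \<partial>lborel)"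
    unfolding e1 by (rule Bochner_Integration.integral_diff[OF test_integrable[OF t1] test_integrable[OF t2]])
  also have "\<dots> = (\<integral>x. - (u x * dir a (\<lambda>x. cnj (w x)) x + dvg a x * (u x * cnj (w x))) - p x * (u x * cnj (w x)) \<partial>lborel)"
    unfolding integral_dir_by_parts[OF a u cw]
    using Bochner_Integration.integral_diff[OF test_integrable[OF test_minus[OF t3]] test_integrable[OF t2]]
    by (simp only: Bochner_Integration.integral_minus)
  finally show ?thesis by (simp only: e2)
qed

text \<open>Terms in which \<open>p\<close>, its conjugate or the divergence stay undifferentiated
  occur in both orders and cancel. What remains is the bracket of the field with its conjugate and a
  zero order factor.\<close>

lemma shifted_commutator:
  assumes a: "smooth_coeffs S a" and p: "smooth_on S p" and w: "test_on S K w" and x: "x \<in> S"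
  shows "shifted_adj a p (shifted a p w) x - shifted a p (shifted_adj a p w) x =
    dir a (dir (cnj_coeffs a) w) x - dir (cnj_coeffs a) (dir a w) x +
    (dir a (dvg (cnj_coeffs a)) x + dir (cnj_coeffs a) p x + dir a (\<lambda>y. cnj (p y)) x) * w x"
proof -
  note ca = smooth_coeffs_cnj[OF S a]
  note cp = smooth_on_cnj[OF S p]
  have d: "p differentiable (at x)" "(\<lambda>y. cnj (p y)) differentiable (at x)" "dvg (cnj_coeffs a) differentiable (at x)"
    using smooth_on_differentiable p cp smooth_on_dvg[OF S ca] x by blast+
  have dw: "w differentiable (at x)" "dir a w differentiable (at x)" "dir (cnj_coeffs a) w differentiable (at x)"
    by (intro test_differentiable test_dir a ca w)+
  have "dir c (shifted a p w) x = dir c (dir a w) x - (p x * dir c w x + w x * dir c p x)" for c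
    unfolding shifted_def[abs_def] using d dw by (simp add: dir_diff dir_mult)
  moreover have "dir c (shifted_adj a p w) x = - dir c (dir (cnj_coeffs a) w) x
     - (dvg (cnj_coeffs a) x * dir c w x + w x * dir c (dvg (cnj_coeffs a)) x)
     - (cnj (p x) * dir c w x + w x * dir c (\<lambda>y. cnj (p y)) x)" for c
    unfolding shifted_adj_def[abs_def] using d dw by (simp add: dir_diff dir_mult dir_minus)
  ultimately show ?thesis
    by (simp add: shifted_def[of _ _ "shifted_adj a p w"] shifted_adj_def[of _ _ "shifted a p w"])
      (simp add: shifted_def shifted_adj_def algebra_simps)
qed

text \<open>The adjoint relation turns both squared norms into pairings with \<open>w\<close>, and
  their difference into the commutator applied to \<open>w\<close> and paired with
  \<open>w\<close>.\<close>

lemma shifted_energy: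
  assumes a: "smooth_coeffs S a" and p: "smooth_on S p" and w: "test_on S K w"
  shows "(\<integral>x. shifted a p w x * cnj (shifted a p w x) \<partial>lborel) - (\<integral>x. shifted_adj a p w x * cnj (shifted_adj a p w x) \<partial>lborel) =
    (\<integral>x. (dir a (dir (cnj_coeffs a) w) x - dir (cnj_coeffs a) (dir a w) x) * cnj (w x) +
    (dir a (dvg (cnj_coeffs a)) x + dir (cnj_coeffs a) p x + dir a (\<lambda>y. cnj (p y)) x) * (w x * cnj (w x)) \<partial>lborel)"
proof -
  note sw = test_shifted[OF a p w] and aw = test_shifted_adj[OF a p w]
  have i1: "integrable lborel (\<lambda>x. shifted_adj a p (shifted a p w) x * cnj (w x))"
    by (intro test_integrable test_mult test_smooth_on test_shifted_adj a p sw test_cnj w)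
  have i2: "integrable lborel (\<lambda>x. shifted a p (shifted_adj a p w) x * cnj (w x))"
    by (intro test_integrable test_mult test_smooth_on test_shifted a p aw test_cnj w)
  have "(\<integral>x. shifted a p w x * cnj (shifted a p w x) \<partial>lborel) = cnj (\<integral>x. shifted a p w x * cnj (shifted a p w x) \<partial>lborel)"
    by (simp only: Bochner_Integration.integral_cnj[symmetric] complex_cnj_mult complex_cnj_cnj mult.commute)
  also have "\<dots> = cnj (\<integral>x. w x * cnj (shifted_adj a p (shifted a p w) x) \<partial>lborel)"
    by (simp only: shifted_adjoint[OF a p w sw])
  also have "\<dots> = (\<integral>x. shifted_adj a p (shifted a p w) x * cnj (w x) \<partial>lborel)"
    by (simp only: Bochner_Integration.integral_cnj[symmetric] complex_cnj_mult complex_cnj_cnj mult.commute)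
  finally have 1: "(\<integral>x. shifted a p w x * cnj (shifted a p w x) \<partial>lborel) = (\<integral>x. shifted_adj a p (shifted a p w) x * cnj (w x) \<partial>lborel)" .
  have 2: "(\<integral>x. shifted_adj a p w x * cnj (shifted_adj a p w x) \<partial>lborel) = (\<integral>x. shifted a p (shifted_adj a p w) x * cnj (w x) \<partial>lborel)"
    by (rule shifted_adjoint[OF a p aw w, symmetric])
  have "shifted_adj a p (shifted a p w) x * cnj (w x) - shifted a p (shifted_adj a p w) x * cnj (w x) =
    (dir a (dir (cnj_coeffs a) w) x - dir (cnj_coeffs a) (dir a w) x) * cnj (w x) +
    (dir a (dvg (cnj_coeffs a)) x + dir (cnj_coeffs a) p x + dir a (\<lambda>y. cnj (p y)) x) * (w x * cnj (w x))" for x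
  proof (cases "x \<in> S")
    case True
    have "shifted_adj a p (shifted a p w) x * cnj (w x) - shifted a p (shifted_adj a p w) x * cnj (w x) =
      (shifted_adj a p (shifted a p w) x - shifted a p (shifted_adj a p w) x) * cnj (w x)" by (simp add: algebra_simps)
    then show ?thesis unfolding shifted_commutator[OF a p w True] by (simp add: algebra_simps)
  next
    case False
    then have "w x = 0" using w KS by (auto simp: test_on_def)
    then show ?thesis by simp
  qed
  then show ?thesis unfolding 1 2 using Bochner_Integration.integral_diff[OF i1 i2] by simp
qed

end

section \<open>A Carleman estimate\<close>

lemma norm_sq_integral: "(\<integral>x. f x * cnj (f x) \<partial>M) = complex_of_real (\<integral>x. (cmod (f x))\<^sup>2 \<partial>M)"
  by (simp only: complex_norm_square[symmetric] integral_complex_of_real)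

text \<open>\<open>a r\<close> plays the role of L_0, and the fields of smaller index are the Z_j.
  The bracket relation is stated on functions, the form in which the commutator produces it.\<close>

locale carleman_fields = test_domain S K for S K :: "'a::euclidean_space set" +
  fixes r :: nat and a :: "nat \<Rightarrow> 'a \<Rightarrow> 'a \<Rightarrow> complex" and ph :: "'a \<Rightarrow> complex"
  assumes a: "\<And>j. j \<le> r \<Longrightarrow> smooth_coeffs S (a j)"
    and ph: "smooth_on S ph" and ph_real: "\<And>x. cnj (ph x) = ph x"
    and bracket: "\<And>w x. smooth_on S w \<Longrightarrow> x \<in> S \<Longrightarrow>
      (\<Sum>j<r. dir (a j) (dir (cnj_coeffs (a j)) w) x - dir (cnj_coeffs (a j)) (dir (a j) w) x) =
      dir (cnj_coeffs (a r)) w x - dir (a r) w x"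
begin

text \<open>The operator Q of the overview, applied to the weight \<open>ph\<close>.\<close>

definition levi :: "'a \<Rightarrow> complex" where
  "levi x = (\<Sum>j<r. dir (cnj_coeffs (a j)) (dir (a j) ph) x + dir (a j) (dir (cnj_coeffs (a j)) ph) x)
     - dir (a r) ph x - dir (cnj_coeffs (a r)) ph x"

lemma smooth_levi: "smooth_on S levi"
  unfolding levi_def[abs_def]
  by (intro smooth_on_diff smooth_on_sum smooth_on_add smooth_on_dir smooth_coeffs_cnj S a ph) auto

lemma cnj_dir_ph: "x \<in> S \<Longrightarrow> cnj (dir (a j) ph x) = dir (cnj_coeffs (a j)) ph x"
  using dir_cnj[OF smooth_on_differentiable[OF ph], of x "cnj_coeffs (a j)"] by (simp add: ph_real)

definition weighted :: "real \<Rightarrow> nat \<Rightarrow> ('a \<Rightarrow> complex) \<Rightarrow> 'a \<Rightarrow> complex" where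
  "weighted t j = shifted (a j) (\<lambda>x. of_real t * dir (a j) ph x)"

lemma smooth_weight: "j \<le> r \<Longrightarrow> smooth_on S (\<lambda>x. of_real t * dir (a j) ph x)"
  by (intro smooth_on_mult smooth_on_const smooth_on_dir S a ph)

lemma test_weighted: "j \<le> r \<Longrightarrow> test_on S K w \<Longrightarrow> test_on S K (weighted t j w)"
  unfolding weighted_def by (intro test_shifted a smooth_weight)

lemma test_norm_sq: "test_on S K w \<Longrightarrow> integrable lborel (\<lambda>x. (cmod (w x))\<^sup>2)"
proof -
  assume w: "test_on S K w"
  have "integrable lborel (\<lambda>x. Re (w x * cnj (w x)))"
    using test_integrable[OF test_mult[OF test_smooth_on[OF w] test_cnj[OF w]]] by (rule integrable_Re)
  moreover have "Re (w x * cnj (w x)) = (cmod (w x))\<^sup>2" for x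
    by (simp only: complex_norm_square[symmetric] Re_complex_of_real)
  ultimately show ?thesis by simp
qed

text \<open>The zero order coefficient free of \<open>t\<close>: derivatives of divergences from the
  commutators, and the divergence left over when the conjugate of L_0 is integrated by
  parts.\<close>

definition lower_order :: "'a \<Rightarrow> complex" where
  "lower_order x = (\<Sum>j<r. dir (a j) (dvg (cnj_coeffs (a j))) x) - dvg (cnj_coeffs (a r)) x"

lemma smooth_lower_order: "smooth_on S lower_order"
  unfolding lower_order_def[abs_def]
  by (intro smooth_on_diff smooth_on_sum smooth_on_dir smooth_on_dvg smooth_coeffs_cnj S a) auto

lemma carleman_identity:
  assumes w: "test_on S K w"
  shows "(\<Sum>j<r. (\<integral>x. (cmod (weighted t j w x))\<^sup>2 \<partial>lborel)) \<ge>
    (\<integral>x. Re ((of_real t * levi x + lower_order x) * (w x * cnj (w x))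
       - weighted t r w x * cnj (w x) - w x * cnj (weighted t r w x)) \<partial>lborel)"
proof -
  let ?p = "\<lambda>j x. of_real t * dir (a j) ph x"
  let ?adj = "\<lambda>j. shifted_adj (a j) (?p j) w"
  let ?I = "\<lambda>j x. (dir (a j) (dir (cnj_coeffs (a j)) w) x - dir (cnj_coeffs (a j)) (dir (a j) w) x) * cnj (w x) +
    (dir (a j) (dvg (cnj_coeffs (a j))) x + dir (cnj_coeffs (a j)) (?p j) x + dir (a j) (\<lambda>y. cnj (?p j y)) x) * (w x * cnj (w x))"
  note ca = smooth_coeffs_cnj[OF S a]
  have ww: "test_on S K (\<lambda>x. w x * cnj (w x))" by (intro test_mult test_smooth_on test_cnj w)
  have tI: "test_on S K (?I j)" if "j < r" for j
    using that by (intro test_add test_mult test_diff test_dir ca a w test_smooth_on test_cnj ww smooth_on_add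
      smooth_on_dir smooth_on_dvg S smooth_weight smooth_on_cnj) auto
  have en: "complex_of_real ((\<integral>x. (cmod (weighted t j w x))\<^sup>2 \<partial>lborel) - (\<integral>x. (cmod (?adj j x))\<^sup>2 \<partial>lborel)) = (\<integral>x. ?I j x \<partial>lborel)"
    if "j < r" for j
    using shifted_energy[OF a smooth_weight w, of j j t] that by (simp add: norm_sq_integral weighted_def)
  let ?J = "\<lambda>x. dir (cnj_coeffs (a r)) w x * cnj (w x)"
  let ?J' = "\<lambda>x. w x * dir (cnj_coeffs (a r)) (\<lambda>x. cnj (w x)) x + dvg (cnj_coeffs (a r)) x * (w x * cnj (w x))"
  let ?T = "\<lambda>x. (of_real t * levi x + lower_order x) * (w x * cnj (w x)) - weighted t r w x * cnj (w x) - w x * cnj (weighted t r w x)"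
  have tJ: "test_on S K ?J" by (intro test_mult test_smooth_on test_dir ca test_cnj w) auto
  have tJ': "test_on S K ?J'"
    by (intro test_add test_mult test_smooth_on test_dir ca test_cnj w smooth_on_dvg S) auto
  have tT: "test_on S K ?T"
    by (intro test_diff test_mult smooth_on_add smooth_on_mult smooth_on_const S smooth_levi smooth_lower_order
      test_smooth_on w test_cnj test_weighted) auto
  have tR: "test_on S K (\<lambda>x. ?T x + ?J' x)" by (rule test_add[OF tT tJ'])
  \<comment> \<open>\<open>?J\<close> and \<open>?J'\<close> have opposite integrals, so after
    integration only \<open>?T\<close> survives.\<close>
  have pt: "(\<Sum>j<r. ?I j x) = ?J x + (?T x + ?J' x)" for x
  proof (cases "x \<in> S")
    case x: True
    have d: "dir (a j) ph differentiable (at x)" "dir (cnj_coeffs (a j)) ph differentiable (at x)" if "j \<le> r" for j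
      using smooth_on_differentiable[OF smooth_on_dir[OF S _ ph] x] a[OF that] ca[OF that] by blast+
    have p1: "dir (cnj_coeffs (a j)) (?p j) x = of_real t * dir (cnj_coeffs (a j)) (dir (a j) ph) x" if "j \<le> r" for j
      by (rule dir_cmult[OF d(1)[OF that]])
    have p2: "dir (a j) (\<lambda>y. cnj (?p j y)) x = of_real t * dir (a j) (dir (cnj_coeffs (a j)) ph) x" if "j \<le> r" for j
    proof -
      \<comment> \<open>The conjugated weight derivative is identified only on \<open>S\<close>; as
        \<open>S\<close> is open, this determines its derivative at \<open>x\<close>.\<close>
      have "dir (a j) (\<lambda>y. cnj (?p j y)) x = dir (a j) (\<lambda>y. of_real t * dir (cnj_coeffs (a j)) ph y) x"
        by (rule dir_cong[OF S x]) (auto simp: cnj_dir_ph intro!: smooth_on_differentiable[OF smooth_on_cnj[OF S smooth_weight[OF that]] x, simplified])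
      then show ?thesis using dir_cmult[OF d(2)[OF that]] by simp
    qed
    have "(\<Sum>j<r. ?I j x) = (\<Sum>j<r. (dir (a j) (dir (cnj_coeffs (a j)) w) x - dir (cnj_coeffs (a j)) (dir (a j) w) x)) * cnj (w x) +
       (\<Sum>j<r. dir (a j) (dvg (cnj_coeffs (a j))) x + of_real t * (dir (cnj_coeffs (a j)) (dir (a j) ph) x + dir (a j) (dir (cnj_coeffs (a j)) ph) x)) * (w x * cnj (w x))"
      unfolding sum_distrib_right sum.distrib[symmetric]
      by (rule sum.cong[OF refl]; subst p1; (subst p2)?) (simp_all add: algebra_simps)
    also have "\<dots> = (dir (cnj_coeffs (a r)) w x - dir (a r) w x) * cnj (w x) +
       (lower_order x + dvg (cnj_coeffs (a r)) x + of_real t * (levi x + dir (a r) ph x + dir (cnj_coeffs (a r)) ph x)) * (w x * cnj (w x))"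
      unfolding bracket[OF test_smooth_on[OF w] x]
      by (simp add: lower_order_def levi_def sum.distrib sum_distrib_left algebra_simps)
    also have "\<dots> = ?J x + (?T x + ?J' x)"
      using dir_cnj[OF test_differentiable[OF w], of "cnj_coeffs (a r)"]
      by (simp add: weighted_def shifted_def cnj_dir_ph[OF x] algebra_simps)
    finally show ?thesis .
  next
    case False
    then have "w x = 0" using w KS by (auto simp: test_on_def)
    then show ?thesis by simp
  qed
  have "complex_of_real (\<Sum>j<r. (\<integral>x. (cmod (weighted t j w x))\<^sup>2 \<partial>lborel) - (\<integral>x. (cmod (?adj j x))\<^sup>2 \<partial>lborel)) = (\<Sum>j<r. (\<integral>x. ?I j x \<partial>lborel))"
    unfolding of_real_sum by (intro sum.cong refl en) simp
  also have "\<dots> = (\<integral>x. (\<Sum>j<r. ?I j x) \<partial>lborel)"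
    by (rule Bochner_Integration.integral_sum[symmetric]) (use tI test_integrable in auto)
  also have "\<dots> = (\<integral>x. ?J x \<partial>lborel) + (\<integral>x. ?T x + ?J' x \<partial>lborel)"
    unfolding pt by (rule Bochner_Integration.integral_add[OF test_integrable[OF tJ] test_integrable[OF tR]])
  also have "(\<integral>x. ?T x + ?J' x \<partial>lborel) = (\<integral>x. ?T x \<partial>lborel) + (\<integral>x. ?J' x \<partial>lborel)"
    by (rule Bochner_Integration.integral_add[OF test_integrable[OF tT] test_integrable[OF tJ']])
  also have "(\<integral>x. ?J x \<partial>lborel) = - (\<integral>x. ?J' x \<partial>lborel)"
    by (rule integral_dir_by_parts[OF ca[OF order_refl] w test_cnj[OF w]])
  finally have "complex_of_real (\<Sum>j<r. (\<integral>x. (cmod (weighted t j w x))\<^sup>2 \<partial>lborel) - (\<integral>x. (cmod (?adj j x))\<^sup>2 \<partial>lborel)) = (\<integral>x. ?T x \<partial>lborel)"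
    by simp
  from arg_cong[OF this, of Re]
  have "(\<Sum>j<r. (\<integral>x. (cmod (weighted t j w x))\<^sup>2 \<partial>lborel) - (\<integral>x. (cmod (?adj j x))\<^sup>2 \<partial>lborel)) = Re (\<integral>x. ?T x \<partial>lborel)"
    by (simp only: Re_complex_of_real)
  also have "\<dots> = (\<integral>x. Re (?T x) \<partial>lborel)" by (rule integral_Re[OF test_integrable[OF tT], symmetric])
  finally have "(\<integral>x. Re (?T x) \<partial>lborel) = (\<Sum>j<r. (\<integral>x. (cmod (weighted t j w x))\<^sup>2 \<partial>lborel) - (\<integral>x. (cmod (?adj j x))\<^sup>2 \<partial>lborel))" by simp
  also have "\<dots> \<le> (\<Sum>j<r. (\<integral>x. (cmod (weighted t j w x))\<^sup>2 \<partial>lborel))"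
    by (intro sum_mono) simp
  finally show ?thesis .
qed

text \<open>\<open>B\<close> bounds the zero order term on \<open>K\<close>. The additional 1 pays
  for the part |w|^2 of the two cross terms with L_0; their other part is the summand of index
  \<open>r\<close> on the right. The constant therefore does not depend on \<open>t\<close>.\<close>

theorem carleman_estimate:
  assumes c: "\<And>x. x \<in> K \<Longrightarrow> Re (levi x) \<ge> c"
  obtains C where "C \<ge> 0" "\<And>t w. t \<ge> 0 \<Longrightarrow> test_on S K w \<Longrightarrow>
     (t * c - C) * (\<integral>x. (cmod (w x))\<^sup>2 \<partial>lborel) \<le> (\<Sum>j<Suc r. (\<integral>x. (cmod (weighted t j w x))\<^sup>2 \<partial>lborel))"
proof -
  have "compact (lower_order ` K)"
    by (intro compact_continuous_image K continuous_on_subset[OF smooth_on_continuous_on[OF smooth_lower_order] KS])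
  from compact_imp_bounded[OF this] obtain B where B: "B > 0" "\<And>x. x \<in> K \<Longrightarrow> cmod (lower_order x) \<le> B"
    unfolding bounded_pos by blast
  have "(t * c - (B + 1)) * (\<integral>x. (cmod (w x))\<^sup>2 \<partial>lborel) \<le> (\<Sum>j<Suc r. (\<integral>x. (cmod (weighted t j w x))\<^sup>2 \<partial>lborel))"
    if t: "t \<ge> 0" and w: "test_on S K w" for t w
  proof -
    let ?T = "\<lambda>x. (of_real t * levi x + lower_order x) * (w x * cnj (w x)) - weighted t r w x * cnj (w x) - w x * cnj (weighted t r w x)"
    have tT: "test_on S K ?T"
      by (intro test_diff test_mult smooth_on_add smooth_on_mult smooth_on_const S smooth_levi smooth_lower_order
        test_smooth_on w test_cnj test_weighted) auto
    have pt: "(t * c - (B + 1)) * (cmod (w x))\<^sup>2 - (cmod (weighted t r w x))\<^sup>2 \<le> Re (?T x)" for x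
    proof (cases "x \<in> K")
      case True
      have "\<bar>Re (lower_order x)\<bar> \<le> B" using B(2)[OF True] abs_Re_le_cmod order_trans by blast
      then have "t * c - B \<le> t * Re (levi x) + Re (lower_order x)" using c[OF True] t mult_left_mono[of c "Re (levi x)" t] by linarith
      then have 1: "(t * c - B) * (cmod (w x))\<^sup>2 \<le> (t * Re (levi x) + Re (lower_order x)) * (cmod (w x))\<^sup>2"
        by (rule mult_right_mono) simp
      have e: "Re ((of_real t * levi x + lower_order x) * (w x * cnj (w x))) = (t * Re (levi x) + Re (lower_order x)) * (cmod (w x))\<^sup>2"
        unfolding complex_norm_square[symmetric] by simp
      have "Re (weighted t r w x * cnj (w x)) \<le> cmod (weighted t r w x) * cmod (w x)"
        using complex_Re_le_cmod[of "weighted t r w x * cnj (w x)"] by (simp add: norm_mult)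
      moreover have "Re (w x * cnj (weighted t r w x)) \<le> cmod (weighted t r w x) * cmod (w x)"
        using complex_Re_le_cmod[of "w x * cnj (weighted t r w x)"] by (simp add: norm_mult mult.commute)
      moreover have "2 * (cmod (weighted t r w x) * cmod (w x)) \<le> (cmod (weighted t r w x))\<^sup>2 + (cmod (w x))\<^sup>2"
        using sum_squares_bound[of "cmod (weighted t r w x)" "cmod (w x)"] by (simp add: mult.assoc)
      ultimately show ?thesis using 1 e by (simp add: algebra_simps)
    next
      case False
      then have "w x = 0" using w by (auto simp: test_on_def)
      then show ?thesis by simp
    qed
    have "(t * c - (B + 1)) * (\<integral>x. (cmod (w x))\<^sup>2 \<partial>lborel) - (\<integral>x. (cmod (weighted t r w x))\<^sup>2 \<partial>lborel) =
      (\<integral>x. (t * c - (B + 1)) * (cmod (w x))\<^sup>2 - (cmod (weighted t r w x))\<^sup>2 \<partial>lborel)"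
      using Bochner_Integration.integral_diff[OF integrable_mult_right[OF test_norm_sq[OF w]] test_norm_sq[OF test_weighted[OF order_refl w]]]
      by simp
    also have "\<dots> \<le> (\<integral>x. Re (?T x) \<partial>lborel)"
    proof (rule Bochner_Integration.integral_mono)
      show "integrable lborel (\<lambda>x. Re (?T x))" using test_integrable[OF tT] by (rule integrable_Re)
      show "integrable lborel (\<lambda>x. (t * c - (B + 1)) * (cmod (w x))\<^sup>2 - (cmod (weighted t r w x))\<^sup>2)"
        by (intro Bochner_Integration.integrable_diff integrable_mult_right test_norm_sq w test_weighted) auto
    qed (rule pt)
    also have "\<dots> \<le> (\<Sum>j<r. (\<integral>x. (cmod (weighted t j w x))\<^sup>2 \<partial>lborel))" by (rule carleman_identity[OF w])
    finally show ?thesis by simp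
  qed
  then show thesis using that[of "B + 1"] B(1) by simp
qed

end

section \<open>Mollification of weak solutions\<close>

text \<open>The ball is convex and compact, so bounds of the partial derivatives on it give a
  Lipschitz constant.\<close>

lemma smooth_on_cball_lipschitz:
  fixes f :: "'a::euclidean_space \<Rightarrow> complex"
  assumes f: "smooth_on S f" and B: "cball x0 R \<subseteq> S"
  obtains L where "L > 0" "\<And>x y. x \<in> cball x0 R \<Longrightarrow> y \<in> cball x0 R \<Longrightarrow> cmod (f x - f y) \<le> L * norm (x - y)"
proof -
  have "\<exists>M>0. \<forall>x\<in>cball x0 R. cmod (frechet_derivative f (at x) b) \<le> M" for b
  proof -
    have "compact ((\<lambda>x. frechet_derivative f (at x) b) ` cball x0 R)"
      by (intro compact_continuous_image compact_cball continuous_on_subset[OF smooth_on_continuous_on[OF smooth_on_deriv[OF f]] B])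
    from compact_imp_bounded[OF this] show ?thesis unfolding bounded_pos by blast
  qed
  then obtain M where M: "\<And>b. M b > 0" "\<And>b x. x \<in> cball x0 R \<Longrightarrow> cmod (frechet_derivative f (at x) b) \<le> M b" by metis
  define N where "N = (\<Sum>b\<in>Basis. M b)"
  have N: "M b \<le> N" if "b \<in> Basis" for b
    unfolding N_def using that M(1) by (intro member_le_sum) (auto simp: less_imp_le)
  have Np: "N > 0" unfolding N_def by (intro sum_pos) (use M(1) in auto)
  have "cmod (f x - f y) \<le> (real DIM('a) * N) * norm (x - y)" if xy: "x \<in> cball x0 R" "y \<in> cball x0 R" for x y
  proof (rule differentiable_bound[where S="cball x0 R" and f'="\<lambda>x. frechet_derivative f (at x)"])
    fix z assume z: "z \<in> cball x0 R"
    show "(f has_derivative frechet_derivative f (at z)) (at z within cball x0 R)"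
      using smooth_on_has_derivative[OF f, of z] z B has_derivative_at_withinI by blast
    show "onorm (frechet_derivative f (at z)) \<le> real DIM('a) * N"
    proof (rule onorm_le)
      fix v
      have d: "f differentiable (at z)" using smooth_on_differentiable[OF f, of z] z B by blast
      have "cmod (frechet_derivative f (at z) b) \<le> N" if "b \<in> Basis" for b
        using M(2)[OF z, of b] N[OF that] by linarith
      then show "cmod (frechet_derivative f (at z) v) \<le> real DIM('a) * N * norm v"
        unfolding frechet_derivative_coords[OF d, of v] by (rule norm_coords_le)
    qed
  qed (use xy in auto)
  moreover have "real DIM('a) * N > 0" using Np by simp
  ultimately show thesis using that by blast
qed

lemma integrable_mult_test:
  fixes u :: "'a::euclidean_space \<Rightarrow> complex"
  assumes "compact K" "continuous_on UNIV u" "\<And>x. x \<notin> K \<Longrightarrow> u x = 0" "integrable lborel f"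
  shows "integrable lborel (\<lambda>x. f x * u x)"
proof -
  obtain M where M: "M > 0" "\<And>x. norm (u x) \<le> M"
    using compact_support_bounded[OF assms(1-3)] by blast
  have [measurable]: "u \<in> borel_measurable borel" using assms(2) by (rule borel_measurable_continuous_onI)
  have [measurable]: "f \<in> borel_measurable borel" using assms(4) by auto
  show ?thesis
    by (rule Bochner_Integration.integrable_bound[of _ "\<lambda>x. M *\<^sub>R f x"])
      (use M assms(4) in \<open>auto simp: norm_mult mult.commute[of _ "cmod (u _)"] intro!: mult_right_mono\<close>)
qed

text \<open>Friedrichs' lemma with a weight. Testing the weak equation with the mollifier times
  weight and cutoff adds 0 to the differentiated convolution and leaves only differences of
  coefficients at points closer than \<open>e\<close>. They compensate the factor 1/e of the kernel
  derivative; the weight contributes t e, and the derivative of the cutoff goes into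
  \<open>H\<close>. The constant is independent of \<open>t\<close> and \<open>e\<close>.\<close>

lemma weighted_mollification_bound:
  fixes F G :: "'a::euclidean_space \<Rightarrow> complex" and \<phi> :: "'a \<Rightarrow> real"
  assumes S: "open S" and R: "R > 0" and B: "cball x0 R \<subseteq> S"
    and a: "smooth_coeffs S a" and \<phi>: "smooth_on S \<phi>"
    and F: "integrable lborel F" and F2: "integrable lborel (\<lambda>x. (cmod (F x))\<^sup>2)"
    and G [measurable]: "G \<in> borel_measurable borel" and \<kappa>: "\<kappa> \<ge> 0" "\<And>x. cmod (G x) \<le> \<kappa> * cmod (F x)"
    and weak: "\<And>u. test_on S (cball x0 R) u \<Longrightarrow>
      (\<integral>x. G x * u x \<partial>lborel) = - (\<integral>x. F x * (\<Sum>b\<in>Basis. frechet_derivative (\<lambda>y. a b y * u y) (at x) b) \<partial>lborel)"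
  defines "bmp \<equiv> bump x0 (R/2)"
  defines "E \<equiv> \<lambda>t y. complex_of_real (exp (t * \<phi> y) * bmp y)"
  defines "H \<equiv> \<lambda>t y. exp (t * \<phi> y) * (bmp y + cmod (dir a (\<lambda>y. of_real (bmp y)) y)) * cmod (F y)"
  obtains C where "C \<ge> 0"
    "\<And>t e. t \<ge> 0 \<Longrightarrow> e > 0 \<Longrightarrow> e \<le> R/2 \<Longrightarrow>
      (\<integral>x. (cmod (dir a (conv (mollifier e) (\<lambda>y. E t y * F y)) x
          - of_real t * dir a (\<lambda>y. of_real (\<phi> y)) x * conv (mollifier e) (\<lambda>y. E t y * F y) x))\<^sup>2 \<partial>lborel)
      \<le> C * ((1 + t\<^sup>2 * e\<^sup>2) * (\<integral>y. (cmod (E t y * F y))\<^sup>2 \<partial>lborel) + (\<integral>y. (H t y)\<^sup>2 \<partial>lborel))"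
    "\<And>t. integrable lborel (\<lambda>y. E t y * F y)" "\<And>t. integrable lborel (\<lambda>y. (cmod (E t y * F y))\<^sup>2)"
    "\<And>t. integrable lborel (\<lambda>y. (H t y)\<^sup>2)"
    "\<And>t e. e > 0 \<Longrightarrow> e \<le> R/2 \<Longrightarrow> test_on S (cball x0 R) (conv (mollifier e) (\<lambda>y. E t y * F y))"
proof -
  let ?K0 = "cball x0 (R/2)" and ?K1 = "cball x0 R"
  let ?bmp = "\<lambda>y. complex_of_real (bmp y)" and ?\<phi> = "\<lambda>y. complex_of_real (\<phi> y)"
  have K01: "?K0 \<subseteq> ?K1" using R by (auto intro: order_trans)
  interpret D0: test_domain S ?K0 using S B K01 by unfold_locales auto
  interpret D1: test_domain S ?K1 using S B by unfold_locales auto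
  have bmp0: "bmp y = 0" if "y \<notin> ?K0" for y
    unfolding bmp_def using that R by (intro bump_eq_0) (auto simp: dist_norm norm_minus_commute)
  have bmpp: "bmp y \<ge> 0" for y unfolding bmp_def by (rule bump_nonneg)
  have sbmp: "smooth_on S ?bmp" unfolding bmp_def by (intro smooth_on_of_real smooth_on_bump S)
  have s\<phi>: "smooth_on S ?\<phi>" by (intro smooth_on_of_real S \<phi>)
  have sexp: "smooth_on S (\<lambda>y. complex_of_real (exp (t * \<phi> y)))" for t
    by (intro smooth_on_of_real smooth_on_exp smooth_on_mult smooth_on_const S \<phi>)
  have tbmp: "test_on S ?K0 ?bmp" using sbmp bmp0 by (simp add: test_on_def)
  \<comment> \<open>The part of the derivative of \<open>E\<close> that falls on the cutoff. The
    other part is \<open>t * dir a \<phi>\<close> times \<open>E\<close> and will meet the zero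
    order shift.\<close>
  define A where "A t y = complex_of_real (exp (t * \<phi> y)) * dir a ?bmp y" for t y
  have tE: "test_on S ?K0 (E t)" for t
    unfolding E_def of_real_mult by (rule D0.test_mult[OF sexp tbmp])
  have tA: "test_on S ?K0 (A t)" for t
    unfolding A_def[abs_def] by (rule D0.test_mult[OF sexp D0.test_dir[OF a tbmp]])
  have E0: "E t y = 0" and A0: "A t y = 0" if "y \<notin> ?K0" for t y
    using tE tA that by (auto simp: test_on_def)
  have [measurable]: "E t \<in> borel_measurable borel" "A t \<in> borel_measurable borel" for t
    using smooth_on_continuous_on[OF D0.test_smooth] tE tA by (blast intro: borel_measurable_continuous_onI)+
  have Fm [measurable]: "F \<in> borel_measurable borel" using F by auto
  have cE: "cmod (E t y) = exp (t * \<phi> y) * bmp y" for t y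
    using bmpp[of y] by (simp add: E_def norm_mult)
  have HE: "H t y = (cmod (E t y) + cmod (A t y)) * cmod (F y)" for t y
    unfolding cE by (simp add: H_def A_def norm_mult algebra_simps)
  have [measurable]: "H t \<in> borel_measurable borel" for t unfolding HE[abs_def] by measurable
  have dE: "dir a (E t) y = of_real t * dir a ?\<phi> y * E t y + A t y" if y: "y \<in> S" for t y
  proof -
    have d: "((\<lambda>y. complex_of_real (exp (t * \<phi> y))) has_derivative
       (\<lambda>v. complex_of_real (exp (t * \<phi> y) * (t * frechet_derivative \<phi> (at y) v)))) (at y)"
      using smooth_on_has_derivative[OF \<phi> y] by (auto intro!: derivative_eq_intros)
    have e1: "frechet_derivative (\<lambda>y. complex_of_real (exp (t * \<phi> y))) (at y) v =
       complex_of_real (exp (t * \<phi> y) * (t * frechet_derivative \<phi> (at y) v))" for v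
      using frechet_derivative_at[OF d] by metis
    have e2: "frechet_derivative ?\<phi> (at y) v = complex_of_real (frechet_derivative \<phi> (at y) v)" for v
      by (rule frechet_derivative_linear_compose[OF smooth_on_differentiable[OF \<phi> y] bounded_linear_of_real])
    have "dir a (\<lambda>y. complex_of_real (exp (t * \<phi> y))) y = of_real t * of_real (exp (t * \<phi> y)) * dir a ?\<phi> y"
      by (simp add: dir_def e1 e2 sum_distrib_left mult_ac)
    moreover have "dir a (E t) y = of_real (exp (t * \<phi> y)) * dir a ?bmp y + ?bmp y * dir a (\<lambda>y. complex_of_real (exp (t * \<phi> y))) y"
      unfolding E_def of_real_mult
      by (rule dir_mult[OF smooth_on_differentiable[OF sexp y] smooth_on_differentiable[OF sbmp y]])
    ultimately show ?thesis by (simp add: A_def E_def mult_ac)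
  qed
  obtain M where M: "M > 0"
    "\<And>e z::'a. e > 0 \<Longrightarrow> mollifier e z \<le> M * ball_kernel e z"
    "\<And>e b z::'a. e > 0 \<Longrightarrow> b \<in> Basis \<Longrightarrow> \<bar>frechet_derivative (mollifier e) (at z) b\<bar> \<le> M / e * ball_kernel e z"
    using mollifier_bounds by blast
  have "\<forall>b. \<exists>L. b \<in> Basis \<longrightarrow> L > 0 \<and> (\<forall>x y. x \<in> ?K1 \<longrightarrow> y \<in> ?K1 \<longrightarrow> cmod (a b x - a b y) \<le> L * norm (x - y))"
  proof
    fix b :: 'a
    show "\<exists>L. b \<in> Basis \<longrightarrow> L > 0 \<and> (\<forall>x y. x \<in> ?K1 \<longrightarrow> y \<in> ?K1 \<longrightarrow> cmod (a b x - a b y) \<le> L * norm (x - y))"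
    proof (cases "b \<in> Basis")
      case True
      then have "smooth_on S (a b)" using a by (simp add: smooth_coeffs_def)
      from smooth_on_cball_lipschitz[OF this B] show ?thesis by blast
    qed simp
  qed
  then obtain La where La: "\<And>b. b \<in> Basis \<Longrightarrow> La b > 0"
    "\<And>b x y. b \<in> Basis \<Longrightarrow> x \<in> ?K1 \<Longrightarrow> y \<in> ?K1 \<Longrightarrow> cmod (a b x - a b y) \<le> La b * norm (x - y)" by metis
  obtain L where L: "L > 0" "\<And>x y. x \<in> ?K1 \<Longrightarrow> y \<in> ?K1 \<Longrightarrow> cmod (dir a ?\<phi> x - dir a ?\<phi> y) \<le> L * norm (x - y)"
    using smooth_on_cball_lipschitz[OF smooth_on_dir[OF S a s\<phi>] B] by blast
  have "compact (dvg a ` ?K1)"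
    by (intro compact_continuous_image compact_cball continuous_on_subset[OF smooth_on_continuous_on[OF smooth_on_dvg[OF S a]] B])
  from compact_imp_bounded[OF this] obtain D where D: "D > 0" "\<And>x. x \<in> ?K1 \<Longrightarrow> cmod (dvg a x) \<le> D"
    unfolding bounded_pos by blast
  \<comment> \<open>\<open>M\<close> bounds the kernel; the summands account for the coefficient
    differences, the divergence, the variation of \<open>dir a \<phi>\<close>, the right hand side
    \<open>G\<close> and the cutoff term.\<close>
  define C0 where "C0 = M * ((\<Sum>b\<in>Basis. La b) + D + L + \<kappa> + 1)"
  have Lap: "(\<Sum>b\<in>Basis. La b) \<ge> 0" using La(1) by (intro sum_nonneg) (auto simp: less_imp_le)
  have C0p: "C0 \<ge> 0" using M(1) Lap D(1) L(1) \<kappa>(1) by (simp add: C0_def)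
  have vi: "integrable lborel (\<lambda>y. E t y * F y)" for t
    using integrable_mult_test[OF compact_cball[of x0 "R/2"] smooth_on_continuous_on[OF D0.test_smooth[OF tE]] E0 F]
    by (simp add: mult.commute)
  have sq: "integrable lborel (\<lambda>y. ((cmod (E t y) + cmod (A t y)) * cmod (F y))\<^sup>2)" for t
  proof -
    obtain m1 where m1: "m1 > 0" "\<And>y. norm (E t y) \<le> m1"
      using compact_support_bounded[OF compact_cball[of x0 "R/2"] smooth_on_continuous_on[OF D0.test_smooth[OF tE]] E0] by blast
    obtain m2 where m2: "m2 > 0" "\<And>y. norm (A t y) \<le> m2"
      using compact_support_bounded[OF compact_cball[of x0 "R/2"] smooth_on_continuous_on[OF D0.test_smooth[OF tA]] A0] by blast
    show ?thesis
    proof (rule Bochner_Integration.integrable_bound[of _ "\<lambda>y. (m1 + m2)\<^sup>2 * (cmod (F y))\<^sup>2"])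
      have "((cmod (E t y) + cmod (A t y)) * cmod (F y))\<^sup>2 \<le> ((m1 + m2) * cmod (F y))\<^sup>2" for y
        using m1(2)[of y] m2(2)[of y] by (intro power_mono mult_right_mono add_mono) auto
      then show "AE y in lborel. norm (((cmod (E t y) + cmod (A t y)) * cmod (F y))\<^sup>2) \<le> norm ((m1 + m2)\<^sup>2 * (cmod (F y))\<^sup>2)"
        by (simp add: power_mult_distrib)
    qed (use F2 in auto)
  qed
  have Hi: "integrable lborel (\<lambda>y. (H t y)\<^sup>2)" for t using sq by (simp add: HE)
  have v2i: "integrable lborel (\<lambda>y. (cmod (E t y * F y))\<^sup>2)" for t
  proof (rule Bochner_Integration.integrable_bound[OF sq[of t]])
    have "(cmod (E t y) * cmod (F y))\<^sup>2 \<le> ((cmod (E t y) + cmod (A t y)) * cmod (F y))\<^sup>2" for y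
      by (intro power_mono mult_right_mono) auto
    then show "AE y in lborel. norm ((cmod (E t y * F y))\<^sup>2) \<le> norm (((cmod (E t y) + cmod (A t y)) * cmod (F y))\<^sup>2)"
      by (simp add: norm_mult)
  qed auto
  have tw: "test_on S ?K1 (conv (mollifier e) (\<lambda>y. E t y * F y))" if e: "e > 0" "e \<le> R/2" for t e
    unfolding test_on_def
  proof (intro conjI allI impI)
    show "smooth_on S (conv (mollifier e) (\<lambda>y. E t y * F y))"
      by (rule smooth_on_subset[OF smooth_on_conv[OF compact_cball[of 0 e] mollifier_smooth mollifier_cball[OF e(1)] vi]]) (assumption | rule subset_UNIV)+
    fix x assume x: "x \<notin> ?K1"
    have "mollifier e (x - y) *\<^sub>R (E t y * F y) = 0" for y
    proof (cases "y \<in> ?K0")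
      case True
      then have "e \<le> norm (x - y)" using x e norm_triangle_ineq[of "x - y" "y - x0"] by (auto simp: dist_norm norm_minus_commute)
      then show ?thesis using mollifier_eq_0[OF e(1), of "x - y"] by simp
    qed (simp add: E0)
    then show "conv (mollifier e) (\<lambda>y. E t y * F y) x = 0"
      unfolding conv_def by (simp only: Bochner_Integration.integral_zero)
  qed
  have bound: "ennreal (cmod (dir a (conv (mollifier e) (\<lambda>y. E t y * F y)) x
      - of_real t * dir a ?\<phi> x * conv (mollifier e) (\<lambda>y. E t y * F y) x))
     \<le> (\<integral>\<^sup>+y. ennreal (ball_kernel e (x - y)) * ennreal (C0 * ((1 + t * e) * cmod (E t y * F y) + H t y)) \<partial>lborel)"
    if t: "t \<ge> 0" and e: "e > 0" "e \<le> R/2" and x: "x \<in> ?K1" for t e x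
  proof -
    let ?k = "mollifier e" and ?v = "\<lambda>y. E t y * F y"
    let ?dk = "\<lambda>b y. frechet_derivative (mollifier e) (at (x - y)) b"
    have xS: "x \<in> S" using x B by auto
    \<comment> \<open>The test function of Friedrichs' argument, for the fixed point
      \<open>x\<close> at which the convolution is evaluated.\<close>
    define u where "u y = complex_of_real (?k (x - y)) * E t y" for y
    have sk: "smooth_on UNIV (\<lambda>y. ?k (x - y))"
      by (rule smooth_on_compose[where f="\<lambda>y. x - y" and T=UNIV])
        (auto intro!: smooth_on_diff smooth_on_const smooth_on_ident mollifier_smooth)
    then have skc: "smooth_on S (\<lambda>y. complex_of_real (?k (x - y)))"
      using smooth_on_subset[of UNIV _ S] S by (intro smooth_on_of_real) auto
    have tu: "test_on S ?K0 u" unfolding u_def[abs_def] by (rule D0.test_mult[OF skc tE])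
    then have tu1: "test_on S ?K1 u" using K01 unfolding test_on_def by blast
    have dk: "frechet_derivative (\<lambda>y. complex_of_real (?k (x - y))) (at y) b = - complex_of_real (?dk b y)" for y b
    proof -
      have "((\<lambda>y. ?k (x - y)) has_derivative (\<lambda>v. frechet_derivative ?k (at (x - y)) (- v))) (at y)"
        by (rule has_derivative_compose[where f="\<lambda>y. x - y", OF _ smooth_on_has_derivative[OF mollifier_smooth UNIV_I]])
          (auto intro!: derivative_eq_intros)
      then have "frechet_derivative (\<lambda>y. ?k (x - y)) (at y) b = frechet_derivative ?k (at (x - y)) (- b)"
        using frechet_derivative_at by metis
      also have "\<dots> = - ?dk b y"
        by (rule linear_neg[OF linear_frechet_derivative[OF smooth_on_differentiable[OF mollifier_smooth UNIV_I]]])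
      finally show ?thesis
        using frechet_derivative_linear_compose[OF smooth_on_differentiable[OF sk UNIV_I] bounded_linear_of_real, of y b] by simp
    qed
    let ?X = "\<lambda>y. complex_of_real (?k (x - y)) * (dir a (E t) y + dvg a y * E t y) - E t y * (\<Sum>b\<in>Basis. a b y * complex_of_real (?dk b y))"
    have du: "(\<Sum>b\<in>Basis. frechet_derivative (\<lambda>y. a b y * u y) (at y) b) = ?X y" for y
    proof (cases "y \<in> S")
      case True
      have "frechet_derivative (\<lambda>y. a b y * u y) (at y) b = a b y * frechet_derivative u (at y) b + frechet_derivative (a b) (at y) b * u y"
        if "b \<in> Basis" for b
        using a that True
        by (intro frechet_derivative_mult D0.test_differentiable[OF tu] smooth_on_differentiable) (auto simp: smooth_coeffs_def)
      then have "(\<Sum>b\<in>Basis. frechet_derivative (\<lambda>y. a b y * u y) (at y) b) = dir a u y + dvg a y * u y"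
        by (simp add: dir_def dvg_def sum.distrib sum_distrib_right)
      also have "dir a u y = complex_of_real (?k (x - y)) * dir a (E t) y + E t y * dir a (\<lambda>y. complex_of_real (?k (x - y))) y"
        unfolding u_def[abs_def] by (rule dir_mult[OF smooth_on_differentiable[OF skc True] D0.test_differentiable[OF tE]])
      also have "dir a (\<lambda>y. complex_of_real (?k (x - y))) y = - (\<Sum>b\<in>Basis. a b y * complex_of_real (?dk b y))"
        unfolding dir_def dk by (simp add: sum_negf)
      finally show ?thesis by (simp add: u_def algebra_simps)
    next
      case False
      then have y: "y \<notin> ?K0" using B K01 by auto
      have "frechet_derivative (\<lambda>y. a b y * u y) (at y) b = 0" for b
        by (rule deriv_zero_off[OF closed_cball y]) (use tu in \<open>auto simp: test_on_def\<close>)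
      moreover have "frechet_derivative (E t) (at y) b = 0" for b
        by (rule deriv_zero_off[OF closed_cball y]) (use E0 in auto)
      ultimately show ?thesis using E0[OF y] by (simp add: dir_def)
    qed
    let ?T1 = "\<lambda>b y. a b x * (?dk b y *\<^sub>R ?v y)"
    let ?T2 = "\<lambda>y. of_real t * dir a ?\<phi> x * (?k (x - y) *\<^sub>R ?v y)"
    let ?T3 = "\<lambda>y. G y * u y" and ?T4 = "\<lambda>y. F y * ?X y"
    have kz: "\<And>z. z \<notin> cball 0 e \<Longrightarrow> ?k z = 0" by (rule mollifier_cball[OF e(1)])
    have i1: "integrable lborel (?T1 b)" for b
      by (intro integrable_mult_right conv_integrable[OF compact_cball[of 0 e] smooth_on_continuous_on[OF smooth_on_deriv[OF mollifier_smooth]]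
         deriv_zero_off[OF closed_cball[of 0 e] _ kz] vi])
    have i2: "integrable lborel ?T2"
      by (intro integrable_mult_right conv_integrable[OF compact_cball[of 0 e] smooth_on_continuous_on[OF mollifier_smooth] kz vi])
    have Gi: "integrable lborel G"
      by (rule Bochner_Integration.integrable_bound[of _ "\<lambda>x. \<kappa> *\<^sub>R F x"]) (use F \<kappa> in auto)
    have i3: "integrable lborel ?T3"
      by (rule integrable_mult_test[OF compact_cball[of x0 "R/2"] smooth_on_continuous_on[OF D0.test_smooth[OF tu]] _ Gi])
        (use tu in \<open>auto simp: test_on_def\<close>)
    have tX: "test_on S ?K0 ?X"
    proof -
      have "test_on S ?K0 (\<lambda>y. \<Sum>b\<in>Basis. frechet_derivative (\<lambda>y. a b y * u y) (at y) b)"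
      proof (rule D0.test_sum)
        fix b :: 'a assume b: "b \<in> Basis"
        have "test_on S ?K0 (\<lambda>y. a b y * u y)" using a b by (intro D0.test_mult tu) (auto simp: smooth_coeffs_def)
        then show "test_on S ?K0 (\<lambda>y. frechet_derivative (\<lambda>y. a b y * u y) (at y) b)"
          using deriv_zero_off[OF closed_cball[of x0 "R/2"], of _ "\<lambda>y. a b y * u y"] smooth_on_deriv unfolding test_on_def by blast
      qed
      then show ?thesis by (simp only: du)
    qed
    have i4: "integrable lborel ?T4"
      by (rule integrable_mult_test[OF compact_cball[of x0 "R/2"] smooth_on_continuous_on[OF D0.test_smooth[OF tX]] _ F])
        (use tX in \<open>unfold test_on_def, blast\<close>)
    \<comment> \<open>The weak equation for \<open>u\<close>. Adding this 0 brings in the terms that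
      cancel the singular part of the differentiated convolution.\<close>
    have 34: "(\<integral>y. ?T3 y \<partial>lborel) + (\<integral>y. ?T4 y \<partial>lborel) = 0"
      using weak[OF tu1] by (simp only: du) simp
    have T2: "(\<integral>y. ?T2 y \<partial>lborel) = of_real t * dir a ?\<phi> x * conv ?k ?v x"
      unfolding conv_def by (rule integral_mult_right_zero)
    have "frechet_derivative (conv ?k ?v) (at x) b = (\<integral>y. ?dk b y *\<^sub>R ?v y \<partial>lborel)" for b
      by (rule trans[OF conv_deriv[OF compact_cball[of 0 e] mollifier_smooth kz vi[of t], where x=x and h=b] conv_def])
    then have "dir a (conv ?k ?v) x = (\<Sum>b\<in>Basis. (\<integral>y. ?T1 b y \<partial>lborel))"
      unfolding dir_def by (simp only: integral_mult_right_zero)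
    also have "\<dots> = (\<integral>y. (\<Sum>b\<in>Basis. ?T1 b y) \<partial>lborel)"
      by (rule Bochner_Integration.integral_sum[symmetric]) (rule i1)
    finally have "dir a (conv ?k ?v) x - of_real t * dir a ?\<phi> x * conv ?k ?v x =
      (\<integral>y. (\<Sum>b\<in>Basis. ?T1 b y) \<partial>lborel) - (\<integral>y. ?T2 y \<partial>lborel) + ((\<integral>y. ?T3 y \<partial>lborel) + (\<integral>y. ?T4 y \<partial>lborel))"
      unfolding 34 T2 by (simp only: add_0_right)
    also have "\<dots> = (\<integral>y. (\<Sum>b\<in>Basis. ?T1 b y) - ?T2 y + (?T3 y + ?T4 y) \<partial>lborel)"
      using i1 i2 i3 i4 by simp
    finally have eq: "dir a (conv ?k ?v) x - of_real t * dir a ?\<phi> x * conv ?k ?v x =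
      (\<integral>y. (\<Sum>b\<in>Basis. ?T1 b y) - ?T2 y + (?T3 y + ?T4 y) \<partial>lborel)" .
    have ji: "integrable lborel (\<lambda>y. (\<Sum>b\<in>Basis. ?T1 b y) - ?T2 y + (?T3 y + ?T4 y))"
      using i1 i2 i3 i4 by (intro Bochner_Integration.integrable_add Bochner_Integration.integrable_diff Bochner_Integration.integrable_sum) auto
    have pt: "cmod ((\<Sum>b\<in>Basis. ?T1 b y) - ?T2 y + (?T3 y + ?T4 y)) \<le>
       ball_kernel e (x - y) * (C0 * ((1 + t * e) * cmod (?v y) + H t y))" for y
    proof (cases "y \<in> ?K0 \<and> norm (x - y) < e")
      case True
      then have y0: "y \<in> ?K0" and y1: "y \<in> ?K1" and yS: "y \<in> S" and xy: "norm (x - y) < e" using K01 B by auto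
      let ?N = "ball_kernel e (x - y)"
      have N0: "?N \<ge> 0" using e by (simp add: ball_kernel_def)
      have k0: "?k (x - y) \<ge> 0" using mollifier_nonneg[OF e(1)] .
      have kN: "?k (x - y) \<le> M * ?N" using M(2)[OF e(1)] .
      \<comment> \<open>Once \<open>dir a (E t)\<close> is expanded, the kernel derivative meets
        \<open>a b x - a b y\<close>, and the shift meets the difference of
        \<open>dir a \<phi>\<close> at the two points.\<close>
      have J: "(\<Sum>b\<in>Basis. ?T1 b y) - ?T2 y + (?T3 y + ?T4 y) =
        (\<Sum>b\<in>Basis. (a b x - a b y) * complex_of_real (?dk b y)) * ?v y
        + ?k (x - y) * (G y * E t y + A t y * F y + dvg a y * ?v y + t * (dir a ?\<phi> y - dir a ?\<phi> x) * ?v y)"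
        unfolding dE[OF yS] u_def
        by (simp add: scaleR_conv_of_real sum_subtractf sum_distrib_left sum_distrib_right algebra_simps)
      have "cmod (\<Sum>b\<in>Basis. (a b x - a b y) * complex_of_real (?dk b y)) \<le> (\<Sum>b\<in>Basis. M * ?N * La b)"
      proof (rule sum_norm_le)
        fix b :: 'a assume b: "b \<in> Basis"
        have "cmod (a b x - a b y) \<le> La b * e"
          using La(2)[OF b x y1] mult_left_mono[of "norm (x - y)" e "La b"] La(1)[OF b] xy by linarith
        then have "cmod ((a b x - a b y) * complex_of_real (?dk b y)) \<le> (La b * e) * (M / e * ?N)"
          unfolding norm_mult using M(3)[OF e(1) b, of "x - y"] La(1)[OF b] e(1) by (intro mult_mono) auto
        also have "\<dots> = M * ?N * La b" using e(1) by simp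
        finally show "cmod ((a b x - a b y) * complex_of_real (?dk b y)) \<le> M * ?N * La b" .
      qed
      then have 1: "cmod ((\<Sum>b\<in>Basis. (a b x - a b y) * complex_of_real (?dk b y)) * ?v y) \<le> (M * ?N) * (\<Sum>b\<in>Basis. La b) * cmod (?v y)"
        unfolding norm_mult[of "sum _ _"] by (intro mult_right_mono) (simp_all add: sum_distrib_left)
      have Gy: "cmod (G y * E t y) \<le> \<kappa> * cmod (?v y)"
        using mult_right_mono[OF \<kappa>(2)[of y], of "cmod (E t y)"] by (simp add: norm_mult mult_ac)
      have Dy: "cmod (dvg a y * ?v y) \<le> D * cmod (?v y)"
        unfolding norm_mult[of "dvg a y"] using D(2)[OF y1] by (intro mult_right_mono) auto
      have "cmod (dir a ?\<phi> y - dir a ?\<phi> x) \<le> L * e"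
      proof -
        have "L * norm (y - x) \<le> L * e" using L(1) xy by (intro mult_left_mono) (auto simp: norm_minus_commute)
        then show ?thesis using L(2)[OF y1 x] by linarith
      qed
      then have "cmod (t * (dir a ?\<phi> y - dir a ?\<phi> x)) \<le> t * (L * e)" using t by (simp add: norm_mult mult_left_mono)
      then have Ly: "cmod (t * (dir a ?\<phi> y - dir a ?\<phi> x) * ?v y) \<le> t * (L * e) * cmod (?v y)"
        unfolding norm_mult[of "_ * _" "?v y"] by (rule mult_right_mono) simp
      have Ay: "cmod (A t y * F y) \<le> H t y" unfolding HE norm_mult by (intro mult_right_mono) auto
      have "cmod (G y * E t y + A t y * F y + dvg a y * ?v y + t * (dir a ?\<phi> y - dir a ?\<phi> x) * ?v y) \<le>
         \<kappa> * cmod (?v y) + H t y + D * cmod (?v y) + t * (L * e) * cmod (?v y)"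
        by (intro norm_triangle_mono Gy Ay Dy Ly)
      then have 2: "cmod (?k (x - y) * (G y * E t y + A t y * F y + dvg a y * ?v y + t * (dir a ?\<phi> y - dir a ?\<phi> x) * ?v y)) \<le>
         (M * ?N) * (\<kappa> * cmod (?v y) + H t y + D * cmod (?v y) + t * (L * e) * cmod (?v y))"
        unfolding norm_mult[of "complex_of_real (?k (x - y))"] using k0 kN by (intro mult_mono) auto
      have H0: "H t y \<ge> 0" by (simp add: HE)
      have "cmod ((\<Sum>b\<in>Basis. ?T1 b y) - ?T2 y + (?T3 y + ?T4 y)) \<le>
         (M * ?N) * ((\<Sum>b\<in>Basis. La b) * cmod (?v y) + (\<kappa> * cmod (?v y) + H t y + D * cmod (?v y) + t * (L * e) * cmod (?v y)))"
        unfolding J using norm_triangle_mono[OF 1 2] by (simp add: algebra_simps)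
      also have "\<dots> \<le> (M * ?N) * (((\<Sum>b\<in>Basis. La b) + D + L + \<kappa> + 1) * ((1 + t * e) * cmod (?v y) + H t y))"
      proof (rule mult_left_mono)
        let ?s = "\<Sum>b\<in>Basis. La b" and ?V = "cmod (?v y)"
        have n: "0 \<le> ?s * H t y" "0 \<le> D * H t y" "0 \<le> L * H t y" "0 \<le> \<kappa> * H t y" "0 \<le> L * ?V"
          "0 \<le> (t * e) * (?s * ?V)" "0 \<le> (t * e) * (D * ?V)" "0 \<le> (t * e) * (\<kappa> * ?V)" "0 \<le> (t * e) * ?V" "0 \<le> ?V"
          using Lap D(1) L(1) \<kappa>(1) H0 t e(1) by auto
        show "?s * ?V + (\<kappa> * ?V + H t y + D * ?V + t * (L * e) * ?V) \<le> (?s + D + L + \<kappa> + 1) * ((1 + t * e) * ?V + H t y)"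
          using n by (simp add: algebra_simps)
      qed (use M(1) N0 in auto)
      finally show ?thesis by (simp add: C0_def mult_ac)
    next
      \<comment> \<open>Off the support of the cutoff, or at distance at least \<open>e\<close> from
        \<open>x\<close>, every summand is 0.\<close>
      case False
      have r0: "0 \<le> ball_kernel e (x - y) * (C0 * ((1 + t * e) * cmod (?v y) + H t y))"
        using e t C0p by (intro mult_nonneg_nonneg add_nonneg_nonneg) (auto simp: ball_kernel_def HE)
      have "(\<Sum>b\<in>Basis. ?T1 b y) - ?T2 y + (?T3 y + ?T4 y) = 0"
      proof (cases "y \<in> ?K0")
        case True
        then have xy: "e \<le> norm (x - y)" using False by simp
        have k0: "?k (x - y) = 0" by (rule mollifier_eq_0[OF e(1) xy])
        have kd: "?dk b y = 0" if "b \<in> Basis" for b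
          using M(3)[OF e(1) that, of "x - y"] xy by (simp add: ball_kernel_def)
        have "(\<Sum>b\<in>Basis. ?T1 b y) = 0" using kd by (intro sum.neutral) simp
        moreover have "(\<Sum>b\<in>Basis. a b y * complex_of_real (?dk b y)) = 0" using kd by (intro sum.neutral) simp
        ultimately show ?thesis by (simp add: k0 u_def)
      next
        case y: False
        have "frechet_derivative (E t) (at y) b = 0" for b
          by (rule deriv_zero_off[OF closed_cball y]) (use E0 in auto)
        then have "dir a (E t) y = 0" by (simp add: dir_def)
        then show ?thesis using E0[OF y] by (simp add: u_def)
      qed
      then show ?thesis using r0 by simp
    qed
    have "ennreal (cmod (dir a (conv ?k ?v) x - of_real t * dir a ?\<phi> x * conv ?k ?v x)) \<le>
       (\<integral>\<^sup>+y. ennreal (cmod ((\<Sum>b\<in>Basis. ?T1 b y) - ?T2 y + (?T3 y + ?T4 y))) \<partial>lborel)"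
      unfolding eq by (rule integral_norm_bound_ennreal[OF ji])
    also have "\<dots> \<le> (\<integral>\<^sup>+y. ennreal (ball_kernel e (x - y)) * ennreal (C0 * ((1 + t * e) * cmod (?v y) + H t y)) \<partial>lborel)"
    proof (rule nn_integral_mono)
      fix y
      have "0 \<le> ball_kernel e (x - y)" using e by (simp add: ball_kernel_def)
      then show "ennreal (cmod ((\<Sum>b\<in>Basis. ?T1 b y) - ?T2 y + (?T3 y + ?T4 y))) \<le>
        ennreal (ball_kernel e (x - y)) * ennreal (C0 * ((1 + t * e) * cmod (?v y) + H t y))"
        using ennreal_leI[OF pt[of y]] by (simp only: ennreal_mult')
    qed
    finally show ?thesis .
  qed
  \<comment> \<open>Young's inequality with \<open>ball_kernel\<close> contributes the square of
    this volume. The factor 4 below comes from splitting the squares of two sums.\<close>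
  define V where "V = measure lborel (ball (0::'a) 1)"
  have fin: "(\<integral>x. (cmod (dir a (conv (mollifier e) (\<lambda>y. E t y * F y)) x
          - of_real t * dir a ?\<phi> x * conv (mollifier e) (\<lambda>y. E t y * F y) x))\<^sup>2 \<partial>lborel)
      \<le> V\<^sup>2 * C0\<^sup>2 * 4 * ((1 + t\<^sup>2 * e\<^sup>2) * (\<integral>y. (cmod (E t y * F y))\<^sup>2 \<partial>lborel) + (\<integral>y. (H t y)\<^sup>2 \<partial>lborel))"
    if t: "t \<ge> 0" and e: "e > 0" "e \<le> R/2" for t e
  proof -
    let ?P = "\<lambda>x. dir a (conv (mollifier e) (\<lambda>y. E t y * F y)) x - of_real t * dir a ?\<phi> x * conv (mollifier e) (\<lambda>y. E t y * F y) x"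
    let ?h = "\<lambda>y. C0 * ((1 + t * e) * cmod (E t y * F y) + H t y)"
    let ?c = "(1 + t\<^sup>2 * e\<^sup>2) * (\<integral>y. (cmod (E t y * F y))\<^sup>2 \<partial>lborel) + (\<integral>y. (H t y)\<^sup>2 \<partial>lborel)"
    have tP: "test_on S ?K1 ?P"
      by (intro D1.test_diff D1.test_mult D1.test_dir a tw e smooth_on_mult smooth_on_const S smooth_on_dir s\<phi>)
    have z: "?P x = 0" if "x \<notin> ?K1" for x using tP that by (simp add: test_on_def)
    have "ennreal (cmod (?P x)) \<le> (\<integral>\<^sup>+y. ennreal (ball_kernel e (x - y)) * ennreal (?h y) \<partial>lborel)" for x
      by (cases "x \<in> ?K1") (simp_all add: bound[OF t e] z)
    then have "(\<integral>\<^sup>+x. ennreal ((cmod (?P x))\<^sup>2) \<partial>lborel) \<le> (\<integral>\<^sup>+x. (\<integral>\<^sup>+y. ennreal (ball_kernel e (x - y)) * ennreal (?h y) \<partial>lborel)\<^sup>2 \<partial>lborel)"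
      by (intro nn_integral_mono) (simp add: ennreal_power[symmetric] power_mono)
    also have "\<dots> \<le> (ennreal V)\<^sup>2 * (\<integral>\<^sup>+y. (ennreal (?h y))\<^sup>2 \<partial>lborel)"
      unfolding V_def nn_integral_ball_kernel[OF e(1), symmetric] by (rule nn_conv_L2) simp_all
    also have "(\<integral>\<^sup>+y. (ennreal (?h y))\<^sup>2 \<partial>lborel) \<le> (\<integral>\<^sup>+y. ennreal (C0\<^sup>2 * 4 * ((1 + t\<^sup>2 * e\<^sup>2) * (cmod (E t y * F y))\<^sup>2 + (H t y)\<^sup>2)) \<partial>lborel)"
    proof (rule nn_integral_mono)
      fix y
      have H0: "H t y \<ge> 0" by (simp add: HE)
      then have h0: "?h y \<ge> 0" using C0p t e by simp
      let ?V = "cmod (E t y * F y)"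
      have "(p + q)\<^sup>2 \<le> 2 * p\<^sup>2 + 2 * q\<^sup>2" for p q :: real using sum_squares_bound[of p q] by (simp add: power2_sum)
      from this[of "(1 + t * e) * ?V" "H t y"] this[of 1 "t * e"]
      have "((1 + t * e) * ?V + H t y)\<^sup>2 \<le> 2 * ((2 + 2 * (t * e)\<^sup>2) * ?V\<^sup>2) + 2 * (H t y)\<^sup>2"
        using mult_right_mono[of "(1 + t * e)\<^sup>2" "2 + 2 * (t * e)\<^sup>2" "?V\<^sup>2"] by (simp add: power_mult_distrib)
      also have "\<dots> \<le> 4 * ((1 + t\<^sup>2 * e\<^sup>2) * ?V\<^sup>2 + (H t y)\<^sup>2)" by (simp add: power_mult_distrib algebra_simps)
      finally have "(?h y)\<^sup>2 \<le> C0\<^sup>2 * (4 * ((1 + t\<^sup>2 * e\<^sup>2) * ?V\<^sup>2 + (H t y)\<^sup>2))"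
        unfolding power_mult_distrib[of C0] by (rule mult_left_mono) simp
      then show "(ennreal (?h y))\<^sup>2 \<le> ennreal (C0\<^sup>2 * 4 * ((1 + t\<^sup>2 * e\<^sup>2) * ?V\<^sup>2 + (H t y)\<^sup>2))"
        unfolding ennreal_power[OF h0] by (simp add: ennreal_leI mult.assoc)
    qed
    also have "(\<integral>\<^sup>+y. ennreal (C0\<^sup>2 * 4 * ((1 + t\<^sup>2 * e\<^sup>2) * (cmod (E t y * F y))\<^sup>2 + (H t y)\<^sup>2)) \<partial>lborel) = ennreal (C0\<^sup>2 * 4 * ?c)"
      using v2i[of t] Hi[of t] by (subst nn_integral_eq_integral) auto
    finally have "(\<integral>\<^sup>+x. ennreal ((cmod (?P x))\<^sup>2) \<partial>lborel) \<le> (ennreal V)\<^sup>2 * ennreal (C0\<^sup>2 * 4 * ?c)"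
      by (simp add: mult_left_mono)
    moreover have "(\<integral>\<^sup>+x. ennreal ((cmod (?P x))\<^sup>2) \<partial>lborel) = ennreal (\<integral>x. (cmod (?P x))\<^sup>2 \<partial>lborel)"
    proof (rule nn_integral_eq_integral)
      have "integrable lborel (\<lambda>x. Re (?P x * cnj (?P x)))"
        by (rule integrable_Re[OF D1.test_integrable[OF D1.test_mult[OF D1.test_smooth_on[OF tP] D1.test_cnj[OF tP]]]])
      moreover have "Re (z * cnj z) = (cmod z)\<^sup>2" for z by (simp only: complex_norm_square[symmetric] Re_complex_of_real)
      ultimately show "integrable lborel (\<lambda>x. (cmod (?P x))\<^sup>2)" by (simp only:)
    qed simp
    moreover have c0: "?c \<ge> 0" by simp
    ultimately have "ennreal (\<integral>x. (cmod (?P x))\<^sup>2 \<partial>lborel) \<le> ennreal (V\<^sup>2 * (C0\<^sup>2 * 4 * ?c))"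
      by (simp add: V_def ennreal_power ennreal_mult')
    then show ?thesis using c0 by (simp add: mult.assoc)
  qed
  show thesis by (rule that[OF _ fin vi v2i Hi tw]) auto
qed

section \<open>Local uniqueness across a weight\<close>

text \<open>Carleman estimate and mollification bound together bound
  \<open>(t * c - C) * V t\<close> by a multiple of \<open>V t\<close> plus cutoff errors. These lie
  either where the bump is bounded below, and are absorbed, or where the weight is at most
  -\<delta>, and then decay like exp (-2 t \<delta>). Near \<open>x0\<close> the weight is at least
  -\<delta>/2, so the mass of \<open>F\<close> there must be 0.\<close>

theorem carleman_uniqueness:
  fixes S :: "'a::euclidean_space set" and a :: "nat \<Rightarrow> 'a \<Rightarrow> 'a \<Rightarrow> complex" and \<phi> :: "'a \<Rightarrow> real"
    and F :: "'a \<Rightarrow> complex" and G :: "nat \<Rightarrow> 'a \<Rightarrow> complex"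
  assumes S: "open S" and R0: "R0 > 0" and B: "cball x0 R0 \<subseteq> S"
    and a: "\<And>j. j \<le> r \<Longrightarrow> smooth_coeffs S (a j)" and \<phi>: "smooth_on S \<phi>" and \<phi>0: "\<phi> x0 = 0"
    and bracket: "\<And>w x. smooth_on S w \<Longrightarrow> x \<in> S \<Longrightarrow>
      (\<Sum>j<r. dir (a j) (dir (cnj_coeffs (a j)) w) x - dir (cnj_coeffs (a j)) (dir (a j) w) x) =
      dir (cnj_coeffs (a r)) w x - dir (a r) w x"
    and levi: "Re ((\<Sum>j<r. dir (cnj_coeffs (a j)) (dir (a j) (\<lambda>x. of_real (\<phi> x))) x0
           + dir (a j) (dir (cnj_coeffs (a j)) (\<lambda>x. of_real (\<phi> x))) x0)
       - dir (a r) (\<lambda>x. of_real (\<phi> x)) x0 - dir (cnj_coeffs (a r)) (\<lambda>x. of_real (\<phi> x)) x0) > 0"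
    and F: "integrable lborel F" and F2: "integrable lborel (\<lambda>x. (cmod (F x))\<^sup>2)"
    and G: "\<And>j. j \<le> r \<Longrightarrow> G j \<in> borel_measurable borel"
    and \<kappa>: "\<kappa> \<ge> 0" "\<And>j x. j \<le> r \<Longrightarrow> cmod (G j x) \<le> \<kappa> * cmod (F x)"
    and weak: "\<And>j u. j \<le> r \<Longrightarrow> test_on S (cball x0 R0) u \<Longrightarrow>
      (\<integral>x. G j x * u x \<partial>lborel) = - (\<integral>x. F x * (\<Sum>b\<in>Basis. frechet_derivative (\<lambda>y. a j b y * u y) (at x) b) \<partial>lborel)"
    and \<epsilon>: "\<epsilon> > 0" and neg: "\<And>x. x \<in> cball x0 R0 \<Longrightarrow> F x \<noteq> 0 \<Longrightarrow> \<phi> x \<le> - \<epsilon> * (norm (x - x0))\<^sup>2"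
  shows "\<exists>d>0. AE x in lborel. x \<in> ball x0 d \<longrightarrow> F x = 0"
proof -
  let ?\<phi> = "\<lambda>x. complex_of_real (\<phi> x)"
  have s\<phi>: "smooth_on S ?\<phi>" by (intro smooth_on_of_real S \<phi>)
  interpret C0: carleman_fields S "cball x0 R0" r a ?\<phi>
    by unfold_locales (use S B a s\<phi> bracket in auto)
  have x0S: "x0 \<in> S" using B R0 by auto
  \<comment> \<open>Half the value at the centre, which by continuity leaves a ball on which
    \<open>levi\<close> stays above \<open>c\<close>.\<close>
  define c where "c = Re (C0.levi x0) / 2"
  have c: "c > 0" using levi by (simp add: c_def C0.levi_def)
  have "isCont C0.levi x0"
    using smooth_on_continuous_on[OF C0.smooth_levi] S x0S by (simp add: continuous_on_eq_continuous_at)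
  then have "isCont (\<lambda>x. Re (C0.levi x)) x0" by (rule continuous_Re)
  then have "\<forall>\<^sub>F x in at x0. c < Re (C0.levi x)"
    unfolding isCont_def using order_tendstoD(1)[of _ "Re (C0.levi x0)" "at x0" c] c by (simp add: c_def)
  then obtain R2 where R2: "R2 > 0" "\<And>x. x \<noteq> x0 \<Longrightarrow> dist x x0 < R2 \<Longrightarrow> c < Re (C0.levi x)"
    unfolding eventually_at by blast
  define R where "R = min R0 (R2 / 2)"
  have R: "R > 0" "R \<le> R0" using R0 R2 by (auto simp: R_def)
  have KR: "cball x0 R \<subseteq> cball x0 R0" using R by auto
  have cR: "Re (C0.levi x) \<ge> c" if "x \<in> cball x0 R" for x
    using that R2(2)[of x] R2(1) c by (cases "x = x0") (auto simp: R_def c_def dist_commute)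
  have BR: "cball x0 R \<subseteq> S" using KR B by blast
  interpret C1: carleman_fields S "cball x0 R" r a ?\<phi>
    by unfold_locales (use S BR a s\<phi> bracket in auto)
  obtain C where C: "C \<ge> 0" "\<And>t w. t \<ge> 0 \<Longrightarrow> test_on S (cball x0 R) w \<Longrightarrow>
     (t * c - C) * (\<integral>x. (cmod (w x))\<^sup>2 \<partial>lborel) \<le> (\<Sum>j<Suc r. (\<integral>x. (cmod (C1.weighted t j w x))\<^sup>2 \<partial>lborel))"
    using C1.carleman_estimate[of c] cR by blast
  let ?bmp = "\<lambda>y. bump x0 (R/2) y"
  define v where "v t y = complex_of_real (exp (t * \<phi> y) * ?bmp y) * F y" for t y
  define H where "H j t y = exp (t * \<phi> y) * (?bmp y + cmod (dir (a j) (\<lambda>y. of_real (?bmp y)) y)) * cmod (F y)" for j t y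
  define V where "V t = (\<integral>y. (cmod (v t y))\<^sup>2 \<partial>lborel)" for t
  define HH where "HH j t = (\<integral>y. (H j t y)\<^sup>2 \<partial>lborel)" for j t
  define FF where "FF = (\<integral>y. (cmod (F y))\<^sup>2 \<partial>lborel)"
  have FF0: "FF \<ge> 0" and V0: "V t \<ge> 0" for t by (simp_all add: FF_def V_def)
  have weakR: "(\<integral>x. G j x * u x \<partial>lborel) = - (\<integral>x. F x * (\<Sum>b\<in>Basis. frechet_derivative (\<lambda>y. a j b y * u y) (at x) b) \<partial>lborel)"
    if "j \<le> r" "test_on S (cball x0 R) u" for j u
  proof (rule weak[OF that(1)])
    show "test_on S (cball x0 R0) u" using that(2) KR unfolding test_on_def by blast
  qed
  \<comment> \<open>The conclusions of the mollification bound, packaged so that one constant for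
    each index can be chosen from an existential statement.\<close>
  define bounded_by where "bounded_by j Cj \<longleftrightarrow> Cj \<ge> 0 \<and> (\<forall>t e. t \<ge> 0 \<longrightarrow> e > 0 \<longrightarrow> e \<le> R/2 \<longrightarrow>
      (\<integral>x. (cmod (C1.weighted t j (conv (mollifier e) (v t)) x))\<^sup>2 \<partial>lborel) \<le> Cj * ((1 + t\<^sup>2 * e\<^sup>2) * V t + HH j t))" for j Cj
  define regular where "regular j \<longleftrightarrow> (\<forall>t. integrable lborel (v t)) \<and> (\<forall>t. integrable lborel (\<lambda>y. (cmod (v t y))\<^sup>2))
     \<and> (\<forall>t. integrable lborel (\<lambda>y. (H j t y)\<^sup>2)) \<and> (\<forall>t e. e > 0 \<longrightarrow> e \<le> R/2 \<longrightarrow> test_on S (cball x0 R) (conv (mollifier e) (v t)))" for j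
  have mb: "\<exists>Cj. bounded_by j Cj \<and> regular j" if j: "j \<le> r" for j
    apply (rule weighted_mollification_bound[OF S R(1) BR a[OF j] \<phi> F F2 G[OF j] \<kappa>(1) \<kappa>(2)[OF j] weakR[OF j]])
       apply assumption+
    subgoal premises h for C
      unfolding bounded_by_def regular_def C1.weighted_def C1.shifted_def V_def HH_def v_def[abs_def] H_def
      by (intro exI[of _ C] conjI allI impI h) assumption+
    done
  then have "\<forall>j. \<exists>Cj. j \<le> r \<longrightarrow> bounded_by j Cj" by blast
  from choice[OF this] obtain Cf where Cf': "\<And>j. j \<le> r \<Longrightarrow> bounded_by j (Cf j)" by blast
  have Cf: "Cf j \<ge> 0" "t \<ge> 0 \<Longrightarrow> e > 0 \<Longrightarrow> e \<le> R/2 \<Longrightarrow>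
      (\<integral>x. (cmod (C1.weighted t j (conv (mollifier e) (v t)) x))\<^sup>2 \<partial>lborel) \<le> Cf j * ((1 + t\<^sup>2 * e\<^sup>2) * V t + HH j t)"
    if "j \<le> r" for j t e
    using Cf'[OF that] by (simp_all add: bounded_by_def)
  have reg: "regular j" if "j \<le> r" for j using mb[OF that] by blast
  have vi: "integrable lborel (v t)" and v2i: "integrable lborel (\<lambda>y. (cmod (v t y))\<^sup>2)"
    and tw: "e > 0 \<Longrightarrow> e \<le> R/2 \<Longrightarrow> test_on S (cball x0 R) (conv (mollifier e) (v t))" for t e
    using reg[of 0] by (simp_all add: regular_def)
  have Hi: "integrable lborel (\<lambda>y. (H j t y)\<^sup>2)" if "j \<le> r" for j t
    using reg[OF that] by (simp add: regular_def)
  \<comment> \<open>Here \<open>e\<close> tends to 0 with \<open>t\<close> fixed, so the factor 1 +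
    t^2 e^2 becomes 1; lower semicontinuity passes the bound to \<open>v t\<close> itself.\<close>
  have main1: "(t * c - C) * V t \<le> (\<Sum>j<Suc r. Cf j * (V t + HH j t))" if t: "t \<ge> 0" and tc: "t * c - C > 0" for t
  proof -
    define e where "e n = R / 2 * inverse (real (Suc n))" for n
    have e: "e n > 0" "e n \<le> R / 2" for n
      using R(1) by (auto simp: e_def field_simps)
    have e0: "e \<longlonglongrightarrow> 0"
      unfolding e_def[abs_def] using tendsto_mult_right_zero[OF LIMSEQ_inverse_real_of_nat] by blast
    define b where "b n = (\<Sum>j<Suc r. Cf j * ((1 + t\<^sup>2 * (e n)\<^sup>2) * V t + HH j t)) / (t * c - C)" for n
    have bl: "b \<longlonglongrightarrow> (\<Sum>j<Suc r. Cf j * ((1 + t\<^sup>2 * 0\<^sup>2) * V t + HH j t)) / (t * c - C)"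
      unfolding b_def by (intro tendsto_intros e0) (use tc in auto)
    have le: "(\<integral>\<^sup>+x. ennreal ((norm (conv (mollifier (e n)) (v t) x))\<^sup>2) \<partial>lborel) \<le> ennreal (b n)" for n
    proof -
      note tn = tw[OF e(1)[of n] e(2)[of n], of t]
      have "(t * c - C) * (\<integral>x. (cmod (conv (mollifier (e n)) (v t) x))\<^sup>2 \<partial>lborel) \<le>
        (\<Sum>j<Suc r. (\<integral>x. (cmod (C1.weighted t j (conv (mollifier (e n)) (v t)) x))\<^sup>2 \<partial>lborel))"
        by (rule C(2)[OF t tn])
      also have "\<dots> \<le> (\<Sum>j<Suc r. Cf j * ((1 + t\<^sup>2 * (e n)\<^sup>2) * V t + HH j t))"
        by (intro sum_mono Cf(2) t e) auto
      finally have "(\<integral>x. (cmod (conv (mollifier (e n)) (v t) x))\<^sup>2 \<partial>lborel) \<le> b n"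
        unfolding b_def using tc by (simp add: pos_le_divide_eq mult.commute)
      then show ?thesis
        by (subst nn_integral_eq_integral[OF C1.test_norm_sq[OF tn]]) (auto intro: ennreal_leI)
    qed
    have "(\<integral>\<^sup>+x. ennreal ((norm (v t x))\<^sup>2) \<partial>lborel) \<le> ennreal ((\<Sum>j<Suc r. Cf j * ((1 + t\<^sup>2 * 0\<^sup>2) * V t + HH j t)) / (t * c - C))"
      by (rule mollifier_lower_semicontinuous[OF e(1) e0 vi _ tendsto_ennrealI[OF bl]])
        (use le in \<open>auto intro: always_eventually\<close>)
    then have "ennreal (V t) \<le> ennreal ((\<Sum>j<Suc r. Cf j * (V t + HH j t)) / (t * c - C))"
      using nn_integral_eq_integral[OF v2i[of t]] by (simp add: V_def)
    moreover have "0 \<le> (\<Sum>j<Suc r. Cf j * (V t + HH j t)) / (t * c - C)"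
      using tc Cf(1) by (intro divide_nonneg_pos sum_nonneg mult_nonneg_nonneg) (auto simp: HH_def V_def)
    ultimately have "V t \<le> (\<Sum>j<Suc r. Cf j * (V t + HH j t)) / (t * c - C)" by (simp add: ennreal_le_iff)
    then show ?thesis using tc by (simp add: pos_le_divide_eq mult.commute)
  qed
  have "continuous_on (cball x0 (R/4)) ?bmp"
    using smooth_on_continuous_on[OF smooth_on_bump[OF open_UNIV]] by (rule continuous_on_subset) simp
  then obtain y0 where y0: "y0 \<in> cball x0 (R/4)" "\<And>y. y \<in> cball x0 (R/4) \<Longrightarrow> ?bmp y0 \<le> ?bmp y"
    using continuous_attains_inf[of "cball x0 (R/4)" ?bmp] R(1) by (auto simp: not_le)
  \<comment> \<open>On the ball of radius R/4 the bump is at least \<open>m\<close>, so there any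
    bounded function, such as the derivative of the bump, is at most a multiple of the bump.\<close>
  define m where "m = ?bmp y0"
  have m: "m > 0" using y0(1) R(1) unfolding m_def by (subst bump_pos_iff) (auto simp: dist_norm norm_minus_commute)
  \<comment> \<open>By \<open>neg\<close>, \<phi> is at most -\<delta> at points of the large ball
    that are outside radius R/4 and at which \<open>F\<close> does not vanish.\<close>
  define \<delta> where "\<delta> = \<epsilon> * (R/4)\<^sup>2"
  have \<delta>: "\<delta> > 0" using \<epsilon> R by (simp add: \<delta>_def)
  have tbmp: "test_on S (cball x0 R) (\<lambda>y. complex_of_real (?bmp y))"
    unfolding test_on_def by (auto intro!: smooth_on_of_real smooth_on_bump S bump_eq_0 simp: dist_norm norm_minus_commute) (use R in auto)
  have bmp0: "?bmp y = 0" "dir (a j) (\<lambda>y. complex_of_real (?bmp y)) y = 0" if y: "y \<notin> cball x0 (R/2)" for y j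
  proof -
    have z: "?bmp y = 0" if "y \<notin> cball x0 (R/2)" for y
      using that R(1) by (intro bump_eq_0) (auto simp: dist_norm norm_minus_commute)
    then show "?bmp y = 0" using y by blast
    have "frechet_derivative (\<lambda>y. complex_of_real (?bmp y)) (at y) b = 0" for b
      by (rule deriv_zero_off[OF closed_cball y]) (use z in auto)
    then show "dir (a j) (\<lambda>y. complex_of_real (?bmp y)) y = 0" by (simp add: dir_def)
  qed
  have main2: "\<exists>D\<ge>0. \<forall>t\<ge>0. HH j t \<le> D * (V t + (exp (- (t * \<delta>)))\<^sup>2 * FF)" if j: "j \<le> r" for j
  proof -
    note td = C1.test_dir[OF a[OF j] tbmp]
    have "\<And>x. x \<notin> cball x0 R \<Longrightarrow> dir (a j) (\<lambda>y. complex_of_real (?bmp y)) x = 0" using td by (simp add: test_on_def)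
    from compact_support_bounded[OF compact_cball[of x0 R] smooth_on_continuous_on[OF C1.test_smooth[OF td]] this]
    obtain N where N: "N > 0" "\<And>y. cmod (dir (a j) (\<lambda>y. complex_of_real (?bmp y)) y) \<le> N" by blast
    \<comment> \<open>The first square serves the ball of radius R/4, the second the annulus where
      the weight is at most -\<delta>.\<close>
    let ?D = "(1 + N / m)\<^sup>2 + (1 + N)\<^sup>2"
    have "HH j t \<le> ?D * (V t + (exp (- (t * \<delta>)))\<^sup>2 * FF)" if t: "t \<ge> 0" for t
    proof -
      have "(H j t y)\<^sup>2 \<le> ?D * ((cmod (v t y))\<^sup>2 + (exp (- (t * \<delta>)))\<^sup>2 * (cmod (F y))\<^sup>2)" for y
      proof -
        have cv: "cmod (v t y) = exp (t * \<phi> y) * ?bmp y * cmod (F y)"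
          by (simp add: v_def norm_mult bump_nonneg)
        have H0: "H j t y \<ge> 0" by (simp add: H_def bump_nonneg)
        consider "y \<in> cball x0 (R/4)" | "F y = 0 \<or> y \<notin> cball x0 (R/2)" | "F y \<noteq> 0" "y \<in> cball x0 (R/2)" "y \<notin> cball x0 (R/4)"
          by blast
        then show ?thesis
        proof cases
          case 1
          have "N \<le> N / m * ?bmp y" using y0(2)[OF 1] N(1) m by (simp add: m_def field_simps)
          then have "?bmp y + cmod (dir (a j) (\<lambda>y. complex_of_real (?bmp y)) y) \<le> (1 + N / m) * ?bmp y"
            using N(2)[of y] by (simp add: algebra_simps)
          then have "H j t y \<le> exp (t * \<phi> y) * ((1 + N / m) * ?bmp y) * cmod (F y)"
            unfolding H_def by (intro mult_right_mono mult_left_mono) auto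
          then have h: "H j t y \<le> (1 + N / m) * cmod (v t y)" by (simp add: cv mult_ac)
          have "(H j t y)\<^sup>2 \<le> (1 + N / m)\<^sup>2 * (cmod (v t y))\<^sup>2"
            using power_mono[OF h H0, of 2] by (simp only: power_mult_distrib)
          also have "\<dots> \<le> ?D * ((cmod (v t y))\<^sup>2 + (exp (- (t * \<delta>)))\<^sup>2 * (cmod (F y))\<^sup>2)"
            by (intro mult_mono) auto
          finally show ?thesis .
        next
          case 2
          then have "H j t y = 0" using bmp0 by (auto simp: H_def)
          then show ?thesis by simp
        next
          case 3
          have "y \<in> cball x0 R0" using 3(2) R by simp
          then have "\<phi> y \<le> - \<epsilon> * (norm (y - x0))\<^sup>2" using neg 3(1) by blast
          moreover have "(R/4)\<^sup>2 \<le> (norm (y - x0))\<^sup>2"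
            using 3(3) R(1) by (intro power_mono) (auto simp: dist_norm norm_minus_commute)
          then have "\<epsilon> * (R/4)\<^sup>2 \<le> \<epsilon> * (norm (y - x0))\<^sup>2" using \<epsilon> by (intro mult_left_mono) auto
          ultimately have "\<phi> y \<le> - \<delta>" by (simp add: \<delta>_def)
          then have "t * \<phi> y \<le> - (t * \<delta>)" using t mult_left_mono[of "\<phi> y" "- \<delta>" t] by simp
          then have "H j t y \<le> exp (- (t * \<delta>)) * (1 + N) * cmod (F y)"
            unfolding H_def using N(2)[of y] bump_le_1[of x0 "R/2" y] N(1)
            by (intro mult_right_mono mult_mono) (auto intro: add_mono simp: bump_nonneg)
          then have "(H j t y)\<^sup>2 \<le> (exp (- (t * \<delta>)) * (1 + N) * cmod (F y))\<^sup>2" using H0 by (rule power_mono)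
          also have "\<dots> = (1 + N)\<^sup>2 * ((exp (- (t * \<delta>)))\<^sup>2 * (cmod (F y))\<^sup>2)" by (simp only: power_mult_distrib mult_ac)
          also have "\<dots> \<le> ?D * ((cmod (v t y))\<^sup>2 + (exp (- (t * \<delta>)))\<^sup>2 * (cmod (F y))\<^sup>2)"
            by (intro mult_mono) auto
          finally show ?thesis .
        qed
      qed
      then have "HH j t \<le> (\<integral>y. ?D * ((cmod (v t y))\<^sup>2 + (exp (- (t * \<delta>)))\<^sup>2 * (cmod (F y))\<^sup>2) \<partial>lborel)"
        unfolding HH_def using Hi[OF j, of t] v2i[of t] F2
        by (intro Bochner_Integration.integral_mono) auto
      also have "\<dots> = ?D * (V t + (exp (- (t * \<delta>)))\<^sup>2 * FF)"
        using v2i[of t] F2 by (simp add: V_def FF_def)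
      finally show ?thesis .
    qed
    then show ?thesis by (intro exI[of _ ?D]) simp
  qed
  then have "\<forall>j. \<exists>D. j \<le> r \<longrightarrow> D \<ge> 0 \<and> (\<forall>t\<ge>0. HH j t \<le> D * (V t + (exp (- (t * \<delta>)))\<^sup>2 * FF))" by blast
  from choice[OF this] obtain D where D: "\<And>j. j \<le> r \<Longrightarrow> D j \<ge> 0"
    "\<And>j t. j \<le> r \<Longrightarrow> t \<ge> 0 \<Longrightarrow> HH j t \<le> D j * (V t + (exp (- (t * \<delta>)))\<^sup>2 * FF)" by blast
  define X where "X = (\<Sum>j<Suc r. Cf j * (1 + D j))"
  define Y where "Y = (\<Sum>j<Suc r. Cf j * D j)"
  have XY: "X \<ge> 0" "Y \<ge> 0" unfolding X_def Y_def
    by (intro sum_nonneg mult_nonneg_nonneg add_nonneg_nonneg; use Cf(1) D(1) in force)+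
  \<comment> \<open>Beyond \<open>T\<close> the factor t c - C is at least X + Y + 1: the part X
    absorbs the terms in \<open>V t\<close> on the right, and Y + 1 remains against Y on the error
    term.\<close>
  define T where "T = (C + X + Y + 1) / c"
  have T: "T \<ge> 0" using C(1) XY c by (simp add: T_def)
  have main3: "V t \<le> (exp (- (t * \<delta>)))\<^sup>2 * FF" if t: "t \<ge> T" for t
  proof -
    let ?q = "(exp (- (t * \<delta>)))\<^sup>2 * FF"
    have q: "?q \<ge> 0" using FF0 by simp
    have t0: "t \<ge> 0" using t T by linarith
    have tc: "t * c - C \<ge> X + Y + 1" using t c by (simp add: T_def pos_divide_le_eq)
    have "(t * c - C) * V t \<le> (\<Sum>j<Suc r. Cf j * (V t + HH j t))" using main1[OF t0] tc XY by simp
    also have "\<dots> \<le> (\<Sum>j<Suc r. Cf j * (V t + D j * (V t + ?q)))"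
      using Cf(1) D(2)[OF _ t0] by (intro sum_mono mult_left_mono add_left_mono) auto
    also have "\<dots> = X * V t + Y * ?q"
      unfolding X_def Y_def sum_distrib_right sum.distrib[symmetric] by (intro sum.cong) (auto simp: algebra_simps)
    finally have 1: "(t * c - C) * V t \<le> X * V t + Y * ?q" .
    have "(X + Y + 1) * V t \<le> (t * c - C) * V t" using tc V0 by (intro mult_right_mono) auto
    with 1 have "(Y + 1) * V t \<le> (Y + 1) * ?q" using q by (simp add: algebra_simps)
    then show ?thesis using XY(2) by (simp add: mult_le_cancel_left_pos)
  qed
  have "isCont \<phi> x0"
    using smooth_on_continuous_on[OF \<phi>] S x0S by (simp add: continuous_on_eq_continuous_at)
  then have "\<forall>\<^sub>F x in at x0. - (\<delta> / 2) < \<phi> x"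
    unfolding isCont_def using order_tendstoD(1)[of \<phi> "\<phi> x0" "at x0" "- (\<delta> / 2)"] \<delta> \<phi>0 by simp
  then obtain d0 where d0: "d0 > 0" "\<And>x. x \<noteq> x0 \<Longrightarrow> dist x x0 < d0 \<Longrightarrow> - (\<delta> / 2) < \<phi> x"
    unfolding eventually_at by blast
  \<comment> \<open>Small enough for the weight to be at least -\<delta>/2 and for the bump to be at
    least \<open>m\<close>.\<close>
  define d where "d = min d0 (R/4)"
  have d: "d > 0" "d \<le> R/4" using d0 R by (auto simp: d_def)
  have \<phi>d: "- (\<delta> / 2) \<le> \<phi> x" if "x \<in> ball x0 d" for x
    using that d0(2)[of x] \<delta> \<phi>0 by (cases "x = x0") (auto simp: d_def dist_commute less_imp_le)
  let ?f = "\<lambda>y. indicator (ball x0 d) y * (cmod (F y))\<^sup>2"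
  have fi: "integrable lborel ?f"
    by (rule Bochner_Integration.integrable_bound[OF F2]) (use F in \<open>auto simp: indicator_def\<close>)
  \<comment> \<open>The left side of \<open>main3\<close> is at least exp (-t \<delta>) times the
    local mass, its right side is of order exp (-2 t \<delta>); after division one decaying factor
    remains.\<close>
  have le: "m\<^sup>2 * (\<integral>y. ?f y \<partial>lborel) \<le> exp (- (t * \<delta>)) * FF" if t: "t \<ge> T" for t
  proof -
    have t0: "t \<ge> 0" using t T by linarith
    have "exp (- (t * \<delta>)) * m\<^sup>2 * ?f y \<le> (cmod (v t y))\<^sup>2" for y
    proof (cases "y \<in> ball x0 d")
      case True
      have cv: "cmod (v t y) = exp (t * \<phi> y) * ?bmp y * cmod (F y)"
        by (simp add: v_def norm_mult bump_nonneg)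
      have "- (t * \<delta> / 2) \<le> t * \<phi> y" using \<phi>d[OF True] t0 mult_left_mono[of "- (\<delta> / 2)" "\<phi> y" t] by simp
      moreover have "m \<le> ?bmp y" unfolding m_def using True d by (intro y0(2)) auto
      ultimately have "exp (- (t * \<delta> / 2)) * m * cmod (F y) \<le> exp (t * \<phi> y) * ?bmp y * cmod (F y)"
        using m by (intro mult_right_mono mult_mono) auto
      then have "(exp (- (t * \<delta> / 2)) * m * cmod (F y))\<^sup>2 \<le> (cmod (v t y))\<^sup>2"
        unfolding cv using m by (intro power_mono) auto
      moreover have "(exp (- (t * \<delta> / 2)))\<^sup>2 = exp (- (t * \<delta>))"
        by (simp add: power2_eq_square exp_add[symmetric])
      ultimately show ?thesis using True by (simp add: power_mult_distrib)
    qed simp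
    then have "(\<integral>y. exp (- (t * \<delta>)) * m\<^sup>2 * ?f y \<partial>lborel) \<le> V t"
      unfolding V_def using fi v2i[of t] by (intro Bochner_Integration.integral_mono) auto
    then have A: "exp (- (t * \<delta>)) * (m\<^sup>2 * (\<integral>y. ?f y \<partial>lborel)) \<le> V t"
      by (simp only: integral_mult_right_zero mult.assoc)
    have "(exp (- (t * \<delta>)))\<^sup>2 * FF = exp (- (t * \<delta>)) * (exp (- (t * \<delta>)) * FF)"
      by (simp only: power2_eq_square mult.assoc)
    with A main3[OF t]
    have "exp (- (t * \<delta>)) * (m\<^sup>2 * (\<integral>y. ?f y \<partial>lborel)) \<le> exp (- (t * \<delta>)) * (exp (- (t * \<delta>)) * FF)"
      by linarith
    then show ?thesis by (rule mult_left_le_imp_le) simp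
  qed
  have "((\<lambda>t. exp (- (t * \<delta>)) * FF) \<longlongrightarrow> 0 * FF) at_top"
  proof (intro tendsto_mult tendsto_const)
    have "filterlim (\<lambda>t. \<delta> * t) at_top at_top"
      by (rule filterlim_tendsto_pos_mult_at_top[OF tendsto_const \<delta> filterlim_ident])
    then have "filterlim (\<lambda>t. t * \<delta>) at_top at_top" by (simp only: mult.commute)
    then have "filterlim (\<lambda>t. - (t * \<delta>)) at_bot at_top" by (rule filterlim_uminus_at_top[THEN iffD1])
    then show "((\<lambda>t. exp (- (t * \<delta>))) \<longlongrightarrow> 0) at_top" by (rule filterlim_compose[OF exp_at_bot])
  qed
  then have "m\<^sup>2 * (\<integral>y. ?f y \<partial>lborel) \<le> 0 * FF"
    by (rule tendsto_lowerbound) (use le in \<open>auto simp: eventually_at_top_linorder\<close>)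
  then have "(\<integral>y. ?f y \<partial>lborel) \<le> 0" using m by (simp add: mult_le_0_iff)
  moreover have "(\<integral>y. ?f y \<partial>lborel) \<ge> 0" by simp
  ultimately have "(\<integral>y. ?f y \<partial>lborel) = 0" by linarith
  then have "AE y in lborel. ?f y = 0" using integral_nonneg_eq_0_iff_AE[OF fi] by simp
  then have "AE y in lborel. y \<in> ball x0 d \<longrightarrow> F y = 0" by eventually_elim auto
  then show ?thesis using d(1) by blast
qed

section \<open>Symmetry of second derivatives\<close>

text \<open>The mean value theorem is applied twice: along \<open>b\<close> to the difference in
  direction \<open>c\<close>, then along \<open>c\<close> to the derivative in direction
  \<open>b\<close>. It is the reason for treating real values separately.\<close>

lemma second_difference:
  fixes g :: "'a::real_normed_vector \<Rightarrow> real"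
  assumes d: "d > 0" and g: "smooth_on S g"
    and sub: "\<And>s k. 0 \<le> s \<Longrightarrow> s \<le> d \<Longrightarrow> 0 \<le> k \<Longrightarrow> k \<le> d \<Longrightarrow> x + s *\<^sub>R b + k *\<^sub>R c \<in> S"
  obtains s k where "0 < s" "s < d" "0 < k" "k < d"
    "g (x + d *\<^sub>R b + d *\<^sub>R c) - g (x + d *\<^sub>R b) - (g (x + d *\<^sub>R c) - g x)
      = d * d * frechet_derivative (\<lambda>y. frechet_derivative g (at y) b) (at (x + s *\<^sub>R b + k *\<^sub>R c)) c"
proof -
  let ?gb = "\<lambda>y. frechet_derivative g (at y) b"
  have D1: "((\<lambda>s. g (x + s *\<^sub>R b + k *\<^sub>R c)) has_real_derivative ?gb (x + s *\<^sub>R b + k *\<^sub>R c)) (at s)"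
    if "0 \<le> s" "s \<le> d" "0 \<le> k" "k \<le> d" for s k
  proof -
    have g': "(g has_derivative frechet_derivative g (at (x + s *\<^sub>R b + k *\<^sub>R c))) (at (x + s *\<^sub>R b + k *\<^sub>R c))"
      using smooth_on_has_derivative[OF g] sub that by blast
    have "((\<lambda>s. g (x + s *\<^sub>R b + k *\<^sub>R c)) has_derivative (\<lambda>h. frechet_derivative g (at (x + s *\<^sub>R b + k *\<^sub>R c)) (h *\<^sub>R b))) (at s)"
      by (rule has_derivative_compose[where f="\<lambda>s. x + s *\<^sub>R b + k *\<^sub>R c", OF _ g']) (auto intro!: derivative_eq_intros)
    then show ?thesis
      using linear_cmul[OF has_derivative_linear[OF g']] by (simp add: has_field_derivative_def mult_commute_abs)
  qed
  have D2: "((\<lambda>k. ?gb (x + s *\<^sub>R b + k *\<^sub>R c)) has_real_derivative frechet_derivative ?gb (at (x + s *\<^sub>R b + k *\<^sub>R c)) c) (at k)"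
    if "0 \<le> s" "s \<le> d" "0 \<le> k" "k \<le> d" for s k
  proof -
    have g': "(?gb has_derivative frechet_derivative ?gb (at (x + s *\<^sub>R b + k *\<^sub>R c))) (at (x + s *\<^sub>R b + k *\<^sub>R c))"
      using smooth_on_has_derivative[OF smooth_on_deriv[OF g]] sub that by blast
    have "((\<lambda>k. ?gb (x + s *\<^sub>R b + k *\<^sub>R c)) has_derivative (\<lambda>h. frechet_derivative ?gb (at (x + s *\<^sub>R b + k *\<^sub>R c)) (h *\<^sub>R c))) (at k)"
      by (rule has_derivative_compose[where f="\<lambda>k. x + s *\<^sub>R b + k *\<^sub>R c", OF _ g']) (auto intro!: derivative_eq_intros)
    then show ?thesis
      using linear_cmul[OF has_derivative_linear[OF g']] by (simp add: has_field_derivative_def mult_commute_abs)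
  qed
  define \<phi> where "\<phi> s = g (x + s *\<^sub>R b + d *\<^sub>R c) - g (x + s *\<^sub>R b + 0 *\<^sub>R c)" for s
  have "DERIV \<phi> s :> ?gb (x + s *\<^sub>R b + d *\<^sub>R c) - ?gb (x + s *\<^sub>R b + 0 *\<^sub>R c)" if "0 \<le> s" "s \<le> d" for s
    unfolding \<phi>_def[abs_def] by (intro DERIV_diff D1 that) (use d in auto)
  from MVT2[OF d this] obtain s where s: "0 < s" "s < d"
    "\<phi> d - \<phi> 0 = d * (?gb (x + s *\<^sub>R b + d *\<^sub>R c) - ?gb (x + s *\<^sub>R b + 0 *\<^sub>R c))" by (metis diff_zero)
  have "DERIV (\<lambda>k. ?gb (x + s *\<^sub>R b + k *\<^sub>R c)) k :> frechet_derivative ?gb (at (x + s *\<^sub>R b + k *\<^sub>R c)) c"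
    if "0 \<le> k" "k \<le> d" for k
    using D2[of s k] s that by simp
  from MVT2[OF d this] obtain k where k: "0 < k" "k < d"
    "?gb (x + s *\<^sub>R b + d *\<^sub>R c) - ?gb (x + s *\<^sub>R b + 0 *\<^sub>R c) = d * frechet_derivative ?gb (at (x + s *\<^sub>R b + k *\<^sub>R c)) c"
    by (metis diff_zero)
  have "\<phi> d - \<phi> 0 = d * d * frechet_derivative ?gb (at (x + s *\<^sub>R b + k *\<^sub>R c)) c"
    unfolding s(3) k(3) by simp
  then show thesis using that[OF s(1,2) k(1,2)] by (simp add: \<phi>_def)
qed

text \<open>The second difference is symmetric in the two directions, so the two mixed derivatives
  take a common value at two points near \<open>x\<close>; continuity brings both points to
  \<open>x\<close> as the steps shrink.\<close>

lemma second_derivative_symmetric_real: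
  fixes g :: "'a::real_normed_vector \<Rightarrow> real"
  assumes S: "open S" and x: "x \<in> S" and g: "smooth_on S g"
  shows "frechet_derivative (\<lambda>y. frechet_derivative g (at y) b) (at x) c = frechet_derivative (\<lambda>y. frechet_derivative g (at y) c) (at x) b"
proof -
  let ?bc = "\<lambda>y. frechet_derivative (\<lambda>y. frechet_derivative g (at y) b) (at y) c"
  let ?cb = "\<lambda>y. frechet_derivative (\<lambda>y. frechet_derivative g (at y) c) (at y) b"
  obtain e where e: "e > 0" "ball x e \<subseteq> S" using S x open_contains_ball by blast
  \<comment> \<open>Steps tending to 0, scaled so that the parallelogram with sides d n b and d n c
    stays inside the ball of radius e.\<close>
  define d where "d n = e / 2 / (norm b + norm c + 1) * inverse (real (Suc n))" for n
  have nb: "norm b + norm c + 1 > 0" by (simp add: add_nonneg_pos)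
  have d: "d n > 0" for n using e(1) nb by (simp add: d_def)
  have d0: "d \<longlonglongrightarrow> 0"
    unfolding d_def[abs_def] using tendsto_mult_right_zero[OF LIMSEQ_inverse_real_of_nat] by blast
  have dle: "d n * (norm b + norm c) < e" for n
  proof -
    have "d n \<le> e / 2 / (norm b + norm c + 1)"
      unfolding d_def using e(1) nb by (intro mult_right_le_one_le) (auto simp: field_simps)
    then have "d n * (norm b + norm c + 1) \<le> e / 2" by (rule pos_le_divide_eq[OF nb, THEN iffD1])
    then show ?thesis using d[of n] e(1) by (simp add: algebra_simps)
  qed
  have near: "norm (s *\<^sub>R b + k *\<^sub>R c) \<le> d n * (norm b + norm c)" if "0 \<le> s" "s \<le> d n" "0 \<le> k" "k \<le> d n" for s k n
  proof -
    have "norm (s *\<^sub>R b + k *\<^sub>R c) \<le> s * norm b + k * norm c"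
      using norm_triangle_ineq[of "s *\<^sub>R b" "k *\<^sub>R c"] that by simp
    also have "\<dots> \<le> d n * norm b + d n * norm c" using that by (intro add_mono mult_right_mono) auto
    finally show ?thesis by (simp add: algebra_simps)
  qed
  have inS: "x + s *\<^sub>R b + k *\<^sub>R c \<in> S" if "0 \<le> s" "s \<le> d n" "0 \<le> k" "k \<le> d n" for s k n
  proof -
    have "dist x (x + (s *\<^sub>R b + k *\<^sub>R c)) = norm (s *\<^sub>R b + k *\<^sub>R c)"
      unfolding dist_norm by (metis add_diff_cancel_left' norm_minus_commute)
    then have "x + (s *\<^sub>R b + k *\<^sub>R c) \<in> ball x e" using near[OF that] dle[of n] unfolding mem_ball by linarith
    then show ?thesis using e(2) by (auto simp: add.assoc)
  qed
  have "\<forall>n. \<exists>p q. norm (p - x) \<le> d n * (norm b + norm c) \<and> norm (q - x) \<le> d n * (norm b + norm c) \<and> ?bc p = ?cb q"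
  proof
    fix n
    obtain s k where 1: "0 < s" "s < d n" "0 < k" "k < d n"
      "g (x + d n *\<^sub>R b + d n *\<^sub>R c) - g (x + d n *\<^sub>R b) - (g (x + d n *\<^sub>R c) - g x) = d n * d n * ?bc (x + s *\<^sub>R b + k *\<^sub>R c)"
      using second_difference[OF d g, of n x b c] inS by blast
    have "x + s *\<^sub>R c + k *\<^sub>R b \<in> S" if "0 \<le> s" "s \<le> d n" "0 \<le> k" "k \<le> d n" for s k
      using inS[of k n s] that by (simp add: add.assoc add.commute[of "s *\<^sub>R c"])
    then obtain s' k' where 2: "0 < s'" "s' < d n" "0 < k'" "k' < d n"
      "g (x + d n *\<^sub>R c + d n *\<^sub>R b) - g (x + d n *\<^sub>R c) - (g (x + d n *\<^sub>R b) - g x) = d n * d n * ?cb (x + s' *\<^sub>R c + k' *\<^sub>R b)"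
      using second_difference[OF d g, of n x c b] by blast
    have "g (x + d n *\<^sub>R b + d n *\<^sub>R c) - g (x + d n *\<^sub>R b) - (g (x + d n *\<^sub>R c) - g x) =
      g (x + d n *\<^sub>R c + d n *\<^sub>R b) - g (x + d n *\<^sub>R c) - (g (x + d n *\<^sub>R b) - g x)"
      by (simp add: add.assoc add.commute[of "d n *\<^sub>R b"])
    then have "?bc (x + s *\<^sub>R b + k *\<^sub>R c) = ?cb (x + s' *\<^sub>R c + k' *\<^sub>R b)"
      using 1(5) 2(5) d[of n] by simp
    moreover have "norm (x + s *\<^sub>R b + k *\<^sub>R c - x) \<le> d n * (norm b + norm c)"
      using near[of s n k] 1 by (simp add: add.assoc)
    moreover have "norm (x + s' *\<^sub>R c + k' *\<^sub>R b - x) \<le> d n * (norm b + norm c)"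
      using near[of k' n s'] 2 by (simp add: add.assoc add.commute)
    ultimately show "\<exists>p q. norm (p - x) \<le> d n * (norm b + norm c) \<and> norm (q - x) \<le> d n * (norm b + norm c) \<and> ?bc p = ?cb q"
      by blast
  qed
  from choice[OF this] obtain p where "\<forall>n. \<exists>q. norm (p n - x) \<le> d n * (norm b + norm c) \<and> norm (q - x) \<le> d n * (norm b + norm c) \<and> ?bc (p n) = ?cb q"
    by blast
  from choice[OF this] obtain q where pq: "\<And>n. norm (p n - x) \<le> d n * (norm b + norm c)" "\<And>n. norm (q n - x) \<le> d n * (norm b + norm c)"
    "\<And>n. ?bc (p n) = ?cb (q n)" by blast
  have l0: "(\<lambda>n. d n * (norm b + norm c)) \<longlonglongrightarrow> 0" using tendsto_mult_left_zero[OF d0] .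
  have "(\<lambda>n. p n - x) \<longlonglongrightarrow> 0" "(\<lambda>n. q n - x) \<longlonglongrightarrow> 0"
    by (rule Lim_null_comparison[OF _ l0]; use pq in \<open>auto intro: always_eventually\<close>)+
  then have pl: "p \<longlonglongrightarrow> x" "q \<longlonglongrightarrow> x" by (simp_all add: LIM_zero_iff)
  have "isCont ?bc x" "isCont ?cb x"
    using smooth_on_continuous_on[OF smooth_on_deriv[OF smooth_on_deriv[OF g]]] S x by (auto simp: continuous_on_eq_continuous_at)
  then have "(\<lambda>n. ?bc (p n)) \<longlonglongrightarrow> ?bc x" "(\<lambda>n. ?cb (q n)) \<longlonglongrightarrow> ?cb x"
    using pl isCont_tendsto_compose by blast+
  then show ?thesis using pq(3) LIMSEQ_unique by simp
qed

text \<open>Real and imaginary part are bounded linear, hence commute with both differentiations,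
  and reduce the claim to the real case.\<close>

lemma second_derivative_symmetric:
  fixes g :: "'a::real_normed_vector \<Rightarrow> complex"
  assumes S: "open S" and x: "x \<in> S" and g: "smooth_on S g"
  shows "frechet_derivative (\<lambda>y. frechet_derivative g (at y) b) (at x) c = frechet_derivative (\<lambda>y. frechet_derivative g (at y) c) (at x) b"
proof -
  have lin: "frechet_derivative (\<lambda>y. frechet_derivative (\<lambda>z. L (g z)) (at y) v) (at x) w
      = L (frechet_derivative (\<lambda>y. frechet_derivative g (at y) v) (at x) w)"
    if L: "bounded_linear L" for L :: "complex \<Rightarrow> real" and v w
  proof -
    have lc: "frechet_derivative (\<lambda>z. L (u z)) (at y) v = L (frechet_derivative u (at y) v)" if "u differentiable (at y)" for u :: "'a \<Rightarrow> complex" and y v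
      using frechet_derivative_at[OF bounded_linear.has_derivative[OF L that[unfolded frechet_derivative_works]]] by metis
    have dv: "(\<lambda>y. frechet_derivative g (at y) v) differentiable (at x)"
      using smooth_on_differentiable[OF smooth_on_deriv[OF g] x] .
    have e: "L (frechet_derivative g (at y) v) = frechet_derivative (\<lambda>z. L (g z)) (at y) v" if "y \<in> S" for y
      using lc[OF smooth_on_differentiable[OF g that]] by simp
    have dl: "(\<lambda>y. L (frechet_derivative g (at y) v)) differentiable (at x)"
      using smooth_on_differentiable[OF smooth_on_linear[OF S L smooth_on_deriv[OF g]] x] .
    have "frechet_derivative (\<lambda>y. L (frechet_derivative g (at y) v)) (at x) =
        frechet_derivative (\<lambda>y. frechet_derivative (\<lambda>z. L (g z)) (at y) v) (at x)"
      by (rule frechet_derivative_transform_within_open[OF dl S x e])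
    then show ?thesis using lc[OF dv, of w] by simp
  qed
  have "L (frechet_derivative (\<lambda>y. frechet_derivative g (at y) b) (at x) c) = L (frechet_derivative (\<lambda>y. frechet_derivative g (at y) c) (at x) b)"
    if L: "bounded_linear L" for L :: "complex \<Rightarrow> real"
    using second_derivative_symmetric_real[OF S x smooth_on_linear[OF S L g], of b c] unfolding lin[OF L] .
  from this[OF bounded_linear_Re] this[OF bounded_linear_Im] show ?thesis by (simp add: complex_eq_iff)
qed

section \<open>Smooth functions and tangent vectors on a manifold\<close>

lemma sum_fun_apply: "(\<Sum>i\<in>I. F i) x = (\<Sum>i\<in>I. F i x)"
  by (induction I rule: infinite_finite_induct) auto

lemma cscale_apply: "cscale c X f = c * X f"
  by (simp add: cscale_def)

abbreviation (input) coord :: "('m \<Rightarrow> 'e::euclidean_space) \<Rightarrow> 'e \<Rightarrow> 'm \<Rightarrow> complex" where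
  "coord \<phi> b \<equiv> (\<lambda>q. complex_of_real (\<phi> q \<bullet> b))"

locale atlas =
  fixes A :: "('m::{t2_space,second_countable_topology}, 'e::euclidean_space) chart set"
  assumes atlas: "smooth_atlas A"
begin

lemma chart_exists: obtains V \<phi> where "(V, \<phi>) \<in> A" "p \<in> V"
proof -
  have "p \<in> (\<Union>(U, \<phi>)\<in>A. U)" using atlas unfolding smooth_atlas_def by simp
  then obtain c where c: "c \<in> A" "p \<in> (case c of (U, \<phi>) \<Rightarrow> U)" by (rule UN_E)
  then show thesis using that[of "fst c" "snd c"] by (simp add: case_prod_unfold)
qed

lemma chartD:
  assumes "(V, \<phi>) \<in> A"
  shows "open V" "open (\<phi> ` V)" "homeomorphism V (\<phi> ` V) \<phi> (inv_into V \<phi>)"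
  using atlas assms unfolding smooth_atlas_def by blast+

lemma chart_transition:
  assumes "(V, \<phi>) \<in> A" "(V', \<phi>') \<in> A"
  shows "smooth_on (\<phi>' ` (V' \<inter> V)) (\<lambda>x. \<phi> (inv_into V' \<phi>' x))"
  using atlas assms unfolding smooth_atlas_def by blast

lemma chart_inj: "(V, \<phi>) \<in> A \<Longrightarrow> inj_on \<phi> V"
  using chartD(3) by (metis homeomorphism_apply1 inj_on_inverseI)

lemma chart_inv: "(V, \<phi>) \<in> A \<Longrightarrow> q \<in> V \<Longrightarrow> inv_into V \<phi> (\<phi> q) = q"
  using chart_inj by (simp add: inv_into_f_f)

lemma chart_open:
  assumes "(V, \<phi>) \<in> A" "open W"
  shows "open (\<phi> ` (W \<inter> V))"
proof -
  have "openin (top_of_set V) (W \<inter> V)" using assms(2) by (metis Int_commute openin_open)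
  then have "openin (top_of_set (\<phi> ` V)) (\<phi> ` (W \<inter> V))"
    using homeomorphism_imp_open_map[OF chartD(3)[OF assms(1)]] by blast
  then show ?thesis using chartD(2)[OF assms(1)] openin_open_trans by blast
qed

lemma msmooth_chart:
  "msmooth_on A W f \<Longrightarrow> (V, \<phi>) \<in> A \<Longrightarrow> smooth_on (\<phi> ` (W \<inter> V)) (\<lambda>x. f (inv_into V \<phi> x))"
  unfolding msmooth_on_def by blast

lemma msmoothI:
  "(\<And>V \<phi>. (V, \<phi>) \<in> A \<Longrightarrow> smooth_on (\<phi> ` (W \<inter> V)) (\<lambda>x. f (inv_into V \<phi> x))) \<Longrightarrow> msmooth_on A W f"
  unfolding msmooth_on_def by blast

lemma msmooth_subset: "msmooth_on A W f \<Longrightarrow> W' \<subseteq> W \<Longrightarrow> msmooth_on A W' f"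
  unfolding msmooth_on_def by (auto intro: smooth_on_subset)

lemma msmooth_cong:
  assumes "open W" "\<And>q. q \<in> W \<Longrightarrow> f q = g q" "msmooth_on A W f"
  shows "msmooth_on A W g"
proof (rule msmoothI)
  fix V \<phi> assume c: "(V, \<phi>) \<in> A"
  show "smooth_on (\<phi> ` (W \<inter> V)) (\<lambda>x. g (inv_into V \<phi> x))"
    by (rule smooth_on_cong[OF chart_open[OF c assms(1)] _ msmooth_chart[OF assms(3) c]])
      (auto simp: chart_inv[OF c] assms(2))
qed

lemma msmooth_const: "open W \<Longrightarrow> msmooth_on A W (\<lambda>q. c)"
  by (rule msmoothI) (auto intro: smooth_on_const chart_open)

lemma msmooth_add: "open W \<Longrightarrow> msmooth_on A W f \<Longrightarrow> msmooth_on A W g \<Longrightarrow> msmooth_on A W (\<lambda>q. f q + g q)"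
  by (rule msmoothI) (auto intro: smooth_on_add chart_open msmooth_chart)

lemma msmooth_minus: "open W \<Longrightarrow> msmooth_on A W f \<Longrightarrow> msmooth_on A W (\<lambda>q. - f q)"
  by (rule msmoothI) (auto intro: smooth_on_minus chart_open msmooth_chart)

lemma msmooth_diff: "open W \<Longrightarrow> msmooth_on A W f \<Longrightarrow> msmooth_on A W g \<Longrightarrow> msmooth_on A W (\<lambda>q. f q - g q)"
  by (rule msmoothI) (auto intro: smooth_on_diff chart_open msmooth_chart)

lemma msmooth_mult:
  fixes f g :: "'m \<Rightarrow> 'b::real_normed_algebra"
  shows "open W \<Longrightarrow> msmooth_on A W f \<Longrightarrow> msmooth_on A W g \<Longrightarrow> msmooth_on A W (\<lambda>q. f q * g q)"
  by (rule msmoothI) (auto intro: smooth_on_mult chart_open msmooth_chart)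

lemma msmooth_divide:
  fixes f g :: "'m \<Rightarrow> complex"
  assumes "open W" "msmooth_on A W f" "msmooth_on A W g" "\<And>q. q \<in> W \<Longrightarrow> g q \<noteq> 0"
  shows "msmooth_on A W (\<lambda>q. f q / g q)"
proof (rule msmoothI)
  fix V \<phi> assume c: "(V, \<phi>) \<in> A"
  show "smooth_on (\<phi> ` (W \<inter> V)) (\<lambda>x. f (inv_into V \<phi> x) / g (inv_into V \<phi> x))"
    by (rule smooth_on_divide[OF chart_open[OF c assms(1)] msmooth_chart[OF assms(2) c] msmooth_chart[OF assms(3) c]])
      (auto simp: chart_inv[OF c] assms(4))
qed

lemma msmooth_cnj: "open W \<Longrightarrow> msmooth_on A W f \<Longrightarrow> msmooth_on A W (\<lambda>q. cnj (f q))"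
  by (rule msmoothI) (auto intro: smooth_on_cnj chart_open msmooth_chart)

lemma msmooth_of_real: "open W \<Longrightarrow> msmooth_on A W f \<Longrightarrow> msmooth_on A W (\<lambda>q. complex_of_real (f q))"
  by (rule msmoothI) (auto intro: smooth_on_of_real chart_open msmooth_chart)

lemma msmooth_sum:
  "open W \<Longrightarrow> (\<And>i. i \<in> I \<Longrightarrow> msmooth_on A W (f i)) \<Longrightarrow> msmooth_on A W (\<lambda>q. \<Sum>i\<in>I. f i q)"
  by (induction I rule: infinite_finite_induct) (auto intro: msmooth_const msmooth_add)

text \<open>Every other chart sees the function composed with a smooth transition map, so smoothness
  in a single chart is enough.\<close>

lemma msmooth_transfer:
  assumes c: "(V, \<phi>) \<in> A" and W: "open W" "W \<subseteq> V" and w: "smooth_on (\<phi> ` W) w"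
  shows "msmooth_on A W (\<lambda>q. w (\<phi> q))"
proof (rule msmoothI)
  fix V' \<phi>' assume c': "(V', \<phi>') \<in> A"
  show "smooth_on (\<phi>' ` (W \<inter> V')) (\<lambda>x. w (\<phi> (inv_into V' \<phi>' x)))"
  proof (rule smooth_on_compose[OF chart_open[OF c' W(1)] _ w])
    show "smooth_on (\<phi>' ` (W \<inter> V')) (\<lambda>x. \<phi> (inv_into V' \<phi>' x))"
      by (rule smooth_on_subset[OF chart_transition[OF c c']]) (use W in auto)
    show "(\<lambda>x. \<phi> (inv_into V' \<phi>' x)) ` \<phi>' ` (W \<inter> V') \<subseteq> \<phi> ` W"
      by (auto simp: chart_inv[OF c'])
  qed
qed

lemma msmooth_coord:
  assumes c: "(V, \<phi>) \<in> A"
  shows "msmooth_on A V (coord \<phi> b)"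
  by (rule msmooth_transfer[OF c, where w="\<lambda>x. complex_of_real (x \<bullet> b)"])
    (use chartD[OF c] in \<open>auto intro!: smooth_on_of_real smooth_on_inner_const smooth_on_ident\<close>)

lemma nearI: "open W \<Longrightarrow> p \<in> W \<Longrightarrow> msmooth_on A W f \<Longrightarrow> msmooth_near A p f"
  unfolding msmooth_near_def by blast

lemma near_coord: "(V, \<phi>) \<in> A \<Longrightarrow> p \<in> V \<Longrightarrow> msmooth_near A p (coord \<phi> b)"
  using nearI[OF chartD(1) _ msmooth_coord] by blast

lemma near_common:
  assumes "msmooth_near A p f" "msmooth_near A p g"
  obtains W where "open W" "p \<in> W" "msmooth_on A W f" "msmooth_on A W g"
proof -
  obtain W1 where W1: "open W1" "p \<in> W1" "msmooth_on A W1 f" using assms(1) unfolding msmooth_near_def by blast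
  obtain W2 where W2: "open W2" "p \<in> W2" "msmooth_on A W2 g" using assms(2) unfolding msmooth_near_def by blast
  show thesis
    by (rule that[of "W1 \<inter> W2"]) (use W1 W2 in \<open>auto intro: msmooth_subset\<close>)
qed

lemma near_differentiable:
  assumes "msmooth_near A p f" "(V, \<phi>) \<in> A" "p \<in> V"
  shows "(\<lambda>x. f (inv_into V \<phi> x)) differentiable (at (\<phi> p))"
proof -
  obtain W where W: "open W" "p \<in> W" "msmooth_on A W f" using assms(1) unfolding msmooth_near_def by blast
  show ?thesis using smooth_on_differentiable[OF msmooth_chart[OF W(3) assms(2)]] W(2) assms(3) by blast
qed

lemma near_add: "msmooth_near A p f \<Longrightarrow> msmooth_near A p g \<Longrightarrow> msmooth_near A p (\<lambda>q. f q + g q)"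
  by (erule (1) near_common) (rule nearI, assumption+, rule msmooth_add)

lemma near_mult:
  fixes f g :: "'m \<Rightarrow> complex"
  shows "msmooth_near A p f \<Longrightarrow> msmooth_near A p g \<Longrightarrow> msmooth_near A p (\<lambda>q. f q * g q)"
  by (erule (1) near_common) (rule nearI, assumption+, rule msmooth_mult)

lemma near_const: "msmooth_near A p (\<lambda>q. c)"
  by (rule nearI[of UNIV]) (auto intro: msmooth_const)

lemma near_cnj: "msmooth_near A p f \<Longrightarrow> msmooth_near A p (\<lambda>q. cnj (f q))"
  unfolding msmooth_near_def using msmooth_cnj by blast

lemma near_cnj_iff: "msmooth_near A p (\<lambda>q. cnj (f q)) \<longleftrightarrow> msmooth_near A p f"
  using near_cnj[of p f] near_cnj[of p "\<lambda>q. cnj (f q)"] by auto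

lemma near_cong:
  assumes "open W" "p \<in> W" "\<And>q. q \<in> W \<Longrightarrow> f q = g q" "msmooth_near A p f"
  shows "msmooth_near A p g"
proof -
  obtain W' where W': "open W'" "p \<in> W'" "msmooth_on A W' f" using assms(4) unfolding msmooth_near_def by blast
  have "msmooth_on A (W \<inter> W') f" using msmooth_subset[OF W'(3)] by blast
  then have "msmooth_on A (W \<inter> W') g" using msmooth_cong[of "W \<inter> W'" f g] assms W' by auto
  then show ?thesis using nearI[of "W \<inter> W'"] assms W' by auto
qed

section \<open>Complexified tangent vectors as functionals\<close>

lemma ctangent_subspace: "cvec.subspace (ctangent_space A p)"
  unfolding ctangent_space_def by (rule cvec.subspace_span)

lemma tangent_ctangent: "X \<in> tangent_space A p \<Longrightarrow> X \<in> ctangent_space A p"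
  unfolding ctangent_space_def by (rule cvec.span_base)

text \<open>The default value 0 on functions that are not smooth near the point survives complex
  combinations. Equality of vectors can therefore be tested on smooth functions alone.\<close>

lemma ctangent_zero:
  assumes "X \<in> ctangent_space A p" "\<not> msmooth_near A p f"
  shows "X f = 0"
proof -
  have "ctangent_space A p \<subseteq> {X. X f = 0}"
    unfolding ctangent_space_def
  proof (rule cvec.span_minimal)
    show "tangent_space A p \<subseteq> {X. X f = 0}" using assms(2) by (auto simp: tangent_space_def)
    show "cvec.subspace {X. X f = 0}"
      unfolding cvec.subspace_def by (auto simp: cscale_apply)
  qed
  then show ?thesis using assms(1) by blast
qed

text \<open>The vector may be given in another chart; the chain rule for the transition map rewrites
  it, and evaluation at the coordinate functions identifies the coefficients.\<close>

lemma tangent_expand: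
  assumes X: "X \<in> tangent_space A p" and c: "(V, \<phi>) \<in> A" and p: "p \<in> V" and f: "msmooth_near A p f"
  shows "X f = (\<Sum>b\<in>Basis. X (coord \<phi> b) * frechet_derivative (\<lambda>x. f (inv_into V \<phi> x)) (at (\<phi> p)) b)"
proof -
  obtain V' \<phi>' v where c': "(V', \<phi>') \<in> A" "p \<in> V'" and Xd: "X = (\<lambda>f. if msmooth_near A p f
     then frechet_derivative (\<lambda>x. f (inv_into V' \<phi>' x)) (at (\<phi>' p)) v else 0)"
    using X unfolding tangent_space_def by blast
  let ?T = "\<lambda>x. \<phi> (inv_into V' \<phi>' x)" and ?f = "\<lambda>x. f (inv_into V \<phi> x)"
  let ?O = "\<phi>' ` (V' \<inter> V)"
  have O: "open ?O" "\<phi>' p \<in> ?O" using chart_open[OF c'(1) chartD(1)[OF c]] p c'(2) by (auto simp: Int_commute)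
  have dT: "(?T has_derivative frechet_derivative ?T (at (\<phi>' p))) (at (\<phi>' p))"
    using smooth_on_has_derivative[OF chart_transition[OF c c'(1)] O(2)] .
  have T0: "?T (\<phi>' p) = \<phi> p" by (simp add: chart_inv[OF c'])
  have df: "(?f has_derivative frechet_derivative ?f (at (\<phi> p))) (at (?T (\<phi>' p)))"
    using near_differentiable[OF f c p] by (simp add: frechet_derivative_works T0)
  have comp: "((\<lambda>x. ?f (?T x)) has_derivative (\<lambda>h. frechet_derivative ?f (at (\<phi> p)) (frechet_derivative ?T (at (\<phi>' p)) h))) (at (\<phi>' p))"
    using has_derivative_compose[OF dT df] .
  have eq: "?f (?T x) = f (inv_into V' \<phi>' x)" if "x \<in> ?O" for x
    using that by (auto simp: chart_inv[OF c'(1)] chart_inv[OF c])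
  have "((\<lambda>x. f (inv_into V' \<phi>' x)) has_derivative (\<lambda>h. frechet_derivative ?f (at (\<phi> p)) (frechet_derivative ?T (at (\<phi>' p)) h))) (at (\<phi>' p))"
    by (rule has_derivative_transform_within_open[OF comp O eq])
  then have "X f = frechet_derivative ?f (at (\<phi> p)) (frechet_derivative ?T (at (\<phi>' p)) v)"
    using f frechet_derivative_at unfolding Xd by metis
  also have "\<dots> = (\<Sum>b\<in>Basis. (frechet_derivative ?T (at (\<phi>' p)) v \<bullet> b) *\<^sub>R frechet_derivative ?f (at (\<phi> p)) b)"
    by (rule frechet_derivative_coords[OF near_differentiable[OF f c p]])
  also have "\<dots> = (\<Sum>b\<in>Basis. X (coord \<phi> b) * frechet_derivative ?f (at (\<phi> p)) b)"
  proof (rule sum.cong[OF refl])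
    fix b :: 'e
    have "((\<lambda>x. complex_of_real (?T x \<bullet> b)) has_derivative (\<lambda>h. complex_of_real (frechet_derivative ?T (at (\<phi>' p)) h \<bullet> b))) (at (\<phi>' p))"
      using dT by (auto intro!: derivative_eq_intros)
    then have "X (coord \<phi> b) = complex_of_real (frechet_derivative ?T (at (\<phi>' p)) v \<bullet> b)"
      using near_coord[OF c p] frechet_derivative_at unfolding Xd by metis
    then show "(frechet_derivative ?T (at (\<phi>' p)) v \<bullet> b) *\<^sub>R frechet_derivative ?f (at (\<phi> p)) b = X (coord \<phi> b) * frechet_derivative ?f (at (\<phi> p)) b"
      by (simp add: scaleR_conv_of_real)
  qed
  finally show ?thesis .
qed

lemma ctangent_expand:
  assumes X: "X \<in> ctangent_space A p" and c: "(V, \<phi>) \<in> A" and p: "p \<in> V" and f: "msmooth_near A p f"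
  shows "X f = (\<Sum>b\<in>Basis. X (coord \<phi> b) * frechet_derivative (\<lambda>x. f (inv_into V \<phi> x)) (at (\<phi> p)) b)"
proof -
  let ?S = "{X. X f = (\<Sum>b\<in>Basis. X (coord \<phi> b) * frechet_derivative (\<lambda>x. f (inv_into V \<phi> x)) (at (\<phi> p)) b)}"
  have "ctangent_space A p \<subseteq> ?S"
    unfolding ctangent_space_def
  proof (rule cvec.span_minimal)
    show "tangent_space A p \<subseteq> ?S" using tangent_expand[OF _ c p f] by blast
    show "cvec.subspace ?S"
      unfolding cvec.subspace_def
      by (auto simp: cscale_apply sum.distrib sum_distrib_left distrib_right mult.assoc)
  qed
  then show ?thesis using X by blast
qed

lemma ctangent_eqI:
  assumes "X \<in> ctangent_space A p" "Y \<in> ctangent_space A p" "(V, \<phi>) \<in> A" "p \<in> V"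
    "\<And>b. b \<in> Basis \<Longrightarrow> X (coord \<phi> b) = Y (coord \<phi> b)"
  shows "X = Y"
proof
  fix f
  show "X f = Y f"
  proof (cases "msmooth_near A p f")
    case True
    then show ?thesis
      using ctangent_expand[OF assms(1,3,4) True] ctangent_expand[OF assms(2,3,4) True] assms(5) by simp
  qed (simp add: ctangent_zero[OF assms(1)] ctangent_zero[OF assms(2)])
qed

text \<open>Functions on the manifold are total, while the formulas substituted below hold only near
  the point; this locality justifies the substitution. Smoothness near the point is itself local, so
  the default case agrees too.\<close>

lemma ctangent_local:
  assumes X: "X \<in> ctangent_space A p" and W: "open W" "p \<in> W" and eq: "\<And>q. q \<in> W \<Longrightarrow> f q = g q"
  shows "X f = X g"
proof (cases "msmooth_near A p f")
  case True
  have g: "msmooth_near A p g" by (rule near_cong[OF W eq True])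
  obtain V \<phi> where c: "(V, \<phi>) \<in> A" "p \<in> V" by (rule chart_exists)
  have "frechet_derivative (\<lambda>x. f (inv_into V \<phi> x)) (at (\<phi> p)) = frechet_derivative (\<lambda>x. g (inv_into V \<phi> x)) (at (\<phi> p))"
    by (rule frechet_derivative_transform_within_open[OF near_differentiable[OF True c] chart_open[OF c(1) W(1)]])
      (use W c eq in \<open>auto simp: chart_inv[OF c(1)]\<close>)
  then show ?thesis using ctangent_expand[OF X c True] ctangent_expand[OF X c g] by simp
next
  case False
  have "msmooth_near A p f" if "msmooth_near A p g" by (rule near_cong[OF W eq[symmetric] that])
  then have "\<not> msmooth_near A p g" using False by blast
  then show ?thesis using False ctangent_zero[OF X] by simp
qed

lemma ctangent_add:
  assumes X: "X \<in> ctangent_space A p" and f: "msmooth_near A p f" and g: "msmooth_near A p g"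
  shows "X (\<lambda>q. f q + g q) = X f + X g"
proof -
  obtain V \<phi> where c: "(V, \<phi>) \<in> A" "p \<in> V" by (rule chart_exists)
  show ?thesis
    unfolding ctangent_expand[OF X c near_add[OF f g]] ctangent_expand[OF X c f] ctangent_expand[OF X c g]
      frechet_derivative_plus[OF near_differentiable[OF f c] near_differentiable[OF g c]]
    by (simp add: sum.distrib distrib_left)
qed

lemma ctangent_mult:
  assumes X: "X \<in> ctangent_space A p" and f: "msmooth_near A p f" and g: "msmooth_near A p g"
  shows "X (\<lambda>q. f q * g q) = f p * X g + X f * g p"
proof -
  obtain V \<phi> where c: "(V, \<phi>) \<in> A" "p \<in> V" by (rule chart_exists)
  show ?thesis
    unfolding ctangent_expand[OF X c near_mult[OF f g]] ctangent_expand[OF X c f] ctangent_expand[OF X c g]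
      frechet_derivative_mult[OF near_differentiable[OF f c] near_differentiable[OF g c]] chart_inv[OF c]
    by (simp add: sum.distrib distrib_left sum_distrib_left sum_distrib_right mult_ac)
qed

lemma ctangent_const:
  assumes X: "X \<in> ctangent_space A p"
  shows "X (\<lambda>q. c) = 0"
proof -
  obtain V \<phi> where c: "(V, \<phi>) \<in> A" "p \<in> V" by (rule chart_exists)
  show ?thesis by (simp add: ctangent_expand[OF X c near_const])
qed

lemma ctangent_cmult:
  assumes "X \<in> ctangent_space A p" "msmooth_near A p f"
  shows "X (\<lambda>q. c * f q) = c * X f"
  using ctangent_mult[OF assms(1) near_const assms(2)] ctangent_const[OF assms(1)] by simp

lemma ctangent_sum:
  assumes X: "X \<in> ctangent_space A p" and I: "finite I" and f: "\<And>i. i \<in> I \<Longrightarrow> msmooth_near A p (f i)"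
  shows "X (\<lambda>q. \<Sum>i\<in>I. f i q) = (\<Sum>i\<in>I. X (f i))"
proof -
  have "msmooth_near A p (\<lambda>q. \<Sum>i\<in>I. f i q) \<and> X (\<lambda>q. \<Sum>i\<in>I. f i q) = (\<Sum>i\<in>I. X (f i))"
    using I f
    by (induction I rule: finite_induct) (auto simp: near_const ctangent_const[OF X] near_add ctangent_add[OF X])
  then show ?thesis by blast
qed

lemma conj_vec_apply: "conj_vec X f = cnj (X (\<lambda>q. cnj (f q)))"
  by (simp add: conj_vec_def)

lemma conj_vec_invol: "conj_vec (conj_vec X) = X"
  by (simp add: conj_vec_def)

lemma conj_vec_add: "conj_vec (X + Y) = conj_vec X + conj_vec Y"
  by (auto simp: conj_vec_def)

lemma conj_vec_cscale: "conj_vec (cscale c X) = cscale (cnj c) (conj_vec X)"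
  by (auto simp: conj_vec_def cscale_def)

lemma conj_vec_zero: "conj_vec 0 = 0"
  by (auto simp: conj_vec_def)

lemma conj_vec_minus: "conj_vec (- X) = - conj_vec X"
  by (auto simp: conj_vec_def)

lemma conj_vec_sum: "conj_vec (\<Sum>i\<in>I. X i) = (\<Sum>i\<in>I. conj_vec (X i))"
  by (rule ext) (simp add: conj_vec_apply sum_fun_apply)

text \<open>Derivatives in a chart commute with conjugation, and smoothness near the point is
  invariant under it, so the default value is respected as well.\<close>

lemma tangent_conj:
  assumes "X \<in> tangent_space A p"
  shows "conj_vec X = X"
proof
  fix f
  obtain V \<phi> v where c: "(V, \<phi>) \<in> A" "p \<in> V" and X: "X = (\<lambda>f. if msmooth_near A p f
     then frechet_derivative (\<lambda>x. f (inv_into V \<phi> x)) (at (\<phi> p)) v else 0)"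
    using assms unfolding tangent_space_def by blast
  show "conj_vec X f = X f"
  proof (cases "msmooth_near A p f")
    case True
    then show ?thesis
      using frechet_derivative_linear_compose[OF near_differentiable[OF True c] bounded_linear_cnj]
      by (simp add: conj_vec_apply X near_cnj_iff)
  qed (simp add: conj_vec_apply X near_cnj_iff)
qed

lemma ctangent_conj:
  assumes "X \<in> ctangent_space A p"
  shows "conj_vec X \<in> ctangent_space A p"
proof -
  have "cvec.span (tangent_space A p) \<subseteq> {X. conj_vec X \<in> ctangent_space A p}"
  proof (rule cvec.span_minimal)
    show "tangent_space A p \<subseteq> {X. conj_vec X \<in> ctangent_space A p}"
      using tangent_conj tangent_ctangent by auto
    show "cvec.subspace {X. conj_vec X \<in> ctangent_space A p}"
      using ctangent_subspace[of p] unfolding cvec.subspace_def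
      by (auto simp: conj_vec_zero conj_vec_add conj_vec_cscale)
  qed
  then show ?thesis using assms unfolding ctangent_space_def by blast
qed

lemma conj_vec_coord: "conj_vec X (coord \<phi> b) = cnj (X (coord \<phi> b))"
  by (simp add: conj_vec_apply)

definition partial_vec :: "'m set \<Rightarrow> ('m \<Rightarrow> 'e) \<Rightarrow> 'm \<Rightarrow> 'e \<Rightarrow> 'm tvec" where
  "partial_vec V \<phi> p b = (\<lambda>f. if msmooth_near A p f then frechet_derivative (\<lambda>x. f (inv_into V \<phi> x)) (at (\<phi> p)) b else 0)"

lemma partial_vec_tangent: "(V, \<phi>) \<in> A \<Longrightarrow> p \<in> V \<Longrightarrow> partial_vec V \<phi> p b \<in> tangent_space A p"
  unfolding tangent_space_def partial_vec_def by blast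

section \<open>Vector fields and their brackets\<close>

lemma vfield_ctangent: "smooth_vfield A U X \<Longrightarrow> p \<in> U \<Longrightarrow> X p \<in> ctangent_space A p"
  by (simp add: smooth_vfield_def)

lemma vfield_smooth:
  "smooth_vfield A U X \<Longrightarrow> open V \<Longrightarrow> V \<subseteq> U \<Longrightarrow> msmooth_on A V f \<Longrightarrow> msmooth_on A V (\<lambda>q. X q f)"
  by (simp add: smooth_vfield_def)

lemma vfield_subset: "smooth_vfield A U X \<Longrightarrow> U' \<subseteq> U \<Longrightarrow> smooth_vfield A U' X"
  unfolding smooth_vfield_def by (metis subsetD order_trans)

lemma vfield_near:
  assumes "smooth_vfield A U X" "open U" "p \<in> U" "msmooth_near A p f"
  shows "msmooth_near A p (\<lambda>q. X q f)"
proof -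
  obtain W where W: "open W" "p \<in> W" "msmooth_on A W f" using assms(4) unfolding msmooth_near_def by blast
  have "msmooth_on A (U \<inter> W) (\<lambda>q. X q f)"
    using assms(2) W by (intro vfield_smooth[OF assms(1)] msmooth_subset[OF W(3)]) auto
  then show ?thesis using nearI[of "U \<inter> W"] assms W by auto
qed

lemma vfield_conj:
  assumes "smooth_vfield A U X"
  shows "smooth_vfield A U (conj_field X)"
  unfolding smooth_vfield_def conj_field_def
proof (intro conjI ballI allI impI)
  show "conj_vec (X p) \<in> ctangent_space A p" if "p \<in> U" for p
    using ctangent_conj[OF vfield_ctangent[OF assms that]] .
  show "msmooth_on A V (\<lambda>p. conj_vec (X p) f)" if "open V" "V \<subseteq> U" "msmooth_on A V f" for V f
    unfolding conj_vec_apply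
    by (rule msmooth_cnj[OF that(1) vfield_smooth[OF assms that(1,2) msmooth_cnj[OF that(1,3)]]])
qed

lemma vfield_combination:
  assumes "\<And>i. i \<in> I \<Longrightarrow> msmooth_on A U (c i)" "\<And>i. i \<in> I \<Longrightarrow> smooth_vfield A U (X i)"
  shows "smooth_vfield A U (\<lambda>q. \<Sum>i\<in>I. cscale (c i q) (X i q))"
  unfolding smooth_vfield_def
proof (intro conjI ballI allI impI)
  show "(\<Sum>i\<in>I. cscale (c i q) (X i q)) \<in> ctangent_space A q" if "q \<in> U" for q
    using assms(2) that by (intro cvec.subspace_sum cvec.subspace_scale ctangent_subspace vfield_ctangent) auto
  show "msmooth_on A V (\<lambda>q. (\<Sum>i\<in>I. cscale (c i q) (X i q)) f)" if "open V" "V \<subseteq> U" "msmooth_on A V f" for V f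
    unfolding sum_fun_apply cscale_apply
    by (rule msmooth_sum[OF that(1)])
      (rule msmooth_mult[OF that(1) msmooth_subset[OF assms(1) that(2)] vfield_smooth[OF assms(2) that]])
qed

lemma bracket_apply:
  assumes "msmooth_near A p f"
  shows "lie_bracket A X Y p f = X p (\<lambda>q. Y q f) - Y p (\<lambda>q. X q f)"
  using assms by (simp add: lie_bracket_def)

text \<open>Separates the composition of two fields into a first order part and a Hessian part; the
  latter is what cancels in the bracket.\<close>

lemma bracket_expand:
  assumes X: "smooth_vfield A U X" and Y: "smooth_vfield A U Y" and U: "open U" "p \<in> U"
    and c: "(V, \<phi>) \<in> A" and p: "p \<in> V" and f: "msmooth_near A p f"
  shows "X p (\<lambda>q. Y q f) = (\<Sum>b\<in>Basis. X p (\<lambda>q. Y q (coord \<phi> b)) * frechet_derivative (\<lambda>x. f (inv_into V \<phi> x)) (at (\<phi> p)) b)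
     + (\<Sum>b\<in>Basis. \<Sum>d\<in>Basis. Y p (coord \<phi> b) * X p (coord \<phi> d) *
        frechet_derivative (\<lambda>x. frechet_derivative (\<lambda>x. f (inv_into V \<phi> x)) (at x) b) (at (\<phi> p)) d)"
proof -
  let ?f = "\<lambda>x. f (inv_into V \<phi> x)"
  obtain W' where W': "open W'" "p \<in> W'" "msmooth_on A W' f" using f unfolding msmooth_near_def by blast
  define W where "W = W' \<inter> U \<inter> V"
  have W: "open W" "p \<in> W" "W \<subseteq> U" "W \<subseteq> V" "W \<subseteq> W'" using W' U p chartD(1)[OF c] by (auto simp: W_def)
  have fW: "msmooth_on A W f" using msmooth_subset[OF W'(3) W(5)] .
  have sf: "smooth_on (\<phi> ` W) ?f" using msmooth_chart[OF fW c] W(4) by (simp add: Int_absorb2)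
  define P where "P b q = frechet_derivative ?f (at (\<phi> q)) b" for b q
  have P: "msmooth_on A W (P b)" for b
    unfolding P_def[abs_def] by (rule msmooth_transfer[OF c W(1,4), where w="\<lambda>x. frechet_derivative ?f (at x) b"]) (rule smooth_on_deriv[OF sf])
  have Pn: "msmooth_near A p (P b)" for b using nearI[OF W(1,2) P] .
  have Xp: "X p \<in> ctangent_space A p" using vfield_ctangent[OF X U(2)] .
  have Yn: "msmooth_near A p (\<lambda>q. Y q (coord \<phi> b))" for b
    by (rule vfield_near[OF Y U near_coord[OF c p]])
  have oW: "open (\<phi> ` W)" using chart_open[OF c W(1)] W(4) by (simp add: Int_absorb2)
  have dP: "X p (P b) = (\<Sum>d\<in>Basis. X p (coord \<phi> d) * frechet_derivative (\<lambda>x. frechet_derivative ?f (at x) b) (at (\<phi> p)) d)" for b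
  proof -
    have "frechet_derivative (\<lambda>x. frechet_derivative ?f (at x) b) (at (\<phi> p)) = frechet_derivative (\<lambda>x. P b (inv_into V \<phi> x)) (at (\<phi> p))"
      by (rule frechet_derivative_transform_within_open[OF smooth_on_differentiable[OF smooth_on_deriv[OF sf]] oW])
        (use W in \<open>auto simp: P_def chart_inv[OF c] subset_eq\<close>)
    then show ?thesis using ctangent_expand[OF Xp c p Pn] by simp
  qed
  have "X p (\<lambda>q. Y q f) = X p (\<lambda>q. \<Sum>b\<in>Basis. Y q (coord \<phi> b) * P b q)"
  proof (rule ctangent_local[OF Xp W(1,2)])
    fix q assume q: "q \<in> W"
    show "Y q f = (\<Sum>b\<in>Basis. Y q (coord \<phi> b) * P b q)"
      unfolding P_def by (rule ctangent_expand[OF vfield_ctangent[OF Y] c _ nearI[OF W(1) q fW]]) (use q W in auto)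
  qed
  also have "\<dots> = (\<Sum>b\<in>Basis. Y p (coord \<phi> b) * X p (P b) + X p (\<lambda>q. Y q (coord \<phi> b)) * P b p)"
    by (simp add: ctangent_sum[OF Xp finite_Basis near_mult[OF Yn Pn]] ctangent_mult[OF Xp Yn Pn])
  finally show ?thesis
    by (simp add: dP P_def sum.distrib sum_distrib_left mult.assoc)
qed

text \<open>The Hessian parts of the two compositions agree by symmetry of second derivatives, so
  the bracket is a combination of coordinate vectors with its own values on the coordinate functions
  as coefficients.\<close>

lemma bracket_ctangent:
  assumes X: "smooth_vfield A U X" and Y: "smooth_vfield A U Y" and U: "open U" "p \<in> U"
  shows "lie_bracket A X Y p \<in> ctangent_space A p"
proof -
  obtain V \<phi> where c: "(V, \<phi>) \<in> A" and p: "p \<in> V" by (rule chart_exists)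
  have "lie_bracket A X Y p = (\<Sum>b\<in>Basis. cscale (lie_bracket A X Y p (coord \<phi> b)) (partial_vec V \<phi> p b))"
  proof
    fix f
    show "lie_bracket A X Y p f = (\<Sum>b\<in>Basis. cscale (lie_bracket A X Y p (coord \<phi> b)) (partial_vec V \<phi> p b)) f"
    proof (cases "msmooth_near A p f")
      case True
      let ?f = "\<lambda>x. f (inv_into V \<phi> x)"
      let ?dd = "\<lambda>b d. frechet_derivative (\<lambda>x. frechet_derivative ?f (at x) b) (at (\<phi> p)) d"
      obtain W' where W': "open W'" "p \<in> W'" "msmooth_on A W' f" using True unfolding msmooth_near_def by blast
      have sy: "?dd b d = ?dd d b" for b d
        by (rule second_derivative_symmetric[OF chart_open[OF c W'(1)] _ msmooth_chart[OF W'(3) c]]) (use W' p in auto)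
      have "(\<Sum>b\<in>Basis. \<Sum>d\<in>Basis. X p (coord \<phi> b) * Y p (coord \<phi> d) * ?dd b d) =
         (\<Sum>b\<in>Basis. \<Sum>d\<in>Basis. Y p (coord \<phi> b) * X p (coord \<phi> d) * ?dd b d)"
        by (subst sum.swap) (simp add: sy mult.commute)
      then show ?thesis
        using bracket_expand[OF X Y U c p True] bracket_expand[OF Y X U c p True] True
        by (simp add: bracket_apply[OF True] bracket_apply[OF near_coord[OF c p]] sum_fun_apply cscale_apply
            partial_vec_def sum_subtractf left_diff_distrib)
    qed (simp add: lie_bracket_def sum_fun_apply cscale_apply partial_vec_def)
  qed
  also have "\<dots> \<in> ctangent_space A p"
    by (intro cvec.subspace_sum cvec.subspace_scale ctangent_subspace tangent_ctangent partial_vec_tangent c p)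
  finally show ?thesis .
qed

end

section \<open>Smooth linear algebra in a frame\<close>

definition herm_pair :: "('e::euclidean_space \<Rightarrow> complex) \<Rightarrow> ('e \<Rightarrow> complex) \<Rightarrow> complex" where
  "herm_pair u v = (\<Sum>b\<in>Basis. u b * cnj (v b))"

definition indep_at :: "nat \<Rightarrow> (nat \<Rightarrow> 'm \<Rightarrow> 'e::euclidean_space \<Rightarrow> complex) \<Rightarrow> 'm \<Rightarrow> bool" where
  "indep_at n e q \<longleftrightarrow> (\<forall>d. (\<forall>b\<in>Basis. (\<Sum>i<n. d i * e i q b) = 0) \<longrightarrow> (\<forall>i<n. d i = 0))"

lemma indep_atD:
  "indep_at n e q \<Longrightarrow> (\<And>b. b \<in> Basis \<Longrightarrow> (\<Sum>i<n. d i * e i q b) = 0) \<Longrightarrow> i < n \<Longrightarrow> d i = 0"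
  unfolding indep_at_def by blast

text \<open>A Gram-Schmidt step: the component of vector \<open>i\<close> along vector
  \<open>n\<close> is to be removed. The only division is by a nonvanishing squared length, so
  linear systems with smooth data are solved smoothly without determinants.\<close>

definition elim_coeff :: "(nat \<Rightarrow> 'm \<Rightarrow> 'e::euclidean_space \<Rightarrow> complex) \<Rightarrow> nat \<Rightarrow> nat \<Rightarrow> 'm \<Rightarrow> complex" where
  "elim_coeff e n i q = herm_pair (e i q) (e n q) / herm_pair (e n q) (e n q)"

definition elim_vec :: "(nat \<Rightarrow> 'm \<Rightarrow> 'e::euclidean_space \<Rightarrow> complex) \<Rightarrow> nat \<Rightarrow> nat \<Rightarrow> 'm \<Rightarrow> 'e \<Rightarrow> complex" where
  "elim_vec e n i q b = e i q b - elim_coeff e n i q * e n q b"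

lemma herm_pair_nonzero:
  assumes "indep_at (Suc n) e q"
  shows "herm_pair (e n q) (e n q) \<noteq> 0"
proof
  assume "herm_pair (e n q) (e n q) = 0"
  then have "(\<Sum>b\<in>Basis. complex_of_real ((cmod (e n q b))\<^sup>2)) = 0"
    unfolding herm_pair_def complex_norm_square .
  then have "(\<Sum>b\<in>Basis. (cmod (e n q b))\<^sup>2) = 0"
    unfolding of_real_sum[symmetric] of_real_eq_0_iff .
  then have "\<forall>b\<in>Basis. e n q b = 0"
    by (subst (asm) sum_nonneg_eq_0_iff) auto
  then have "(\<Sum>i<Suc n. (if i = n then 1 else 0) * e i q b) = 0" if "b \<in> Basis" for b using that by simp
  from indep_atD[OF assms, of "\<lambda>i. if i = n then 1 else 0" n, OF this] show False by simp
qed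

lemma indep_elim:
  assumes "indep_at (Suc n) e q"
  shows "indep_at n (elim_vec e n) q"
  unfolding indep_at_def
proof (intro allI impI)
  fix d i assume d: "\<forall>b\<in>Basis. (\<Sum>i<n. d i * elim_vec e n i q b) = 0" and i: "i < n"
  let ?d = "d(n := - (\<Sum>i<n. d i * elim_coeff e n i q))"
  have "(\<Sum>i<Suc n. ?d i * e i q b) = (\<Sum>i<n. d i * elim_vec e n i q b)" for b
    by (simp add: elim_vec_def sum_distrib_right right_diff_distrib sum_subtractf mult.assoc)
  then have "?d i = 0" using indep_atD[OF assms, of ?d i] d i by simp
  then show "d i = 0" using i by simp
qed

lemma herm_pair_elim:
  assumes "herm_pair (e n q) (e n q) \<noteq> 0"
  shows "herm_pair (elim_vec e n i q) (e n q) = 0"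
proof -
  have "herm_pair (elim_vec e n i q) (e n q) = herm_pair (e i q) (e n q) - elim_coeff e n i q * herm_pair (e n q) (e n q)"
    by (simp add: herm_pair_def elim_vec_def left_diff_distrib sum_subtractf sum_distrib_left mult.assoc)
  then show ?thesis using assms by (simp add: elim_coeff_def)
qed

context atlas
begin

lemma msmooth_herm_pair:
  assumes "open W" "\<And>b. b \<in> Basis \<Longrightarrow> msmooth_on A W (\<lambda>q. u q b)" "\<And>b. b \<in> Basis \<Longrightarrow> msmooth_on A W (\<lambda>q. v q b)"
  shows "msmooth_on A W (\<lambda>q. herm_pair (u q) (v q :: 'e \<Rightarrow> complex))"
  unfolding herm_pair_def
  by (rule msmooth_sum[OF assms(1)]) (rule msmooth_mult[OF assms(1,2) msmooth_cnj[OF assms(1,3)]])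

lemma msmooth_elim:
  fixes e :: "nat \<Rightarrow> 'm \<Rightarrow> 'e \<Rightarrow> complex"
  assumes W: "open W" and e: "\<And>i b. i < Suc n \<Longrightarrow> b \<in> Basis \<Longrightarrow> msmooth_on A W (\<lambda>q. e i q b)"
    and indep: "\<And>q. q \<in> W \<Longrightarrow> indep_at (Suc n) e q" and i: "i < Suc n"
  shows "msmooth_on A W (elim_coeff e n i)" "b \<in> Basis \<Longrightarrow> msmooth_on A W (\<lambda>q. elim_vec e n i q b)"
proof -
  show 1: "msmooth_on A W (elim_coeff e n i)"
    unfolding elim_coeff_def[abs_def]
    by (rule msmooth_divide[OF W msmooth_herm_pair[OF W e[OF i] e] msmooth_herm_pair[OF W e e] herm_pair_nonzero[OF indep]]) auto
  show "msmooth_on A W (\<lambda>q. elim_vec e n i q b)" if "b \<in> Basis"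
    unfolding elim_vec_def by (rule msmooth_diff[OF W e[OF i that] msmooth_mult[OF W 1 e[OF lessI that]]])
qed

text \<open>The coefficients are given pointwise, with no regularity. Projecting away from the last
  vector leaves a system with one vector fewer and the same remaining coefficients, to which the
  induction hypothesis applies.\<close>

lemma frame_coeffs_smooth:
  fixes e :: "nat \<Rightarrow> 'm \<Rightarrow> 'e \<Rightarrow> complex"
  assumes W: "open W" and e: "\<And>i b. i < n \<Longrightarrow> b \<in> Basis \<Longrightarrow> msmooth_on A W (\<lambda>q. e i q b)"
    and indep: "\<And>q. q \<in> W \<Longrightarrow> indep_at n e q"
    and s: "\<And>b. b \<in> Basis \<Longrightarrow> msmooth_on A W (\<lambda>q. s q b)"
    and eq: "\<And>q b. q \<in> W \<Longrightarrow> b \<in> Basis \<Longrightarrow> s q b = (\<Sum>i<n. c i q * e i q b)"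
    and i: "i < n"
  shows "msmooth_on A W (c i)"
  using e indep s eq i
proof (induction n arbitrary: e s i)
  case (Suc n)
  let ?N = "\<lambda>q. herm_pair (e n q) (e n q)"
  \<comment> \<open>The smooth component of \<open>s\<close> along vector \<open>n\<close>. It
    equals the last coefficient plus known smooth terms, from which that coefficient is recovered at
    the end.\<close>
  let ?\<nu> = "\<lambda>q. herm_pair (s q) (e n q) / ?N q"
  note el = msmooth_elim[OF W Suc.prems(1,2)]
  have \<nu>: "msmooth_on A W ?\<nu>"
    by (rule msmooth_divide[OF W msmooth_herm_pair[OF W Suc.prems(3,1)] msmooth_herm_pair[OF W Suc.prems(1,1)] herm_pair_nonzero[OF Suc.prems(2)]]) auto
  have \<nu>eq: "?\<nu> q = (\<Sum>i<n. c i q * elim_coeff e n i q) + c n q" if q: "q \<in> W" for q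
  proof -
    have "herm_pair (s q) (e n q) = (\<Sum>i<Suc n. c i q * herm_pair (e i q) (e n q))"
      unfolding herm_pair_def sum_distrib_left
      by (subst sum.swap) (simp add: Suc.prems(4)[OF q] sum_distrib_right distrib_right mult.assoc)
    then show ?thesis using herm_pair_nonzero[OF Suc.prems(2)[OF q]]
      by (simp add: elim_coeff_def add_divide_distrib sum_divide_distrib)
  qed
  have s': "msmooth_on A W (\<lambda>q. s q b - ?\<nu> q * e n q b)" if "b \<in> Basis" for b
    by (rule msmooth_diff[OF W Suc.prems(3)[OF that] msmooth_mult[OF W \<nu> Suc.prems(1)[OF lessI that]]])
  have eq': "s q b - ?\<nu> q * e n q b = (\<Sum>i<n. c i q * elim_vec e n i q b)" if q: "q \<in> W" and b: "b \<in> Basis" for q b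
    unfolding \<nu>eq[OF q] Suc.prems(4)[OF q b]
    by (simp add: elim_vec_def algebra_simps sum_subtractf sum_distrib_left)
  have IH: "msmooth_on A W (c i)" if "i < n" for i
  proof (rule Suc.IH[where s="\<lambda>q b. s q b - ?\<nu> q * e n q b" and e="elim_vec e n"])
    show "msmooth_on A W (\<lambda>q. elim_vec e n i q b)" if "i < n" "b \<in> Basis" for i b
      by (rule el(2)) (use that in auto)
    show "indep_at n (elim_vec e n) q" if "q \<in> W" for q by (rule indep_elim[OF Suc.prems(2)[OF that]])
  qed (rule s' eq' that; assumption)+
  show ?case
  proof (cases "i = n")
    case True
    have "msmooth_on A W (\<lambda>q. ?\<nu> q - (\<Sum>i<n. c i q * elim_coeff e n i q))"
      by (rule msmooth_diff[OF W \<nu> msmooth_sum[OF W msmooth_mult[OF W IH el(1)]]]) auto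
    then show ?thesis unfolding True by (rule msmooth_cong[OF W, rotated]) (simp add: \<nu>eq)
  qed (use IH Suc.prems(5) in auto)
qed simp

text \<open>First the system is solved for the vectors made orthogonal to the last one, with
  prescribed values corrected accordingly. Adding a multiple of the conjugate of the last vector
  then adjusts its value and, by orthogonality, no other.\<close>

lemma dual_frame_exists:
  fixes e :: "nat \<Rightarrow> 'm \<Rightarrow> 'e \<Rightarrow> complex"
  assumes W: "open W" and e: "\<And>i b. i < n \<Longrightarrow> b \<in> Basis \<Longrightarrow> msmooth_on A W (\<lambda>q. e i q b)"
    and indep: "\<And>q. q \<in> W \<Longrightarrow> indep_at n e q"
    and \<beta>: "\<And>i. i < n \<Longrightarrow> msmooth_on A W (\<beta> i)"
  shows "\<exists>\<eta>. (\<forall>b\<in>Basis. msmooth_on A W (\<eta> b)) \<and> (\<forall>q\<in>W. \<forall>i<n. (\<Sum>b\<in>Basis. e i q b * \<eta> b q) = \<beta> i q)"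
  using e indep \<beta>
proof (induction n arbitrary: e \<beta>)
  case 0
  show ?case by (rule exI[of _ "\<lambda>b q. 0"]) (simp add: msmooth_const[OF W])
next
  case (Suc n)
  let ?N = "\<lambda>q. herm_pair (e n q) (e n q)"
  note el = msmooth_elim[OF W Suc.prems(1,2)]
  have "\<exists>\<eta>. (\<forall>b\<in>Basis. msmooth_on A W (\<eta> b)) \<and>
     (\<forall>q\<in>W. \<forall>i<n. (\<Sum>b\<in>Basis. elim_vec e n i q b * \<eta> b q) = \<beta> i q - elim_coeff e n i q * \<beta> n q)"
  proof (rule Suc.IH)
    show "msmooth_on A W (\<lambda>q. elim_vec e n i q b)" if "i < n" "b \<in> Basis" for i b
      by (rule el(2)) (use that in auto)
    show "indep_at n (elim_vec e n) q" if "q \<in> W" for q by (rule indep_elim[OF Suc.prems(2)[OF that]])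
    show "msmooth_on A W (\<lambda>q. \<beta> i q - elim_coeff e n i q * \<beta> n q)" if "i < n" for i
      by (rule msmooth_diff[OF W Suc.prems(3) msmooth_mult[OF W el(1) Suc.prems(3)]]) (use that in auto)
  qed
  then obtain \<eta> where \<eta>: "\<And>b. b \<in> Basis \<Longrightarrow> msmooth_on A W (\<eta> b)"
    "\<And>q i. q \<in> W \<Longrightarrow> i < n \<Longrightarrow> (\<Sum>b\<in>Basis. elim_vec e n i q b * \<eta> b q) = \<beta> i q - elim_coeff e n i q * \<beta> n q"
    by blast
  define \<sigma> where "\<sigma> q = (\<beta> n q - (\<Sum>b\<in>Basis. e n q b * \<eta> b q)) / ?N q" for q
  define \<eta>' where "\<eta>' b q = \<eta> b q + \<sigma> q * cnj (e n q b)" for b q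
  have \<sigma>: "msmooth_on A W \<sigma>"
    unfolding \<sigma>_def[abs_def]
    by (rule msmooth_divide[OF W msmooth_diff[OF W Suc.prems(3) msmooth_sum[OF W msmooth_mult[OF W Suc.prems(1) \<eta>(1)]]]
       msmooth_herm_pair[OF W Suc.prems(1,1)] herm_pair_nonzero[OF Suc.prems(2)]]) auto
  have \<eta>': "msmooth_on A W (\<eta>' b)" if "b \<in> Basis" for b
    unfolding \<eta>'_def[abs_def]
    by (rule msmooth_add[OF W \<eta>(1)[OF that] msmooth_mult[OF W \<sigma> msmooth_cnj[OF W Suc.prems(1)[OF lessI that]]]])
  have pair: "(\<Sum>b\<in>Basis. u b * \<eta>' b q) = (\<Sum>b\<in>Basis. u b * \<eta> b q) + \<sigma> q * herm_pair u (e n q)" for u q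
    by (simp add: \<eta>'_def herm_pair_def distrib_left sum.distrib sum_distrib_left mult_ac)
  have n: "(\<Sum>b\<in>Basis. e n q b * \<eta>' b q) = \<beta> n q" if q: "q \<in> W" for q
    unfolding pair using herm_pair_nonzero[OF Suc.prems(2)[OF q]] by (simp add: \<sigma>_def)
  have "(\<Sum>b\<in>Basis. e i q b * \<eta>' b q) = \<beta> i q" if q: "q \<in> W" and i: "i < Suc n" for q i
  proof (cases "i = n")
    case False
    then have i: "i < n" using i by simp
    have "(\<Sum>b\<in>Basis. elim_vec e n i q b * \<eta>' b q) = \<beta> i q - elim_coeff e n i q * \<beta> n q"
      unfolding pair using \<eta>(2)[OF q i] herm_pair_elim[of e n q i, OF herm_pair_nonzero[OF Suc.prems(2)[OF q]]] by simp
    moreover have "(\<Sum>b\<in>Basis. elim_vec e n i q b * \<eta>' b q) = (\<Sum>b\<in>Basis. e i q b * \<eta>' b q) - elim_coeff e n i q * (\<Sum>b\<in>Basis. e n q b * \<eta>' b q)"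
      by (simp add: elim_vec_def left_diff_distrib sum_subtractf sum_distrib_left mult.assoc)
    ultimately show ?thesis using n[OF q] by simp
  qed (use n q in auto)
  then show ?case using \<eta>' by blast
qed

end

section \<open>Frames of an almost-CR structure\<close>

locale almost_CR = atlas A for A :: "('m::{t2_space,second_countable_topology}, 'e::euclidean_space) chart set" +
  fixes T :: "'m \<Rightarrow> 'm tvec set"
  assumes CR: "almost_CR_manifold A T"
begin

text \<open>Independence and span are expressed by indexed coefficient sums, the form in which they
  are applied, instead of through the set of vectors at a point and the injectivity of its
  indexing.\<close>

definition is_frame :: "'m set \<Rightarrow> nat \<Rightarrow> (nat \<Rightarrow> 'm \<Rightarrow> 'm tvec) \<Rightarrow> bool" where
  "is_frame U k E \<longleftrightarrow> open U \<and> (\<forall>l<k. smooth_vfield A U (E l)) \<and>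
     (\<forall>q\<in>U. (\<forall>d. (\<Sum>l<k. cscale (d l) (E l q)) = 0 \<longrightarrow> (\<forall>l<k. d l = 0)) \<and>
        T q = range (\<lambda>d. \<Sum>l<k. cscale (d l) (E l q)))"

lemma frame_exists:
  obtains U k E where "p \<in> U" "is_frame U k E"
proof -
  obtain k where sb: "smooth_subbundle A T k" using CR unfolding almost_CR_manifold_def by blast
  let ?P = "\<lambda>U E. open U \<and> p \<in> U \<and> (\<forall>j<k. smooth_vfield A U (E j)) \<and>
        (\<forall>q\<in>U. inj_on (\<lambda>j. E j q) {..<k} \<and> cvec.independent ((\<lambda>j. E j q) ` {..<k}) \<and>
               T q = cvec.span ((\<lambda>j. E j q) ` {..<k}))"
  have "\<exists>U E. ?P U E" by (rule sb[unfolded smooth_subbundle_def, THEN spec])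
  then obtain U where "\<exists>E. ?P U E" by (rule exE)
  then obtain E where "?P U E" by (rule exE)
  then have U: "open U" "p \<in> U" "\<forall>j<k. smooth_vfield A U (E j)"
    and fr: "\<forall>q\<in>U. inj_on (\<lambda>j. E j q) {..<k} \<and> cvec.independent ((\<lambda>j. E j q) ` {..<k}) \<and>
               T q = cvec.span ((\<lambda>j. E j q) ` {..<k})"
    by simp_all
  have "(\<forall>d. (\<Sum>l<k. cscale (d l) (E l q)) = 0 \<longrightarrow> (\<forall>l<k. d l = 0)) \<and>
        T q = range (\<lambda>d. \<Sum>l<k. cscale (d l) (E l q))" if q: "q \<in> U" for q
  proof (intro conjI allI impI)
    have inj: "inj_on (\<lambda>j. E j q) {..<k}" and ind: "cvec.independent ((\<lambda>j. E j q) ` {..<k})"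
      and Tq: "T q = cvec.span ((\<lambda>j. E j q) ` {..<k})" using fr q by blast+
    have re: "(\<Sum>v\<in>(\<lambda>j. E j q) ` {..<k}. cscale (u v) v) = (\<Sum>l<k. cscale (u (E l q)) (E l q))" for u
      by (rule sum.reindex_cong[OF inj refl refl])
    let ?i = "inv_into {..<k} (\<lambda>j. E j q)"
    have inv: "?i (E l q) = l" if "l < k" for l using inv_into_f_f[OF inj, of l] that by simp
    show "d l = 0" if d: "(\<Sum>l<k. cscale (d l) (E l q)) = 0" and l: "l < k" for d l
    proof -
      have "(\<Sum>v\<in>(\<lambda>j. E j q) ` {..<k}. cscale (d (?i v)) v) = 0"
      proof -
        have "(\<Sum>l<k. cscale (d (?i (E l q))) (E l q)) = (\<Sum>l<k. cscale (d l) (E l q))"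
          by (rule sum.cong[OF refl]) (simp add: inv)
        then show ?thesis unfolding re d .
      qed
      then have "d (?i (E l q)) = 0"
        using cvec.independentD[OF ind finite_imageI[OF finite_lessThan] subset_refl, of "\<lambda>v. d (?i v)" "E l q"] l by blast
      then show ?thesis using inv[OF l] by simp
    qed
    show "T q = range (\<lambda>d. \<Sum>l<k. cscale (d l) (E l q))"
    proof
      show "T q \<subseteq> range (\<lambda>d. \<Sum>l<k. cscale (d l) (E l q))"
        unfolding Tq cvec.span_finite[OF finite_imageI[OF finite_lessThan]] re by auto
      show "range (\<lambda>d. \<Sum>l<k. cscale (d l) (E l q)) \<subseteq> T q"
      proof
        fix x assume "x \<in> range (\<lambda>d. \<Sum>l<k. cscale (d l) (E l q))"
        then obtain d where d: "x = (\<Sum>l<k. cscale (d l) (E l q))" by blast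
        show "x \<in> T q" unfolding d Tq
          by (rule cvec.span_sum, rule cvec.span_scale, rule cvec.span_base) simp
      qed
    qed
  qed
  then have "is_frame U k E" unfolding is_frame_def using U by simp
  then show thesis by (rule that[OF U(2)])
qed

lemma frame_indep: "is_frame U k E \<Longrightarrow> q \<in> U \<Longrightarrow> (\<Sum>l<k. cscale (d l) (E l q)) = 0 \<Longrightarrow> l < k \<Longrightarrow> d l = 0"
  unfolding is_frame_def by blast

lemma T_subspace: "cvec.subspace (T q)"
proof -
  obtain U k E where f: "q \<in> U" "is_frame U k E" by (rule frame_exists)
  then have Tq: "T q = range (\<lambda>d. \<Sum>l<k. cscale (d l) (E l q))" unfolding is_frame_def by blast
  show ?thesis
    unfolding cvec.subspace_def Tq
  proof (intro conjI ballI allI)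
    show "0 \<in> range (\<lambda>d. \<Sum>l<k. cscale (d l) (E l q))"
      by (rule range_eqI[of _ _ "\<lambda>l. 0"]) simp
    fix x y assume x: "x \<in> range (\<lambda>d. \<Sum>l<k. cscale (d l) (E l q))"
    then obtain d where d: "x = (\<Sum>l<k. cscale (d l) (E l q))" by blast
    show "cscale c x \<in> range (\<lambda>d. \<Sum>l<k. cscale (d l) (E l q))" for c
      by (rule range_eqI[of _ _ "\<lambda>l. c * d l"]) (simp add: d cvec.scale_sum_right)
    assume y: "y \<in> range (\<lambda>d. \<Sum>l<k. cscale (d l) (E l q))"
    then obtain d' where d': "y = (\<Sum>l<k. cscale (d' l) (E l q))" by blast
    show "x + y \<in> range (\<lambda>d. \<Sum>l<k. cscale (d l) (E l q))"
      by (rule range_eqI[of _ _ "\<lambda>l. d l + d' l"]) (simp add: d d' cvec.scale_left_distrib sum.distrib)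
  qed
qed

lemma T_ctangent: "T q \<subseteq> ctangent_space A q"
proof -
  obtain U k E where f: "q \<in> U" "is_frame U k E" by (rule frame_exists)
  have "(\<Sum>l<k. cscale (d l) (E l q)) \<in> ctangent_space A q" for d
    using f unfolding is_frame_def
    by (intro cvec.subspace_sum cvec.subspace_scale ctangent_subspace) (auto intro: vfield_ctangent)
  then show ?thesis using f unfolding is_frame_def by auto
qed

lemma T_conj_zero: "X \<in> T q \<Longrightarrow> X = conj_vec Y \<Longrightarrow> Y \<in> T q \<Longrightarrow> X = 0"
  using CR unfolding almost_CR_manifold_def by blast

lemma frame_field: "is_frame U k E \<Longrightarrow> l < k \<Longrightarrow> smooth_vfield A U (E l)"
  by (simp add: is_frame_def)

lemma frame_T: "is_frame U k E \<Longrightarrow> q \<in> U \<Longrightarrow> (\<Sum>l<k. cscale (d l) (E l q)) \<in> T q"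
  by (auto simp: is_frame_def)

text \<open>Coordinates of the frame followed by those of its conjugate. For kernel sections this is
  the family in which the bracket sum is expanded.\<close>

definition full_frame :: "('m \<Rightarrow> 'e) \<Rightarrow> nat \<Rightarrow> (nat \<Rightarrow> 'm \<Rightarrow> 'm tvec) \<Rightarrow> nat \<Rightarrow> 'm \<Rightarrow> 'e \<Rightarrow> complex" where
  "full_frame \<phi> k E i q b = (if i < k then E i q (coord \<phi> b) else conj_vec (E (i - k) q) (coord \<phi> b))"

lemma sum_full_frame:
  "(\<Sum>i<k + k. d i * full_frame \<phi> k E i q b) =
     ((\<Sum>l<k. cscale (d l) (E l q)) + (\<Sum>l<k. cscale (d (k + l)) (conj_vec (E l q)))) (coord \<phi> b)"
proof -
  have "(\<Sum>i<k + k. d i * full_frame \<phi> k E i q b) = (\<Sum>i<k. d i * full_frame \<phi> k E i q b) + (\<Sum>l<k. d (k + l) * full_frame \<phi> k E (k + l) q b)"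
    unfolding lessThan_atLeast0 sum.atLeastLessThan_concat[of 0 k "k + k", symmetric, simplified]
    using sum.shift_bounds_nat_ivl[of "\<lambda>i. d i * full_frame \<phi> k E i q b" 0 k k] by (simp add: add.commute)
  then show ?thesis by (simp add: full_frame_def sum_fun_apply cscale_apply)
qed

text \<open>A vanishing combination exhibits an element of \<open>T q\<close> as the conjugate of
  another one. By the almost-CR condition both are 0, and independence of the frame applies to each
  half.\<close>

lemma full_frame_indep:
  assumes f: "is_frame U k E" and c: "(V, \<phi>) \<in> A" and q: "q \<in> U" "q \<in> V"
  shows "indep_at (k + k) (full_frame \<phi> k E) q"
  unfolding indep_at_def
proof (intro allI impI)
  fix d i assume d: "\<forall>b\<in>Basis. (\<Sum>i<k + k. d i * full_frame \<phi> k E i q b) = 0" and i: "i < k + k"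
  let ?Y = "\<Sum>l<k. cscale (d l) (E l q)" and ?Y' = "\<Sum>l<k. cscale (cnj (d (k + l))) (E l q)"
  have Y: "?Y \<in> T q" "?Y' \<in> T q" by (rule frame_T[OF f q(1)])+
  have Yc: "conj_vec ?Y' = (\<Sum>l<k. cscale (d (k + l)) (conj_vec (E l q)))"
    by (simp add: conj_vec_sum conj_vec_cscale)
  have ct: "?Y + conj_vec ?Y' \<in> ctangent_space A q"
    using Y T_ctangent[of q] by (intro cvec.subspace_add ctangent_subspace ctangent_conj) auto
  have "?Y + conj_vec ?Y' = 0"
    by (rule ctangent_eqI[OF ct cvec.subspace_0[OF ctangent_subspace] c q(2)])
      (use d in \<open>simp add: sum_full_frame Yc\<close>)
  then have e: "?Y = conj_vec (- ?Y')" by (simp add: conj_vec_minus eq_neg_iff_add_eq_0)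
  then have Y0: "?Y = 0" by (rule T_conj_zero[OF Y(1) _ cvec.subspace_neg[OF T_subspace Y(2)]])
  then have "conj_vec (conj_vec (- ?Y')) = 0" using e conj_vec_zero by simp
  then have Y'0: "?Y' = 0" by (simp add: conj_vec_invol)
  show "d i = 0"
  proof (cases "i < k")
    case True
    then show ?thesis by (rule frame_indep[OF f q(1) Y0])
  next
    case False
    then have "i - k < k" "k + (i - k) = i" using i by auto
    then show ?thesis using frame_indep[OF f q(1) Y'0, of "i - k"] by simp
  qed
qed

lemma full_frame_smooth:
  assumes f: "is_frame U k E" and c: "(V, \<phi>) \<in> A" and W: "open W" "W \<subseteq> U" "W \<subseteq> V" and i: "i < k + k"
  shows "msmooth_on A W (\<lambda>q. full_frame \<phi> k E i q b)"
proof -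
  have E: "msmooth_on A W (\<lambda>q. E l q (coord \<phi> b))" if "l < k" for l
    by (rule vfield_smooth[OF frame_field[OF f that] W(1,2) msmooth_subset[OF msmooth_coord[OF c] W(3)]])
  show ?thesis
  proof (cases "i < k")
    case False
    then have "i - k < k" using i by simp
    from msmooth_cnj[OF W(1) E[OF this]] False show ?thesis by (simp add: full_frame_def conj_vec_coord)
  qed (simp add: full_frame_def E)
qed

lemma section_coeffs:
  assumes f: "is_frame U k E" and ch: "(V, \<phi>) \<in> A" and Z: "Z \<in> cr_sections A T U'" and U': "open U'"
  obtains c where "\<And>l. l < k \<Longrightarrow> msmooth_on A (U \<inter> U' \<inter> V) (c l)"
    "\<And>q. q \<in> U \<inter> U' \<inter> V \<Longrightarrow> Z q = (\<Sum>l<k. cscale (c l q) (E l q))"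
proof -
  let ?W = "U \<inter> U' \<inter> V"
  have "\<forall>q. \<exists>d. q \<in> U \<inter> U' \<longrightarrow> Z q = (\<Sum>l<k. cscale (d l) (E l q))"
    using f Z unfolding is_frame_def cr_sections_def by blast
  from choice[OF this] obtain d where d: "\<And>q. q \<in> U \<inter> U' \<Longrightarrow> Z q = (\<Sum>l<k. cscale (d q l) (E l q))" by blast
  have oU: "open U" using f by (simp add: is_frame_def)
  have W: "open ?W" using oU U' chartD(1)[OF ch(1)] by blast
  \<comment> \<open>Zeros on the conjugate half turn the expansion of \<open>Z\<close> into one in
    the full frame.\<close>
  define c where "c i q = (if i < k then d q i else 0)" for i q
  have "msmooth_on A ?W (c l)" if "l < k" for l
  proof (rule frame_coeffs_smooth[OF W, where n="k + k" and e="full_frame \<phi> k E" and s="\<lambda>q b. Z q (coord \<phi> b)"])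
    show "msmooth_on A ?W (\<lambda>q. full_frame \<phi> k E i q b)" if "i < k + k" for i b
      by (rule full_frame_smooth[OF f ch(1) W _ _ that]) auto
    show "indep_at (k + k) (full_frame \<phi> k E) q" if "q \<in> ?W" for q
      by (rule full_frame_indep[OF f ch(1)]) (use that in auto)
    have Zv: "smooth_vfield A U' Z" using Z by (simp add: cr_sections_def)
    show "msmooth_on A ?W (\<lambda>q. Z q (coord \<phi> b))" for b
      by (rule vfield_smooth[OF Zv W _ msmooth_subset[OF msmooth_coord[OF ch(1)]]]) auto
    show "Z q (coord \<phi> b) = (\<Sum>i<k + k. c i q * full_frame \<phi> k E i q b)" if "q \<in> ?W" for q b
      unfolding sum_full_frame using d[of q] that by (simp add: c_def)
  qed (use that in auto)
  then show thesis using that[of c] d by (simp add: c_def)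
qed

end

section \<open>The Levi form and the exterior derivative in a frame\<close>

context atlas
begin

lemma form_combination:
  assumes \<xi>: "real_one_form A U \<xi>" and p: "p \<in> U" and X: "\<And>i. i \<in> I \<Longrightarrow> X i \<in> ctangent_space A p" and I: "finite I"
  shows "\<xi> p (\<Sum>i\<in>I. cscale (c i) (X i)) = (\<Sum>i\<in>I. c i * \<xi> p (X i))"
proof -
  have add: "\<xi> p (X + Y) = \<xi> p X + \<xi> p Y" if "X \<in> ctangent_space A p" "Y \<in> ctangent_space A p" for X Y
    using \<xi> p that unfolding real_one_form_def by blast
  have sc: "\<xi> p (cscale c X) = c * \<xi> p X" if "X \<in> ctangent_space A p" for c X
    using \<xi> p that unfolding real_one_form_def by blast
  have z: "\<xi> p 0 = 0" using sc[OF cvec.subspace_0[OF ctangent_subspace], of 0] by simp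
  show ?thesis
    using I X
  proof (induction I rule: finite_induct)
    case empty
    show ?case by (simp only: sum.empty z)
  next
    case (insert i I)
    have xi: "X i \<in> ctangent_space A p" by (rule insert.prems) simp
    have a: "(\<Sum>i\<in>I. cscale (c i) (X i)) \<in> ctangent_space A p"
      by (intro cvec.subspace_sum cvec.subspace_scale ctangent_subspace) (use insert.prems in auto)
    have b: "cscale (c i) (X i) \<in> ctangent_space A p"
      by (rule cvec.subspace_scale[OF ctangent_subspace xi])
    have ih: "\<xi> p (\<Sum>i\<in>I. cscale (c i) (X i)) = (\<Sum>i\<in>I. c i * \<xi> p (X i))"
      by (rule insert.IH) (use insert.prems in auto)
    show ?case by (simp only: sum.insert[OF insert.hyps] add[OF b a] ih sc[OF xi])
  qed
qed

lemma form_diff: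
  assumes \<xi>: "real_one_form A U \<xi>" and p: "p \<in> U" and X: "X \<in> ctangent_space A p" and Y: "Y \<in> ctangent_space A p"
  shows "\<xi> p (X - Y) = \<xi> p X - \<xi> p Y"
proof -
  have d: "X - Y \<in> ctangent_space A p" by (rule cvec.subspace_diff[OF ctangent_subspace X Y])
  have "\<xi> p ((X - Y) + Y) = \<xi> p (X - Y) + \<xi> p Y"
    using \<xi> p d Y unfolding real_one_form_def by blast
  then show ?thesis by simp
qed

lemma form_add:
  assumes \<xi>: "real_one_form A U \<xi>" and p: "p \<in> U" and X: "X \<in> ctangent_space A p" and Y: "Y \<in> ctangent_space A p"
  shows "\<xi> p (X + Y) = \<xi> p X + \<xi> p Y"
  using \<xi> p X Y unfolding real_one_form_def by blast

lemma form_near: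
  assumes \<xi>: "real_one_form A U \<xi>" and U: "open U" "p \<in> U" and X: "smooth_vfield A U' X" and U': "open U'" "p \<in> U'"
  shows "msmooth_near A p (\<lambda>q. \<xi> q (X q))"
proof (rule nearI)
  have "\<forall>V X. open V \<longrightarrow> V \<subseteq> U \<longrightarrow> smooth_vfield A V X \<longrightarrow> msmooth_on A V (\<lambda>p. \<xi> p (X p))"
    using \<xi> unfolding real_one_form_def by blast
  then show "msmooth_on A (U \<inter> U') (\<lambda>q. \<xi> q (X q))"
    using U(1) U'(1) vfield_subset[OF X, of "U \<inter> U'"] by blast
qed (use U U' in auto)

end

context almost_CR
begin

text \<open>Computed once for two uses: with \<open>F\<close> and \<open>G\<close> derivatives of a
  function it gives the bracket, with values of a 1-form it gives the exterior derivative. The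
  product rule isolates the terms in which a coefficient is differentiated.\<close>

lemma section_pair_expand:
  fixes k :: nat
  assumes Z: "Z = (\<Sum>l<k. cscale (c l p) (E l))" and E: "\<And>l. l < k \<Longrightarrow> E l \<in> ctangent_space A p"
    and c: "\<And>l. l < k \<Longrightarrow> msmooth_near A p (c l)"
    and F: "\<And>l. l < k \<Longrightarrow> msmooth_near A p (F l)" and G: "\<And>l. l < k \<Longrightarrow> msmooth_near A p (G l)"
  shows "Z (\<lambda>q. \<Sum>m<k. cnj (c m q) * F m q) - conj_vec Z (\<lambda>q. \<Sum>l<k. c l q * G l q) =
    (\<Sum>l<k. \<Sum>m<k. c l p * cnj (c m p) * (E l (F m) - conj_vec (E m) (G l)))
      + (\<Sum>m<k. cnj (conj_vec Z (c m)) * F m p) - (\<Sum>l<k. conj_vec Z (c l) * G l p)"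
proof -
  have Zc: "Z \<in> ctangent_space A p"
    unfolding Z by (intro cvec.subspace_sum cvec.subspace_scale ctangent_subspace) (use E in auto)
  note Zb = ctangent_conj[OF Zc]
  have cb: "msmooth_near A p (\<lambda>q. cnj (c m q))" if "m < k" for m using near_cnj[OF c[OF that]] .
  have Zcb: "Z (\<lambda>q. cnj (c m q)) = cnj (conj_vec Z (c m))" for m by (simp add: conj_vec_apply)
  have Zap: "Z f = (\<Sum>l<k. c l p * E l f)" for f by (subst Z) (simp add: sum_fun_apply cscale_apply)
  have Zbap: "conj_vec Z f = (\<Sum>m<k. cnj (c m p) * conj_vec (E m) f)" for f
    by (subst Z) (simp add: conj_vec_sum conj_vec_cscale sum_fun_apply cscale_apply)
  have 1: "Z (\<lambda>q. \<Sum>m<k. cnj (c m q) * F m q) = (\<Sum>m<k. cnj (c m p) * Z (F m) + cnj (conj_vec Z (c m)) * F m p)"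
  proof -
    have "Z (\<lambda>q. \<Sum>m<k. cnj (c m q) * F m q) = (\<Sum>m<k. Z (\<lambda>q. cnj (c m q) * F m q))"
      by (rule ctangent_sum[OF Zc, of "{..<k}" "\<lambda>m q. cnj (c m q) * F m q"]) (use near_mult cb F in auto)
    also have "\<dots> = (\<Sum>m<k. cnj (c m p) * Z (F m) + cnj (conj_vec Z (c m)) * F m p)"
      by (rule sum.cong[OF refl]) (simp add: ctangent_mult[OF Zc cb F] Zcb)
    finally show ?thesis .
  qed
  have 2: "conj_vec Z (\<lambda>q. \<Sum>l<k. c l q * G l q) = (\<Sum>l<k. c l p * conj_vec Z (G l) + conj_vec Z (c l) * G l p)"
  proof -
    have "conj_vec Z (\<lambda>q. \<Sum>l<k. c l q * G l q) = (\<Sum>l<k. conj_vec Z (\<lambda>q. c l q * G l q))"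
      by (rule ctangent_sum[OF Zb, of "{..<k}" "\<lambda>l q. c l q * G l q"]) (use near_mult c G in auto)
    also have "\<dots> = (\<Sum>l<k. c l p * conj_vec Z (G l) + conj_vec Z (c l) * G l p)"
      by (rule sum.cong[OF refl]) (simp add: ctangent_mult[OF Zb c G])
    finally show ?thesis .
  qed
  have 3: "(\<Sum>m<k. cnj (c m p) * Z (F m)) = (\<Sum>l<k. \<Sum>m<k. c l p * cnj (c m p) * E l (F m))"
    unfolding Zap sum_distrib_left by (subst sum.swap) (simp add: mult_ac)
  have 4: "(\<Sum>l<k. c l p * conj_vec Z (G l)) = (\<Sum>l<k. \<Sum>m<k. c l p * cnj (c m p) * conj_vec (E m) (G l))"
    unfolding Zbap sum_distrib_left by (simp add: mult_ac)
  show ?thesis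
    unfolding 1 2 sum.distrib 3 4 by (simp add: right_diff_distrib sum_subtractf)
qed

text \<open>Tensoriality of the Levi form: differentiated coefficients contribute only
  \<open>conj_vec Y - Y\<close> with \<open>Y\<close> in \<open>T p\<close>. In the exterior
  derivative they cancel against the value of \<xi> on that part of the bracket, so the dependence
  on the coefficients is purely pointwise.\<close>

lemma bracket_frame:
  assumes f: "is_frame U k E" and p: "p \<in> U" and Z: "Z \<in> cr_sections A T U'" and U': "open U'" "p \<in> U'"
  shows "\<exists>c Y. Z p = (\<Sum>l<k. cscale (c l) (E l p)) \<and> Y \<in> T p \<and>
     lie_bracket A Z (conj_field Z) p =
       (\<Sum>l<k. \<Sum>m<k. cscale (c l * cnj (c m)) (lie_bracket A (E l) (conj_field (E m)) p)) + (conj_vec Y - Y) \<and>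
     (\<forall>W \<xi>. open W \<longrightarrow> p \<in> W \<longrightarrow> real_one_form A W \<xi> \<longrightarrow>
       ext_deriv A \<xi> Z (conj_field Z) p = (\<Sum>l<k. \<Sum>m<k. c l * cnj (c m) * ext_deriv A \<xi> (E l) (conj_field (E m)) p))"
proof -
  obtain V \<phi> where ch: "(V, \<phi>) \<in> A" "p \<in> V" by (rule chart_exists)
  obtain c where c: "\<And>l. l < k \<Longrightarrow> msmooth_on A (U \<inter> U' \<inter> V) (c l)"
    "\<And>q. q \<in> U \<inter> U' \<inter> V \<Longrightarrow> Z q = (\<Sum>l<k. cscale (c l q) (E l q))"
    using section_coeffs[OF f ch(1) Z U'(1)] by blast
  let ?W = "U \<inter> U' \<inter> V"
  have U: "open U" using f by (simp add: is_frame_def)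
  have W: "open ?W" "p \<in> ?W" using U U' p ch chartD(1)[OF ch(1)] by auto
  have cn: "msmooth_near A p (c l)" if "l < k" for l using nearI[OF W c(1)[OF that]] .
  note E = frame_field[OF f]
  have Ec: "E l q \<in> ctangent_space A q" if "l < k" "q \<in> U" for l q using vfield_ctangent[OF E] that by blast
  have Zv: "smooth_vfield A U' Z" using Z by (simp add: cr_sections_def)
  have Zc: "Z p \<in> ctangent_space A p" using vfield_ctangent[OF Zv U'(2)] .
  have Zp: "Z p = (\<Sum>l<k. cscale (c l p) (E l p))" using c(2) W(2) by blast
  \<comment> \<open>Derivatives of the coefficients along conj Z give \<open>Y\<close>; those of the
    conjugate coefficients along Z give its conjugate.\<close>
  define Y where "Y = (\<Sum>m<k. cscale (conj_vec (Z p) (c m)) (E m p))"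
  have Y: "Y \<in> T p" unfolding Y_def by (rule frame_T[OF f p])
  have Yb: "conj_vec Y = (\<Sum>m<k. cscale (cnj (conj_vec (Z p) (c m))) (conj_vec (E m p)))"
    by (simp add: Y_def conj_vec_sum conj_vec_cscale)
  have Zbq: "conj_vec (Z q) = (\<Sum>m<k. cscale (cnj (c m q)) (conj_vec (E m q)))" if "q \<in> ?W" for q
    by (simp add: c(2)[OF that] conj_vec_sum conj_vec_cscale)
  have br: "lie_bracket A Z (conj_field Z) p =
       (\<Sum>l<k. \<Sum>m<k. cscale (c l p * cnj (c m p)) (lie_bracket A (E l) (conj_field (E m)) p)) + (conj_vec Y - Y)"
  proof
    fix g
    show "lie_bracket A Z (conj_field Z) p g =
       ((\<Sum>l<k. \<Sum>m<k. cscale (c l p * cnj (c m p)) (lie_bracket A (E l) (conj_field (E m)) p)) + (conj_vec Y - Y)) g"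
    proof (cases "msmooth_near A p g")
      case True
      have Fn: "msmooth_near A p (\<lambda>q. conj_vec (E l q) g)" if "l < k" for l
        using vfield_near[OF vfield_conj[OF E[OF that]] U p True] by (simp add: conj_field_def)
      have Gn: "msmooth_near A p (\<lambda>q. E l q g)" if "l < k" for l
        using vfield_near[OF E[OF that] U p True] .
      have "Z p (\<lambda>q. conj_vec (Z q) g) = Z p (\<lambda>q. \<Sum>m<k. cnj (c m q) * conj_vec (E m q) g)"
        by (rule ctangent_local[OF Zc W]) (simp add: Zbq sum_fun_apply cscale_apply)
      moreover have "conj_vec (Z p) (\<lambda>q. Z q g) = conj_vec (Z p) (\<lambda>q. \<Sum>l<k. c l q * E l q g)"
        by (rule ctangent_local[OF ctangent_conj[OF Zc] W]) (simp add: c(2) sum_fun_apply cscale_apply)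
      ultimately have "lie_bracket A Z (conj_field Z) p g =
         Z p (\<lambda>q. \<Sum>m<k. cnj (c m q) * conj_vec (E m q) g) - conj_vec (Z p) (\<lambda>q. \<Sum>l<k. c l q * E l q g)"
        by (simp add: bracket_apply[OF True] conj_field_def)
      also have "\<dots> = (\<Sum>l<k. \<Sum>m<k. c l p * cnj (c m p) * (E l p (\<lambda>q. conj_vec (E m q) g) - conj_vec (E m p) (\<lambda>q. E l q g)))
        + (\<Sum>m<k. cnj (conj_vec (Z p) (c m)) * conj_vec (E m p) g) - (\<Sum>l<k. conj_vec (Z p) (c l) * E l p g)"
        by (rule section_pair_expand[OF Zp Ec[OF _ p] cn Fn Gn])
      also have "\<dots> = ((\<Sum>l<k. \<Sum>m<k. cscale (c l p * cnj (c m p)) (lie_bracket A (E l) (conj_field (E m)) p)) + (conj_vec Y - Y)) g"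
        unfolding Yb by (simp add: Y_def sum_fun_apply cscale_apply bracket_apply[OF True] conj_field_def)
      finally show ?thesis .
    next
      case False
      have "Y g = 0" "conj_vec Y g = 0"
        using ctangent_zero[OF _ False] Y T_ctangent[of p] ctangent_conj by blast+
      then show ?thesis using False by (simp add: lie_bracket_def sum_fun_apply cscale_apply)
    qed
  qed
  have ex: "ext_deriv A \<xi> Z (conj_field Z) p = (\<Sum>l<k. \<Sum>m<k. c l p * cnj (c m p) * ext_deriv A \<xi> (E l) (conj_field (E m)) p)"
    if WW: "open WW" "p \<in> WW" and \<xi>: "real_one_form A WW \<xi>" for WW \<xi>
  proof -
    have Fn: "msmooth_near A p (\<lambda>q. \<xi> q (conj_vec (E l q)))" if "l < k" for l
      using form_near[OF \<xi> WW vfield_conj[OF E[OF that]] U p] by (simp add: conj_field_def)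
    have Gn: "msmooth_near A p (\<lambda>q. \<xi> q (E l q))" if "l < k" for l
      using form_near[OF \<xi> WW E[OF that] U p] .
    have WO: "open (?W \<inter> WW)" "p \<in> ?W \<inter> WW" using W WW by auto
    have "Z p (\<lambda>q. \<xi> q (conj_vec (Z q))) = Z p (\<lambda>q. \<Sum>m<k. cnj (c m q) * \<xi> q (conj_vec (E m q)))"
    proof (rule ctangent_local[OF Zc WO])
      fix q assume q: "q \<in> ?W \<inter> WW"
      then show "\<xi> q (conj_vec (Z q)) = (\<Sum>m<k. cnj (c m q) * \<xi> q (conj_vec (E m q)))"
        using form_combination[OF \<xi>, of q "{..<k}" "\<lambda>m. conj_vec (E m q)" "\<lambda>m. cnj (c m q)"] ctangent_conj[OF Ec]
        by (simp add: Zbq)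
    qed
    moreover have "conj_vec (Z p) (\<lambda>q. \<xi> q (Z q)) = conj_vec (Z p) (\<lambda>q. \<Sum>l<k. c l q * \<xi> q (E l q))"
    proof (rule ctangent_local[OF ctangent_conj[OF Zc] WO])
      fix q assume q: "q \<in> ?W \<inter> WW"
      then show "\<xi> q (Z q) = (\<Sum>l<k. c l q * \<xi> q (E l q))"
        using form_combination[OF \<xi>, of q "{..<k}" "\<lambda>m. E m q" "\<lambda>m. c m q"] Ec by (simp add: c(2))
    qed
    ultimately have 1: "Z p (\<lambda>q. \<xi> q (conj_vec (Z q))) - conj_vec (Z p) (\<lambda>q. \<xi> q (Z q)) =
      (\<Sum>l<k. \<Sum>m<k. c l p * cnj (c m p) * (E l p (\<lambda>q. \<xi> q (conj_vec (E m q))) - conj_vec (E m p) (\<lambda>q. \<xi> q (E l q))))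
        + (\<Sum>m<k. cnj (conj_vec (Z p) (c m)) * \<xi> p (conj_vec (E m p))) - (\<Sum>l<k. conj_vec (Z p) (c l) * \<xi> p (E l p))"
      using section_pair_expand[OF Zp Ec[OF _ p] cn Fn Gn] by simp
    let ?B = "\<lambda>l m. lie_bracket A (E l) (conj_field (E m)) p"
    have B: "?B l m \<in> ctangent_space A p" if "l < k" "m < k" for l m
      by (rule bracket_ctangent[OF E[OF that(1)] vfield_conj[OF E[OF that(2)]] U p])
    have Bs: "(\<Sum>m<k. cscale (c l p * cnj (c m p)) (?B l m)) \<in> ctangent_space A p" if "l < k" for l
      by (intro cvec.subspace_sum cvec.subspace_scale ctangent_subspace) (use B that in auto)
    have Yc: "Y \<in> ctangent_space A p" "conj_vec Y \<in> ctangent_space A p"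
      using Y T_ctangent[of p] ctangent_conj by blast+
    have "\<xi> p (\<Sum>l<k. \<Sum>m<k. cscale (c l p * cnj (c m p)) (?B l m)) = (\<Sum>l<k. \<xi> p (\<Sum>m<k. cscale (c l p * cnj (c m p)) (?B l m)))"
      using form_combination[OF \<xi> WW(2), of "{..<k}" "\<lambda>l. \<Sum>m<k. cscale (c l p * cnj (c m p)) (?B l m)" "\<lambda>_. 1"] Bs by simp
    also have "\<dots> = (\<Sum>l<k. \<Sum>m<k. c l p * cnj (c m p) * \<xi> p (?B l m))"
      by (rule sum.cong[OF refl], rule form_combination[OF \<xi> WW(2)]) (use B in auto)
    finally have 2: "\<xi> p (\<Sum>l<k. \<Sum>m<k. cscale (c l p * cnj (c m p)) (?B l m)) = (\<Sum>l<k. \<Sum>m<k. c l p * cnj (c m p) * \<xi> p (?B l m))" .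
    have 3: "\<xi> p (conj_vec Y) = (\<Sum>m<k. cnj (conj_vec (Z p) (c m)) * \<xi> p (conj_vec (E m p)))"
      unfolding Yb by (rule form_combination[OF \<xi> WW(2)]) (use ctangent_conj[OF Ec[OF _ p]] in auto)
    have 4: "\<xi> p Y = (\<Sum>m<k. conj_vec (Z p) (c m) * \<xi> p (E m p))"
      unfolding Y_def by (rule form_combination[OF \<xi> WW(2)]) (use Ec[OF _ p] in auto)
    have "(\<Sum>l<k. \<Sum>m<k. cscale (c l p * cnj (c m p)) (?B l m)) \<in> ctangent_space A p"
      by (rule cvec.subspace_sum[OF ctangent_subspace]) (use Bs in auto)
    then have "\<xi> p (lie_bracket A Z (conj_field Z) p) =
      (\<Sum>l<k. \<Sum>m<k. c l p * cnj (c m p) * \<xi> p (?B l m)) + (\<xi> p (conj_vec Y) - \<xi> p Y)"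
      unfolding br 2[symmetric]
      by (simp add: form_add[OF \<xi> WW(2)] form_diff[OF \<xi> WW(2)] Yc cvec.subspace_diff[OF ctangent_subspace])
    then show ?thesis
      using 1 unfolding ext_deriv_def 3 4
      by (simp add: conj_field_def right_diff_distrib sum_subtractf)
  qed
  show ?thesis
    by (rule exI[of _ "\<lambda>l. c l p"], rule exI[of _ Y]) (use Zp Y br ex in blast)
qed

text \<open>\<open>h\<close> is the matrix of the represented tensor in the frame. Tensor, brackets
  and exterior derivatives are all expressed through \<open>h\<close>, the brackets up to the vector
  \<open>Y\<close>.\<close>

definition frame_rep where
  "frame_rep p (k::nat) E (r::nat) Z h Y \<longleftrightarrow>
     (\<forall>g g'. (\<Sum>j<r. herm_tensor (Z j p)) g g' = (\<Sum>l<k. \<Sum>m<k. h l m * (E l p g * conj_vec (E m p) g'))) \<and>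
     Y \<in> T p \<and>
     (\<Sum>j<r. lie_bracket A (Z j) (conj_field (Z j)) p) =
       (\<Sum>l<k. \<Sum>m<k. cscale (h l m) (lie_bracket A (E l) (conj_field (E m)) p)) + (conj_vec Y - Y) \<and>
     (\<forall>W \<xi>. open W \<longrightarrow> p \<in> W \<longrightarrow> real_one_form A W \<xi> \<longrightarrow>
       (\<Sum>j<r. ext_deriv A \<xi> (Z j) (conj_field (Z j)) p) =
       (\<Sum>l<k. \<Sum>m<k. h l m * ext_deriv A \<xi> (E l) (conj_field (E m)) p))"

lemma frame_repD:
  assumes "frame_rep p k E r Z h Y"
  shows "(\<Sum>j<r. herm_tensor (Z j p)) g g' = (\<Sum>l<k. \<Sum>m<k. h l m * (E l p g * conj_vec (E m p) g'))"
    and "Y \<in> T p"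
    and "(\<Sum>j<r. lie_bracket A (Z j) (conj_field (Z j)) p) =
       (\<Sum>l<k. \<Sum>m<k. cscale (h l m) (lie_bracket A (E l) (conj_field (E m)) p)) + (conj_vec Y - Y)"
    and "open W \<Longrightarrow> p \<in> W \<Longrightarrow> real_one_form A W \<xi> \<Longrightarrow>
       (\<Sum>j<r. ext_deriv A \<xi> (Z j) (conj_field (Z j)) p) =
       (\<Sum>l<k. \<Sum>m<k. h l m * ext_deriv A \<xi> (E l) (conj_field (E m)) p)"
proof -
  note d = assms[unfolded frame_rep_def]
  show "(\<Sum>j<r. herm_tensor (Z j p)) g g' = (\<Sum>l<k. \<Sum>m<k. h l m * (E l p g * conj_vec (E m p) g'))"
    by (rule d[THEN conjunct1, THEN spec, THEN spec])
  show "Y \<in> T p" by (rule d[THEN conjunct2, THEN conjunct1])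
  show "(\<Sum>j<r. lie_bracket A (Z j) (conj_field (Z j)) p) =
       (\<Sum>l<k. \<Sum>m<k. cscale (h l m) (lie_bracket A (E l) (conj_field (E m)) p)) + (conj_vec Y - Y)"
    by (rule d[THEN conjunct2, THEN conjunct2, THEN conjunct1])
  show "open W \<Longrightarrow> p \<in> W \<Longrightarrow> real_one_form A W \<xi> \<Longrightarrow>
       (\<Sum>j<r. ext_deriv A \<xi> (Z j) (conj_field (Z j)) p) =
       (\<Sum>l<k. \<Sum>m<k. h l m * ext_deriv A \<xi> (E l) (conj_field (E m)) p)"
    by (rule d[THEN conjunct2, THEN conjunct2, THEN conjunct2, THEN spec, THEN spec, THEN mp, THEN mp, THEN mp])
qed

lemma bracket_frame_sum:
  fixes r :: nat
  assumes f: "is_frame U k E" and p: "p \<in> U" and Z: "\<And>j. j < r \<Longrightarrow> Z j \<in> cr_sections A T U'" and U': "open U'" "p \<in> U'"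
  shows "\<exists>h Y. frame_rep p k E r Z h Y"
proof -
  let ?B = "\<lambda>l m. lie_bracket A (E l) (conj_field (E m)) p"
  define P where "P j c Y \<longleftrightarrow> Z j p = (\<Sum>l<k. cscale (c l) (E l p)) \<and> Y \<in> T p \<and>
     lie_bracket A (Z j) (conj_field (Z j)) p = (\<Sum>l<k. \<Sum>m<k. cscale (c l * cnj (c m)) (?B l m)) + (conj_vec Y - Y) \<and>
     (\<forall>W \<xi>. open W \<longrightarrow> p \<in> W \<longrightarrow> real_one_form A W \<xi> \<longrightarrow>
       ext_deriv A \<xi> (Z j) (conj_field (Z j)) p = (\<Sum>l<k. \<Sum>m<k. c l * cnj (c m) * ext_deriv A \<xi> (E l) (conj_field (E m)) p))" for j c Y
  have "\<exists>c Y. P j c Y" if "j < r" for j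
    unfolding P_def by (rule bracket_frame[OF f p Z[OF that] U'])
  then have "\<forall>j. \<exists>c. j < r \<longrightarrow> (\<exists>Y. P j c Y)" by blast
  from choice[OF this] obtain c where "\<forall>j. j < r \<longrightarrow> (\<exists>Y. P j (c j) Y)" by blast
  then have "\<forall>j. \<exists>Y. j < r \<longrightarrow> P j (c j) Y" by blast
  from choice[OF this] obtain Y where cY: "\<And>j. j < r \<Longrightarrow> P j (c j) (Y j)" by blast
  note D = cY[unfolded P_def]
  note Zp = D[THEN conjunct1] and YT = D[THEN conjunct2, THEN conjunct1]
    and br = D[THEN conjunct2, THEN conjunct2, THEN conjunct1]
    and ex = D[THEN conjunct2, THEN conjunct2, THEN conjunct2, THEN spec, THEN spec, THEN mp, THEN mp, THEN mp]
  define h where "h l m = (\<Sum>j<r. c j l * cnj (c j m))" for l m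
  have "frame_rep p k E r Z h (\<Sum>j<r. Y j)"
    unfolding frame_rep_def
  proof (intro conjI allI impI)
    fix g g'
    have "herm_tensor (Z j p) g g' = (\<Sum>l<k. \<Sum>m<k. (c j l * cnj (c j m)) * (E l p g * conj_vec (E m p) g'))" if "j < r" for j
    proof -
      show ?thesis
        unfolding herm_tensor_def Zp[OF that] conj_vec_sum conj_vec_cscale sum_fun_apply cscale_apply sum_product
        by (simp add: mult_ac)
    qed
    then have "(\<Sum>j<r. herm_tensor (Z j p)) g g' = (\<Sum>j<r. \<Sum>l<k. \<Sum>m<k. (c j l * cnj (c j m)) * (E l p g * conj_vec (E m p) g'))"
      by (simp add: sum_fun_apply)
    also have "\<dots> = (\<Sum>l<k. \<Sum>m<k. \<Sum>j<r. (c j l * cnj (c j m)) * (E l p g * conj_vec (E m p) g'))"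
      by (subst sum.swap) (intro sum.cong refl sum.swap)
    finally show "(\<Sum>j<r. herm_tensor (Z j p)) g g' = (\<Sum>l<k. \<Sum>m<k. h l m * (E l p g * conj_vec (E m p) g'))"
      by (simp add: h_def sum_distrib_right)
  next
    show "(\<Sum>j<r. Y j) \<in> T p"
      by (rule cvec.subspace_sum[OF T_subspace]) (simp add: YT)
  next
    have "(\<Sum>j<r. lie_bracket A (Z j) (conj_field (Z j)) p) = (\<Sum>j<r. (\<Sum>l<k. \<Sum>m<k. cscale (c j l * cnj (c j m)) (?B l m)) + (conj_vec (Y j) - Y j))"
      by (rule sum.cong[OF refl], rule br) simp
    also have "\<dots> = (\<Sum>j<r. \<Sum>l<k. \<Sum>m<k. cscale (c j l * cnj (c j m)) (?B l m)) + (conj_vec (\<Sum>j<r. Y j) - (\<Sum>j<r. Y j))"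
      by (simp only: sum.distrib sum_subtractf conj_vec_sum)
    also have "(\<Sum>j<r. \<Sum>l<k. \<Sum>m<k. cscale (c j l * cnj (c j m)) (?B l m)) = (\<Sum>l<k. \<Sum>m<k. \<Sum>j<r. cscale (c j l * cnj (c j m)) (?B l m))"
      by (subst sum.swap) (intro sum.cong refl sum.swap)
    finally show "(\<Sum>j<r. lie_bracket A (Z j) (conj_field (Z j)) p) =
       (\<Sum>l<k. \<Sum>m<k. cscale (h l m) (?B l m)) + (conj_vec (\<Sum>j<r. Y j) - (\<Sum>j<r. Y j))"
      by (simp only: h_def cvec.scale_sum_left)
  next
    fix W \<xi> assume W: "open W" "p \<in> W" "real_one_form A W \<xi>"
    have "(\<Sum>j<r. ext_deriv A \<xi> (Z j) (conj_field (Z j)) p) = (\<Sum>j<r. \<Sum>l<k. \<Sum>m<k. c j l * cnj (c j m) * ext_deriv A \<xi> (E l) (conj_field (E m)) p)"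
      by (rule sum.cong[OF refl], rule ex[OF _ W]) simp
    also have "\<dots> = (\<Sum>l<k. \<Sum>m<k. \<Sum>j<r. c j l * cnj (c j m) * ext_deriv A \<xi> (E l) (conj_field (E m)) p)"
      by (subst sum.swap) (intro sum.cong refl sum.swap)
    finally show "(\<Sum>j<r. ext_deriv A \<xi> (Z j) (conj_field (Z j)) p) = (\<Sum>l<k. \<Sum>m<k. h l m * ext_deriv A \<xi> (E l) (conj_field (E m)) p)"
      by (simp only: h_def sum_distrib_right)
  qed
  then show ?thesis by blast
qed

text \<open>Independence of the frame is applied twice: first in the argument \<open>g\<close>,
  then, after conjugation, in \<open>g'\<close>.\<close>

lemma tensor_coeffs_unique:
  assumes f: "is_frame U k E" and p: "p \<in> U"
    and eq: "\<And>g g'. (\<Sum>l<k. \<Sum>m<k. h l m * (E l p g * conj_vec (E m p) g')) = (\<Sum>l<k. \<Sum>m<k. h' l m * (E l p g * conj_vec (E m p) g'))"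
    and lm: "l < k" "m < k"
  shows "h l m = h' l m"
proof -
  note ind = frame_indep[OF f p]
  let ?d = "\<lambda>l m. h l m - h' l m"
  have d: "(\<Sum>m<k. ?d l m * conj_vec (E m p) g') = 0" if "l < k" for l g'
  proof (rule ind[OF _ that])
    show "(\<Sum>l<k. cscale (\<Sum>m<k. ?d l m * conj_vec (E m p) g') (E l p)) = 0"
    proof
      fix g
      have "(\<Sum>l<k. cscale (\<Sum>m<k. ?d l m * conj_vec (E m p) g') (E l p)) g =
        (\<Sum>l<k. \<Sum>m<k. h l m * (E l p g * conj_vec (E m p) g')) - (\<Sum>l<k. \<Sum>m<k. h' l m * (E l p g * conj_vec (E m p) g'))"
        unfolding sum_fun_apply cscale_apply sum_subtractf[symmetric] sum_distrib_right
        by (intro sum.cong refl) (simp add: algebra_simps)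
      then show "(\<Sum>l<k. cscale (\<Sum>m<k. ?d l m * conj_vec (E m p) g') (E l p)) g = 0 g" by (simp add: eq)
    qed
  qed
  have "conj_vec (\<Sum>m<k. cscale (cnj (?d l m)) (E m p)) = 0"
    by (rule ext) (simp add: conj_vec_sum conj_vec_cscale sum_fun_apply cscale_apply d[OF lm(1)] del: complex_cnj_diff)
  then have "conj_vec (conj_vec (\<Sum>m<k. cscale (cnj (?d l m)) (E m p))) = 0" by (simp only: conj_vec_zero)
  then have "(\<Sum>m<k. cscale (cnj (?d l m)) (E m p)) = 0" by (simp only: conj_vec_invol)
  from ind[OF this lm(2)] show ?thesis by simp
qed

text \<open>Equal tensors have the same matrix in a frame, and that matrix determines the rest. This
  makes the definite descriptions behind \<open>levi_form\<close> and \<open>ddc\<close> well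
  defined.\<close>

lemma representation_independent:
  fixes r r' :: nat
  assumes Z: "\<And>j. j < r \<Longrightarrow> Z j \<in> cr_sections A T U" and U: "open U" "p \<in> U"
    and Z': "\<And>j. j < r' \<Longrightarrow> Z' j \<in> cr_sections A T U'" and U': "open U'" "p \<in> U'"
    and eq: "(\<Sum>j<r. herm_tensor (Z j p)) = (\<Sum>j<r'. herm_tensor (Z' j p))"
  shows "\<exists>Y\<in>T p. (\<Sum>j<r. lie_bracket A (Z j) (conj_field (Z j)) p) =
      (\<Sum>j<r'. lie_bracket A (Z' j) (conj_field (Z' j)) p) + (conj_vec Y - Y)" (is ?thesis1)
    and "open W \<Longrightarrow> p \<in> W \<Longrightarrow> real_one_form A W \<xi> \<Longrightarrow>
      (\<Sum>j<r. ext_deriv A \<xi> (Z j) (conj_field (Z j)) p) = (\<Sum>j<r'. ext_deriv A \<xi> (Z' j) (conj_field (Z' j)) p)"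
proof -
  obtain V k E where f: "p \<in> V" "is_frame V k E" by (rule frame_exists)
  obtain h Y where fr: "frame_rep p k E r Z h Y"
    using bracket_frame_sum[where r=r and Z=Z and U'=U, OF f(2,1) Z U] by blast
  obtain h' Y' where fr': "frame_rep p k E r' Z' h' Y'"
    using bracket_frame_sum[where r=r' and Z=Z' and U'=U', OF f(2,1) Z' U'] by blast
  note h = frame_repD[OF fr] and h' = frame_repD[OF fr']
  have hh: "h l m = h' l m" if "l < k" "m < k" for l m
    by (rule tensor_coeffs_unique[OF f(2,1) _ that]) (simp only: h(1)[symmetric] h'(1)[symmetric] eq)
  have 1: "(\<Sum>l<k. \<Sum>m<k. cscale (h l m) (lie_bracket A (E l) (conj_field (E m)) p)) = (\<Sum>l<k. \<Sum>m<k. cscale (h' l m) (lie_bracket A (E l) (conj_field (E m)) p))"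
    by (intro sum.cong refl) (simp add: hh)
  have "Y - Y' \<in> T p" by (rule cvec.subspace_diff[OF T_subspace h(2) h'(2)])
  moreover have "conj_vec (Y - Y') = conj_vec Y - conj_vec Y'"
    using conj_vec_add[of Y "- Y'"] by (simp add: conj_vec_minus)
  ultimately show ?thesis1
    by (intro bexI[of _ "Y - Y'"]) (simp_all add: h(3) h'(3) 1)
  show "open W \<Longrightarrow> p \<in> W \<Longrightarrow> real_one_form A W \<xi> \<Longrightarrow>
      (\<Sum>j<r. ext_deriv A \<xi> (Z j) (conj_field (Z j)) p) = (\<Sum>j<r'. ext_deriv A \<xi> (Z' j) (conj_field (Z' j)) p)"
    unfolding h(4) h'(4) by (intro sum.cong refl) (simp add: hh)
qed

section \<open>The quotient by HM and sections of the kernel of the Levi form\<close>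

lemma re_vec_add: "re_vec (X + Y) = re_vec X + re_vec Y"
  by (simp add: re_vec_def conj_vec_add cvec.scale_right_distrib add_ac)

lemma re_vec_minus: "re_vec (- X) = - re_vec X"
  by (simp add: re_vec_def conj_vec_minus cvec.scale_minus_right cvec.scale_right_diff_distrib cvec.scale_right_distrib)

lemma HM_add: "X \<in> HM T p \<Longrightarrow> Y \<in> HM T p \<Longrightarrow> X + Y \<in> HM T p"
  unfolding HM_def using cvec.subspace_add[OF T_subspace[of p]] by (auto simp: re_vec_add[symmetric])

lemma HM_minus: "X \<in> HM T p \<Longrightarrow> - X \<in> HM T p"
  unfolding HM_def using cvec.subspace_neg[OF T_subspace[of p]] by (auto simp: re_vec_minus[symmetric])

lemma HM_zero: "0 \<in> HM T p"
proof -
  have "re_vec 0 = (0 :: 'm tvec)" by (simp add: re_vec_def conj_vec_zero)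
  then show ?thesis unfolding HM_def using cvec.subspace_0[OF T_subspace[of p]] by (metis image_eqI)
qed

lemma quot_proj_eqI:
  assumes "X - X' \<in> HM T p"
  shows "quot_proj T p X = quot_proj T p X'"
proof -
  have *: "quot_proj T p X \<subseteq> quot_proj T p X'" if d: "X - X' \<in> HM T p" for X X'
  proof
    fix V assume "V \<in> quot_proj T p X"
    then obtain Y where Y: "V = X + Y" "Y \<in> HM T p" unfolding quot_proj_def by blast
    have "V = X' + ((X - X') + Y)" by (simp add: Y(1))
    then show "V \<in> quot_proj T p X'" unfolding quot_proj_def using HM_add[OF d Y(2)] by blast
  qed
  have "X' - X \<in> HM T p" using HM_minus[OF assms] by simp
  then show ?thesis using *[OF assms] *[of X' X] by blast
qed

lemma quot_proj_zeroD: "quot_proj T p X = quot_proj T p 0 \<Longrightarrow> X \<in> HM T p"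
proof -
  assume e: "quot_proj T p X = quot_proj T p 0"
  have "X + 0 \<in> quot_proj T p X" unfolding quot_proj_def using HM_zero by blast
  then have "X + 0 \<in> quot_proj T p 0" by (simp only: e)
  then obtain Y where "X + 0 = 0 + Y" "Y \<in> HM T p" unfolding quot_proj_def by blast
  then show ?thesis by (simp only: add_0_right add_0_left)
qed

text \<open>The definite description is evaluated on the given sections, since another
  representation changes the bracket sum only by a vector that dies in the quotient. Membership in
  the kernel then says that -i times the bracket sum is the real part of a vector in
  \<open>T p\<close>.\<close>

lemma ker_levi_bracket:
  fixes r :: nat
  assumes \<tau>: "\<tau> \<in> ker_levi A T p" and Z: "\<And>j. j < r \<Longrightarrow> Z j \<in> cr_sections A T U" and U: "open U" "p \<in> U"
    and rep: "\<tau> = (\<Sum>j<r. herm_tensor (Z j p))"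
  obtains L where "L \<in> T p" "(\<Sum>j<r. lie_bracket A (Z j) (conj_field (Z j)) p) = conj_vec L - L"
proof -
  let ?S = "\<lambda>(r::nat) Z. \<Sum>j<r. lie_bracket A (Z j) (conj_field (Z j)) p"
  have sc: "- (\<Sum>j<r. cscale \<i> (lie_bracket A (Z j) (conj_field (Z j)) p)) = cscale (- \<i>) (?S r Z)" for r :: nat and Z
    by (simp add: cvec.scale_sum_right[symmetric] cvec.scale_minus_left)
  have "levi_form A T p \<tau> = quot_proj T p (cscale (- \<i>) (?S r Z))"
    unfolding levi_form_def sc
  proof (rule the_equality)
    show "\<exists>U r' Z'. open U \<and> p \<in> U \<and> (\<forall>j<r'. Z' j \<in> cr_sections A T U) \<and> \<tau> = (\<Sum>j<r'. herm_tensor (Z' j p)) \<and>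
        quot_proj T p (cscale (- \<i>) (?S r Z)) = quot_proj T p (cscale (- \<i>) (?S r' Z'))"
      using Z U rep by blast
  next
    fix c assume "\<exists>U r' Z'. open U \<and> p \<in> U \<and> (\<forall>j<r'. Z' j \<in> cr_sections A T U) \<and> \<tau> = (\<Sum>j<r'. herm_tensor (Z' j p)) \<and>
        c = quot_proj T p (cscale (- \<i>) (?S r' Z'))"
    then obtain U' and r' :: nat and Z' where U': "open U'" "p \<in> U'" and Z': "\<And>j. j < r' \<Longrightarrow> Z' j \<in> cr_sections A T U'"
      and rep': "\<tau> = (\<Sum>j<r'. herm_tensor (Z' j p))" and c: "c = quot_proj T p (cscale (- \<i>) (?S r' Z'))" by blast
    obtain Y where Y: "Y \<in> T p" "?S r' Z' = ?S r Z + (conj_vec Y - Y)"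
    proof -
      have "(\<Sum>j<r'. herm_tensor (Z' j p)) = (\<Sum>j<r. herm_tensor (Z j p))" using rep rep' by simp
      from representation_independent(1)[where r=r' and Z=Z' and r'=r and Z'=Z, OF Z' U' Z U this] show ?thesis using that by blast
    qed
    have "cscale (- \<i>) (?S r' Z') - cscale (- \<i>) (?S r Z) = cscale (- \<i>) (conj_vec Y - Y)"
      unfolding Y(2) by (simp add: cvec.scale_right_distrib)
    \<comment> \<open>Multiplication by -i turns conj Y - Y into the real part of 2 i Y, an element
      of HM.\<close>
    also have "\<dots> = re_vec (cscale (2 * \<i>) Y)"
      by (rule ext) (simp add: re_vec_def cscale_apply conj_vec_cscale algebra_simps)
    also have "\<dots> \<in> HM T p" unfolding HM_def by (rule imageI) (rule cvec.subspace_scale[OF T_subspace Y(1)])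
    finally show "c = quot_proj T p (cscale (- \<i>) (?S r Z))" unfolding c by (rule quot_proj_eqI)
  qed
  then have "cscale (- \<i>) (?S r Z) \<in> HM T p"
    using \<tau> by (intro quot_proj_zeroD) (simp add: ker_levi_def)
  then obtain W where W: "W \<in> T p" "cscale (- \<i>) (?S r Z) = re_vec W" unfolding HM_def by blast
  have "?S r Z = cscale \<i> (cscale (- \<i>) (?S r Z))" by (simp add: cvec.scale_scale)
  \<comment> \<open>For L = -(i/2) W the difference conj L - L is i times the real part of
    W.\<close>
  also have "\<dots> = conj_vec (cscale (- \<i> / 2) W) - cscale (- \<i> / 2) W"
    unfolding W(2) by (rule ext) (simp add: re_vec_def conj_vec_apply cscale_def algebra_simps)
  finally show thesis using that[OF cvec.subspace_scale[OF T_subspace W(1)]] by blast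
qed

text \<open>At each point some L exists. Its coefficients are, up to sign and conjugation, those of
  the smooth bracket sum in the full frame; independence makes them unique, hence smooth. The set
  \<open>WW\<close> allows the field to be obtained inside any given neighbourhood.\<close>

lemma kernel_section_field:
  fixes r :: nat
  assumes \<tau>: "\<And>q. q \<in> U \<Longrightarrow> \<tau> q \<in> ker_levi A T q" and rep: "represents A T U r Z \<tau>" and U: "open U" "p \<in> U"
    and WW: "open WW" "p \<in> WW"
  obtains U0 L0 where "open U0" "p \<in> U0" "U0 \<subseteq> U \<inter> WW" "L0 \<in> cr_sections A T U0"
    "\<And>q. q \<in> U0 \<Longrightarrow> (\<Sum>j<r. lie_bracket A (Z j) (conj_field (Z j)) q) = conj_field L0 q - L0 q"
proof -
  let ?S = "\<lambda>q. \<Sum>j<r. lie_bracket A (Z j) (conj_field (Z j)) q"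
  have Z: "\<And>j. j < r \<Longrightarrow> Z j \<in> cr_sections A T U" and rp: "\<And>q. q \<in> U \<Longrightarrow> \<tau> q = (\<Sum>j<r. herm_tensor (Z j q))"
    using rep unfolding represents_def by blast+
  have Zv: "smooth_vfield A U (Z j)" if "j < r" for j using Z[OF that] by (simp add: cr_sections_def)
  obtain V k E where f: "p \<in> V" "is_frame V k E" by (rule frame_exists)
  obtain V' \<phi> where ch: "(V', \<phi>) \<in> A" "p \<in> V'" by (rule chart_exists)
  let ?W = "V \<inter> U \<inter> WW \<inter> V'"
  have oV: "open V" using f by (simp add: is_frame_def)
  have W: "open ?W" "p \<in> ?W" using oV U WW f(1) ch chartD(1)[OF ch(1)] by auto
  have "\<exists>d. ?S q = conj_vec (\<Sum>l<k. cscale (d l) (E l q)) - (\<Sum>l<k. cscale (d l) (E l q))" if q: "q \<in> ?W" for q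
  proof -
    have qU: "q \<in> U" using q by blast
    obtain L where L: "L \<in> T q" "?S q = conj_vec L - L" by (rule ker_levi_bracket[OF \<tau>[OF qU] Z U(1) qU rp[OF qU]])
    have "T q = range (\<lambda>d. \<Sum>l<k. cscale (d l) (E l q))" using f(2) q unfolding is_frame_def by blast
    then show ?thesis using L by auto
  qed
  then have "\<forall>q. \<exists>d. q \<in> ?W \<longrightarrow> ?S q = conj_vec (\<Sum>l<k. cscale (d l) (E l q)) - (\<Sum>l<k. cscale (d l) (E l q))" by blast
  from choice[OF this] obtain d where
    d: "\<And>q. q \<in> ?W \<Longrightarrow> ?S q = conj_vec (\<Sum>l<k. cscale (d q l) (E l q)) - (\<Sum>l<k. cscale (d q l) (E l q))" by blast
  \<comment> \<open>The coefficients of conj L - L in the full frame: those of -L on the first half,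
    those of conj L on the second.\<close>
  define c where "c i q = (if i < k then - d q i else cnj (d q (i - k)))" for i q
  have c: "msmooth_on A ?W (c i)" if "i < k + k" for i
  proof (rule frame_coeffs_smooth[OF W(1), where n="k + k" and e="full_frame \<phi> k E" and s="\<lambda>q b. ?S q (coord \<phi> b)"])
    show "msmooth_on A ?W (\<lambda>q. full_frame \<phi> k E i q b)" if "i < k + k" for i b
      by (rule full_frame_smooth[OF f(2) ch(1) W(1) _ _ that]) auto
    show "indep_at (k + k) (full_frame \<phi> k E) q" if "q \<in> ?W" for q
      by (rule full_frame_indep[OF f(2) ch(1)]) (use that in auto)
    show "msmooth_on A ?W (\<lambda>q. ?S q (coord \<phi> b))" for b
    proof (rule msmooth_cong[OF W(1)])
      have x: "msmooth_on A ?W (coord \<phi> b)" by (rule msmooth_subset[OF msmooth_coord[OF ch(1)]]) auto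
      have s: "?W \<subseteq> U" by blast
      show "msmooth_on A ?W (\<lambda>q. \<Sum>j<r. Z j q (\<lambda>q. conj_field (Z j) q (coord \<phi> b)) - conj_field (Z j) q (\<lambda>q. Z j q (coord \<phi> b)))"
      proof (rule msmooth_sum[OF W(1)], rule msmooth_diff[OF W(1)])
        fix j assume "j \<in> {..<r}"
        then have j: "j < r" by simp
        show "msmooth_on A ?W (\<lambda>q. Z j q (\<lambda>q. conj_field (Z j) q (coord \<phi> b)))"
          by (rule vfield_smooth[OF Zv[OF j] W(1) s vfield_smooth[OF vfield_conj[OF Zv[OF j]] W(1) s x]])
        show "msmooth_on A ?W (\<lambda>q. conj_field (Z j) q (\<lambda>q. Z j q (coord \<phi> b)))"
          by (rule vfield_smooth[OF vfield_conj[OF Zv[OF j]] W(1) s vfield_smooth[OF Zv[OF j] W(1) s x]])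
      qed
      fix q assume "q \<in> ?W"
      then have "msmooth_near A q (coord \<phi> b)" by (intro near_coord[OF ch(1)]) auto
      then show "(\<Sum>j<r. Z j q (\<lambda>q. conj_field (Z j) q (coord \<phi> b)) - conj_field (Z j) q (\<lambda>q. Z j q (coord \<phi> b))) = ?S q (coord \<phi> b)"
        by (simp add: sum_fun_apply bracket_apply)
    qed
    show "?S q (coord \<phi> b) = (\<Sum>i<k + k. c i q * full_frame \<phi> k E i q b)" if "q \<in> ?W" for q b
      unfolding sum_full_frame d[OF that]
      by (simp add: c_def conj_vec_sum conj_vec_cscale sum_fun_apply cscale_apply sum_negf)
  qed (use that in auto)
  define L0 where "L0 q = (\<Sum>l<k. cscale (- c l q) (E l q))" for q
  have L0d: "L0 q = (\<Sum>l<k. cscale (d q l) (E l q))" for q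
    unfolding L0_def by (rule sum.cong[OF refl]) (simp add: c_def)
  show thesis
  proof (rule that[OF W])
    show "?W \<subseteq> U \<inter> WW" by blast
    have "smooth_vfield A ?W L0"
      unfolding L0_def[abs_def]
    proof (rule vfield_combination)
      show "msmooth_on A ?W (\<lambda>q. - c l q)" if "l \<in> {..<k}" for l
        by (rule msmooth_minus[OF W(1) c]) (use that in auto)
      show "smooth_vfield A ?W (E l)" if "l \<in> {..<k}" for l
        by (rule vfield_subset[OF frame_field[OF f(2)]]) (use that in auto)
    qed
    moreover have "L0 q \<in> T q" if "q \<in> ?W" for q
      unfolding L0_def by (rule frame_T[OF f(2)]) (use that in auto)
    ultimately show "L0 \<in> cr_sections A T ?W" by (simp add: cr_sections_def)
    show "?S q = conj_field L0 q - L0 q" if "q \<in> ?W" for q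
    proof -
      have "conj_field L0 q = conj_vec (L0 q)" by (simp add: conj_field_def)
      then show ?thesis by (simp only: L0d d[OF that])
    qed
  qed
qed

end

section \<open>The value of \<open>dd\<^sup>c\<close> on the kernel\<close>

context atlas
begin

lemma ctangent_partial_expand:
  assumes X: "X \<in> ctangent_space A p" and c: "(V, \<phi>) \<in> A" and p: "p \<in> V"
  shows "X = (\<Sum>b\<in>Basis. cscale (X (coord \<phi> b)) (partial_vec V \<phi> p b))"
proof
  fix f
  show "X f = (\<Sum>b\<in>Basis. cscale (X (coord \<phi> b)) (partial_vec V \<phi> p b)) f"
  proof (cases "msmooth_near A p f")
    case True
    then show ?thesis
      unfolding ctangent_expand[OF X c p True] by (simp add: sum_fun_apply cscale_apply partial_vec_def)
  qed (simp add: ctangent_zero[OF X] sum_fun_apply cscale_apply partial_vec_def)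
qed

lemma form_real: "real_one_form A U \<xi> \<Longrightarrow> p \<in> U \<Longrightarrow> X \<in> tangent_space A p \<Longrightarrow> \<xi> p X \<in> \<real>"
  unfolding real_one_form_def by blast

text \<open>Coordinate vectors are real and \<xi> is real on them, so conjugating the coefficients
  of a vector conjugates the value.\<close>

lemma form_conj:
  assumes \<xi>: "real_one_form A U \<xi>" and p: "p \<in> U" and X: "X \<in> ctangent_space A p"
  shows "\<xi> p (conj_vec X) = cnj (\<xi> p X)"
proof -
  obtain V \<phi> where c: "(V, \<phi>) \<in> A" "p \<in> V" by (rule chart_exists)
  let ?P = "partial_vec V \<phi> p"
  have t: "?P b \<in> tangent_space A p" for b by (rule partial_vec_tangent[OF c])
  note ct = tangent_ctangent[OF t]
  have re: "cnj (\<xi> p (?P b)) = \<xi> p (?P b)" for b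
  proof -
    have "\<xi> p (?P b) \<in> \<real>" by (rule form_real[OF \<xi> p t])
    then show ?thesis by (simp add: Reals_cnj_iff)
  qed
  have e: "X = (\<Sum>b\<in>Basis. cscale (X (coord \<phi> b)) (?P b))" by (rule ctangent_partial_expand[OF X c])
  have 1: "\<xi> p X = (\<Sum>b\<in>Basis. X (coord \<phi> b) * \<xi> p (?P b))"
    by (subst e) (rule form_combination[OF \<xi> p ct finite_Basis])
  have "conj_vec X = (\<Sum>b\<in>Basis. cscale (cnj (X (coord \<phi> b))) (?P b))"
    by (subst e) (simp add: conj_vec_sum conj_vec_cscale tangent_conj[OF t])
  moreover have "\<xi> p (\<Sum>b\<in>Basis. cscale (cnj (X (coord \<phi> b))) (?P b)) = (\<Sum>b\<in>Basis. cnj (X (coord \<phi> b)) * \<xi> p (?P b))"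
    by (rule form_combination[OF \<xi> p ct finite_Basis])
  ultimately have "\<xi> p (conj_vec X) = (\<Sum>b\<in>Basis. cnj (X (coord \<phi> b)) * \<xi> p (?P b))" by (simp only:)
  then show ?thesis unfolding 1 by (simp add: re)
qed

lemma conj_vec_real: "conj_vec X (\<lambda>q. complex_of_real (\<rho> q)) = cnj (X (\<lambda>q. complex_of_real (\<rho> q)))"
  by (simp add: conj_vec_apply)

text \<open>The operator Q of the overview on the manifold; its real part on a defining function is
  the quantity that has to be positive.\<close>

definition levi_op :: "nat \<Rightarrow> (nat \<Rightarrow> 'm \<Rightarrow> 'm tvec) \<Rightarrow> ('m \<Rightarrow> 'm tvec) \<Rightarrow> 'm \<Rightarrow> ('m \<Rightarrow> complex) \<Rightarrow> complex" where
  "levi_op r Z L0 p g = (\<Sum>j<r. Z j p (\<lambda>q. conj_field (Z j) q g) + conj_field (Z j) p (\<lambda>q. Z j q g))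
     - L0 p g - conj_field L0 p g"

text \<open>On a real function the two second order terms are conjugate to each other, and so are
  the two terms with L_0.\<close>

lemma levi_op_real:
  fixes \<rho> :: "'m \<Rightarrow> real"
  shows "levi_op r Z L0 p (\<lambda>q. complex_of_real (\<rho> q)) = complex_of_real (Re (levi_op r Z L0 p (\<lambda>q. complex_of_real (\<rho> q))))"
proof -
  let ?g = "\<lambda>q. complex_of_real (\<rho> q)"
  have 1: "conj_field (Z j) p (\<lambda>q. Z j q ?g) = cnj (Z j p (\<lambda>q. conj_field (Z j) q ?g))" for j
    by (simp add: conj_field_def conj_vec_apply)
  have 2: "conj_field L0 p ?g = cnj (L0 p ?g)" by (simp add: conj_field_def conj_vec_apply)
  have "cnj (levi_op r Z L0 p ?g) = levi_op r Z L0 p ?g"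
    unfolding levi_op_def 1 2 by (simp add: add.commute)
  then have "levi_op r Z L0 p ?g \<in> \<real>" by (simp add: Reals_cnj_iff)
  then show ?thesis by simp
qed

end

context almost_CR
begin

text \<open>A complex covector with the values forced on the frame and on its conjugate exists by
  \<open>dual_frame_exists\<close>. The two prescriptions are conjugate to each other, so the real
  part of the covector still satisfies them and gives a real form.\<close>

lemma form_exists:
  fixes \<rho> :: "'m \<Rightarrow> real"
  assumes \<rho>: "msmooth_on A D \<rho>" and D: "open D" "p \<in> D"
  obtains U \<xi> where "open U" "p \<in> U" "U \<subseteq> D" "real_one_form A U \<xi>"
    "\<And>q X. q \<in> U \<Longrightarrow> X \<in> T q \<Longrightarrow> X (\<lambda>q'. complex_of_real (\<rho> q')) + \<i> * \<xi> q X = 0"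
proof -
  let ?g = "\<lambda>q. complex_of_real (\<rho> q)"
  obtain V k E where f: "p \<in> V" "is_frame V k E" by (rule frame_exists)
  obtain V' \<phi> where ch: "(V', \<phi>) \<in> A" "p \<in> V'" by (rule chart_exists)
  let ?W = "V \<inter> D \<inter> V'"
  have oV: "open V" using f by (simp add: is_frame_def)
  have W: "open ?W" "p \<in> ?W" using oV D f(1) ch chartD(1)[OF ch(1)] by auto
  have g: "msmooth_on A ?W ?g" by (rule msmooth_subset[OF msmooth_of_real[OF D(1) \<rho>]]) auto
  \<comment> \<open>The equation d\<rho> + i \<xi> = 0 on T forces \<xi> = i d\<rho> there, and
    reality forces the conjugate values on the conjugate frame.\<close>
  define \<beta> where "\<beta> i q = (if i < k then \<i> * E i q ?g else - \<i> * conj_vec (E (i - k) q) ?g)" for i q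
  have Eg: "msmooth_on A ?W (\<lambda>q. E l q ?g)" "msmooth_on A ?W (\<lambda>q. conj_vec (E l q) ?g)" if "l < k" for l
  proof -
    have s: "?W \<subseteq> V" by blast
    show 1: "msmooth_on A ?W (\<lambda>q. E l q ?g)" by (rule vfield_smooth[OF frame_field[OF f(2) that] W(1) s g])
    show "msmooth_on A ?W (\<lambda>q. conj_vec (E l q) ?g)"
      unfolding conj_vec_real by (rule msmooth_cnj[OF W(1) 1])
  qed
  have "\<exists>\<eta>. (\<forall>b\<in>Basis. msmooth_on A ?W (\<eta> b)) \<and> (\<forall>q\<in>?W. \<forall>i<k + k. (\<Sum>b\<in>Basis. full_frame \<phi> k E i q b * \<eta> b q) = \<beta> i q)"
  proof (rule dual_frame_exists[OF W(1)])
    show "msmooth_on A ?W (\<lambda>q. full_frame \<phi> k E i q b)" if "i < k + k" for i b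
      by (rule full_frame_smooth[OF f(2) ch(1) W(1) _ _ that]) auto
    show "indep_at (k + k) (full_frame \<phi> k E) q" if "q \<in> ?W" for q
      by (rule full_frame_indep[OF f(2) ch(1)]) (use that in auto)
    show "msmooth_on A ?W (\<beta> i)" if "i < k + k" for i
    proof (cases "i < k")
      case True
      then show ?thesis unfolding \<beta>_def[abs_def] using msmooth_mult[OF W(1) msmooth_const[OF W(1)] Eg(1)] by simp
    next
      case False
      then have "i - k < k" using that by simp
      from msmooth_mult[OF W(1) msmooth_const[OF W(1)] Eg(2)[OF this], of "- \<i>"] False
      show ?thesis unfolding \<beta>_def[abs_def] by simp
    qed
  qed
  then obtain \<eta> where \<eta>: "\<And>b. b \<in> Basis \<Longrightarrow> msmooth_on A ?W (\<eta> b)"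
    "\<And>q i. q \<in> ?W \<Longrightarrow> i < k + k \<Longrightarrow> (\<Sum>b\<in>Basis. full_frame \<phi> k E i q b * \<eta> b q) = \<beta> i q" by blast
  define \<eta>' where "\<eta>' b q = (\<eta> b q + cnj (\<eta> b q)) * (1/2)" for b q
  define \<xi> where "\<xi> q X = (\<Sum>b\<in>Basis. X (coord \<phi> b) * \<eta>' b q)" for q and X :: "'m tvec"
  have \<eta>': "msmooth_on A ?W (\<eta>' b)" if "b \<in> Basis" for b
    unfolding \<eta>'_def[abs_def]
    by (rule msmooth_mult[OF W(1) msmooth_add[OF W(1) \<eta>(1)[OF that] msmooth_cnj[OF W(1) \<eta>(1)[OF that]]] msmooth_const[OF W(1)]])
  have \<xi>E: "\<xi> q (E l q) = \<i> * E l q ?g" if q: "q \<in> ?W" and l: "l < k" for q l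
  proof -
    have 1: "(\<Sum>b\<in>Basis. E l q (coord \<phi> b) * \<eta> b q) = \<i> * E l q ?g"
      using \<eta>(2)[OF q, of l] l by (simp add: full_frame_def \<beta>_def)
    have "(\<Sum>b\<in>Basis. cnj (E l q (coord \<phi> b)) * \<eta> b q) = - \<i> * conj_vec (E l q) ?g"
      using \<eta>(2)[OF q, of "k + l"] l by (simp add: full_frame_def \<beta>_def conj_vec_coord)
    from arg_cong[OF this, of cnj] have 2: "(\<Sum>b\<in>Basis. E l q (coord \<phi> b) * cnj (\<eta> b q)) = \<i> * E l q ?g"
      by (simp add: conj_vec_real)
    have "\<xi> q (E l q) = ((\<Sum>b\<in>Basis. E l q (coord \<phi> b) * \<eta> b q) + (\<Sum>b\<in>Basis. E l q (coord \<phi> b) * cnj (\<eta> b q))) * (1/2)"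
      unfolding \<xi>_def \<eta>'_def sum.distrib[symmetric] sum_distrib_right by (intro sum.cong refl) (simp add: algebra_simps)
    then show ?thesis unfolding 1 2 by simp
  qed
  show thesis
  proof (rule that[OF W])
    show "?W \<subseteq> D" by blast
    show "real_one_form A ?W \<xi>"
      unfolding real_one_form_def
    proof (intro conjI ballI allI impI)
      fix q X Y assume "X \<in> ctangent_space A q" "Y \<in> ctangent_space A q"
      show "\<xi> q (X + Y) = \<xi> q X + \<xi> q Y" by (simp add: \<xi>_def distrib_right sum.distrib)
    next
      fix q X and c :: complex
      show "\<xi> q (cscale c X) = c * \<xi> q X" by (simp add: \<xi>_def cscale_apply sum_distrib_left mult.assoc)
    next
      fix q X assume X: "X \<in> tangent_space A q"
      have "cnj (X (coord \<phi> b)) = X (coord \<phi> b)" for b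
        using conj_vec_coord[of X \<phi> b] tangent_conj[OF X] by simp
      then have "cnj (\<xi> q X) = \<xi> q X" by (simp add: \<xi>_def \<eta>'_def add.commute)
      then show "\<xi> q X \<in> \<real>" by (simp add: Reals_cnj_iff)
    next
      fix V2 X assume V2: "open V2" "V2 \<subseteq> ?W" and X: "smooth_vfield A V2 X"
      show "msmooth_on A V2 (\<lambda>q. \<xi> q (X q))"
        unfolding \<xi>_def
      proof (rule msmooth_sum[OF V2(1)])
        fix b :: 'e assume b: "b \<in> Basis"
        have "V2 \<subseteq> V'" using V2(2) by blast
        from vfield_smooth[OF X V2(1) order_refl msmooth_subset[OF msmooth_coord[OF ch(1)] this]]
        show "msmooth_on A V2 (\<lambda>q. X q (coord \<phi> b) * \<eta>' b q)"
          by (rule msmooth_mult[OF V2(1) _ msmooth_subset[OF \<eta>'[OF b] V2(2)]])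
      qed
    qed
    fix q X assume q: "q \<in> ?W" and X: "X \<in> T q"
    have "T q = range (\<lambda>d. \<Sum>l<k. cscale (d l) (E l q))" using f(2) q unfolding is_frame_def by blast
    then obtain d where d: "X = (\<Sum>l<k. cscale (d l) (E l q))" using X by blast
    have Xap: "X h = (\<Sum>l<k. d l * E l q h)" for h unfolding d by (simp add: sum_fun_apply cscale_apply)
    have "\<xi> q X = (\<Sum>l<k. d l * \<xi> q (E l q))"
      unfolding \<xi>_def Xap sum_distrib_left sum_distrib_right by (subst sum.swap) (simp add: mult.assoc)
    also have "\<dots> = (\<Sum>l<k. d l * (\<i> * E l q ?g))"
      by (intro sum.cong refl) (simp add: \<xi>E[OF q])
    also have "\<dots> = \<i> * X ?g" unfolding Xap by (simp add: sum_distrib_left mult_ac)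
    finally show "X ?g + \<i> * \<xi> q X = 0" by (simp add: mult.assoc[symmetric])
  qed
qed

text \<open>\<xi> is i d\<rho> on T and -i d\<rho> on its conjugate, and by \<open>br\<close> the
  bracket sum lies in their sum. Substitution makes the sum of exterior derivatives equal to -i
  times \<open>levi_op\<close>, and the factor i/2 leaves half of it.\<close>

lemma ddc_form_value:
  fixes \<rho> :: "'m \<Rightarrow> real" and r :: nat
  assumes Z: "\<And>j. j < r \<Longrightarrow> Z j \<in> cr_sections A T U0" and U0: "open U0" "p \<in> U0"
    and L0: "L0 p \<in> T p" and br: "(\<Sum>j<r. lie_bracket A (Z j) (conj_field (Z j)) p) = conj_field L0 p - L0 p"
    and U: "open U" "p \<in> U" and \<rho>: "msmooth_on A U \<rho>" and \<xi>: "real_one_form A U \<xi>"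
    and eq: "\<And>q X. q \<in> U \<Longrightarrow> X \<in> T q \<Longrightarrow> X (\<lambda>q'. complex_of_real (\<rho> q')) + \<i> * \<xi> q X = 0"
  shows "\<i> / 2 * (\<Sum>j<r. ext_deriv A \<xi> (Z j) (conj_field (Z j)) p) = levi_op r Z L0 p (\<lambda>q. complex_of_real (\<rho> q)) / 2"
proof -
  let ?g = "\<lambda>q. complex_of_real (\<rho> q)"
  have g: "msmooth_near A p ?g" by (rule nearI[OF U msmooth_of_real[OF U(1) \<rho>]])
  have \<xi>T: "\<xi> q X = \<i> * X ?g" if "q \<in> U" "X \<in> T q" for q X
  proof -
    have "\<i> * (X ?g + \<i> * \<xi> q X) = 0" using eq[OF that] by simp
    then show ?thesis by (simp add: distrib_left mult.assoc[symmetric])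
  qed
  have \<xi>Tb: "\<xi> q (conj_vec X) = - \<i> * conj_vec X ?g" if "q \<in> U" "X \<in> T q" for q X
    using form_conj[OF \<xi> that(1), of X] that T_ctangent[of q] by (auto simp: \<xi>T[OF that] conj_vec_real)
  have WU: "open (U \<inter> U0)" "p \<in> U \<inter> U0" using U U0 by auto
  have ex: "ext_deriv A \<xi> (Z j) (conj_field (Z j)) p =
      - \<i> * (Z j p (\<lambda>q. conj_field (Z j) q ?g) + conj_field (Z j) p (\<lambda>q. Z j q ?g)) - \<xi> p (lie_bracket A (Z j) (conj_field (Z j)) p)"
    if j: "j < r" for j
  proof -
    have Zv: "smooth_vfield A U0 (Z j)" and ZT: "\<And>q. q \<in> U0 \<Longrightarrow> Z j q \<in> T q" using Z[OF j] by (auto simp: cr_sections_def)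
    note Zb = vfield_conj[OF Zv]
    have "Z j p (\<lambda>q. \<xi> q (conj_field (Z j) q)) = Z j p (\<lambda>q. - \<i> * conj_field (Z j) q ?g)"
      by (rule ctangent_local[OF vfield_ctangent[OF Zv U0(2)] WU]) (simp add: conj_field_def \<xi>Tb ZT)
    also have "\<dots> = - \<i> * Z j p (\<lambda>q. conj_field (Z j) q ?g)"
      by (rule ctangent_cmult[OF vfield_ctangent[OF Zv U0(2)] vfield_near[OF Zb U0 g]])
    finally have 1: "Z j p (\<lambda>q. \<xi> q (conj_field (Z j) q)) = - \<i> * Z j p (\<lambda>q. conj_field (Z j) q ?g)" .
    have "conj_field (Z j) p (\<lambda>q. \<xi> q (Z j q)) = conj_field (Z j) p (\<lambda>q. \<i> * Z j q ?g)"
      by (rule ctangent_local[OF vfield_ctangent[OF Zb U0(2)] WU]) (simp add: \<xi>T ZT)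
    also have "\<dots> = \<i> * conj_field (Z j) p (\<lambda>q. Z j q ?g)"
      by (rule ctangent_cmult[OF vfield_ctangent[OF Zb U0(2)] vfield_near[OF Zv U0 g]])
    finally show ?thesis unfolding ext_deriv_def 1 by (simp add: algebra_simps)
  qed
  have Bc: "lie_bracket A (Z j) (conj_field (Z j)) p \<in> ctangent_space A p" if "j < r" for j
  proof -
    have Zv: "smooth_vfield A U0 (Z j)" using Z[OF that] by (simp add: cr_sections_def)
    show ?thesis by (rule bracket_ctangent[OF Zv vfield_conj[OF Zv] U0])
  qed
  have Lc: "L0 p \<in> ctangent_space A p" using L0 T_ctangent[of p] by blast
  have "(\<Sum>j<r. \<xi> p (lie_bracket A (Z j) (conj_field (Z j)) p)) = \<xi> p (\<Sum>j<r. lie_bracket A (Z j) (conj_field (Z j)) p)"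
    using form_combination[OF \<xi> U(2), of "{..<r}" "\<lambda>j. lie_bracket A (Z j) (conj_field (Z j)) p" "\<lambda>_. 1"] Bc by simp
  also have "\<dots> = \<xi> p (conj_vec (L0 p) - L0 p)" unfolding br by (simp add: conj_field_def)
  also have "\<dots> = - \<i> * conj_vec (L0 p) ?g - \<i> * L0 p ?g"
    unfolding form_diff[OF \<xi> U(2) ctangent_conj[OF Lc] Lc] \<xi>T[OF U(2) L0] \<xi>Tb[OF U(2) L0] ..
  finally have 2: "(\<Sum>j<r. \<xi> p (lie_bracket A (Z j) (conj_field (Z j)) p)) = - \<i> * conj_vec (L0 p) ?g - \<i> * L0 p ?g" .
  have "(\<Sum>j<r. ext_deriv A \<xi> (Z j) (conj_field (Z j)) p) =
    (\<Sum>j<r. - \<i> * (Z j p (\<lambda>q. conj_field (Z j) q ?g) + conj_field (Z j) p (\<lambda>q. Z j q ?g)) - \<xi> p (lie_bracket A (Z j) (conj_field (Z j)) p))"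
    by (rule sum.cong[OF refl], rule ex) simp
  also have "\<dots> = - \<i> * levi_op r Z L0 p ?g"
    unfolding sum_subtractf 2 sum_distrib_left[symmetric] by (simp add: levi_op_def conj_field_def algebra_simps)
  finally show ?thesis by simp
qed

text \<open>Existence for the definite description comes from \<open>form_exists\<close>. For
  uniqueness a competing family of sections is exchanged for the given one without changing the
  exterior derivatives, after which the value is the same for every admissible \<xi>.\<close>

lemma ddc_value:
  fixes \<rho> :: "'m \<Rightarrow> real" and r :: nat
  assumes Z: "\<And>j. j < r \<Longrightarrow> Z j \<in> cr_sections A T U0" and U0: "open U0" "p \<in> U0"
    and \<tau>: "\<tau> = (\<Sum>j<r. herm_tensor (Z j p))"
    and L0: "L0 p \<in> T p" and br: "(\<Sum>j<r. lie_bracket A (Z j) (conj_field (Z j)) p) = conj_field L0 p - L0 p"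
    and \<rho>: "msmooth_on A D \<rho>" and D: "open D" "p \<in> D"
  shows "ddc A T \<rho> p \<tau> = Re (levi_op r Z L0 p (\<lambda>q. complex_of_real (\<rho> q))) / 2"
proof -
  let ?Q = "levi_op r Z L0 p (\<lambda>q. complex_of_real (\<rho> q))"
  have val: "\<i> / 2 * (\<Sum>j<r. ext_deriv A \<xi> (Z j) (conj_field (Z j)) p) = ?Q / 2"
    if "open U" "p \<in> U" "msmooth_on A U \<rho>" "real_one_form A U \<xi>"
      "\<And>q X. q \<in> U \<Longrightarrow> X \<in> T q \<Longrightarrow> X (\<lambda>q'. complex_of_real (\<rho> q')) + \<i> * \<xi> q X = 0" for U \<xi>
    by (rule ddc_form_value[OF _ U0 L0 br that]) (rule Z)
  show ?thesis
    unfolding ddc_def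
  proof (rule the_equality)
    obtain U \<xi> where U: "open U" "p \<in> U" "U \<subseteq> D" "real_one_form A U \<xi>"
      "\<And>q X. q \<in> U \<Longrightarrow> X \<in> T q \<Longrightarrow> X (\<lambda>q'. complex_of_real (\<rho> q')) + \<i> * \<xi> q X = 0"
      using form_exists[OF \<rho> D] by blast
    have \<rho>U: "msmooth_on A U \<rho>" by (rule msmooth_subset[OF \<rho> U(3)])
    have Qv: "complex_of_real (Re ?Q / 2) = \<i> / 2 * (\<Sum>j<r. ext_deriv A \<xi> (Z j) (conj_field (Z j)) p)"
    proof -
      have "?Q = complex_of_real (Re ?Q)" by (rule levi_op_real)
      then have "complex_of_real (Re ?Q / 2) = ?Q / 2" by (simp only: of_real_divide of_real_numeral)
      then show ?thesis using val[OF U(1,2) \<rho>U U(4,5)] by (simp only:)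
    qed
    \<comment> \<open>The description asks for one open set that carries \<rho>, \<xi> and the
      sections alike.\<close>
    have UU0: "open (U \<inter> U0)" "p \<in> U \<inter> U0" using U U0 by auto
    let ?P = "\<lambda>U \<xi> r Z. open U \<and> p \<in> U \<and> msmooth_on A U \<rho> \<and>
     real_one_form A U \<xi> \<and>
     (\<forall>q\<in>U. \<forall>X\<in>T q. X (\<lambda>q'. complex_of_real (\<rho> q')) + \<i> * \<xi> q X = 0) \<and>
     (\<forall>j<r. Z j \<in> cr_sections A T U) \<and> \<tau> = (\<Sum>j<r. herm_tensor (Z j p)) \<and>
     complex_of_real (Re ?Q / 2) = \<i> / 2 * (\<Sum>j<(r::nat). ext_deriv A \<xi> (Z j) (conj_field (Z j)) p)"
    have "?P (U \<inter> U0) \<xi> r Z"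
    proof (intro conjI)
      show "msmooth_on A (U \<inter> U0) \<rho>" by (rule msmooth_subset[OF \<rho>U]) blast
      show "real_one_form A (U \<inter> U0) \<xi>" using U(4) unfolding real_one_form_def by blast
      show "\<forall>q\<in>U \<inter> U0. \<forall>X\<in>T q. X (\<lambda>q'. complex_of_real (\<rho> q')) + \<i> * \<xi> q X = 0" using U(5) by blast
      show "\<forall>j<r. Z j \<in> cr_sections A T (U \<inter> U0)"
        using Z by (auto simp: cr_sections_def intro: vfield_subset)
    qed (rule UU0, rule UU0, rule \<tau>, rule Qv)
    then have "\<exists>Z. ?P (U \<inter> U0) \<xi> r Z" by (rule exI[where x=Z])
    then have "\<exists>r Z. ?P (U \<inter> U0) \<xi> r Z" by (rule exI[where x=r])
    then have "\<exists>\<xi> r Z. ?P (U \<inter> U0) \<xi> r Z" by (rule exI[where x=\<xi>])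
    then show "\<exists>U \<xi> r Z. ?P U \<xi> r Z" by (rule exI[where x="U \<inter> U0"])
  next
    let ?P = "\<lambda>v U \<xi> r Z. open U \<and> p \<in> U \<and> msmooth_on A U \<rho> \<and>
     real_one_form A U \<xi> \<and>
     (\<forall>q\<in>U. \<forall>X\<in>T q. X (\<lambda>q'. complex_of_real (\<rho> q')) + \<i> * \<xi> q X = 0) \<and>
     (\<forall>j<r. Z j \<in> cr_sections A T U) \<and> \<tau> = (\<Sum>j<r. herm_tensor (Z j p)) \<and>
     complex_of_real v = \<i> / 2 * (\<Sum>j<(r::nat). ext_deriv A \<xi> (Z j) (conj_field (Z j)) p)"
    fix v assume "\<exists>U \<xi> r Z. ?P v U \<xi> r Z"
    then obtain U where "\<exists>\<xi> r Z. ?P v U \<xi> r Z" by (rule exE)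
    then obtain \<xi> where "\<exists>r Z. ?P v U \<xi> r Z" by (rule exE)
    then obtain r' where "\<exists>Z. ?P v U \<xi> r' Z" by (rule exE)
    then obtain Z' where "?P v U \<xi> r' Z'" by (rule exE)
    then have U: "open U" "p \<in> U" and \<rho>U: "msmooth_on A U \<rho>" and \<xi>: "real_one_form A U \<xi>"
      and eq: "\<And>q X. q \<in> U \<Longrightarrow> X \<in> T q \<Longrightarrow> X (\<lambda>q'. complex_of_real (\<rho> q')) + \<i> * \<xi> q X = 0"
      and Z': "\<And>j. j < r' \<Longrightarrow> Z' j \<in> cr_sections A T U" and \<tau>': "\<tau> = (\<Sum>j<r'. herm_tensor (Z' j p))"
      and v: "complex_of_real v = \<i> / 2 * (\<Sum>j<r'. ext_deriv A \<xi> (Z' j) (conj_field (Z' j)) p)" by simp_all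
    have "(\<Sum>j<r'. herm_tensor (Z' j p)) = (\<Sum>j<r. herm_tensor (Z j p))" using \<tau> \<tau>' by simp
    from representation_independent(2)[where r=r' and Z=Z' and r'=r and Z'=Z, OF Z' U Z U0 this U \<xi>]
    have "complex_of_real v = ?Q / 2"
      using val[OF U \<rho>U \<xi> eq] unfolding v by simp
    from arg_cong[OF this, of Re] show "v = Re ?Q / 2" by simp
  qed
qed

end

section \<open>Transfer to a chart\<close>

lemma lebesgue_borel_representative:
  fixes g :: "'a::euclidean_space \<Rightarrow> complex"
  assumes "g \<in> borel_measurable lebesgue"
  obtains g' where "g' \<in> borel_measurable borel" "AE x in lborel. g x = g' x"
proof -
  have "(\<lambda>x. Re (g x)) \<in> borel_measurable (completion lborel)" "(\<lambda>x. Im (g x)) \<in> borel_measurable (completion lborel)"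
    using assms by measurable
  then obtain u v where u: "u \<in> borel_measurable lborel" "AE x in lborel. Re (g x) = u x"
    and v: "v \<in> borel_measurable lborel" "AE x in lborel. Im (g x) = v x"
    using completion_ex_borel_measurable_real by metis
  have "(\<lambda>x. Complex (u x) (v x)) \<in> borel_measurable borel"
    using u(1) v(1) unfolding borel_measurable_complex_iff by simp
  moreover have "AE x in lborel. g x = Complex (u x) (v x)"
    using u(2) v(2) by eventually_elim (simp add: complex_eq_iff)
  ultimately show thesis by (rule that)
qed

context atlas
begin

text \<open>Differentiable maps from a Euclidean space to itself preserve null sets, so
  negligibility does not depend on the chart.\<close>

lemma negligible_transition:
  assumes c: "(V, \<phi>) \<in> A" and c': "(V', \<phi>') \<in> A" and N: "N \<subseteq> V" and neg: "negligible (\<phi> ` N)"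
  shows "negligible (\<phi>' ` (N \<inter> V'))"
proof -
  let ?T = "\<lambda>x. \<phi>' (inv_into V \<phi> x)"
  have "?T differentiable_on \<phi> ` (N \<inter> V')"
  proof (rule differentiable_at_imp_differentiable_on)
    fix x assume "x \<in> \<phi> ` (N \<inter> V')"
    then have "x \<in> \<phi> ` (V \<inter> V')" using N by blast
    then show "?T differentiable (at x)" by (rule smooth_on_differentiable[OF chart_transition[OF c' c]])
  qed
  moreover have "negligible (\<phi> ` (N \<inter> V'))" by (rule negligible_subset[OF neg]) blast
  ultimately have "negligible (?T ` \<phi> ` (N \<inter> V'))"
    by (intro negligible_differentiable_image_negligible) auto
  moreover have "?T ` \<phi> ` (N \<inter> V') = \<phi>' ` (N \<inter> V')"
    unfolding image_image by (rule image_cong[OF refl]) (use N chart_inv[OF c] in auto)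
  ultimately show ?thesis by simp
qed

text \<open>\<open>ae_on\<close> quantifies over all charts. For a set inside one chart domain the
  exceptional set stays null under every transition map, so one chart decides.\<close>

lemma ae_on_transfer:
  assumes c: "(V, \<phi>) \<in> A" and N: "N \<subseteq> V"
    and ae: "AE x in lborel. x \<in> \<phi> ` N \<longrightarrow> P (inv_into V \<phi> x)"
  shows "ae_on A N P"
  unfolding ae_on_def
proof (intro ballI, clarify)
  fix V' \<phi>' assume c': "(V', \<phi>') \<in> A"
  let ?B = "{q \<in> N. \<not> P q}"
  obtain M where M: "{x \<in> space lborel. \<not> (x \<in> \<phi> ` N \<longrightarrow> P (inv_into V \<phi> x))} \<subseteq> M" "emeasure lborel M = 0" "M \<in> sets lborel"
    using ae by (rule AE_E)
  have "\<phi> ` ?B \<subseteq> M" using M(1) N by (auto simp: chart_inv[OF c] subset_eq)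
  moreover have "negligible M"
    using M(2,3) by (simp add: negligible_iff_null_sets null_sets_completionI null_sets_def)
  ultimately have "negligible (\<phi> ` ?B)" using negligible_subset by blast
  then have "negligible (\<phi>' ` (?B \<inter> V'))" using N by (intro negligible_transition[OF c c']) auto
  then have n: "\<phi>' ` (?B \<inter> V') \<in> null_sets lebesgue" by (simp add: negligible_iff_null_sets)
  show "AE x in lebesgue. x \<in> \<phi>' ` (N \<inter> V') \<longrightarrow> P (inv_into V' \<phi>' x)"
    by (rule AE_I'[OF n]) (auto simp: chart_inv[OF c'])
qed

definition corresponds :: "'m set \<Rightarrow> 'm set \<Rightarrow> ('m \<Rightarrow> 'e) \<Rightarrow> ('m \<Rightarrow> 'm tvec) \<Rightarrow> ('e \<Rightarrow> 'e \<Rightarrow> complex) \<Rightarrow> bool" where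
  "corresponds U V \<phi> X a \<longleftrightarrow> smooth_vfield A U X \<and> (\<forall>x\<in>\<phi> ` U. \<forall>b. a b x = X (inv_into V \<phi> x) (coord \<phi> b))"

lemma corresponds_conj:
  "corresponds U V \<phi> X a \<Longrightarrow> corresponds U V \<phi> (conj_field X) (cnj_coeffs a)"
  using vfield_conj[of U X] by (auto simp: corresponds_def conj_field_def cnj_coeffs_def conj_vec_coord)

lemma corresponds_smooth:
  assumes X: "corresponds U V \<phi> X a" and c: "(V, \<phi>) \<in> A" and U: "open U" "U \<subseteq> V"
  shows "smooth_coeffs (\<phi> ` U) a"
  unfolding smooth_coeffs_def
proof
  fix b :: 'e
  have UV: "U \<inter> V = U" using U by blast
  have o: "open (\<phi> ` U)" using chart_open[OF c U(1)] UV by simp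
  have Xv: "smooth_vfield A U X" using X by (simp add: corresponds_def)
  have "msmooth_on A U (\<lambda>q. X q (coord \<phi> b))"
    by (rule vfield_smooth[OF Xv U(1) order_refl msmooth_subset[OF msmooth_coord[OF c] U(2)]])
  from msmooth_chart[OF this c] have "smooth_on (\<phi> ` U) (\<lambda>x. X (inv_into V \<phi> x) (coord \<phi> b))" by (simp only: UV)
  then show "smooth_on (\<phi> ` U) (a b)"
    by (rule smooth_on_cong[OF o, rotated]) (use X in \<open>auto simp: corresponds_def\<close>)
qed

text \<open>Both sides expand in the values of the field on coordinate functions. \<open>w\<close>
  has to represent \<open>h\<close> on the image of \<open>U\<close> only, because derivatives are
  local.\<close>

lemma corresponds_dir:
  assumes X: "corresponds U V \<phi> X a" and c: "(V, \<phi>) \<in> A" and U: "open U" "U \<subseteq> V"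
    and h: "msmooth_on A U h" and w: "\<And>x. x \<in> \<phi> ` U \<Longrightarrow> w x = h (inv_into V \<phi> x)" and x: "x \<in> \<phi> ` U"
  shows "dir a w x = X (inv_into V \<phi> x) h"
proof -
  obtain q where q: "q \<in> U" "x = \<phi> q" using x by blast
  have UV: "U \<inter> V = U" using U by blast
  have o: "open (\<phi> ` U)" using chart_open[OF c U(1)] UV by simp
  have qV: "q \<in> V" using q U by blast
  have i: "inv_into V \<phi> x = q" using chart_inv[OF c qV] q by simp
  have hn: "msmooth_near A q h" by (rule nearI[OF U(1) q(1) h])
  have Xc: "X q \<in> ctangent_space A q" using X q(1) by (auto simp: corresponds_def intro: vfield_ctangent)
  have "frechet_derivative w (at x) = frechet_derivative (\<lambda>x. h (inv_into V \<phi> x)) (at x)"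
    using frechet_derivative_transform_within_open[OF near_differentiable[OF hn c qV], of "\<phi> ` U" w] o x w q(2) by simp
  then have "dir a w x = (\<Sum>b\<in>Basis. X q (coord \<phi> b) * frechet_derivative (\<lambda>x. h (inv_into V \<phi> x)) (at (\<phi> q)) b)"
    unfolding dir_def using X q i by (auto simp: corresponds_def)
  then show ?thesis unfolding i ctangent_expand[OF Xc c qV hn] .
qed

lemma corresponds_dir_dir:
  assumes X: "corresponds U V \<phi> X a" and Y: "corresponds U V \<phi> Y d" and c: "(V, \<phi>) \<in> A" and U: "open U" "U \<subseteq> V"
    and h: "msmooth_on A U h" and w: "\<And>x. x \<in> \<phi> ` U \<Longrightarrow> w x = h (inv_into V \<phi> x)" and x: "x \<in> \<phi> ` U"
  shows "dir a (dir d w) x = X (inv_into V \<phi> x) (\<lambda>q. Y q h)"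
proof -
  have Yv: "smooth_vfield A U Y" using Y by (simp add: corresponds_def)
  show ?thesis
    by (rule corresponds_dir[OF X c U vfield_smooth[OF Yv U(1) order_refl h] _ x]) (rule corresponds_dir[OF Y c U h w])
qed

end

section \<open>The Levi operator in coordinates\<close>

text \<open>The expression of \<open>levi\<close> with the weight as an argument, so that values for
  different weights can be compared before one is fixed.\<close>

definition chart_levi :: "nat \<Rightarrow> (nat \<Rightarrow> 'e::euclidean_space \<Rightarrow> 'e \<Rightarrow> complex) \<Rightarrow> ('e \<Rightarrow> complex) \<Rightarrow> 'e \<Rightarrow> complex" where
  "chart_levi r a w x = (\<Sum>j<r. dir (cnj_coeffs (a j)) (dir (a j) w) x + dir (a j) (dir (cnj_coeffs (a j)) w) x)
     - dir (a r) w x - dir (cnj_coeffs (a r)) w x"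

lemma dir_lincomb:
  assumes "u differentiable (at x)" "w differentiable (at x)"
  shows "dir a (\<lambda>y. u y + c * w y) x = dir a u x + c * dir a w x"
  using assms by (simp add: dir_add dir_cmult)

lemma chart_levi_lincomb:
  assumes S: "open S" and a: "\<And>j. j \<le> r \<Longrightarrow> smooth_coeffs S (a j)" and u: "smooth_on S u" and w: "smooth_on S w" and x: "x \<in> S"
  shows "chart_levi r a (\<lambda>y. u y + c * w y) x = chart_levi r a u x + c * chart_levi r a w x"
proof -
  note d = smooth_on_differentiable[OF u] smooth_on_differentiable[OF w]
  have nested: "dir a' (dir d (\<lambda>y. u y + c * w y)) x = dir a' (dir d u) x + c * dir a' (dir d w) x"
    if e: "smooth_coeffs S d" for a' d
  proof -
    have sm: "smooth_on S (dir d (\<lambda>y. u y + c * w y))"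
      by (intro smooth_on_dir S e smooth_on_add smooth_on_mult smooth_on_const u w)
    have "dir a' (dir d (\<lambda>y. u y + c * w y)) x = dir a' (\<lambda>y. dir d u y + c * dir d w y) x"
      by (rule dir_cong[OF S x _ smooth_on_differentiable[OF sm x]]) (rule dir_lincomb[OF d])
    then show ?thesis
      using dir_lincomb[OF smooth_on_differentiable[OF smooth_on_dir[OF S e u] x] smooth_on_differentiable[OF smooth_on_dir[OF S e w] x]] by simp
  qed
  have "(\<Sum>j<r. dir (cnj_coeffs (a j)) (dir (a j) (\<lambda>y. u y + c * w y)) x + dir (a j) (dir (cnj_coeffs (a j)) (\<lambda>y. u y + c * w y)) x) =
    (\<Sum>j<r. (dir (cnj_coeffs (a j)) (dir (a j) u) x + dir (a j) (dir (cnj_coeffs (a j)) u) x)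
       + c * (dir (cnj_coeffs (a j)) (dir (a j) w) x + dir (a j) (dir (cnj_coeffs (a j)) w) x))"
    by (rule sum.cong[OF refl]) (simp add: nested a smooth_coeffs_cnj[OF S a] algebra_simps)
  then show ?thesis
    unfolding chart_levi_def dir_lincomb[OF d(1)[OF x] d(2)[OF x]]
    by (simp add: sum.distrib sum_distrib_left algebra_simps)
qed

text \<open>At a zero of \<rho> every term with an undifferentiated factor \<rho> drops out,
  including both terms with L_0. Each of the two orders of Z_j and its conjugate contributes twice
  |Z_j \<rho>|^2.\<close>

lemma chart_levi_square:
  fixes \<rho> :: "'e::euclidean_space \<Rightarrow> real"
  assumes S: "open S" and a: "\<And>j. j \<le> r \<Longrightarrow> smooth_coeffs S (a j)" and \<rho>: "smooth_on S \<rho>" and x: "x \<in> S" "\<rho> x = 0"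
  shows "chart_levi r a (\<lambda>y. complex_of_real ((\<rho> y)\<^sup>2)) x =
     complex_of_real (4 * (\<Sum>j<r. (cmod (dir (a j) (\<lambda>y. complex_of_real (\<rho> y)) x))\<^sup>2))"
proof -
  let ?\<rho> = "\<lambda>y. complex_of_real (\<rho> y)"
  have s: "smooth_on S ?\<rho>" by (rule smooth_on_of_real[OF S \<rho>])
  have sq: "(\<lambda>y. complex_of_real ((\<rho> y)\<^sup>2)) = (\<lambda>y. ?\<rho> y * ?\<rho> y)" by (simp add: power2_eq_square)
  note d = smooth_on_differentiable[OF s]
  have one: "dir d (\<lambda>y. ?\<rho> y * ?\<rho> y) y = 2 * (?\<rho> y * dir d ?\<rho> y)" if "y \<in> S" for d y
    using dir_mult[OF d[OF that] d[OF that]] by simp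
  have nested: "dir a' (dir e (\<lambda>y. ?\<rho> y * ?\<rho> y)) x = 2 * (dir a' ?\<rho> x * dir e ?\<rho> x)" if e: "smooth_coeffs S e" for a' e
  proof -
    have sm: "smooth_on S (dir e (\<lambda>y. ?\<rho> y * ?\<rho> y))" by (intro smooth_on_dir S e smooth_on_mult s)
    have de: "dir e ?\<rho> differentiable (at x)" by (rule smooth_on_differentiable[OF smooth_on_dir[OF S e s] x(1)])
    have "dir a' (dir e (\<lambda>y. ?\<rho> y * ?\<rho> y)) x = dir a' (\<lambda>y. 2 * (?\<rho> y * dir e ?\<rho> y)) x"
      by (rule dir_cong[OF S x(1) one smooth_on_differentiable[OF sm x(1)]])
    also have "\<dots> = 2 * dir a' (\<lambda>y. ?\<rho> y * dir e ?\<rho> y) x"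
      by (rule dir_cmult) (use d[OF x(1)] de in simp)
    also have "dir a' (\<lambda>y. ?\<rho> y * dir e ?\<rho> y) x = dir a' ?\<rho> x * dir e ?\<rho> x"
      using dir_mult[OF d[OF x(1)] de] x(2) by simp
    finally show ?thesis .
  qed
  have cj: "dir (cnj_coeffs e) ?\<rho> x = cnj (dir e ?\<rho> x)" for e
    using dir_cnj[OF d[OF x(1)], of "cnj_coeffs e"] by simp
  have "(\<Sum>j<r. dir (cnj_coeffs (a j)) (dir (a j) (\<lambda>y. ?\<rho> y * ?\<rho> y)) x + dir (a j) (dir (cnj_coeffs (a j)) (\<lambda>y. ?\<rho> y * ?\<rho> y)) x) =
    (\<Sum>j<r. complex_of_real (4 * (cmod (dir (a j) ?\<rho> x))\<^sup>2))"
  proof (rule sum.cong[OF refl])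
    fix j assume "j \<in> {..<r}"
    then have j: "smooth_coeffs S (a j)" using a by simp
    have "dir (cnj_coeffs (a j)) (dir (a j) (\<lambda>y. ?\<rho> y * ?\<rho> y)) x + dir (a j) (dir (cnj_coeffs (a j)) (\<lambda>y. ?\<rho> y * ?\<rho> y)) x =
      4 * (dir (a j) ?\<rho> x * cnj (dir (a j) ?\<rho> x))"
      unfolding nested[OF j] nested[OF smooth_coeffs_cnj[OF S j]] cj by simp
    then show "dir (cnj_coeffs (a j)) (dir (a j) (\<lambda>y. ?\<rho> y * ?\<rho> y)) x + dir (a j) (dir (cnj_coeffs (a j)) (\<lambda>y. ?\<rho> y * ?\<rho> y)) x =
      complex_of_real (4 * (cmod (dir (a j) ?\<rho> x))\<^sup>2)"
      unfolding complex_norm_square[symmetric] by simp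
  qed
  then show ?thesis
    unfolding chart_levi_def sq using x by (simp add: one sum_distrib_left)
qed

text \<open>The function and its derivatives are only Lebesgue measurable, and their relations hold almost
  everywhere; \<open>carleman_uniqueness\<close> is applied to Borel representatives that are 0 on a Borel null set
  containing all exceptional points.\<close>

lemma carleman_uniqueness_lebesgue:
  fixes S :: "'a::euclidean_space set" and a :: "nat \<Rightarrow> 'a \<Rightarrow> 'a \<Rightarrow> complex" and \<phi> :: "'a \<Rightarrow> real"
    and f :: "'a \<Rightarrow> complex" and g :: "nat \<Rightarrow> 'a \<Rightarrow> complex" and r :: nat and x0 :: 'a and R0 :: real
  defines "K \<equiv> cball x0 R0"
  assumes S: "open S" and R0: "R0 > 0" and B: "K \<subseteq> S"
    and a: "\<And>j. j \<le> r \<Longrightarrow> smooth_coeffs S (a j)" and \<phi>: "smooth_on S \<phi>" and \<phi>0: "\<phi> x0 = 0"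
    and bracket: "\<And>w x. smooth_on S w \<Longrightarrow> x \<in> S \<Longrightarrow>
      (\<Sum>j<r. dir (a j) (dir (cnj_coeffs (a j)) w) x - dir (cnj_coeffs (a j)) (dir (a j) w) x) =
      dir (cnj_coeffs (a r)) w x - dir (a r) w x"
    and levi: "Re (chart_levi r a (\<lambda>x. complex_of_real (\<phi> x)) x0) > 0"
    and f: "set_borel_measurable lebesgue K f" and f2: "set_integrable lebesgue K (\<lambda>x. (cmod (f x))\<^sup>2)"
    and g: "\<And>j. j \<le> r \<Longrightarrow> set_borel_measurable lebesgue K (g j)"
    and C: "\<And>j. j \<le> r \<Longrightarrow> AE x in lebesgue. x \<in> K \<longrightarrow> cmod (g j x) \<le> C j * cmod (f x)"
    and weak: "\<And>j u. j \<le> r \<Longrightarrow> smooth_on UNIV u \<Longrightarrow> (\<And>x. x \<notin> K \<Longrightarrow> u x = 0) \<Longrightarrow>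
      (LINT x|lebesgue. g j x * u x) = - (LINT x|lebesgue. f x * (\<Sum>b\<in>Basis. frechet_derivative (\<lambda>y. a j b y * u y) (at x) b))"
    and \<epsilon>: "\<epsilon> > 0" and neg: "\<And>x. x \<in> K \<Longrightarrow> f x \<noteq> 0 \<Longrightarrow> \<phi> x \<le> - \<epsilon> * (norm (x - x0))\<^sup>2"
  shows "\<exists>d>0. AE x in lborel. x \<in> ball x0 d \<longrightarrow> f x = 0"
proof -
  have cK: "compact K" unfolding K_def by (rule compact_cball)
  interpret test_domain S K by standard (rule S cK B)+
  have KB: "K \<in> sets borel" using cK by (simp add: compact_imp_closed)
  define f1 where "f1 = (\<lambda>x. indicat_real K x *\<^sub>R f x)"
  define g1 where "g1 = (\<lambda>j x. indicat_real K x *\<^sub>R g j x)"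
  have f1m: "f1 \<in> borel_measurable lebesgue" using f unfolding set_borel_measurable_def f1_def .
  have g1m: "g1 j \<in> borel_measurable lebesgue" if "j \<le> r" for j using g[OF that] unfolding set_borel_measurable_def g1_def .
  obtain f' where f': "f' \<in> borel_measurable borel" "AE x in lborel. f1 x = f' x"
    by (rule lebesgue_borel_representative[OF f1m])
  have ex: "\<exists>h. j \<le> r \<longrightarrow> h \<in> borel_measurable borel \<and> (AE x in lborel. g1 j x = h x)" for j
  proof (cases "j \<le> r")
    case True
    obtain h where "h \<in> borel_measurable borel" "AE x in lborel. g1 j x = h x"
      by (rule lebesgue_borel_representative[OF g1m[OF True]])
    then show ?thesis by blast
  qed simp
  have "\<exists>h. \<forall>j. j \<le> r \<longrightarrow> h j \<in> borel_measurable borel \<and> (AE x in lborel. g1 j x = h j x)"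
    by (rule choice) (rule allI, rule ex)
  then obtain g' where g': "\<And>j. j \<le> r \<Longrightarrow> g' j \<in> borel_measurable borel" "\<And>j. j \<le> r \<Longrightarrow> AE x in lborel. g1 j x = g' j x"
    by blast
  have "AE x in lborel. \<forall>j\<in>{..r}. g1 j x = g' j x \<and> (x \<in> K \<longrightarrow> cmod (g j x) \<le> C j * cmod (f x))"
  proof (rule AE_finite_allI)
    fix j assume "j \<in> {..r}"
    then have j: "j \<le> r" by simp
    have "AE x in lborel. x \<in> K \<longrightarrow> cmod (g j x) \<le> C j * cmod (f x)" using C[OF j] by (simp only: AE_completion_iff)
    with g'(2)[OF j] show "AE x in lborel. g1 j x = g' j x \<and> (x \<in> K \<longrightarrow> cmod (g j x) \<le> C j * cmod (f x))"
      by eventually_elim simp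
  qed simp
  with f'(2) have "AE x in lborel. f1 x = f' x \<and> (\<forall>j\<in>{..r}. g1 j x = g' j x \<and> (x \<in> K \<longrightarrow> cmod (g j x) \<le> C j * cmod (f x)))"
    by eventually_elim simp
  then obtain N where N: "{x \<in> space lborel. \<not> (f1 x = f' x \<and> (\<forall>j\<in>{..r}. g1 j x = g' j x \<and> (x \<in> K \<longrightarrow> cmod (g j x) \<le> C j * cmod (f x))))} \<subseteq> N"
    "emeasure lborel N = 0" "N \<in> sets lborel" by (rule AE_E)
  have off: "f1 x = f' x" "\<And>j. j \<le> r \<Longrightarrow> g1 j x = g' j x" "\<And>j. j \<le> r \<Longrightarrow> x \<in> K \<Longrightarrow> cmod (g j x) \<le> C j * cmod (f x)"
    if "x \<notin> N" for x using N(1) that by (auto simp: subset_eq)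
  have NB: "N \<in> sets borel" using N(3) by simp
  have AEN: "AE x in lborel. x \<notin> N" by (rule AE_I[OF _ N(2,3)]) auto
  then have AEN': "AE x in lebesgue. x \<notin> N" by (rule AE_completion)
  define F where "F = (\<lambda>x. indicat_real (K - N) x *\<^sub>R f' x)"
  define G where "G = (\<lambda>j x. indicat_real (K - N) x *\<^sub>R g' j x)"
  have KN: "K - N \<in> sets borel" using KB NB by blast
  have Fm: "F \<in> borel_measurable borel" unfolding F_def using KN f'(1) by measurable
  have Gm: "G j \<in> borel_measurable borel" if "j \<le> r" for j unfolding G_def using KN g'(1)[OF that] by measurable
  have Fv: "F x = (if x \<in> K - N then f x else 0)" for x using off(1)[of x] by (auto simp: F_def f1_def indicator_def)
  have Gv: "G j x = (if x \<in> K - N then g j x else 0)" if "j \<le> r" for j x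
    using off(2)[of x j, OF _ that] by (auto simp: G_def g1_def indicator_def)
  have AEF: "AE x in lebesgue. F x = f1 x" using AEN' by eventually_elim (simp add: Fv f1_def indicator_def)
  have AEG: "AE x in lebesgue. G j x = g1 j x" if "j \<le> r" for j
    using AEN' by eventually_elim (simp add: Gv[OF that] g1_def indicator_def)
  have leb: "h \<in> borel_measurable lebesgue" if "h \<in> borel_measurable borel" for h :: "'a \<Rightarrow> 'b::euclidean_space"
    by (rule measurable_completion) (use that in simp)
  have F2: "integrable lborel (\<lambda>x. (cmod (F x))\<^sup>2)"
  proof -
    have m: "(\<lambda>x. (cmod (F x))\<^sup>2) \<in> borel_measurable borel" using Fm by measurable
    have "integrable lebesgue (\<lambda>x. (cmod (F x))\<^sup>2) \<longleftrightarrow> integrable lebesgue (\<lambda>x. indicat_real K x *\<^sub>R (cmod (f x))\<^sup>2)"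
    proof (rule integrable_cong_AE)
      show "(\<lambda>x. (cmod (F x))\<^sup>2) \<in> borel_measurable lebesgue" by (rule leb[OF m])
      show "(\<lambda>x. indicat_real K x *\<^sub>R (cmod (f x))\<^sup>2) \<in> borel_measurable lebesgue"
        using f2 unfolding set_integrable_def by (rule borel_measurable_integrable)
      show "AE x in lebesgue. (cmod (F x))\<^sup>2 = indicat_real K x *\<^sub>R (cmod (f x))\<^sup>2"
        using AEF by eventually_elim (simp add: f1_def indicator_def)
    qed
    then have "integrable lebesgue (\<lambda>x. (cmod (F x))\<^sup>2)" using f2 unfolding set_integrable_def by blast
    then show ?thesis using integrable_completion[of "\<lambda>x. (cmod (F x))\<^sup>2" lborel] m by simp
  qed
  have F1: "integrable lborel F"
  proof (rule Bochner_Integration.integrable_bound)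
    have "emeasure lborel K < \<infinity>" using cK by (rule emeasure_compact_finite)
    then have "integrable lborel (indicat_real K)" using KB by simp
    then show "integrable lborel (\<lambda>x. indicat_real K x + (cmod (F x))\<^sup>2)" using F2 by simp
    show "F \<in> borel_measurable lborel" using Fm by simp
    show "AE x in lborel. norm (F x) \<le> norm (indicat_real K x + (cmod (F x))\<^sup>2)"
    proof (rule AE_I2)
      fix x
      \<comment> \<open>On the bounded set \<open>K\<close> square integrability implies
        integrability, by |F| at most 1 + |F|^2.\<close>
      have "2 * cmod (F x) \<le> 1 + (cmod (F x))\<^sup>2" using zero_le_power2[of "cmod (F x) - 1"] by (simp add: power2_diff)
      then have "cmod (F x) \<le> 1 + (cmod (F x))\<^sup>2" using norm_ge_zero[of "F x"] by linarith
      moreover have "F x = 0" if "x \<notin> K" using that by (simp add: Fv)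
      ultimately show "norm (F x) \<le> norm (indicat_real K x + (cmod (F x))\<^sup>2)" by (cases "x \<in> K") auto
    qed
  qed
  \<comment> \<open>The sum of absolute values gives one nonnegative constant for all indices,
    whatever the signs of the \<open>C j\<close>.\<close>
  define \<kappa> where "\<kappa> = (\<Sum>j\<le>r. \<bar>C j\<bar>)"
  have \<kappa>0: "\<kappa> \<ge> 0" unfolding \<kappa>_def by (rule sum_nonneg) simp
  have GF: "cmod (G j x) \<le> \<kappa> * cmod (F x)" if j: "j \<le> r" for j x
  proof (cases "x \<in> K - N")
    case True
    have "C j \<le> \<kappa>" unfolding \<kappa>_def using member_le_sum[of j "{..r}" "\<lambda>j. \<bar>C j\<bar>"] j by fastforce
    then have "C j * cmod (f x) \<le> \<kappa> * cmod (f x)" by (rule mult_right_mono) simp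
    then show ?thesis using off(3)[of x j] True j by (simp add: Fv Gv)
  next
    case False
    then show ?thesis by (auto simp: Fv Gv[OF j])
  qed
  have weak': "(\<integral>x. G j x * u x \<partial>lborel) = - (\<integral>x. F x * (\<Sum>b\<in>Basis. frechet_derivative (\<lambda>y. a j b y * u y) (at x) b) \<partial>lborel)"
    if j: "j \<le> r" and u: "test_on S K u" for j u
  proof -
    define D where "D = (\<lambda>x. \<Sum>b\<in>Basis. frechet_derivative (\<lambda>y. a j b y * u y) (at x) b)"
    have uK: "u x = 0" if "x \<notin> K" for x using u that by (simp add: test_on_def)
    have t: "test_on S K (\<lambda>y. a j b y * u y)" if "b \<in> Basis" for b
      by (rule test_mult[OF _ u]) (use a[OF j] that in \<open>simp add: smooth_coeffs_def\<close>)
    have DK: "D x = 0" if "x \<notin> K" for x unfolding D_def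
      by (rule sum.neutral, rule ballI, rule deriv_zero_off[OF compact_imp_closed[OF cK] that]) (simp add: uK)
    have "continuous_on UNIV D" unfolding D_def
      by (intro continuous_on_sum smooth_on_continuous_on smooth_on_deriv test_smooth[OF t])
    then have Dm: "D \<in> borel_measurable borel" by (rule borel_measurable_continuous_onI)
    have um: "u \<in> borel_measurable borel" by (rule borel_measurable_continuous_onI[OF smooth_on_continuous_on[OF test_smooth[OF u]]])
    \<comment> \<open>The factor \<open>h\<close> vanishes off \<open>K\<close>, so the integrand
      does not see the truncation to \<open>K\<close>; this passes between Lebesgue integrals of the
      given functions and Borel integrals of their representatives.\<close>
    have trans: "(\<integral>x. H x * h x \<partial>lborel) = (LINT x|lebesgue. k x * h x)"
      if H: "H \<in> borel_measurable borel" and h: "h \<in> borel_measurable borel" and hK: "\<And>x. x \<notin> K \<Longrightarrow> h x = 0"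
        and k: "(\<lambda>x. indicat_real K x *\<^sub>R k x) \<in> borel_measurable lebesgue" and eq: "AE x in lebesgue. H x = indicat_real K x *\<^sub>R k x"
      for H h k :: "'a \<Rightarrow> complex"
    proof -
      have m: "(\<lambda>x. H x * h x) \<in> borel_measurable borel" using H h by measurable
      have "(\<integral>x. H x * h x \<partial>lborel) = (LINT x|lebesgue. H x * h x)"
        using integral_completion[of "\<lambda>x. H x * h x" lborel] m by simp
      also have "\<dots> = (LINT x|lebesgue. (indicat_real K x *\<^sub>R k x) * h x)"
      proof (rule integral_cong_AE[OF leb[OF m]])
        show "(\<lambda>x. (indicat_real K x *\<^sub>R k x) * h x) \<in> borel_measurable lebesgue"
          by (rule borel_measurable_times[OF k leb[OF h]])
        show "AE x in lebesgue. H x * h x = (indicat_real K x *\<^sub>R k x) * h x" using eq by eventually_elim simp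
      qed
      also have "(\<lambda>x. (indicat_real K x *\<^sub>R k x) * h x) = (\<lambda>x. k x * h x)"
        by (rule ext) (use hK in \<open>auto simp: indicator_def\<close>)
      finally show ?thesis .
    qed
    have "(\<integral>x. G j x * u x \<partial>lborel) = (LINT x|lebesgue. g j x * u x)"
      by (rule trans[OF Gm[OF j] um uK g1m[OF j, unfolded g1_def] AEG[OF j, unfolded g1_def]])
    also have "\<dots> = - (LINT x|lebesgue. f x * D x)" unfolding D_def by (rule weak[OF j test_smooth[OF u] uK])
    also have "(LINT x|lebesgue. f x * D x) = (\<integral>x. F x * D x \<partial>lborel)"
      by (rule trans[OF Fm Dm DK f1m[unfolded f1_def] AEF[unfolded f1_def], symmetric])
    finally show ?thesis unfolding D_def .
  qed
  have "\<exists>d>0. AE x in lborel. x \<in> ball x0 d \<longrightarrow> F x = 0"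
    by (rule carleman_uniqueness[OF S R0 B[unfolded K_def] a \<phi> \<phi>0 bracket levi[unfolded chart_levi_def] F1 F2 Gm \<kappa>0 GF weak'[unfolded K_def] \<epsilon> neg[folded K_def]])
      (auto simp: Fv K_def split: if_splits)
  then obtain d where d: "d > 0" "AE x in lborel. x \<in> ball x0 d \<longrightarrow> F x = 0" by blast
  show ?thesis
  proof (intro exI conjI)
    show "min d R0 > 0" using d R0 by simp
    show "AE x in lborel. x \<in> ball x0 (min d R0) \<longrightarrow> f x = 0"
      using d(2) AEN by eventually_elim (auto simp: Fv K_def split: if_splits)
  qed
qed

context atlas
begin

text \<open>The weight is assembled in a chart. By linearity its Levi value at the centre splits
  into those of \<rho>, of \<mu> times its square, and of the quadratic correction, so the
  hypothesis \<open>Q\<close> gives positivity once \<epsilon> is small.\<close>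

lemma uniqueness_from_levi:
  fixes \<rho> :: "'m \<Rightarrow> real" and f :: "'m \<Rightarrow> complex" and r :: nat
  assumes c: "(V, \<phi>) \<in> A" and U: "open U" "U \<subseteq> V" "p0 \<in> U"
    and Z: "\<And>j. j < r \<Longrightarrow> smooth_vfield A U (Z j)" and L0: "smooth_vfield A U L0"
    and br: "\<And>q. q \<in> U \<Longrightarrow> (\<Sum>j<r. lie_bracket A (Z j) (conj_field (Z j)) q) = conj_field L0 q - L0 q"
    and \<rho>: "msmooth_on A U \<rho>" and \<rho>0: "\<rho> p0 = 0"
    and Q: "Re (levi_op r Z L0 p0 (\<lambda>q. complex_of_real (\<rho> q)))
       + 4 * \<mu> * (\<Sum>j<r. (cmod (Z j p0 (\<lambda>q. complex_of_real (\<rho> q))))\<^sup>2) > 0"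
    and f: "L2_loc A U f"
    and star: "\<And>j. j < Suc r \<Longrightarrow> \<exists>g \<kappa>. weak_deriv A U ((Z(r := L0)) j) f g \<and> L2_loc A U g \<and> Linf_loc A U \<kappa> \<and>
       ae_on A U (\<lambda>p. cmod (g p) \<le> \<kappa> p * cmod (f p))"
    and neg: "\<And>q. q \<in> U \<Longrightarrow> f q \<noteq> 0 \<Longrightarrow> \<rho> q < 0"
  shows "\<exists>N. open N \<and> p0 \<in> N \<and> ae_on A N (\<lambda>q. f q = 0)"
proof -
  define \<psi> where "\<psi> = inv_into V \<phi>"
  define S where "S = \<phi> ` U"
  define x0 where "x0 = \<phi> p0"
  define a where "a = (\<lambda>j b x. (Z(r := L0)) j (\<psi> x) (coord \<phi> b))"
  define \<rho>' where "\<rho>' = (\<lambda>x. \<rho> (\<psi> x))"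
  have UV: "U \<inter> V = U" using U by blast
  have S: "open S" unfolding S_def using chart_open[OF c U(1)] UV by simp
  have x0: "x0 \<in> S" unfolding x0_def S_def using U by simp
  have \<psi>\<phi>: "\<psi> (\<phi> q) = q" if "q \<in> U" for q unfolding \<psi>_def using chart_inv[OF c] that U by blast
  have \<psi>U: "\<psi> x \<in> U" "\<phi> (\<psi> x) = x" if "x \<in> S" for x using that \<psi>\<phi> by (auto simp: S_def)
  have \<psi>0: "\<psi> x0 = p0" unfolding x0_def by (rule \<psi>\<phi>[OF U(3)])
  have corZ: "corresponds U V \<phi> (Z j) (a j)" if "j < r" for j
    using Z[OF that] that by (simp add: corresponds_def a_def \<psi>_def)
  have corL: "corresponds U V \<phi> L0 (a r)"
    using L0 by (simp add: corresponds_def a_def \<psi>_def)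
  have a: "smooth_coeffs S (a j)" if "j \<le> r" for j
  proof (cases "j = r")
    case True
    then show ?thesis unfolding S_def using corresponds_smooth[OF corL c U(1,2)] by simp
  next
    case False
    then have "j < r" using that by simp
    then show ?thesis unfolding S_def by (rule corresponds_smooth[OF corZ c U(1,2)])
  qed
  have \<rho>': "smooth_on S \<rho>'"
    using msmooth_chart[OF \<rho> c] unfolding UV S_def \<rho>'_def \<psi>_def .
  have \<rho>'0: "\<rho>' x0 = 0" unfolding \<rho>'_def \<psi>0 by (rule \<rho>0)
  have bracket: "(\<Sum>j<r. dir (a j) (dir (cnj_coeffs (a j)) w) x - dir (cnj_coeffs (a j)) (dir (a j) w) x) =
      dir (cnj_coeffs (a r)) w x - dir (a r) w x" if w: "smooth_on S w" and x: "x \<in> S" for w x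
  proof -
    define h where "h = (\<lambda>q. w (\<phi> q))"
    have h: "msmooth_on A U h" unfolding h_def by (rule msmooth_transfer[OF c U(1,2)]) (use w in \<open>simp add: S_def\<close>)
    have wh: "w y = h (inv_into V \<phi> y)" if "y \<in> \<phi> ` U" for y
      using \<psi>U(2)[of y] that by (simp add: h_def S_def \<psi>_def)
    have x': "x \<in> \<phi> ` U" using x by (simp add: S_def)
    have near: "msmooth_near A (\<psi> x) h" by (rule nearI[OF U(1) \<psi>U(1)[OF x] h])
    have "(\<Sum>j<r. dir (a j) (dir (cnj_coeffs (a j)) w) x - dir (cnj_coeffs (a j)) (dir (a j) w) x) =
      (\<Sum>j<r. lie_bracket A (Z j) (conj_field (Z j)) (\<psi> x) h)"
    proof (rule sum.cong[OF refl])
      fix j assume "j \<in> {..<r}"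
      then have j: "j < r" by simp
      note cj = corZ[OF j] corresponds_conj[OF corZ[OF j]]
      show "dir (a j) (dir (cnj_coeffs (a j)) w) x - dir (cnj_coeffs (a j)) (dir (a j) w) x =
        lie_bracket A (Z j) (conj_field (Z j)) (\<psi> x) h"
        unfolding bracket_apply[OF near] unfolding \<psi>_def
        by (rule arg_cong2[where f="(-)"]; rule corresponds_dir_dir[OF _ _ c U(1,2) h _ x']; (rule cj | (rule wh, assumption)))
    qed
    also have "\<dots> = (\<Sum>j<r. lie_bracket A (Z j) (conj_field (Z j)) (\<psi> x)) h" by (rule sum_fun_apply[symmetric])
    also have "\<dots> = (conj_field L0 (\<psi> x) - L0 (\<psi> x)) h" unfolding br[OF \<psi>U(1)[OF x]] ..
    also have "\<dots> = conj_field L0 (\<psi> x) h - L0 (\<psi> x) h" by simp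
    also have "\<dots> = dir (cnj_coeffs (a r)) w x - dir (a r) w x"
      unfolding \<psi>_def
      by (rule arg_cong2[where f="(-)"]; rule corresponds_dir[OF _ c U(1,2) h _ x', symmetric]; (rule corL corresponds_conj[OF corL] | (rule wh, assumption)))
    finally show ?thesis .
  qed
  let ?c = "\<lambda>u :: 'e \<Rightarrow> real. \<lambda>x. complex_of_real (u x)"
  let ?g = "\<lambda>q. complex_of_real (\<rho> q)"
  have g: "msmooth_on A U ?g" by (rule msmooth_of_real[OF U(1) \<rho>])
  have gx: "?c \<rho>' y = ?g (inv_into V \<phi> y)" for y by (simp add: \<rho>'_def \<psi>_def)
  have x0': "x0 \<in> \<phi> ` U" using x0 by (simp add: S_def)
  have \<psi>0': "inv_into V \<phi> x0 = p0" using \<psi>0 by (simp add: \<psi>_def)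
  have levi_\<rho>: "chart_levi r a (?c \<rho>') x0 = levi_op r Z L0 p0 ?g"
  proof -
    have "(\<Sum>j<r. dir (cnj_coeffs (a j)) (dir (a j) (?c \<rho>')) x0 + dir (a j) (dir (cnj_coeffs (a j)) (?c \<rho>')) x0) =
       (\<Sum>j<r. Z j p0 (\<lambda>q. conj_field (Z j) q ?g) + conj_field (Z j) p0 (\<lambda>q. Z j q ?g))"
    proof (rule sum.cong[OF refl])
      fix j assume "j \<in> {..<r}"
      then have j: "j < r" by simp
      note cj = corZ[OF j] corresponds_conj[OF corZ[OF j]]
      show "dir (cnj_coeffs (a j)) (dir (a j) (?c \<rho>')) x0 + dir (a j) (dir (cnj_coeffs (a j)) (?c \<rho>')) x0 =
        Z j p0 (\<lambda>q. conj_field (Z j) q ?g) + conj_field (Z j) p0 (\<lambda>q. Z j q ?g)"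
        unfolding corresponds_dir_dir[OF cj c U(1,2) g gx x0'] corresponds_dir_dir[OF cj(2,1) c U(1,2) g gx x0'] \<psi>0'
        by (rule add.commute)
    qed
    then show ?thesis
      unfolding chart_levi_def levi_op_def corresponds_dir[OF corL c U(1,2) g gx x0']
        corresponds_dir[OF corresponds_conj[OF corL] c U(1,2) g gx x0'] \<psi>0' by (simp only:)
  qed
  have dir_\<rho>: "dir (a j) (?c \<rho>') x0 = Z j p0 ?g" if "j < r" for j
    using corresponds_dir[OF corZ[OF that] c U(1,2) g gx x0'] unfolding \<psi>0' .
  define q where "q = (\<lambda>x. (norm (x - x0))\<^sup>2)"
  have q: "smooth_on S q" unfolding q_def by (rule smooth_on_dist_sq[OF S])
  define s where "s = Re (levi_op r Z L0 p0 ?g) + 4 * \<mu> * (\<Sum>j<r. (cmod (Z j p0 ?g))\<^sup>2)"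
  define t where "t = \<bar>Re (chart_levi r a (?c q) x0)\<bar>"
  \<comment> \<open>With this choice \<epsilon> t is at most s/2, so the quadratic correction cannot
    destroy positivity; 1 + t avoids division by 0.\<close>
  define \<epsilon> where "\<epsilon> = s / (2 * (1 + t))"
  have s: "s > 0" using Q by (simp only: s_def)
  have t: "t \<ge> 0" by (simp add: t_def)
  have \<epsilon>: "\<epsilon> > 0" unfolding \<epsilon>_def using s t by simp
  have \<epsilon>t: "\<epsilon> * t < s"
  proof -
    have "\<epsilon> * t \<le> \<epsilon> * (1 + t)" using \<epsilon> by simp
    also have "\<dots> = s / 2" unfolding \<epsilon>_def using t by (simp add: field_simps)
    finally show ?thesis using s by simp
  qed
  define w where "w = (\<lambda>x. (\<rho>' x + \<mu> * (\<rho>' x)\<^sup>2) + (- \<epsilon>) * q x)"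
  have \<rho>2: "smooth_on S (\<lambda>x. (\<rho>' x)\<^sup>2)" by (rule smooth_on_power2[OF S \<rho>'])
  have w1: "smooth_on S (\<lambda>x. \<rho>' x + \<mu> * (\<rho>' x)\<^sup>2)"
    by (intro smooth_on_add smooth_on_mult smooth_on_const S \<rho>' \<rho>2)
  have w: "smooth_on S w" unfolding w_def
    by (intro smooth_on_add[OF S w1] smooth_on_mult smooth_on_const S q)
  have w0: "w x0 = 0" by (simp add: w_def q_def \<rho>'0)
  have wc: "?c w = (\<lambda>x. ?c (\<lambda>x. \<rho>' x + \<mu> * (\<rho>' x)\<^sup>2) x + complex_of_real (- \<epsilon>) * ?c q x)"
    by (rule ext) (simp only: w_def of_real_add of_real_mult)
  have w1c: "?c (\<lambda>x. \<rho>' x + \<mu> * (\<rho>' x)\<^sup>2) = (\<lambda>x. ?c \<rho>' x + complex_of_real \<mu> * ?c (\<lambda>x. (\<rho>' x)\<^sup>2) x)"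
    by (rule ext) (simp only: of_real_add of_real_mult)
  note sr = smooth_on_of_real[OF S]
  note lin = chart_levi_lincomb[where r=r and a=a and x=x0, OF S a _ _ x0]
  have "chart_levi r a (?c w) x0 = chart_levi r a (?c (\<lambda>x. \<rho>' x + \<mu> * (\<rho>' x)\<^sup>2)) x0
      + complex_of_real (- \<epsilon>) * chart_levi r a (?c q) x0"
    unfolding wc by (rule lin[OF _ sr[OF w1] sr[OF q]])
  also have "chart_levi r a (?c (\<lambda>x. \<rho>' x + \<mu> * (\<rho>' x)\<^sup>2)) x0 =
      chart_levi r a (?c \<rho>') x0 + complex_of_real \<mu> * chart_levi r a (?c (\<lambda>x. (\<rho>' x)\<^sup>2)) x0"
    unfolding w1c by (rule lin[OF _ sr[OF \<rho>'] sr[OF \<rho>2]])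
  also have "chart_levi r a (?c (\<lambda>x. (\<rho>' x)\<^sup>2)) x0 = complex_of_real (4 * (\<Sum>j<r. (cmod (dir (a j) (?c \<rho>') x0))\<^sup>2))"
    by (rule chart_levi_square[where r=r and a=a, OF S a \<rho>' x0 \<rho>'0])
  also have "(\<Sum>j<r. (cmod (dir (a j) (?c \<rho>') x0))\<^sup>2) = (\<Sum>j<r. (cmod (Z j p0 ?g))\<^sup>2)"
    by (rule sum.cong[OF refl]) (simp only: dir_\<rho> lessThan_iff)
  finally have "Re (chart_levi r a (?c w) x0) = s - \<epsilon> * Re (chart_levi r a (?c q) x0)"
    by (simp add: s_def levi_\<rho>)
  moreover have "\<epsilon> * Re (chart_levi r a (?c q) x0) \<le> \<epsilon> * t" using \<epsilon> by (simp add: t_def)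
  ultimately have levi: "Re (chart_levi r a (?c w) x0) > 0" using \<epsilon>t by linarith
  \<comment> \<open>A ball on which |\<mu> \<rho>'| < 1. There \<rho>' (1 + \<mu> \<rho>') is at
    most 0 wherever \<rho>' < 0, for either sign of \<mu>, so adding the square keeps the weight
    below the quadratic term where \<open>f\<close> is nonzero.\<close>
  have "continuous_on S (\<lambda>x. \<mu> * \<rho>' x)"
    by (intro continuous_intros smooth_on_continuous_on \<rho>')
  then have "open (S \<inter> (\<lambda>x. \<mu> * \<rho>' x) -` {-1<..<1})" using S by (rule continuous_open_preimage) simp
  moreover have "x0 \<in> S \<inter> (\<lambda>x. \<mu> * \<rho>' x) -` {-1<..<1}" using x0 \<rho>'0 by simp
  ultimately obtain R0 where R0: "R0 > 0" "cball x0 R0 \<subseteq> S \<inter> (\<lambda>x. \<mu> * \<rho>' x) -` {-1<..<1}"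
    unfolding open_contains_cball by blast
  let ?K = "cball x0 R0"
  have KS: "?K \<subseteq> S" using R0(2) by blast
  have K: "compact ?K" "?K \<subseteq> \<phi> ` (U \<inter> V)" using KS compact_cball unfolding S_def UV by blast+
  have f1: "set_borel_measurable lebesgue ?K (\<lambda>x. f (\<psi> x))" "set_integrable lebesgue ?K (\<lambda>x. (cmod (f (\<psi> x)))\<^sup>2)"
    using f c K unfolding L2_loc_def \<psi>_def by blast+
  \<comment> \<open>A weak derivative bundled with its bound, so that a single choice over
    \<open>j\<close> provides both. On the compact ball the locally bounded \<kappa> turns into a
    constant.\<close>
  let ?P = "\<lambda>j g C. set_borel_measurable lebesgue ?K g \<and> (AE x in lebesgue. x \<in> ?K \<longrightarrow> cmod (g x) \<le> C * cmod (f (\<psi> x))) \<and>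
      (\<forall>u. smooth_on UNIV u \<longrightarrow> (\<forall>x. x \<notin> ?K \<longrightarrow> u x = 0) \<longrightarrow>
       (LINT x|lebesgue. g x * u x) = - (LINT x|lebesgue. f (\<psi> x) * (\<Sum>b\<in>Basis. frechet_derivative (\<lambda>y. a j b y * u y) (at x) b)))"
  have ex: "\<exists>gC. j \<le> r \<longrightarrow> ?P j (fst gC) (snd gC)" for j
  proof (cases "j \<le> r")
    case True
    then have "j < Suc r" by simp
    then obtain g \<kappa> where gw: "weak_deriv A U ((Z(r := L0)) j) f g" and gl: "L2_loc A U g" and \<kappa>: "Linf_loc A U \<kappa>"
      and ae: "ae_on A U (\<lambda>p. cmod (g p) \<le> \<kappa> p * cmod (f p))" using star by blast
    obtain C where C: "AE x in lebesgue. x \<in> ?K \<longrightarrow> \<bar>\<kappa> (\<psi> x)\<bar> \<le> C"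
      using \<kappa> c K unfolding Linf_loc_def \<psi>_def by blast
    have "AE x in lebesgue. x \<in> \<phi> ` (U \<inter> V) \<longrightarrow> cmod (g (\<psi> x)) \<le> \<kappa> (\<psi> x) * cmod (f (\<psi> x))"
      using ae c unfolding ae_on_def \<psi>_def by blast
    with C have "AE x in lebesgue. x \<in> ?K \<longrightarrow> cmod (g (\<psi> x)) \<le> C * cmod (f (\<psi> x))"
    proof eventually_elim
      case (elim x)
      show ?case
      proof
        assume x: "x \<in> ?K"
        then have "cmod (g (\<psi> x)) \<le> \<kappa> (\<psi> x) * cmod (f (\<psi> x))" using elim(2) K(2) by blast
        also have "\<dots> \<le> C * cmod (f (\<psi> x))" using elim(1) x by (intro mult_right_mono) auto
        finally show "cmod (g (\<psi> x)) \<le> C * cmod (f (\<psi> x))" .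
      qed
    qed
    moreover have "set_borel_measurable lebesgue ?K (\<lambda>x. g (\<psi> x))"
      using gl c K unfolding L2_loc_def \<psi>_def by blast
    moreover have "(LINT x|lebesgue. g (\<psi> x) * u x) = - (LINT x|lebesgue. f (\<psi> x) * (\<Sum>b\<in>Basis. frechet_derivative (\<lambda>y. a j b y * u y) (at x) b))"
      if "smooth_on UNIV u" "\<forall>x. x \<notin> ?K \<longrightarrow> u x = 0" for u
      using gw c K that unfolding weak_deriv_def \<psi>_def a_def by blast
    ultimately have "?P j (\<lambda>x. g (\<psi> x)) C" by blast
    then show ?thesis by (intro exI[of _ "(\<lambda>x. g (\<psi> x), C)"]) simp
  qed simp
  have "\<exists>gC. \<forall>j. j \<le> r \<longrightarrow> ?P j (fst (gC j)) (snd (gC j))"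
    by (rule choice) (rule allI, rule ex)
  then obtain gC where gC: "\<And>j. j \<le> r \<Longrightarrow> ?P j (fst (gC j)) (snd (gC j))" by blast
  have neg': "w x \<le> - \<epsilon> * (norm (x - x0))\<^sup>2" if x: "x \<in> ?K" and fx: "f (\<psi> x) \<noteq> 0" for x
  proof -
    have "x \<in> S" using KS x by blast
    from neg[OF \<psi>U(1)[OF this] fx] have "\<rho>' x < 0" by (simp add: \<rho>'_def)
    moreover have "x \<in> (\<lambda>x. \<mu> * \<rho>' x) -` {-1<..<1}" using R0(2) x by blast
    then have "1 + \<mu> * \<rho>' x \<ge> 0" by simp
    ultimately have "\<rho>' x * (1 + \<mu> * \<rho>' x) \<le> 0" by (intro mult_nonpos_nonneg) auto
    then show ?thesis by (simp add: w_def q_def algebra_simps power2_eq_square)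
  qed
  have "\<exists>d>0. AE x in lborel. x \<in> ball x0 d \<longrightarrow> f (\<psi> x) = 0"
    by (rule carleman_uniqueness_lebesgue[where g="\<lambda>j. fst (gC j)" and C="\<lambda>j. snd (gC j)",
        OF S R0(1) KS a w w0 bracket levi f1 _ _ _ \<epsilon> neg'])
      (use gC in simp_all)
  then obtain d where d: "d > 0" "AE x in lborel. x \<in> ball x0 d \<longrightarrow> f (\<psi> x) = 0" by blast
  let ?N = "U \<inter> \<phi> -` ball x0 d"
  have "continuous_on U \<phi>" using homeomorphism_cont1[OF chartD(3)[OF c]] U(2) by (rule continuous_on_subset)
  then have "open ?N" using U(1) by (rule continuous_open_preimage) simp
  moreover have "p0 \<in> ?N" using U(3) d(1) by (simp add: x0_def)
  moreover have "ae_on A ?N (\<lambda>q. f q = 0)"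
  proof (rule ae_on_transfer[OF c])
    show "?N \<subseteq> V" using U(2) by blast
    show "AE x in lborel. x \<in> \<phi> ` ?N \<longrightarrow> f (inv_into V \<phi> x) = 0"
      using d(2) unfolding \<psi>_def by eventually_elim blast
  qed
  ultimately show ?thesis by blast
qed

end

section \<open>From kernel sections to vanishing near the boundary point\<close>

lemma L2_loc_subset:
  assumes f: "L2_loc A W f" and U: "U \<subseteq> W"
  shows "L2_loc A U f"
  unfolding L2_loc_def
proof (clarify, intro conjI)
  fix V \<phi> K assume c: "(V, \<phi>) \<in> A" and K: "compact K" "K \<subseteq> \<phi> ` (U \<inter> V)"
  have "K \<subseteq> \<phi> ` (W \<inter> V)" using K(2) U by blast
  then show "set_borel_measurable lebesgue K (\<lambda>x. f (inv_into V \<phi> x))"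
    "set_integrable lebesgue K (\<lambda>x. (cmod (f (inv_into V \<phi> x)))\<^sup>2)"
    using f c K(1) unfolding L2_loc_def by blast+
qed

context atlas
begin

lemma msmooth_continuous_on:
  assumes f: "msmooth_on A D f" and c: "(V, \<phi>) \<in> A"
  shows "continuous_on (D \<inter> V) f"
proof -
  have "continuous_on (D \<inter> V) \<phi>"
    using homeomorphism_cont1[OF chartD(3)[OF c]] by (rule continuous_on_subset) blast
  then have "continuous_on (D \<inter> V) (\<lambda>q. f (inv_into V \<phi> (\<phi> q)))"
    by (rule continuous_on_compose2[OF smooth_on_continuous_on[OF msmooth_chart[OF f c]]]) blast
  then show ?thesis by (rule continuous_on_eq) (simp add: chart_inv[OF c])
qed

text \<open>Frontier points lie outside the open set \<Omega>, so \<rho> is not negative there; a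
  positive value would persist nearby and give a neighbourhood disjoint from \<Omega>.\<close>

lemma defining_function_frontier:
  fixes \<rho> :: "'m \<Rightarrow> real"
  assumes \<Omega>: "open \<Omega>" and D: "open D" "\<Omega> \<inter> D = {q \<in> D. \<rho> q < 0}" and \<rho>: "msmooth_on A D \<rho>"
    and q: "q \<in> D" "q \<in> frontier \<Omega>"
  shows "\<rho> q = 0"
proof -
  obtain V \<phi> where c: "(V, \<phi>) \<in> A" "q \<in> V" by (rule chart_exists)
  have "open (D \<inter> V)" using D(1) chartD(1)[OF c(1)] by blast
  with msmooth_continuous_on[OF \<rho> c(1)] have pos: "open (D \<inter> V \<inter> \<rho> -` {0<..})"
    by (rule continuous_open_preimage) simp
  have "q \<in> closure \<Omega>" "q \<notin> \<Omega>" using q(2) \<Omega> by (auto simp: frontier_def interior_open)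
  then have "\<not> \<rho> q < 0" using D(2) q(1) by blast
  moreover have "\<not> \<rho> q > 0"
  proof
    assume "\<rho> q > 0"
    then have "q \<in> (D \<inter> V \<inter> \<rho> -` {0<..}) \<inter> closure \<Omega>" using q(1) c(2) \<open>q \<in> closure \<Omega>\<close> by simp
    then have "(D \<inter> V \<inter> \<rho> -` {0<..}) \<inter> \<Omega> \<noteq> {}" using open_Int_closure_eq_empty[OF pos, of \<Omega>] by blast
    then obtain y where "y \<in> D" "\<rho> y > 0" "y \<in> \<Omega>" by auto
    then have "y \<in> {q \<in> D. \<rho> q < 0}" unfolding D(2)[symmetric] by simp
    then show False using \<open>\<rho> y > 0\<close> by simp
  qed
  ultimately show ?thesis by simp
qed

end

context almost_CR
begin

lemma represents_subset: "represents A T U r Z \<tau> \<Longrightarrow> U' \<subseteq> U \<Longrightarrow> represents A T U' r Z \<tau>"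
  unfolding represents_def cr_sections_def using vfield_subset by blast

text \<open>Each generator lies in the span with Kronecker delta coefficients. In this way
  \<open>condition_star\<close> is brought to bear on the single fields Z_j and L_0.\<close>

lemma Theta_tilde_generator:
  assumes rep: "represents A T U r Z \<tau>" and U: "open U" and \<tau>: "\<And>q. q \<in> U \<Longrightarrow> \<tau> q \<in> ker_levi A T q"
    and L0: "L0 \<in> cr_sections A T U"
    and br: "\<And>q. q \<in> U \<Longrightarrow> (\<Sum>j<r. lie_bracket A (Z j) (conj_field (Z j)) q) = conj_field L0 q - L0 q"
    and j: "j < Suc r"
  shows "(Z(r := L0)) j \<in> Theta_tilde A T U"
proof -
  let ?X = "Z(r := L0)"
  have "\<tau> \<in> ker_levi_sections A T U"
    unfolding ker_levi_sections_def using \<tau> rep U by blast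
  moreover have "?X j \<in> smooth_span A U (Suc r) ?X"
    unfolding smooth_span_def
  proof (rule CollectI, intro exI conjI allI impI ballI)
    show "msmooth_on A U (\<lambda>q. if i = j then 1 else 0 :: complex)" for i by (rule msmooth_const[OF U])
    show "?X j q = (\<Sum>i<Suc r. cscale (if i = j then 1 else 0) (?X i q))" for q
    proof -
      have "(\<Sum>i<Suc r. cscale (if i = j then 1 else 0) (?X i q)) = (\<Sum>i<Suc r. if i = j then ?X i q else 0)"
        by (rule sum.cong[OF refl]) (simp only: cvec.scale_one cvec.scale_zero_left split: if_split, simp)
      also have "\<dots> = ?X j q" using j by (simp only: sum.delta finite_lessThan lessThan_iff if_True)
      finally show ?thesis by (rule sym)
    qed
  qed
  then have "?X j \<in> Theta_tilde_of A T U \<tau>"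
    unfolding Theta_tilde_of_def using rep L0 br by blast
  ultimately show ?thesis unfolding Theta_tilde_def by blast
qed

text \<open>The field L_0 is constructed inside the proof, so the positivity hypothesis ranges over
  all fields compatible with the bracket sum at \<open>p0\<close>, and \<mu> may depend on the
  field.\<close>

lemma kernel_uniqueness:
  fixes \<rho> :: "'m \<Rightarrow> real" and f :: "'m \<Rightarrow> complex"
  assumes W: "open W" "p0 \<in> W" and star: "condition_star A T W f"
    and rep: "represents A T U r Z \<tau>" and U: "open U" "p0 \<in> U" and \<tau>: "\<And>q. q \<in> U \<Longrightarrow> \<tau> q \<in> ker_levi A T q"
    and D: "open D" "p0 \<in> D" and \<rho>: "msmooth_on A D \<rho>" and \<rho>0: "\<rho> p0 = 0"
    and neg: "\<And>q. q \<in> D \<Longrightarrow> f q \<noteq> 0 \<Longrightarrow> \<rho> q < 0"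
    and Q: "\<And>L0. L0 p0 \<in> T p0 \<Longrightarrow> (\<Sum>j<r. lie_bracket A (Z j) (conj_field (Z j)) p0) = conj_field L0 p0 - L0 p0 \<Longrightarrow>
      \<exists>\<mu>. Re (levi_op r Z L0 p0 (\<lambda>q. complex_of_real (\<rho> q)))
       + 4 * \<mu> * (\<Sum>j<r. (cmod (Z j p0 (\<lambda>q. complex_of_real (\<rho> q))))\<^sup>2) > 0"
  shows "\<exists>N. open N \<and> p0 \<in> N \<and> ae_on A N (\<lambda>q. f q = 0)"
proof -
  obtain V \<phi> where c: "(V, \<phi>) \<in> A" "p0 \<in> V" by (rule chart_exists)
  have WW: "open (W \<inter> D \<inter> V)" "p0 \<in> W \<inter> D \<inter> V" using W D c chartD(1)[OF c(1)] by auto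
  let ?br = "\<lambda>L0 q. (\<Sum>j<r. lie_bracket A (Z j) (conj_field (Z j)) q) = conj_field L0 q - L0 q"
  have "\<exists>U0 L0. open U0 \<and> p0 \<in> U0 \<and> U0 \<subseteq> U \<inter> (W \<inter> D \<inter> V) \<and> L0 \<in> cr_sections A T U0 \<and> (\<forall>q\<in>U0. ?br L0 q)"
  proof (rule kernel_section_field[OF _ rep U WW])
    show "\<tau> q \<in> ker_levi A T q" if "q \<in> U" for q by (rule \<tau>[OF that])
    fix U0 L0 assume "open U0" "p0 \<in> U0" "U0 \<subseteq> U \<inter> (W \<inter> D \<inter> V)" "L0 \<in> cr_sections A T U0" "\<And>q. q \<in> U0 \<Longrightarrow> ?br L0 q"
    then show "\<exists>U0 L0. open U0 \<and> p0 \<in> U0 \<and> U0 \<subseteq> U \<inter> (W \<inter> D \<inter> V) \<and> L0 \<in> cr_sections A T U0 \<and> (\<forall>q\<in>U0. ?br L0 q)" by (intro exI conjI) auto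
  qed
  then obtain U0 L0 where U0: "open U0" "p0 \<in> U0" "U0 \<subseteq> U \<inter> (W \<inter> D \<inter> V)" and L0: "L0 \<in> cr_sections A T U0"
    and br: "\<And>q. q \<in> U0 \<Longrightarrow> ?br L0 q" by blast
  have sub: "U0 \<subseteq> U" "U0 \<subseteq> W" "U0 \<subseteq> D" "U0 \<subseteq> V" using U0(3) by auto
  note rep0 = represents_subset[OF rep sub(1)]
  have Z: "smooth_vfield A U0 (Z j)" if "j < r" for j
    using rep0 that by (simp add: represents_def cr_sections_def)
  have "L0 p0 \<in> T p0" using L0 U0(2) by (simp add: cr_sections_def)
  from Q[OF this br[OF U0(2)]] obtain \<mu> where \<mu>: "Re (levi_op r Z L0 p0 (\<lambda>q. complex_of_real (\<rho> q)))
       + 4 * \<mu> * (\<Sum>j<r. (cmod (Z j p0 (\<lambda>q. complex_of_real (\<rho> q))))\<^sup>2) > 0" by blast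
  show ?thesis
  proof (rule uniqueness_from_levi[OF c(1) U0(1) sub(4) U0(2) Z _ br msmooth_subset[OF \<rho> sub(3)] \<rho>0 \<mu>])
    show "smooth_vfield A U0 L0" using L0 by (simp add: cr_sections_def)
    show "L2_loc A U0 f"
    proof (rule L2_loc_subset[OF _ sub(2)])
      show "L2_loc A W f" using star by (simp add: condition_star_def)
    qed
    show "\<exists>g \<kappa>. weak_deriv A U0 ((Z(r := L0)) j) f g \<and> L2_loc A U0 g \<and> Linf_loc A U0 \<kappa> \<and>
       ae_on A U0 (\<lambda>p. cmod (g p) \<le> \<kappa> p * cmod (f p))" if "j < Suc r" for j
    proof -
      have "(Z(r := L0)) j \<in> Theta_tilde A T U0"
        by (rule Theta_tilde_generator[OF rep0 U0(1) _ L0 br that]) (use \<tau> sub(1) in blast)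
      then show ?thesis using star U0(1) sub(2) unfolding condition_star_def by blast
    qed
    show "\<rho> q < 0" if "q \<in> U0" "f q \<noteq> 0" for q using neg that sub(3) by blast
  qed
qed

text \<open>\<open>X0\<close> does not annihilate \<rho>, but its summand tangent to
  \<open>N\<close> does, so the other summand Re Z has a nonzero value on \<rho>. Expanding Z in its
  generators, one of them must differentiate \<rho> nontrivially.\<close>

lemma noncharacteristic_generator:
  fixes \<rho> :: "'m \<Rightarrow> real"
  assumes nc: "Theta_noncharacteristic A T N p0" and D: "open D" "p0 \<in> D" and \<rho>: "msmooth_on A D \<rho>"
    and N: "\<And>q. q \<in> D \<Longrightarrow> q \<in> N \<Longrightarrow> \<rho> q = 0"
    and X0: "X0 \<in> tangent_space A p0" "X0 (\<lambda>q. complex_of_real (\<rho> q)) \<noteq> 0"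
  shows "\<exists>U r Z \<tau> j. open U \<and> p0 \<in> U \<and> represents A T U r Z \<tau> \<and> (\<forall>q\<in>U. \<tau> q \<in> ker_levi A T q) \<and>
    j < r \<and> Z j p0 (\<lambda>q. complex_of_real (\<rho> q)) \<noteq> 0"
proof -
  let ?g = "\<lambda>q. complex_of_real (\<rho> q)"
  let ?Y = "{re_vec (Z p0) | Z U. open U \<and> p0 \<in> U \<and> Z \<in> Theta A T U}"
  have "X0 \<in> {X + Y | X Y. X \<in> {X \<in> tangent_space A p0. tangent_to A N p0 X} \<and> Y \<in> ?Y}"
    using X0(1) nc unfolding Theta_noncharacteristic_def by (simp only:)
  then have "\<exists>X Y. X0 = X + Y \<and> X \<in> {X \<in> tangent_space A p0. tangent_to A N p0 X} \<and> Y \<in> ?Y"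
    by (rule CollectD)
  then obtain X where "\<exists>Y. X0 = X + Y \<and> X \<in> {X \<in> tangent_space A p0. tangent_to A N p0 X} \<and> Y \<in> ?Y" by (rule exE)
  then obtain Y where "X0 = X + Y \<and> X \<in> {X \<in> tangent_space A p0. tangent_to A N p0 X} \<and> Y \<in> ?Y" by (rule exE)
  then have XY: "X0 = X + Y" and X: "tangent_to A N p0 X" and "Y \<in> ?Y" by (simp_all only: mem_Collect_eq)
  from CollectD[OF this(3)]
  obtain Z0 where "\<exists>U. Y = re_vec (Z0 p0) \<and> open U \<and> p0 \<in> U \<and> Z0 \<in> Theta A T U" by (rule exE)
  then obtain U where "Y = re_vec (Z0 p0) \<and> open U \<and> p0 \<in> U \<and> Z0 \<in> Theta A T U" by (rule exE)
  then have Y: "Y = re_vec (Z0 p0)" and U: "open U" "p0 \<in> U" and Z0: "Z0 \<in> Theta A T U" by simp_all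
  have "X ?g = 0"
    using X[unfolded tangent_to_def, rule_format, of D ?g] D N msmooth_of_real[OF D(1) \<rho>] by simp
  then have "Y ?g \<noteq> 0" using X0(2) unfolding XY by simp
  then have Z0g: "Z0 p0 ?g \<noteq> 0" unfolding Y re_vec_def cscale_apply by (auto simp: conj_vec_apply)
  obtain \<tau> where \<tau>: "\<tau> \<in> ker_levi_sections A T U" "Z0 \<in> Theta_of A T U \<tau>"
    using Z0 unfolding Theta_def by blast
  then obtain r Z where rep: "represents A T U r Z \<tau>" and "Z0 \<in> smooth_span A U r Z"
    unfolding Theta_of_def by blast
  then obtain b where "Z0 p0 = (\<Sum>j<r. cscale (b j p0) (Z j p0))" using U(2) unfolding smooth_span_def by blast
  then have "Z0 p0 ?g = (\<Sum>j<r. b j p0 * Z j p0 ?g)" by (simp only: sum_fun_apply cscale_apply)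
  with Z0g have "(\<Sum>j<r. b j p0 * Z j p0 ?g) \<noteq> 0" by simp
  then obtain j where "j \<in> {..<r}" "b j p0 * Z j p0 ?g \<noteq> 0" by (rule sum.not_neutral_contains_not_neutral)
  then have j: "j < r" "Z j p0 ?g \<noteq> 0" by simp_all
  have "\<forall>q\<in>U. \<tau> q \<in> ker_levi A T q" using \<tau>(1) by (simp add: ker_levi_sections_def)
  with U rep j show ?thesis by blast
qed

end

theorem proposition8p9:
  fixes A :: "('m::{t2_space,second_countable_topology}, 'e::euclidean_space) chart set"
    and T01 :: "'m \<Rightarrow> 'm tvec set"
    and \<Omega> :: "'m set" and p0 :: 'm and f :: "'m \<Rightarrow> complex"
  assumes "almost_CR_manifold A T01"
    and "open \<Omega>"
    and "smooth_boundary_point A \<Omega> p0"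
    and "Theta_noncharacteristic A T01 (frontier \<Omega>) p0 \<or> strongly_1_convex A T01 \<Omega> p0"
    and "condition_star A T01 \<Omega> f"
    and "zero_boundary_values A T01 \<Omega> p0 f"
  shows "\<exists>V. open V \<and> p0 \<in> V \<and> ae_on A (\<Omega> \<inter> V) (\<lambda>q. f q = 0)"
proof -
  interpret almost_CR A T01
    by unfold_locales (use assms(1) in \<open>simp_all add: almost_CR_manifold_def\<close>)
  \<comment> \<open>The zero extension satisfies \<open>condition_star\<close> across the boundary
    and is nonzero only inside \<Omega>, which near \<open>p0\<close> means only where \<rho> <
    0.\<close>
  define f0 where "f0 = (\<lambda>q. if q \<in> \<Omega> then f q else 0)"
  obtain W where W: "open W" "p0 \<in> W" and star: "condition_star A T01 W f0"
    using assms(6) unfolding zero_boundary_values_def f0_def by blast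
  have fr: "p0 \<in> frontier \<Omega>" using assms(3) by (simp add: smooth_boundary_point_def)
  have "\<exists>N. open N \<and> p0 \<in> N \<and> ae_on A N (\<lambda>q. f0 q = 0)"
    using assms(4)
  proof
    assume nc: "Theta_noncharacteristic A T01 (frontier \<Omega>) p0"
    obtain \<rho> where "defining_function A \<Omega> p0 \<rho>" using assms(3) unfolding smooth_boundary_point_def by blast
    then obtain D X0 where D: "open D" "p0 \<in> D" "msmooth_on A D \<rho>" "\<Omega> \<inter> D = {q \<in> D. \<rho> q < 0}"
      and X0: "X0 \<in> tangent_space A p0" "X0 (\<lambda>q. complex_of_real (\<rho> q)) \<noteq> 0"
      unfolding defining_function_def by blast
    note z = defining_function_frontier[OF assms(2) D(1,4,3)]
    have "\<exists>U r Z \<tau> j. open U \<and> p0 \<in> U \<and> represents A T01 U r Z \<tau> \<and> (\<forall>q\<in>U. \<tau> q \<in> ker_levi A T01 q) \<and>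
      j < r \<and> Z j p0 (\<lambda>q. complex_of_real (\<rho> q)) \<noteq> 0"
      by (rule noncharacteristic_generator[OF nc D(1-3) z X0])
    then obtain U r Z \<tau> j where U: "open U" "p0 \<in> U" and rep: "represents A T01 U r Z \<tau>"
      and \<tau>: "\<And>q. q \<in> U \<Longrightarrow> \<tau> q \<in> ker_levi A T01 q" and j: "j < r" "Z j p0 (\<lambda>q. complex_of_real (\<rho> q)) \<noteq> 0"
      by blast
    show ?thesis
    proof (rule kernel_uniqueness[OF W star rep U \<tau> D(1-3) z[OF D(2) fr]])
      show "\<rho> q < 0" if "q \<in> D" "f0 q \<noteq> 0" for q
        using D(4) that by (auto simp: f0_def split: if_splits)
      fix L0
      let ?s = "\<Sum>j<r. (cmod (Z j p0 (\<lambda>q. complex_of_real (\<rho> q))))\<^sup>2"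
      let ?l = "Re (levi_op r Z L0 p0 (\<lambda>q. complex_of_real (\<rho> q)))"
      have "(cmod (Z j p0 (\<lambda>q. complex_of_real (\<rho> q))))\<^sup>2 \<le> ?s"
        by (rule member_le_sum) (use j in auto)
      moreover have "(cmod (Z j p0 (\<lambda>q. complex_of_real (\<rho> q))))\<^sup>2 > 0" using j by simp
      ultimately have s: "?s > 0" by linarith
      \<comment> \<open>The witness \<mu> = (1 + |l|) / (4 s) outweighs a negative Levi value l and
        leaves at least 1.\<close>
      have "?l + 4 * ((1 + \<bar>?l\<bar>) / (4 * ?s)) * ?s = ?l + 1 + \<bar>?l\<bar>" using s by (simp add: field_simps)
      also have "\<dots> > 0" by linarith
      finally show "\<exists>\<mu>. ?l + 4 * \<mu> * ?s > 0" by (rule exI)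
    qed
  next
    assume "strongly_1_convex A T01 \<Omega> p0"
    then obtain \<rho> U \<tau> where \<rho>: "defining_function A \<Omega> p0 \<rho>" and U: "p0 \<in> U" and \<tau>: "\<tau> \<in> ker_levi_sections A T01 U"
      and pos: "ddc A T01 \<rho> p0 (\<tau> p0) > 0"
      unfolding strongly_1_convex_def by blast
    obtain D where D: "open D" "p0 \<in> D" "msmooth_on A D \<rho>" "\<Omega> \<inter> D = {q \<in> D. \<rho> q < 0}"
      using \<rho> unfolding defining_function_def by blast
    obtain V r Z where V: "open V" "p0 \<in> V" "V \<subseteq> U" and rep: "represents A T01 V r Z \<tau>"
      using \<tau> U unfolding ker_levi_sections_def by blast
    show ?thesis
    proof (rule kernel_uniqueness[OF W star rep V(1,2) _ D(1-3) defining_function_frontier[OF assms(2) D(1,4,3,2) fr]])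
      show "\<tau> q \<in> ker_levi A T01 q" if "q \<in> V" for q
        using \<tau> V(3) that unfolding ker_levi_sections_def by blast
      show "\<rho> q < 0" if "q \<in> D" "f0 q \<noteq> 0" for q
        using D(4) that by (auto simp: f0_def split: if_splits)
      fix L0 assume L0: "L0 p0 \<in> T01 p0"
        and br: "(\<Sum>j<r. lie_bracket A (Z j) (conj_field (Z j)) p0) = conj_field L0 p0 - L0 p0"
      have Z: "Z j \<in> cr_sections A T01 V" if "j < r" for j using rep that by (simp add: represents_def)
      have \<tau>p: "\<tau> p0 = (\<Sum>j<r. herm_tensor (Z j p0))" using rep V(2) unfolding represents_def by blast
      have "ddc A T01 \<rho> p0 (\<tau> p0) = Re (levi_op r Z L0 p0 (\<lambda>q. complex_of_real (\<rho> q))) / 2"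
        by (rule ddc_value[OF _ V(1,2) \<tau>p L0 br D(3,1,2)]) (rule Z)
      with pos have "Re (levi_op r Z L0 p0 (\<lambda>q. complex_of_real (\<rho> q))) > 0" by simp
      \<comment> \<open>Half of the Levi value is \<open>ddc\<close>, which is positive already, so
        \<mu> = 0 is enough.\<close>
      then show "\<exists>\<mu>. Re (levi_op r Z L0 p0 (\<lambda>q. complex_of_real (\<rho> q)))
         + 4 * \<mu> * (\<Sum>j<r. (cmod (Z j p0 (\<lambda>q. complex_of_real (\<rho> q))))\<^sup>2) > 0" by (intro exI[of _ 0]) simp
    qed
  qed
  then obtain N where N: "open N" "p0 \<in> N" "ae_on A N (\<lambda>q. f0 q = 0)" by blast
  have "ae_on A (\<Omega> \<inter> N) (\<lambda>q. f q = 0)"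
    unfolding ae_on_def
  proof (intro ballI, clarify)
    fix V \<phi> assume c: "(V, \<phi>) \<in> A"
    then have "AE x in lebesgue. x \<in> \<phi> ` (N \<inter> V) \<longrightarrow> f0 (inv_into V \<phi> x) = 0"
      using N(3) unfolding ae_on_def by blast
    then show "AE x in lebesgue. x \<in> \<phi> ` (\<Omega> \<inter> N \<inter> V) \<longrightarrow> f (inv_into V \<phi> x) = 0"
      by eventually_elim (auto simp: f0_def chart_inv[OF c] split: if_splits)
  qed
  then show ?thesis using N by blast
qed

end
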